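(* Let $K$ be a discrete valuation field with valuation ring $\mathcal{O}_K$ and algebraically closed residue field $k$, and $S=\mathrm{Spec}\,\mathcal{O}_K$. If $\Phi\in X_5(\mathcal{O}_K)$ is minimal then $\mathcal{C}_\Phi$ is a fibred surface, i.e. an integral projective flat $S$-scheme of dimension $2$.
   Context: A Pfaffian model over a ring $R$ is a $5\times5$ alternating matrix of linear forms in $R[x_1,\dots,x_5]$; $X_5(R)$ is the set of these. For $A,B\in\mathrm{GL}_5(R)$, $[A,B]\Phi$ is obtained by replacing $\Phi$ by $A\Phi A^T$ and substituting $x_j'=\sum_iB_{ij}x_i$ for $x_j$; models related in this way with $A,B\in\mathrm{GL}_5(R)$ are $R$-equivalent; $\det[A,B]=(\det A)^2\det B$. For a field $F$ and $\Phi\in X_5(F)$, $C_\Phi\subset\mathbb{P}^4_F$ is defined by the $4\times4$ Pfaffians of $\Phi$ and $\Phi$ is nonsingular if $C_\Phi$ is a smooth genus one curve. $\Delta\in\mathbb{Z}[X_5]$ is the standard discriminant of Pfaffian models (Fisher's normalisation): degree $60$, $\Delta(g\Phi)=(\det g)^{12}\Delta(\Phi)$, nonzero exactly on nonsingular models, and equal for nonsingular $\Phi$ to the discriminant of a Weierstrass equation of the Jacobian of $C_\Phi$. Let $v$ be the normalised valuation of $K$ and $\pi$ a uniformiser. For nonsingular $\Phi\in X_5(\mathcal{O}_K)$ one has $v(\Delta(\Phi))=v(\Delta_E)+12\ell(\Phi)$ with $\Delta_E$ the minimal discriminant of the Jacobian $E$ of $C_\Phi$ and $\ell(\Phi)\ge0$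 an integer; $\Phi$ is minimal if it is nonsingular and $v(\Delta(\Phi))$ is minimal among all models in $X_5(\mathcal{O}_K)$ that are $K$-equivalent to $\Phi$. For $\Phi\in X_5(\mathcal{O}_K)$, $\mathcal{C}_\Phi\subset\mathbb{P}^4_S$ is the closed subscheme defined by the $4\times4$ Pfaffians of $\Phi$. *)

theory Defs
  imports
    "HOL-Analysis.Analysis"
    "HOL-Algebra.Algebraic_Closure_Type"
    "HOL-Algebra.Ring_Divisibility"
    "HOL-Library.Poly_Mapping"
    "HOL-Library.Extended_Nat"
begin

text \<open>Subsets of a type-class ring, regarded as rings in the sense of HOL-Algebra.\<close>

definition ring_on :: "'r::comm_ring_1 set \<Rightarrow> 'r ring" where
  "ring_on A = \<lparr>carrier = A, mult = (*), one = 1, zero = 0, add = (+)\<rparr>"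


section \<open>Polynomials in several variables\<close>

type_synonym ('v, 'a) mpol = "('v \<Rightarrow>\<^sub>0 nat) \<Rightarrow>\<^sub>0 'a"

text \<open>The five homogeneous coordinates are indexed by the type \<open>5\<close>, with elements \<open>0 < 1 < 2 < 3 < 4\<close>.\<close>

type_synonym 'a pol5 = "(5, 'a) mpol"

definition mconst :: "'a::zero \<Rightarrow> ('v, 'a) mpol" where
  "mconst c = Poly_Mapping.single 0 c"

definition mvar :: "'v \<Rightarrow> ('v, 'a::zero_neq_one) mpol" where
  "mvar i = Poly_Mapping.single (Poly_Mapping.single i 1) 1"

definition mon_deg :: "('v \<Rightarrow>\<^sub>0 nat) \<Rightarrow> nat" where
  "mon_deg m = (\<Sum>i\<in>Poly_Mapping.keys m. Poly_Mapping.lookup m i)"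

definition form_of_degree :: "nat \<Rightarrow> ('v, 'a::zero) mpol \<Rightarrow> bool" where
  "form_of_degree d p \<longleftrightarrow> (\<forall>m\<in>Poly_Mapping.keys p. mon_deg m = d)"

definition form_part :: "nat \<Rightarrow> ('v, 'a::comm_monoid_add) mpol \<Rightarrow> ('v, 'a) mpol" where
  "form_part d p = (\<Sum>m\<in>{m\<in>Poly_Mapping.keys p. mon_deg m = d}. Poly_Mapping.single m (Poly_Mapping.lookup p m))"

text \<open>Evaluation at \<open>s\<close> after mapping the coefficients by \<open>h\<close>.\<close>

definition meval :: "('a::zero \<Rightarrow> 'b::comm_semiring_1) \<Rightarrow> ('v \<Rightarrow> 'b) \<Rightarrow> ('v, 'a) mpol \<Rightarrow> 'b" where
  "meval h s p = (\<Sum>m\<in>Poly_Mapping.keys p. h (Poly_Mapping.lookup p m) * (\<Prod>i\<in>Poly_Mapping.keys m. s i ^ Poly_Mapping.lookup m i))"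

definition mpols_over :: "'a::zero set \<Rightarrow> ('v, 'a) mpol set" where
  "mpols_over R = {p. \<forall>m. Poly_Mapping.lookup p m \<in> R}"

abbreviation mpol_ring :: "'a::comm_ring_1 set \<Rightarrow> 'a pol5 ring" where
  "mpol_ring R \<equiv> ring_on (mpols_over R)"

definition homogeneous_ideal :: "'a::comm_ring_1 set \<Rightarrow> 'a pol5 set \<Rightarrow> bool" where
  "homogeneous_ideal R J \<longleftrightarrow> ideal J (mpol_ring R) \<and> (\<forall>p\<in>J. \<forall>d. form_part d p \<in> J)"


section \<open>Dimension, irreducibility, regularity, flatness\<close>

definition chain_dim :: "'p set set \<Rightarrow> enat" where
  "chain_dim C = Sup {enat n | n. \<exists>c. (\<forall>i\<le>n. c i \<in> C) \<and> (\<forall>i<n. c i \<subset> c (Suc i))}"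

definition irreducible_space :: "'p topology \<Rightarrow> bool" where
  "irreducible_space S \<longleftrightarrow> topspace S \<noteq> {} \<and>
    (\<forall>A B. closedin S A \<longrightarrow> closedin S B \<longrightarrow> topspace S = A \<union> B \<longrightarrow>
      A = topspace S \<or> B = topspace S)"

definition space_dim :: "'p topology \<Rightarrow> enat" where
  "space_dim S = chain_dim {Z. closedin S Z \<and> irreducible_space (subtopology S Z)}"

definition krull_dim :: "('r, 'e) ring_scheme \<Rightarrow> enat" where
  "krull_dim A = chain_dim {P. primeideal P A}"

definition reduced_ring :: "('r, 'e) ring_scheme \<Rightarrow> bool" where
  "reduced_ring A \<longleftrightarrow>
    (\<forall>x\<in>carrier A. \<forall>n::nat. x [^]\<^bsub>A\<^esub> n = \<zero>\<^bsub>A\<^esub> \<longrightarrow> x = \<zero>\<^bsub>A\<^esub>)"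

definition regular_local_ring :: "('r, 'e) ring_scheme \<Rightarrow> bool" where
  "regular_local_ring A \<longleftrightarrow> cring A \<and> noetherian_ring A \<and>
    (\<exists>\<mm>. (\<forall>J. maximalideal J A \<longleftrightarrow> J = \<mm>) \<and>
      (\<exists>G\<subseteq>carrier A. finite G \<and> \<mm> = Idl\<^bsub>A\<^esub> G \<and> enat (card G) = krull_dim A))"

text \<open>
  \<open>N \<otimes>\<^sub>A M\<close> is the free abelian group on \<open>carrier N \<times> carrier M\<close> modulo \<open>tensor_relations A N M\<close>.
\<close>

inductive_set tensor_relations ::
    "('a, 'e) ring_scheme \<Rightarrow> ('a, 'n) module \<Rightarrow> ('a, 'm) module \<Rightarrow> (('n \<times> 'm) \<Rightarrow>\<^sub>0 int) set"
  for A N M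
where
  zero: "0 \<in> tensor_relations A N M"
| diff: "s \<in> tensor_relations A N M \<Longrightarrow> t \<in> tensor_relations A N M \<Longrightarrow>
    s - t \<in> tensor_relations A N M"
| add_left: "x \<in> carrier N \<Longrightarrow> x' \<in> carrier N \<Longrightarrow> y \<in> carrier M \<Longrightarrow>
    frag_of (x \<oplus>\<^bsub>N\<^esub> x', y) - frag_of (x, y) - frag_of (x', y) \<in> tensor_relations A N M"
| add_right: "x \<in> carrier N \<Longrightarrow> y \<in> carrier M \<Longrightarrow> y' \<in> carrier M \<Longrightarrow>
    frag_of (x, y \<oplus>\<^bsub>M\<^esub> y') - frag_of (x, y) - frag_of (x, y') \<in> tensor_relations A N M"
| balanced: "a \<in> carrier A \<Longrightarrow> x \<in> carrier N \<Longrightarrow> y \<in> carrier M \<Longrightarrow>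
    frag_of (a \<odot>\<^bsub>N\<^esub> x, y) - frag_of (x, a \<odot>\<^bsub>M\<^esub> y) \<in> tensor_relations A N M"

definition module_mono ::
    "('a, 'e) ring_scheme \<Rightarrow> ('a, 'n) module \<Rightarrow> ('a, 'n) module \<Rightarrow> ('n \<Rightarrow> 'n) \<Rightarrow> bool" where
  "module_mono A N' N \<phi> \<longleftrightarrow> Module.module A N' \<and> Module.module A N \<and>
    \<phi> \<in> carrier N' \<rightarrow> carrier N \<and> inj_on \<phi> (carrier N') \<and>
    (\<forall>x\<in>carrier N'. \<forall>y\<in>carrier N'. \<phi> (x \<oplus>\<^bsub>N'\<^esub> y) = \<phi> x \<oplus>\<^bsub>N\<^esub> \<phi> y) \<and>
    (\<forall>a\<in>carrier A. \<forall>x\<in>carrier N'. \<phi> (a \<odot>\<^bsub>N'\<^esub> x) = a \<odot>\<^bsub>N\<^esub> \<phi> x)"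

text \<open>
  Flatness: \<open>N' \<otimes>\<^sub>A M \<rightarrow> N \<otimes>\<^sub>A M\<close> is injective for every injective \<open>N' \<rightarrow> N\<close>, where the test modules
  have elements in the type \<open>'n\<close>.  A theorem that leaves \<open>'n\<close> free covers test modules on
  every type; one type for both modules suffices, as \<open>N'\<close> may be replaced by its image in \<open>N\<close>.
\<close>

definition flat_module :: "'n itself \<Rightarrow> ('a, 'e) ring_scheme \<Rightarrow> ('a, 'm) module \<Rightarrow> bool" where
  "flat_module _ A M \<longleftrightarrow> Module.module A M \<and>
    (\<forall>(N' :: ('a, 'n) module) N \<phi>. module_mono A N' N \<phi> \<longrightarrow>
      (\<forall>t. Poly_Mapping.keys t \<subseteq> carrier N' \<times> carrier M \<longrightarrow>
        frag_extend (\<lambda>(x, y). frag_of (\<phi> x, y)) t \<in> tensor_relations A N M \<longrightarrow>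
        t \<in> tensor_relations A N' M))"


section \<open>Closed subschemes of projective 4-space\<close>

text \<open>
  Let \<open>R\<close> be a subring of a field.  A homogeneous ideal \<open>I\<close> of \<open>R[x\<^sub>0,\<dots>,x\<^sub>4]\<close> defines the closed
  subscheme \<open>V\<^sub>+(I) = Proj (R[x\<^sub>0,\<dots>,x\<^sub>4]/I)\<close> of projective 4-space over \<open>R\<close>.  Its points are the
  homogeneous primes \<open>P\<close> of \<open>R[x\<^sub>0,\<dots>,x\<^sub>4]\<close> that contain \<open>I\<close> but not all the \<open>x\<^sub>i\<close>.
\<close>

definition proj_points :: "'a::field set \<Rightarrow> 'a pol5 set \<Rightarrow> 'a pol5 set set" where
  "proj_points R I = {P. primeideal P (mpol_ring R) \<and> homogeneous_ideal R P \<and> I \<subseteq> P \<and>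
    (\<exists>i. mvar i \<notin> P)}"

definition proj_open :: "'a::field set \<Rightarrow> 'a pol5 set \<Rightarrow> 'a pol5 set set \<Rightarrow> bool" where
  "proj_open R I U \<longleftrightarrow> (\<exists>J\<subseteq>mpols_over R. U = {P\<in>proj_points R I. \<not> J \<subseteq> P})"

definition proj_space :: "'a::field set \<Rightarrow> 'a pol5 set \<Rightarrow> 'a pol5 set topology" where
  "proj_space R I = topology (proj_open R I)"

lemma istopology_proj_open:
  fixes R :: "'a::field set"
  shows "istopology (proj_open R I)"
  unfolding istopology_def
proof (intro conjI allI impI)
  fix S T assume "proj_open R I S" "proj_open R I T"
  then obtain J J' where J: "J \<subseteq> mpols_over R" "S = {P\<in>proj_points R I. \<not> J \<subseteq> P}"
    and J': "J' \<subseteq> mpols_over R" "T = {P\<in>proj_points R I. \<not> J' \<subseteq> P}"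
    unfolding proj_open_def by blast
  define L where "L = {p * q | p q. p \<in> J \<and> q \<in> J'} \<inter> mpols_over R"
  have "\<not> L \<subseteq> P \<longleftrightarrow> \<not> J \<subseteq> P \<and> \<not> J' \<subseteq> P" if P: "P \<in> proj_points R I" for P
  proof -
    interpret primeideal P "mpol_ring R" using P by (simp add: proj_points_def)
    have mult: "p * q \<in> P" if "p \<in> P" "q \<in> mpols_over R" for p q :: "'a pol5"
      using I_r_closed[of p q] that by (simp add: ring_on_def)
    have mult': "p * q \<in> P" if "q \<in> P" "p \<in> mpols_over R" for p q :: "'a pol5"
      using mult[OF that] by (simp add: mult.commute)
    have closed: "p * q \<in> mpols_over R" if "p \<in> mpols_over R" "q \<in> mpols_over R" for p q :: "'a pol5"
      using m_closed[of p q] that by (simp add: ring_on_def)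
    have prime: "p \<in> P \<or> q \<in> P"
      if "p * q \<in> P" "p \<in> mpols_over R" "q \<in> mpols_over R" for p q :: "'a pol5"
      using I_prime[of p q] that by (simp add: ring_on_def)
    show ?thesis
    proof
      assume "\<not> L \<subseteq> P"
      then obtain p q where pq: "p \<in> J" "q \<in> J'" "p * q \<notin> P"
        unfolding L_def by blast
      then have "p \<notin> P" "q \<notin> P"
        using mult[of p q] mult'[of q p] J(1) J'(1) by auto
      then show "\<not> J \<subseteq> P \<and> \<not> J' \<subseteq> P" using pq by auto
    next
      assume "\<not> J \<subseteq> P \<and> \<not> J' \<subseteq> P"
      then obtain p q where pq: "p \<in> J" "p \<notin> P" "q \<in> J'" "q \<notin> P" by blast
      then have R: "p \<in> mpols_over R" "q \<in> mpols_over R" using J(1) J'(1) by auto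
      have "p * q \<in> L" using closed[OF R] pq unfolding L_def by auto
      moreover have "p * q \<notin> P" using prime[OF _ R] pq by auto
      ultimately show "\<not> L \<subseteq> P" by auto
    qed
  qed
  then have "S \<inter> T = {P\<in>proj_points R I. \<not> L \<subseteq> P}"
    unfolding J(2) J'(2) by auto
  moreover have "L \<subseteq> mpols_over R" by (simp add: L_def)
  ultimately show "proj_open R I (S \<inter> T)"
    unfolding proj_open_def by (intro exI[of _ L] conjI)
next
  fix \<K> assume *: "\<forall>K\<in>\<K>. proj_open R I K"
  then obtain J where J:
    "\<forall>K\<in>\<K>. J K \<subseteq> mpols_over R \<and> K = {P\<in>proj_points R I. \<not> J K \<subseteq> P}"
    unfolding proj_open_def Bex_def by (auto dest!: bchoice)
  have mem: "P \<in> K \<longleftrightarrow> P \<in> proj_points R I \<and> \<not> J K \<subseteq> P" if "K \<in> \<K>" for K P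
  proof -
    have "K = {P\<in>proj_points R I. \<not> J K \<subseteq> P}" using J that by simp
    then have "P \<in> K \<longleftrightarrow> P \<in> {P\<in>proj_points R I. \<not> J K \<subseteq> P}" by (rule arg_cong)
    then show ?thesis by simp
  qed
  have "\<Union>\<K> = {P\<in>proj_points R I. \<not> (\<Union>K\<in>\<K>. J K) \<subseteq> P}"
  proof (rule Set.set_eqI)
    fix P
    have "P \<in> \<Union>\<K> \<longleftrightarrow> (\<exists>K. K \<in> \<K> \<and> P \<in> K)" by blast
    also have "\<dots> \<longleftrightarrow> (\<exists>K. K \<in> \<K> \<and> P \<in> proj_points R I \<and> \<not> J K \<subseteq> P)"
      using mem by metis
    also have "\<dots> \<longleftrightarrow> P \<in> {P\<in>proj_points R I. \<not> (\<Union>K\<in>\<K>. J K) \<subseteq> P}"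
      by (simp add: UN_subset_iff) blast
    finally show "P \<in> \<Union>\<K> \<longleftrightarrow> P \<in> {P\<in>proj_points R I. \<not> (\<Union>K\<in>\<K>. J K) \<subseteq> P}" .
  qed
  moreover have "(\<Union>K\<in>\<K>. J K) \<subseteq> mpols_over R" using J by blast
  ultimately show "proj_open R I (\<Union>\<K>)"
    unfolding proj_open_def by (intro exI[of _ "\<Union>K\<in>\<K>. J K"] conjI)
qed

lemma openin_proj_space: "openin (proj_space R I) U \<longleftrightarrow> proj_open R I U"
  by (simp add: proj_space_def topology_inverse' istopology_proj_open)

text \<open>
  The stalk of the structure sheaf at \<open>P\<close>: fractions \<open>f/g\<close> of forms of the same degree with
  \<open>g \<notin> P\<close>, where \<open>f/g = f'/g'\<close> iff \<open>h (f g' - f' g) \<in> I\<close> for some form \<open>h \<notin> P\<close>.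
\<close>

definition fractions :: "'a::field set \<Rightarrow> 'a pol5 set \<Rightarrow> ('a pol5 \<times> 'a pol5) set" where
  "fractions R P = {(f, g). f \<in> mpols_over R \<and> g \<in> mpols_over R - P \<and>
    (\<exists>d. form_of_degree d f \<and> form_of_degree d g)}"

definition fraction ::
    "'a::field set \<Rightarrow> 'a pol5 set \<Rightarrow> 'a pol5 set \<Rightarrow> 'a pol5 \<Rightarrow> 'a pol5 \<Rightarrow> ('a pol5 \<times> 'a pol5) set" where
  "fraction R I P f g = {(f', g') \<in> fractions R P.
    \<exists>h\<in>mpols_over R - P. (\<exists>d. form_of_degree d h) \<and> h * (f * g' - f' * g) \<in> I}"

text \<open>
  If \<open>P\<close> lies over the prime \<open>\<s> = P \<inter> R\<close> of \<open>R\<close>, this is the local ring of \<open>Spec R\<close> at \<open>\<s>\<close>,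
  realised inside the field containing \<open>R\<close>.
\<close>

definition base_stalk :: "'a::field set \<Rightarrow> 'a pol5 set \<Rightarrow> 'a ring" where
  "base_stalk R P = ring_on {a / b | a b. a \<in> R \<and> b \<in> R \<and> mconst b \<notin> P}"

definition stalk ::
    "'a::field set \<Rightarrow> 'a pol5 set \<Rightarrow> 'a pol5 set \<Rightarrow> ('a, ('a pol5 \<times> 'a pol5) set) module" where
  "stalk R I P =
    \<lparr>carrier = (\<lambda>(f, g). fraction R I P f g) ` fractions R P,
     mult = (\<lambda>U V. \<Union>(f, g)\<in>U. \<Union>(f', g')\<in>V. fraction R I P (f * f') (g * g')),
     one = fraction R I P 1 1,
     zero = fraction R I P 0 1,
     add = (\<lambda>U V. \<Union>(f, g)\<in>U. \<Union>(f', g')\<in>V. fraction R I P (f * g' + f' * g) (g * g')),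
     smult = (\<lambda>c U. \<Union>{fraction R I P (mconst a * f) (mconst b * g) | a b f g.
       a \<in> R \<and> b \<in> R \<and> mconst b \<notin> P \<and> c = a / b \<and> (f, g) \<in> U})\<rparr>"

definition integral_scheme :: "'a::field set \<Rightarrow> 'a pol5 set \<Rightarrow> bool" where
  "integral_scheme R I \<longleftrightarrow> irreducible_space (proj_space R I) \<and>
    (\<forall>P\<in>proj_points R I. reduced_ring (stalk R I P))"

definition regular_scheme :: "'a::field set \<Rightarrow> 'a pol5 set \<Rightarrow> bool" where
  "regular_scheme R I \<longleftrightarrow> (\<forall>P\<in>proj_points R I. regular_local_ring (stalk R I P))"

definition flat_over_base :: "'n itself \<Rightarrow> 'a::field set \<Rightarrow> 'a pol5 set \<Rightarrow> bool" where
  "flat_over_base T R I \<longleftrightarrow>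
    (\<forall>P\<in>proj_points R I. flat_module T (base_stalk R P) (stalk R I P))"

text \<open>
  The homogeneity of \<open>I\<close> says that the scheme is a closed subscheme of projective 4-space over
  \<open>R\<close>; this is where projectivity enters.
\<close>

definition fibred_surface :: "'n itself \<Rightarrow> 'a::field set \<Rightarrow> 'a pol5 set \<Rightarrow> bool" where
  "fibred_surface T R I \<longleftrightarrow> homogeneous_ideal R I \<and> integral_scheme R I \<and>
    flat_over_base T R I \<and> space_dim (proj_space R I) = 2"


section \<open>Pfaffian models\<close>

type_synonym 'a pfaffian_model = "'a pol5 ^ 5 ^ 5"

definition X5 :: "'a::comm_ring_1 set \<Rightarrow> 'a pfaffian_model set" where
  "X5 R = {\<Phi>. (\<forall>i j. \<Phi> $ i $ j \<in> mpols_over R \<and> form_of_degree 1 (\<Phi> $ i $ j)) \<and>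
    (\<forall>i j. \<Phi> $ j $ i = - \<Phi> $ i $ j) \<and> (\<forall>i. \<Phi> $ i $ i = 0)}"

definition GL5 :: "'a::comm_ring_1 set \<Rightarrow> ('a ^ 5 ^ 5) set" where
  "GL5 R = {A. (\<forall>i j. A $ i $ j \<in> R) \<and>
    (\<exists>B. (\<forall>i j. B $ i $ j \<in> R) \<and> A ** B = mat 1 \<and> B ** A = mat 1)}"

definition model_act ::
    "'a::comm_ring_1 ^ 5 ^ 5 \<Rightarrow> 'a ^ 5 ^ 5 \<Rightarrow> 'a pfaffian_model \<Rightarrow> 'a pfaffian_model" where
  "model_act A B \<Phi> =
    (let A' = (\<chi> i j. mconst (A $ i $ j)) :: 'a pfaffian_model in
      (\<chi> r s. meval mconst (\<lambda>j. \<Sum>i\<in>UNIV. mconst (B $ i $ j) * mvar i)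
        ((A' ** \<Phi> ** transpose A') $ r $ s)))"

definition model_equiv :: "'a::comm_ring_1 set \<Rightarrow> 'a pfaffian_model \<Rightarrow> 'a pfaffian_model \<Rightarrow> bool" where
  "model_equiv R \<Phi> \<Psi> \<longleftrightarrow> (\<exists>A\<in>GL5 R. \<exists>B\<in>GL5 R. \<Psi> = model_act A B \<Phi>)"

definition pfaffians :: "'a::comm_ring_1 pfaffian_model \<Rightarrow> 'a pol5 set" where
  "pfaffians \<Phi> = {\<Phi> $ a $ b * \<Phi> $ c $ d - \<Phi> $ a $ c * \<Phi> $ b $ d + \<Phi> $ a $ d * \<Phi> $ b $ c
    | a b c d. a < b \<and> b < c \<and> c < d}"

definition pfaffian_ideal :: "'a::comm_ring_1 set \<Rightarrow> 'a pfaffian_model \<Rightarrow> 'a pol5 set" where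
  "pfaffian_ideal R \<Phi> = Idl\<^bsub>mpol_ring R\<^esub> (pfaffians \<Phi>)"


section \<open>Nonsingular models\<close>

definition forms_dim :: "'a::field pol5 set \<Rightarrow> nat \<Rightarrow> nat" where
  "forms_dim V d = vector_space.dim (\<lambda>c p. mconst c * p) {p\<in>V. form_of_degree d p}"

definition hilbert_function :: "'a::field pol5 set \<Rightarrow> nat \<Rightarrow> nat" where
  "hilbert_function I d = forms_dim (UNIV :: 'a pol5 set) d - forms_dim I d"

text \<open>
  For a curve with Hilbert polynomial \<open>H\<close> the arithmetic genus is \<open>1 - H(0)\<close>.
\<close>

definition curve_has_arithmetic_genus :: "'a::field pol5 set \<Rightarrow> int \<Rightarrow> bool" where
  "curve_has_arithmetic_genus I g \<longleftrightarrow> (\<exists>H :: rat Polynomial.poly.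
    (\<forall>\<^sub>F d in sequentially. Polynomial.poly H (of_nat d) = of_nat (hilbert_function I d)) \<and>
    of_int g = 1 - Polynomial.poly H 0)"

text \<open>
  A smooth genus one curve is smooth and geometrically integral of dimension one and genus one;
  smoothness is regularity after base change to the algebraic closure, and dimension and genus
  are insensitive to that base change.
\<close>

definition base_change_ac :: "'a::field pfaffian_model \<Rightarrow> 'a alg_closure pfaffian_model" where
  "base_change_ac \<Phi> = (\<chi> i j. Poly_Mapping.map to_ac (\<Phi> $ i $ j))"

definition nonsingular_model :: "'a::field pfaffian_model \<Rightarrow> bool" where
  "nonsingular_model \<Phi> \<longleftrightarrow>
    (let I = pfaffian_ideal UNIV (base_change_ac \<Phi>) in
      integral_scheme UNIV I \<and> regular_scheme UNIV I \<and>
      space_dim (proj_space UNIV I) = 1 \<and> curve_has_arithmetic_genus I 1)"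


section \<open>The discriminant\<close>

text \<open>
  Elements of \<open>\<int>[X\<^sub>5]\<close>: the variable \<open>(i, j, k)\<close> with \<open>i < j\<close> stands for the coefficient of
  \<open>x\<^sub>k\<close> in the entry \<open>(i, j)\<close>.
\<close>

type_synonym X5_pol = "(5 \<times> 5 \<times> 5, int) mpol"

definition X5_polynomial :: "X5_pol \<Rightarrow> bool" where
  "X5_polynomial D \<longleftrightarrow> (\<forall>m\<in>Poly_Mapping.keys D. \<forall>(i, j, k)\<in>Poly_Mapping.keys m. i < j)"

definition eval_model :: "X5_pol \<Rightarrow> 'a::comm_ring_1 pfaffian_model \<Rightarrow> 'a" where
  "eval_model D \<Phi> =
    meval of_int (\<lambda>(i, j, k). Poly_Mapping.lookup (\<Phi> $ i $ j) (Poly_Mapping.single k 1)) D"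

definition weierstrass_disc :: "'a::comm_ring_1 \<Rightarrow> 'a \<Rightarrow> 'a \<Rightarrow> 'a \<Rightarrow> 'a \<Rightarrow> 'a" where
  "weierstrass_disc a1 a2 a3 a4 a6 =
    (let b2 = a1 ^ 2 + 4 * a2;
         b4 = 2 * a4 + a1 * a3;
         b6 = a3 ^ 2 + 4 * a6;
         b8 = a1 ^ 2 * a6 + 4 * a2 * a6 - a1 * a3 * a4 + a2 * a3 ^ 2 - a4 ^ 2
     in - (b2 ^ 2 * b8) - 8 * b4 ^ 3 - 27 * b6 ^ 2 + 9 * b2 * b4 * b6)"

text \<open>
  The Pfaffian model of the curve \<open>y\<^sup>2 + a\<^sub>1xy + a\<^sub>3y = x\<^sup>3 + a\<^sub>2x\<^sup>2 + a\<^sub>4x + a\<^sub>6\<close> embedded by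
  \<open>(x\<^sub>0 : x\<^sub>1 : x\<^sub>2 : x\<^sub>3 : x\<^sub>4) = (1 : x : y : x\<^sup>2 : xy)\<close>, that is, by the divisor \<open>5\<cdot>O\<close>.
  Three of its Pfaffians are the minors of the matrix with rows \<open>(x\<^sub>0, x\<^sub>1, x\<^sub>2)\<close> and
  \<open>(x\<^sub>1, x\<^sub>3, x\<^sub>4)\<close>, the other two are the Weierstrass equation and \<open>x\<close> times it.
\<close>

definition weierstrass_model :: "'a::comm_ring_1 \<Rightarrow> 'a \<Rightarrow> 'a \<Rightarrow> 'a \<Rightarrow> 'a \<Rightarrow> 'a pfaffian_model" where
  "weierstrass_model a1 a2 a3 a4 a6 =
    (let u = (\<lambda>(i :: 5) (j :: 5).
        if (i, j) = (0, 2) then mvar 0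
        else if (i, j) = (0, 3) then mvar 1
        else if (i, j) = (0, 4) then mvar 2
        else if (i, j) = (1, 2) then mvar 1
        else if (i, j) = (1, 3) then mvar 3
        else if (i, j) = (1, 4) then mvar 4
        else if (i, j) = (2, 3) then mvar 2
        else if (i, j) = (2, 4) then mvar 3
        else if (i, j) = (3, 4) then
          mconst a1 * mvar 4 + mconst a3 * mvar 2 - mconst a2 * mvar 3
            - mconst a4 * mvar 1 - mconst a6 * mvar 0
        else 0)
     in \<chi> i j. u i j - u j i)"

text \<open>
  The properties of the discriminant over a given field: an integral form of degree 60 and
  weight 12, nonzero exactly on nonsingular models, and normalised so that a Weierstrass
  equation and the corresponding Pfaffian model have the same discriminant.  Over the complex
  numbers every nonsingular model is equivalent to a Weierstrass model, so there the properties
  single out one polynomial with integer coefficients.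
\<close>

definition pfaffian_discriminant :: "'f::field itself \<Rightarrow> X5_pol \<Rightarrow> bool" where
  "pfaffian_discriminant _ D \<longleftrightarrow> X5_polynomial D \<and> form_of_degree 60 D \<and>
    (\<forall>\<Phi>\<in>X5 (UNIV :: 'f set). \<forall>A\<in>GL5 UNIV. \<forall>B\<in>GL5 UNIV.
      eval_model D (model_act A B \<Phi>) = (det A ^ 2 * det B) ^ 12 * eval_model D \<Phi>) \<and>
    (\<forall>\<Phi>\<in>X5 (UNIV :: 'f set). eval_model D \<Phi> \<noteq> 0 \<longleftrightarrow> nonsingular_model \<Phi>) \<and>
    (\<forall>a1 a2 a3 a4 a6 :: 'f.
      eval_model D (weierstrass_model a1 a2 a3 a4 a6) = weierstrass_disc a1 a2 a3 a4 a6)"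


section \<open>Discrete valuations and minimal models\<close>

text \<open>A normalised discrete valuation; the value at \<open>0\<close> is immaterial.\<close>

definition discrete_valuation :: "('a::field \<Rightarrow> int) \<Rightarrow> bool" where
  "discrete_valuation v \<longleftrightarrow>
    (\<forall>x y. x \<noteq> 0 \<longrightarrow> y \<noteq> 0 \<longrightarrow> v (x * y) = v x + v y) \<and>
    (\<forall>x y. x \<noteq> 0 \<longrightarrow> y \<noteq> 0 \<longrightarrow> x + y \<noteq> 0 \<longrightarrow> min (v x) (v y) \<le> v (x + y)) \<and>
    (\<exists>\<pi>. \<pi> \<noteq> 0 \<and> v \<pi> = 1)"

definition valuation_ring :: "('a::field \<Rightarrow> int) \<Rightarrow> 'a set" where
  "valuation_ring v = {x. x = 0 \<or> 0 \<le> v x}"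

definition residue_field :: "('a::field \<Rightarrow> int) \<Rightarrow> 'a set ring" where
  "residue_field v = ring_on (valuation_ring v) Quot {x. x = 0 \<or> 0 < v x}"

definition minimal_model :: "('a::field \<Rightarrow> int) \<Rightarrow> X5_pol \<Rightarrow> 'a pfaffian_model \<Rightarrow> bool" where
  "minimal_model v D \<Phi> \<longleftrightarrow> \<Phi> \<in> X5 (valuation_ring v) \<and> nonsingular_model \<Phi> \<and>
    (\<forall>\<Psi>\<in>X5 (valuation_ring v). model_equiv UNIV \<Phi> \<Psi> \<longrightarrow>
      v (eval_model D \<Phi>) \<le> v (eval_model D \<Psi>))"

end

theory Submission
  imports Defs "HOL-Algebra.Free_Abelian_Groups"
begin

text \<open>
  Write \<open>\<Phi>\<close> as a tensor \<open>c\<close> with entries in the valuation ring. Minimality of the discriminant says that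
  \<open>det A\<^sup>2 det B\<close> is integral whenever \<open>[A, B]\<close> keeps the tensor integral; diagonal \<open>[A, B]\<close> exclude
  zero patterns of \<open>c\<close> modulo the maximal ideal. If the special fibre had a component of dimension at least two,
  with prime \<open>P\<close>, a discussion by the number of independent linear forms in \<open>P\<close> would produce an excluded
  pattern; when there is none, one projects from a point where \<open>\<Phi>\<close> has rank two, and \<open>P\<close> contains no
  two independent quadrics in four variables. So every three coordinates satisfy an equation on the special fibre, the
  Pfaffians have grade three there, and the Buchsbaum-Eisenbud complex is exact modulo the maximal ideal. Its first
  syzygies lift, which makes the homogeneous coordinate ring torsion-free over the base, and it grows linearly.

  Torsion-freeness gives flatness, since finitely generated torsion-free modules over a valuation ring are free. It also
  makes the closure of the geometric generic fibre, which is integral by nonsingularity, the whole scheme. Linear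
  growth bounds the dimension by two; a chain of three points is obtained by contracting two points of the geometric
  generic fibre and adding a point of the special fibre.
\<close>

section \<open>Ideals of a subring and linear relations modulo a prime\<close>

text \<open>Polynomial rings over the residue field are never formed. What is said modulo the
  maximal ideal is said inside \<open>K[x]\<close>, as membership in \<open>Mv\<close>, in
  \<open>N\<close> (coefficients in \<open>Mv\<close>), or in a prime of \<open>S\<close> above
  \<open>N\<close>; thus both fibres and the total space live in one type. The residue field enters
  only through \<open>root_mod_M\<close>. Dimension is replaced by counting.
  \<open>bounded_growth\<close> says that, up to a denominator, the forms of degree \<open>d\<close>
  are spanned by \<open>C (d + 1)\<close> elements, and this is incompatible with about
  \<open>m^2\<close> independent forms of degree proportional to \<open>m\<close>. The same count
  excludes large components of the special fibre and bounds chains of points. A diagonal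
  \<open>[A, B]\<close> with exponents \<open>\<alpha>\<close>, \<open>\<beta>\<close> contradicts
  minimality as soon as \<open>2 sum \<alpha> + sum \<beta>\<close> is negative; every excluded
  pattern is one where the value -1 can be reached, sometimes after a preliminary row or column
  operation. The residue characteristic may be two. Hence alternating includes the zero diagonal,
  and the vanishing of a quadratic form is always stated for the coefficients of squares and of
  mixed monomials separately.\<close>

definition sub_ring :: "'r::comm_ring_1 set => bool" where
 "sub_ring R \<longleftrightarrow> 0 : R & 1 : R & (ALL a:R. - a : R) & (ALL a:R. ALL b:R. a + b : R & a * b : R)"

definition is_ideal :: "'r::comm_ring_1 set => 'r set => bool" where
 "is_ideal R J \<longleftrightarrow> J \<subseteq> R & 0 : J & (ALL a:J. ALL b:J. a + b : J) & (ALL r:R. ALL a:J. r * a : J)"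

definition is_prime :: "'r::comm_ring_1 set => 'r set => bool" where
 "is_prime R P \<longleftrightarrow> is_ideal R P & 1 ~: P & (ALL a:R. ALL b:R. a * b : P --> a : P \<or> b : P)"

lemma sub_ringD:
 assumes "sub_ring R"
 shows "0 : R" "1 : R" "a : R ==> - a : R" "a : R ==> b : R ==> a + b : R"
  "a : R ==> b : R ==> a * b : R" "a : R ==> b : R ==> a - b : R" "a : R ==> a ^ n : R"
  "(!!i. i : I ==> f i : R) ==> sum f I : R" "(!!i. i : I ==> f i : R) ==> prod f I : R"
proof -
 show *: "0 : R" "1 : R" "a : R ==> - a : R" "!!a b. a : R ==> b : R ==> a + b : R"
  "!!a b. a : R ==> b : R ==> a * b : R"
  using assms by (auto simp: sub_ring_def)
 show "a : R ==> b : R ==> a - b : R"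
  using assms unfolding sub_ring_def by (metis diff_conv_add_uminus)
 show "a : R ==> a ^ n : R" by (induction n) (auto simp: *)
 show "(!!i. i : I ==> f i : R) ==> sum f I : R"
  by (induction I rule: infinite_finite_induct) (auto simp: *)
 show "(!!i. i : I ==> f i : R) ==> prod f I : R"
  by (induction I rule: infinite_finite_induct) (auto simp: *)
qed

lemma is_idealD:
 assumes "sub_ring R" "is_ideal R J"
 shows "a : J ==> a : R" "0 : J" "a : J ==> b : J ==> a + b : J" "r : R ==> a : J ==> r * a : J"
  "r : R ==> a : J ==> a * r : J" "a : J ==> - a : J" "a : J ==> b : J ==> a - b : J"
  "(!!i. i : I ==> f i : J) ==> sum f I : J"
proof -
 show *: "!!a b. a : J ==> b : J ==> a + b : J" "a : J ==> a : R" "0 : J" "r : R ==> a : J ==> r * a : J"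
  using assms(2) by (auto simp: is_ideal_def)
 show "r : R ==> a : J ==> a * r : J" using assms(2) by (metis is_ideal_def mult.commute)
 have m: "- a : J" if "a : J" for a
 proof -
  have "(- 1) * a : J" using assms that unfolding is_ideal_def sub_ring_def by blast
  thus ?thesis by simp
 qed
 show "a : J ==> - a : J" by (rule m)
 show "a : J ==> b : J ==> a - b : J" using *(1)[of a "- b"] m[of b] by simp
 show "(!!i. i : I ==> f i : J) ==> sum f I : J"
  by (induction I rule: infinite_finite_induct) (auto simp: *)
qed

lemma is_idealI:
 assumes "J \<subseteq> R" "0 : J" "!!a b. a : J ==> b : J ==> a + b : J" "!!r a. r : R ==> a : J ==> r * a : J"
 shows "is_ideal R J"
 using assms by (auto simp: is_ideal_def)

lemma is_primeD:
 assumes "is_prime R P"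
 shows "is_ideal R P" "1 ~: P" "a : R ==> b : R ==> a * b : P ==> a : P \<or> b : P"
 using assms by (auto simp: is_prime_def)

lemma is_prime_power:
 assumes "sub_ring R" "is_prime R P" "a : R" "a ^ n : P"
 shows "a : P"
 using assms(4)
proof (induction n)
 case 0 thus ?case using is_primeD(2)[OF assms(2)] by simp
next
 case (Suc n)
 thus ?case using is_primeD(3)[OF assms(2,3) sub_ringD(7)[OF assms(1,3), of n]] by auto
qed

text \<open>The notions of the statement are locales of HOL-Algebra; this lemma and
  \<open>primeideal_ring_on_iff\<close> translate them once, so that all computations take place
  with sets in type-class rings.\<close>

lemma ideal_ring_on_iff:
 assumes "sub_ring R" shows "ideal J (ring_on R) \<longleftrightarrow> is_ideal R J"
proof
 assume "ideal J (ring_on R)"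
 then interpret ideal J "ring_on R" .
 show "is_ideal R J"
  using a_subset additive_subgroup.zero_closed[OF is_additive_subgroup] additive_subgroup.a_closed[OF is_additive_subgroup] I_l_closed
  by (intro is_idealI) (auto simp: ring_on_def)
next
 assume J: "is_ideal R J"
 note s = sub_ringD[OF assms]
 have R: "ring (ring_on R)"
  by (rule ringI, rule abelian_groupI, auto simp: ring_on_def s algebra_simps intro!: monoidI)
   (metis add.right_inverse add.commute s(3))
 show "ideal J (ring_on R)"
 proof (rule idealI[OF R])
  show "subgroup J (add_monoid (ring_on R))"
  proof
   show "J \<subseteq> carrier (add_monoid (ring_on R))" using is_idealD(1)[OF assms J] by (auto simp: ring_on_def)
   show "inv\<^bsub>add_monoid (ring_on R)\<^esub> x : J" if x: "x : J" for x
   proof -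
    have xR: "x : R" using x is_idealD(1)[OF assms J] by auto
    interpret ring "ring_on R" by (rule R)
    have "inv\<^bsub>add_monoid (ring_on R)\<^esub> x = - x"
     using minus_equality[of "-x" x] xR s(3)[OF xR] by (simp add: ring_on_def a_inv_def)
    thus ?thesis using is_idealD(6)[OF assms J x] by simp
   qed
  qed (use is_idealD[OF assms J] in \<open>auto simp: ring_on_def\<close>)
 qed (use is_idealD[OF assms J] in \<open>auto simp: ring_on_def\<close>)
qed

lemma cring_ring_on: assumes "sub_ring R" shows "cring (ring_on R)"
proof -
 note s = sub_ringD[OF assms]
 show ?thesis
  by (rule cringI, rule abelian_groupI, auto simp: ring_on_def s algebra_simps intro!: comm_monoidI)
   (metis add.right_inverse add.commute s(3))
qed

lemma primeideal_ring_on_iff: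
 assumes "sub_ring R" shows "primeideal P (ring_on R) \<longleftrightarrow> is_prime R P"
proof
 assume "primeideal P (ring_on R)"
 then interpret primeideal P "ring_on R" .
 have "is_ideal R P" using ideal_ring_on_iff[OF assms] is_ideal by simp
 moreover have "1 ~: P" using I_notcarr one_imp_carrier by (auto simp: ring_on_def)
 ultimately show "is_prime R P" using I_prime by (auto simp: is_prime_def ring_on_def)
next
 assume P: "is_prime R P"
 show "primeideal P (ring_on R)"
 proof (rule primeidealI)
  show "ideal P (ring_on R)" using P ideal_ring_on_iff[OF assms] by (simp add: is_prime_def)
  show "cring (ring_on R)" by (rule cring_ring_on[OF assms])
  show "carrier (ring_on R) ~= P" using is_primeD(2)[OF P] sub_ringD(2)[OF assms] by (auto simp: ring_on_def)
 qed (use is_primeD(3)[OF P] in \<open>auto simp: ring_on_def\<close>)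
qed

text \<open>An ideal that is maximal among those containing \<open>J\<close> and missing the
  multiplicative set \<open>T\<close> is prime; Zorn's lemma provides one.\<close>

lemma exists_prime_avoiding:
 fixes R :: "'a::comm_ring_1 set"
 assumes R: "sub_ring R" and J: "is_ideal R J" and T: "T \<subseteq> R" "1 : T" "!!a b. a : T ==> b : T ==> a * b : T"
  and JT: "J \<inter> T = {}"
 shows "EX P. is_prime R P & J \<subseteq> P & P \<inter> T = {}"
proof -
 define \<A> where "\<A> = {P. is_ideal R P & J \<subseteq> P & P \<inter> T = {}}"
 have "EX P:\<A>. ALL Y:\<A>. P \<subseteq> Y --> Y = P"
 proof (rule subset_Zorn_nonempty)
  show "\<A> ~= {}" using J JT by (auto simp: \<A>_def)
  fix \<C> assume C: "\<C> ~= {}" "subset.chain \<A> \<C>"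
  have "a + b : \<Union>\<C>" if ab: "a : \<Union>\<C>" "b : \<Union>\<C>" for a b
  proof -
   obtain A B where AB: "A : \<C>" "a : A" "B : \<C>" "b : B" using ab by auto
   hence "A \<subseteq> B \<or> B \<subseteq> A" using C(2) by (auto simp: subset_chain_def)
   then obtain D where D: "D : \<C>" "a : D" "b : D" using AB by blast
   hence "is_ideal R D" using C(2) by (auto simp: subset_chain_def \<A>_def)
   thus ?thesis using is_idealD(3)[OF R, of D a b] D by auto
  qed
  hence "is_ideal R (\<Union>\<C>)"
  proof (intro is_idealI)
   have D: "is_ideal R D" if "D : \<C>" for D using C(2) that by (auto simp: subset_chain_def \<A>_def)
   show "\<Union>\<C> \<subseteq> R" using is_idealD(1)[OF R D] by auto
   show "0 : \<Union>\<C>" using is_idealD(2)[OF R D] C(1) by auto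
   show "r * a : \<Union>\<C>" if "r : R" "a : \<Union>\<C>" for r a
    using is_idealD(4)[OF R D] that by auto
  qed
  thus "\<Union>\<C> : \<A>" using C unfolding subset_chain_def \<A>_def by blast
 qed
 then obtain P where P: "P : \<A>" and max: "!!Y. Y : \<A> ==> P \<subseteq> Y ==> Y = P" by blast
 have iP: "is_ideal R P" and JP: "J \<subseteq> P" and PT: "P \<inter> T = {}" using P by (auto simp: \<A>_def)
 note s = sub_ringD[OF R] and d = is_idealD[OF R iP]
 \<comment> \<open>Maximality of \<open>P\<close>: together with any \<open>a\<close> outside it, it
   generates an ideal that meets \<open>T\<close>.\<close>
 have ex: "EX p:P. EX r:R. p + r * a : T" if a: "a : R" "a ~: P" for a
 proof (rule ccontr)
  assume n: "\<not> ?thesis"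
  let ?X = "{p + r * a | p r. p : P & r : R}"
  have "is_ideal R ?X"
  proof (intro is_idealI)
   show "?X \<subseteq> R" using a(1) d(1) s by auto
   have "(0::'a) = 0 + 0 * a" by simp
   thus "0 : ?X" using d(2) s(1) by blast
   fix x y assume "x : ?X"
   then obtain p r where x: "x = p + r * a" "p : P" "r : R" by blast
   { assume "y : ?X"
    then obtain p' r' where y: "y = p' + r' * a" "p' : P" "r' : R" by blast
    have "x + y = (p + p') + (r + r') * a" by (simp add: x y algebra_simps)
    thus "x + y : ?X" using d(3)[OF x(2) y(2)] s(4)[OF x(3) y(3)] by blast }
   { assume "y : R"
    hence "y * x = y * p + (y * r) * a" "y * p : P" "y * r : R"
     using x d(4) s(5) by (simp_all add: distrib_left mult.assoc)
    thus "y * x : ?X" by blast }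
  qed
  moreover have sub: "P \<subseteq> ?X" using s(1) by force
  moreover have "?X \<inter> T = {}" using n by auto
  ultimately have "?X = P" using max[of ?X] JP by (auto simp: \<A>_def)
  moreover have "a : ?X" using d(2) s(2) by force
  ultimately show False using a by simp
 qed
 have "a : P \<or> b : P" if ab: "a : R" "b : R" "a * b : P" for a b
 proof (rule ccontr)
  assume "\<not> ?thesis"
  then obtain p r p' r' where *: "p : P" "r : R" "p + r * a : T" "p' : P" "r' : R" "p' + r' * b : T"
   using ex[of a] ex[of b] ab by blast
  have "(p + r * a) * (p' + r' * b) = p * (p' + r' * b) + (r * a) * p' + (r * r') * (a * b)"
   by (simp add: algebra_simps)
  also have "... : P"
   using d(5)[OF subsetD[OF T(1) *(6)] *(1)] d(4)[OF s(5)[OF *(2) ab(1)] *(4)] d(4)[OF s(5)[OF *(2,5)] ab(3)]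
   by (intro d(3))
  finally show False using T(3)[OF *(3,6)] PT by auto
 qed
 hence "is_prime R P" using iP PT T(2) by (auto simp: is_prime_def)
 thus ?thesis using JP PT by blast
qed

text \<open>By fraction-free elimination.\<close>

lemma relation_mod_prime:
 assumes R: "sub_ring R" and q: "is_prime R q" and "finite E" "finite I" "card E < card I"
  and "!!i e. i : I ==> e : E ==> f i e : R"
 shows "EX b. (ALL i:I. b i : R) & (EX i:I. b i ~: q) & (ALL e:E. (SUM i:I. b i * f i e) : q)"
 using assms(3-6)
proof (induction E arbitrary: I f)
 case empty
 hence "I ~= {}" by auto
 thus ?case
  using sub_ringD(2)[OF R] is_primeD(2)[OF q] by (intro exI[of _ "%_. 1"]) auto
next
 case (insert e E)
 note s = sub_ringD[OF R] and d = is_idealD[OF R is_primeD(1)[OF q]]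
 show ?case
 proof (cases "ALL i:I. f i e : q")
  case True
  obtain b where b: "ALL i:I. b i : R" "EX i:I. b i ~: q" "ALL e:E. (SUM i:I. b i * f i e) : q"
   using insert.IH[of I f] insert.prems insert.hyps by auto
  moreover have "(SUM i:I. b i * f i e) : q" using True b(1) by (auto intro!: d(8) d(4))
  ultimately show ?thesis by (intro exI[of _ b]) auto
 next
  case False
  then obtain i0 where i0: "i0 : I" "f i0 e ~: q" by auto
  let ?I = "I - {i0}" and ?f = "%i x. f i0 e * f i x - f i e * f i0 x"
  have "card E < card ?I" using insert.prems insert.hyps i0 by simp
  then obtain b where b: "ALL i:?I. b i : R" "EX i:?I. b i ~: q" "ALL x:E. (SUM i:?I. b i * ?f i x) : q"
   using insert.IH[of ?I ?f] insert.prems i0 by (auto intro!: s)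
  define c where "c i = (if i = i0 then - (SUM i:?I. b i * f i e) else b i * f i0 e)" for i
  have sum: "(SUM i:I. c i * f i x) = (SUM i:?I. b i * ?f i x)" for x
  proof -
   have "(SUM i:I. c i * f i x) = c i0 * f i0 x + (SUM i:?I. c i * f i x)"
    using i0 insert.prems(1) by (simp add: sum.remove)
   also have "(SUM i:?I. c i * f i x) = (SUM i:?I. b i * f i0 e * f i x)" by (intro sum.cong) (auto simp: c_def)
   finally have "(SUM i:I. c i * f i x) = c i0 * f i0 x + (SUM i:?I. b i * f i0 e * f i x)" .
   moreover have "c i0 = - (SUM i:?I. b i * f i e)" by (simp add: c_def)
   ultimately show ?thesis
    by (simp add: sum_distrib_left sum_distrib_right sum_subtractf right_diff_distrib mult_ac)
  qed
  have "(SUM i:I. c i * f i e) = 0" by (simp add: sum algebra_simps)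
  hence "ALL x:insert e E. (SUM i:I. c i * f i x) : q" using b(3) d(2) by (auto simp: sum)
  moreover have "ALL i:I. c i : R" using b(1) i0 insert.prems by (auto simp: c_def intro!: s)
  moreover obtain j where j: "j : ?I" "b j ~: q" using b(2) by auto
  hence "c j ~: q" using is_primeD(3)[OF q, of "b j" "f i0 e"] b(1) i0 insert.prems(3) by (auto simp: c_def)
  ultimately show ?thesis using j by blast
 qed
qed

section \<open>Polynomials\<close>

abbreviation "sgl \<equiv> Poly_Mapping.single"
abbreviation "supp \<equiv> Poly_Mapping.keys"
abbreviation "pcoeff \<equiv> Polynomial.coeff"
abbreviation "coef \<equiv> Poly_Mapping.lookup"
abbreviation "mnm m \<equiv> sgl m 1"

definition rhom :: "('a::comm_ring_1 => 'b::comm_ring_1) => bool" where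
 "rhom h \<longleftrightarrow> h 1 = 1 & (ALL a b. h (a + b) = h a + h b) & (ALL a b. h (a * b) = h a * h b)"

lemma rhomD:
 assumes "rhom h" shows "h 1 = 1" "h (a + b) = h a + h b" "h (a * b) = h a * h b" "h 0 = 0"
  "h (- a) = - h a" "h (a - b) = h a - h b" "h (sum f I) = (SUM i:I. h (f i))" "h (a ^ n) = h a ^ n"
proof -
 show *: "h 1 = 1" "h (a + b) = h a + h b" "h (a * b) = h a * h b" and 0: "h 0 = 0"
  using assms unfolding rhom_def by (auto, metis add_cancel_right_left)
 show m: "h (- a) = - h a" for a using assms 0 unfolding rhom_def by (metis add.right_inverse add_eq_0_iff)
 show "h (a - b) = h a - h b" using assms m unfolding rhom_def by (metis diff_conv_add_uminus)
 show "h (sum f I) = (SUM i:I. h (f i))"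
  using assms 0 by (induction I rule: infinite_finite_induct) (auto simp: rhom_def)
 show "h (a ^ n) = h a ^ n" using assms by (induction n) (auto simp: rhom_def)
qed

text \<open>The product runs over the whole finite index type instead of the support of
  \<open>m\<close>, which makes it multiplicative in \<open>m\<close> by \<open>power_add\<close>
  alone.\<close>

definition mval :: "('v::finite => 'b::comm_semiring_1) => ('v \<Rightarrow>\<^sub>0 nat) => 'b" where
 "mval s m = (\<Prod>i\<in>UNIV. s i ^ coef m i)"

lemma mval_add: "mval s (m + n) = mval s m * mval s n"
 by (simp add: mval_def lookup_add power_add prod.distrib)

lemma mval_0 [simp]: "mval s 0 = 1" by (simp add: mval_def)

lemma mval_single: "mval s (sgl i n) = s i ^ n"
proof -
 have "mval s (sgl i n) = (\<Prod>j\<in>UNIV. if j = i then s i ^ n else 1)"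
  unfolding mval_def by (intro prod.cong) (auto simp: lookup_single when_def)
 thus ?thesis by simp
qed

lemma meval_alt:
 fixes s :: "'v::finite => 'b::comm_semiring_1"
 assumes "finite A" "supp p \<subseteq> A" "h 0 = 0"
 shows "meval h s p = (SUM m:A. h (coef p m) * mval s m)"
proof -
 have "(\<Prod>i\<in>supp m. s i ^ coef m i) = mval s m" for m
  unfolding mval_def by (intro prod.mono_neutral_left) (auto simp: in_keys_iff)
 thus ?thesis unfolding meval_def using assms
  by (simp, intro sum.mono_neutral_left) (auto simp: in_keys_iff)
qed

lemma poly_sum_single: "p = (SUM m:supp p. sgl m (coef p m))"
 by (rule poly_mapping_eqI) (auto simp: lookup_sum lookup_single when_def in_keys_iff)

lemma rhom_meval:
 fixes s :: "'v::finite => 'b::comm_ring_1"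
 assumes h: "rhom h"
 shows "rhom (meval h s)" and "meval h s (sgl m c) = h c * mval s m"
proof -
 note h0 = rhomD(4)[OF h]
 have single: "meval h s (sgl m c) = h c * mval s m" for m c
  by (subst meval_alt[of "{m}"]) (auto simp: h0)
 show "meval h s (sgl m c) = h c * mval s m" by (rule single)
 have add: "meval h s (p + q) = meval h s p + meval h s q" for p q
 proof -
  let ?A = "supp p \<union> supp q"
  have "meval h s (p + q) = (SUM m:?A. h (coef (p + q) m) * mval s m)"
   by (rule meval_alt) (auto simp: h0 dest: subsetD[OF keys_add])
  also have "... = (SUM m:?A. h (coef p m) * mval s m) + (SUM m:?A. h (coef q m) * mval s m)"
   by (simp add: lookup_add rhomD[OF h] distrib_right sum.distrib)
  also have "... = meval h s p + meval h s q"
   using meval_alt[of ?A p h s] meval_alt[of ?A q h s] h0 by auto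
  finally show ?thesis .
 qed
 have 0: "meval h s 0 = 0" by (simp add: meval_def)
 have sum: "meval h s (sum f I) = (SUM i:I. meval h s (f i))" for f :: "_ => ('v, _) mpol" and I :: "('v \<Rightarrow>\<^sub>0 nat) set"
  by (induction I rule: infinite_finite_induct) (auto simp: add 0)
 have "meval h s (p * q) = meval h s p * meval h s q" for p q
 proof -
  have "meval h s (p * q) = meval h s ((SUM m:supp p. sgl m (coef p m)) *
    (SUM n:supp q. sgl n (coef q n)))"
   using poly_sum_single[of p] poly_sum_single[of q] by simp
  also have "... = (SUM m:supp p. SUM n:supp q.
    (h (coef p m) * mval s m) * (h (coef q n) * mval s n))"
   by (simp add: sum_product sum mult_single single mval_add rhomD[OF h] mult_ac)
  also have "... = meval h s p * meval h s q"
   using meval_alt[of "supp p" p h s] meval_alt[of "supp q" q h s] h0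
   by (simp add: sum_product)
  finally show ?thesis .
 qed
 moreover have "meval h s 1 = 1" using single[of 0 1] by (simp add: rhomD[OF h])
 ultimately show "rhom (meval h s)" by (simp add: rhom_def add)
qed

lemma rhom_mconst: "rhom (mconst :: 'a::comm_ring_1 => ('v, 'a) mpol)"
 by (simp add: rhom_def mconst_def single_add mult_single)

lemma meval_mconst [simp]: "rhom h ==> meval h s (mconst c :: ('v::finite, 'a::comm_ring_1) mpol) = h c"
 by (simp add: mconst_def rhom_meval)

lemma meval_mvar [simp]: "rhom h ==> meval h s (mvar i :: ('v::finite, 'a::comm_ring_1) mpol) = s i"
 by (simp add: mvar_def rhom_meval mval_single rhomD)

lemma mono_eq_mval: "mnm m = mval (mvar :: 'v::finite => ('v, 'a::comm_ring_1) mpol) m"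
proof -
 have p: "mvar i ^ n = (sgl (sgl i n) 1 :: ('v, 'a) mpol)" for i :: 'v and n
  by (induction n) (auto simp: mvar_def mult_single single_add[symmetric] single_zero)
 have "prod (%i. mnm (f i)) I = (mnm (sum f I) :: ('v, 'a) mpol)" for f :: "'v => _" and I
  by (induction I rule: infinite_finite_induct) (auto simp: mult_single)
 moreover have "m = (SUM i:UNIV. sgl i (coef m i))"
  by (rule poly_mapping_eqI) (simp add: lookup_sum lookup_single when_def)
 ultimately show ?thesis unfolding mval_def p by metis
qed

lemma single_conv: "sgl m c = mconst c * mnm m"
 for c :: "'a::comm_ring_1"
 by (simp add: mconst_def mult_single)

text \<open>Membership in \<open>mpols_over R\<close> is handed out only in the additive case; an
  application that needs it for products has to include it in \<open>Q\<close>.\<close>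

lemma mpols_over_induct [consumes 2, case_names const var add mult]:
 fixes p :: "('v::finite, 'a::comm_ring_1) mpol"
 assumes p: "p : mpols_over R" and R: "sub_ring R"
  and "!!a. a : R ==> Q (mconst a)" "!!i. Q (mvar i)"
  and "!!p q. p : mpols_over R ==> q : mpols_over R ==> Q p ==> Q q ==> Q (p + q)" "!!p q. Q p ==> Q q ==> Q (p * q)"
 shows "Q p"
proof -
 note s = sub_ringD[OF R]
 have q1: "Q 1" using assms(3)[of 1] s by (simp add: mconst_def)
 have pw: "Q (mvar i ^ n)" for i n by (induction n) (auto simp: q1 assms)
 have "Q (prod (%i. mvar i ^ f i) I)" for f :: "'v => nat" and I
  by (induction I rule: infinite_finite_induct) (auto simp: q1 pw assms)
 hence mono: "Q (mnm m)" for m unfolding mono_eq_mval mval_def by blast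
 have coR: "coef p m : R" for m using p by (auto simp: mpols_over_def)
 have "Q (SUM m:A. sgl m (coef p m)) & (SUM m:A. sgl m (coef p m)) : mpols_over R" for A
 proof (induction A rule: infinite_finite_induct)
  case (insert x A)
  have "sgl x (coef p x) : mpols_over R"
   by (auto simp: mpols_over_def lookup_single when_def coR s)
  moreover have "Q (sgl x (coef p x))" by (subst single_conv) (use coR mono assms in auto)
  ultimately show ?case using insert assms(5) s by (auto simp: mpols_over_def lookup_add)
 qed (use assms(3)[of 0] s in \<open>auto simp: mconst_def mpols_over_def\<close>)
 thus ?thesis using poly_sum_single[of p] by metis
qed

lemma sub_ring_UNIV: "sub_ring UNIV" by (simp add: sub_ring_def)

lemma mpol_induct [case_names const var add mult]:
 fixes p :: "('v::finite, 'a::comm_ring_1) mpol"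
 assumes "!!a. Q (mconst a)" "!!i. Q (mvar i)" "!!p q. Q p ==> Q q ==> Q (p + q)" "!!p q. Q p ==> Q q ==> Q (p * q)"
 shows "Q p"
proof -
 have "p : mpols_over UNIV" by (simp add: mpols_over_def)
 thus ?thesis using sub_ring_UNIV by (rule mpols_over_induct) (use assms in auto)
qed

lemma rhom_eqI:
 fixes \<alpha> \<beta> :: "('v::finite, 'a::comm_ring_1) mpol => 'b::comm_ring_1"
 assumes "rhom \<alpha>" "rhom \<beta>" "!!a. \<alpha> (mconst a) = \<beta> (mconst a)" "!!i. \<alpha> (mvar i) = \<beta> (mvar i)"
 shows "\<alpha> p = \<beta> p"
 by (induction p rule: mpol_induct) (simp_all add: assms rhomD[OF assms(1)] rhomD[OF assms(2)])

lemma meval_meval: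
 fixes t :: "'v::finite => ('w::finite, 'a::comm_ring_1) mpol"
 assumes "rhom h"
 shows "meval h s (meval mconst t p) = meval h (%j. meval h s (t j)) p"
proof (rule rhom_eqI[where \<alpha> = "%p. meval h s (meval mconst t p)"])
 show "rhom (%p. meval h s (meval mconst t p))"
  by (simp add: rhom_def rhomD[OF rhom_meval(1)[OF assms]] rhomD[OF rhom_meval(1)[OF rhom_mconst]])
qed (simp_all add: assms rhom_mconst rhom_meval)

lemma meval_id: "meval mconst mvar p = (p :: ('v::finite, 'a::comm_ring_1) mpol)"
 by (rule rhom_eqI[OF rhom_meval(1)[OF rhom_mconst], where \<beta> = "%p. p"]) (simp_all add: rhom_mconst, simp add: rhom_def)

lemma coef_mult_single: "coef (sgl m c * p) (m + n) = c * coef (p :: ('v, 'a::comm_ring_1) mpol) n"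
proof -
 have "coef (sgl m c * p) (m + n) =
  (SUM k:supp p. coef (sgl (m + k) (c * coef p k)) (m + n))"
  by (subst poly_sum_single[of p]) (simp add: sum_distrib_left mult_single lookup_sum)
 also have "... = (SUM k:supp p. if k = n then c * coef p n else 0)"
  by (intro sum.cong) (auto simp: lookup_single when_def)
 also have "... = c * coef p n" by (simp add: in_keys_iff)
 finally show ?thesis .
qed

lemma coef_mult_single_not:
 assumes "!!n. k ~= m + n"
 shows "coef (sgl m c * p) k = (0 :: 'a::comm_ring_1)"
 by (subst poly_sum_single[of p])
  (auto simp: sum_distrib_left mult_single lookup_sum lookup_single when_def assms intro!: sum.neutral)

lemma coef_mconst_mult [simp]: "coef (mconst c * p) n = c * coef (p :: ('v, 'a::comm_ring_1) mpol) n"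
 using coef_mult_single[of 0 c p n] by (simp add: mconst_def)

lemma sub_ring_mpols_over:
 assumes "sub_ring R" shows "sub_ring (mpols_over R :: ('v, 'a::comm_ring_1) mpol set)"
proof -
 note s = sub_ringD[OF assms]
 have add: "sum f I : mpols_over R" if "!!i. i : I ==> f i : mpols_over R" for f :: "('v \<Rightarrow>\<^sub>0 nat) => ('v, 'a) mpol" and I
  using that by (auto simp: mpols_over_def lookup_sum intro!: s)
 have "p * q : mpols_over R" if "p : mpols_over R" "q : mpols_over R" for p q :: "('v, 'a) mpol"
 proof -
  have "p * q = (SUM m:supp p. SUM n:supp q. sgl (m + n) (coef p m * coef q n))"
   by (subst poly_sum_single[of p], subst poly_sum_single[of q]) (simp add: sum_product mult_single)
  also have "... : mpols_over R"
   using that by (intro add) (auto simp: mpols_over_def lookup_single when_def intro!: s)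
  finally show ?thesis .
 qed
 thus ?thesis
  by (auto simp: sub_ring_def mpols_over_def lookup_add lookup_one when_def s)
qed

lemma mconst_in [simp]: "0 : R ==> mconst c : mpols_over R \<longleftrightarrow> c : R"
 by (auto simp: mconst_def mpols_over_def lookup_single when_def)

lemma mono_in: "sub_ring R ==> mnm m : mpols_over R"
 by (auto simp: mpols_over_def lookup_single when_def sub_ringD)

lemma mvar_in: "sub_ring R ==> mvar i : mpols_over R"
 unfolding mvar_def by (rule mono_in)

lemma single_in: "sub_ring R ==> c : R ==> sgl m c : mpols_over R"
 by (auto simp: mpols_over_def lookup_single when_def sub_ringD)

lemma meval_in:
 assumes "sub_ring R" "sub_ring T" "rhom h" "!!a. a : R ==> h a : T" "!!i. s i : T" "p : mpols_over R"
 shows "meval h s (p :: ('v::finite, 'a::comm_ring_1) mpol) : T"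
 using assms(6,1) by (induction rule: mpols_over_induct)
  (auto simp: assms rhomD[OF rhom_meval(1)[OF assms(3)]] sub_ringD[OF assms(2)])

section \<open>Forms\<close>

lemma mon_deg_sum: "mon_deg (m :: 'v::finite \<Rightarrow>\<^sub>0 nat) = (SUM i:UNIV. coef m i)"
 unfolding mon_deg_def by (intro sum.mono_neutral_left) (auto simp: in_keys_iff)

lemma mon_deg_add [simp]: "mon_deg (m + n :: 'v::finite \<Rightarrow>\<^sub>0 nat) = mon_deg m + mon_deg n"
 by (simp add: mon_deg_sum lookup_add sum.distrib)

lemma mon_deg_single [simp]: "mon_deg (sgl (i :: 'v::finite) n) = n"
 by (simp add: mon_deg_sum lookup_single when_def)

lemma mon_deg_0 [simp]: "mon_deg 0 = 0" by (simp add: mon_deg_def)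

lemma form_of_degree_alt: "form_of_degree d p \<longleftrightarrow> (ALL m. coef p m ~= 0 --> mon_deg m = d)"
 by (auto simp: form_of_degree_def in_keys_iff)

lemma coef_form_part: "coef (form_part d p) m = (if mon_deg m = d then coef p m else 0)"
 unfolding form_part_def lookup_sum lookup_single when_def
 by (auto simp: in_keys_iff)

lemma form_form_part [simp]: "form_of_degree d (form_part d p)"
 by (simp add: form_of_degree_alt coef_form_part)

lemma form_part_add: "form_part d (p + q) = form_part d p + form_part d q"
 by (rule poly_mapping_eqI) (simp add: coef_form_part lookup_add)

lemma form_part_0 [simp]: "form_part d 0 = 0"
 by (rule poly_mapping_eqI) (simp add: coef_form_part)

lemma form_part_diff: "form_part d (p - q :: ('v, 'a::comm_ring_1) mpol) = form_part d p - form_part d q"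
 by (rule poly_mapping_eqI) (simp add: coef_form_part lookup_minus)

lemma form_part_sum: "form_part d (sum f I) = (SUM i:I. form_part d (f i))"
 by (induction I rule: infinite_finite_induct) (auto simp: form_part_add)

lemma form_part_form: "form_of_degree e p ==> form_part d p = (if d = e then p else 0)"
 by (rule poly_mapping_eqI) (auto simp: coef_form_part form_of_degree_alt)

lemma form_part_in: "0 : R ==> p : mpols_over R ==> form_part d p : mpols_over R"
 by (auto simp: mpols_over_def coef_form_part)

lemma sum_form_parts: "p = (SUM d:mon_deg ` supp p. form_part d p)"
proof (rule poly_mapping_eqI)
 fix m
 have "(SUM d:mon_deg ` supp p. coef (form_part d p) m) =
  (SUM d:mon_deg ` supp p. if d = mon_deg m then coef p m else 0)"
  by (intro sum.cong) (auto simp: coef_form_part)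
 thus "coef p m = coef (SUM d:mon_deg ` supp p. form_part d p) m"
  by (auto simp: lookup_sum in_keys_iff)
qed

lemma form_add: "form_of_degree d p ==> form_of_degree d q ==> form_of_degree d (p + q)"
 by (auto simp: form_of_degree_alt lookup_add) (metis add_0)

lemma form_0 [simp]: "form_of_degree d 0" by (simp add: form_of_degree_def)

lemma form_uminus: "form_of_degree d (p :: ('v, 'a::comm_ring_1) mpol) ==> form_of_degree d (- p)"
 by (auto simp: form_of_degree_alt)

lemma form_diff: "form_of_degree d p ==> form_of_degree d q ==> form_of_degree d (p - q :: ('v, 'a::comm_ring_1) mpol)"
 using form_add[OF _ form_uminus, of d p q] by simp

lemma form_sum: "(!!i. i : I ==> form_of_degree d (f i)) ==> form_of_degree d (sum f I)"
 by (induction I rule: infinite_finite_induct) (auto intro: form_add)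

lemma form_single: "form_of_degree d (sgl m c) \<longleftrightarrow> c = 0 \<or> mon_deg m = d"
 by (auto simp: form_of_degree_def)

lemma form_mult:
 assumes "form_of_degree d p" "form_of_degree e q"
 shows "form_of_degree (d + e) (p * q :: ('v::finite, 'a::comm_ring_1) mpol)"
proof -
 have "p * q = (SUM m:supp p. SUM n:supp q. sgl (m + n) (coef p m * coef q n))"
  by (subst poly_sum_single[of p], subst poly_sum_single[of q]) (simp add: sum_product mult_single)
 also have "form_of_degree (d + e) ..."
  using assms by (intro form_sum) (auto simp: form_single form_of_degree_def)
 finally show ?thesis .
qed

lemma form_mvar: "form_of_degree 1 (mvar i :: ('v::finite, 'a::comm_ring_1) mpol)"
 by (simp add: mvar_def form_single)

lemma form_mconst: "form_of_degree 0 (mconst c :: ('v::finite, 'a::comm_ring_1) mpol)"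
 by (simp add: mconst_def form_single)

lemma form_mconst_mult: "form_of_degree d p ==> form_of_degree d (mconst c * p :: ('v::finite, 'a::comm_ring_1) mpol)"
 using form_mult[OF form_mconst] by fastforce

lemma form_power: "form_of_degree d p ==> form_of_degree (n * d) (p ^ n :: ('v::finite, 'a::comm_ring_1) mpol)"
 using form_mconst[of 1] by (induction n) (auto simp: mconst_def intro: form_mult)

lemma form_part_mult:
 fixes p q :: "('v::finite, 'a::comm_ring_1) mpol"
 assumes "form_of_degree e p"
 shows "form_part d (p * q) = (if e <= d then p * form_part (d - e) q else 0)"
proof -
 have "p * q = (SUM k:mon_deg ` supp q. p * form_part k q)"
  using sum_form_parts[of q] by (metis sum_distrib_left)
 hence "form_part d (p * q) = (SUM k:mon_deg ` supp q. if d = e + k then p * form_part k q else 0)"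
  by (simp add: form_part_sum form_part_form[OF form_mult[OF assms form_form_part]])
 also have "... = (if e <= d then SUM k:mon_deg ` supp q. if k = d - e then p * form_part k q else 0 else 0)"
  by (auto intro!: sum.cong sum.neutral simp del: sum.delta sum.delta')
 also have "... = (if e <= d then p * form_part (d - e) q else 0)"
 proof -
  have "form_part (d - e) q = 0" if "d - e ~: mon_deg ` supp q"
  proof (rule poly_mapping_eqI)
   fix k show "coef (form_part (d - e) q) k = coef 0 k"
    using that by (cases "k : supp q") (auto simp: coef_form_part in_keys_iff, metis image_eqI in_keys_iff)
  qed
  thus ?thesis by auto
 qed
 finally show ?thesis .
qed

lemma form_subst:
 fixes p :: "('v::finite, 'a::comm_ring_1) mpol" and t :: "'v => ('w::finite, 'a) mpol"
 assumes "form_of_degree d p" "!!i. form_of_degree 1 (t i)"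
 shows "form_of_degree d (meval mconst t p)"
proof -
 have pr: "form_of_degree (SUM i:I. coef m i) (\<Prod>i\<in>I. t i ^ coef m i)" for I m
  using form_mconst[of 1] form_power[OF assms(2)]
  by (induction I rule: infinite_finite_induct) (auto simp: mconst_def intro!: form_mult)
 have "form_of_degree d (mconst (coef p m) * mval t m)" if "m : supp p" for m
  using pr[of m UNIV] assms(1) that unfolding mval_def
  by (intro form_mconst_mult) (auto simp: form_of_degree_def mon_deg_sum)
 thus ?thesis
  by (subst meval_alt[of "supp p"]) (auto intro!: form_sum simp: rhomD(4)[OF rhom_mconst])
qed

section \<open>Discrete valuation rings\<close>

locale dvr =
 fixes v :: "'a::field => int"
 assumes dv: "discrete_valuation v"
begin

abbreviation "Ov \<equiv> valuation_ring v"
definition "Mv = {x. x = 0 \<or> 0 < v x}"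

lemma v_mult: "x ~= 0 ==> y ~= 0 ==> v (x * y) = v x + v y"
 and v_add: "x ~= 0 ==> y ~= 0 ==> x + y ~= 0 ==> min (v x) (v y) <= v (x + y)"
 using dv by (auto simp: discrete_valuation_def)

lemma v_1 [simp]: "v 1 = 0" using v_mult[of 1 1] by simp

lemma v_uminus: "x ~= 0 ==> v (- x) = v x"
 using v_mult[of "-1" "-1"] v_mult[of "-1" x] by simp

lemma v_inverse: "x ~= 0 ==> v (inverse x) = - v x"
 using v_mult[of x "inverse x"] by simp

lemma v_divide: "x ~= 0 ==> y ~= 0 ==> v (x / y) = v x - v y"
 by (simp add: divide_inverse v_mult v_inverse)

lemma v_power: "x ~= 0 ==> v (x ^ n) = int n * v x"
 by (induction n) (auto simp: v_mult algebra_simps)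

lemma sub_ring_O: "sub_ring Ov"
proof -
 have "a + b : Ov" if "a : Ov" "b : Ov" for a b
  using that v_add[of a b] by (cases "a = 0 \<or> b = 0 \<or> a + b = 0") (auto simp: valuation_ring_def)
 moreover have "- a : Ov" if "a : Ov" for a
  using that by (cases "a = 0") (auto simp: valuation_ring_def v_uminus)
 moreover have "a * b : Ov" if "a : Ov" "b : Ov" for a b
  using that by (cases "a = 0 \<or> b = 0") (auto simp: valuation_ring_def v_mult)
 ultimately show ?thesis by (auto simp: sub_ring_def valuation_ring_def)
qed

lemmas O_closed = sub_ringD[OF sub_ring_O]

lemma prime_M: "is_prime Ov Mv"
proof -
 have "a + b : Mv" if "a : Mv" "b : Mv" for a b
  using that v_add[of a b] by (cases "a = 0 \<or> b = 0 \<or> a + b = 0") (auto simp: Mv_def)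
 moreover have "r * a : Mv" if "r : Ov" "a : Mv" for r a
  using that by (cases "r = 0 \<or> a = 0") (auto simp: Mv_def valuation_ring_def v_mult)
 ultimately have "is_ideal Ov Mv" by (intro is_idealI) (auto simp: Mv_def valuation_ring_def)
 moreover have "a : Mv \<or> b : Mv" if "a : Ov" "b : Ov" "a * b : Mv" for a b
  using that v_mult[of a b] by (cases "a = 0 \<or> b = 0") (auto simp: Mv_def valuation_ring_def)
 ultimately show ?thesis by (auto simp: is_prime_def Mv_def)
qed

lemmas M_closed = is_idealD[OF sub_ring_O is_primeD(1)[OF prime_M]]
lemmas M_prime = is_primeD(3)[OF prime_M]

lemma one_notin_M [simp]: "1 ~: Mv" and zero_in_M [simp]: "0 : Mv" by (simp_all add: Mv_def)

lemma unitD: assumes "x : Ov" "x ~: Mv" shows "x ~= 0" "inverse x : Ov" "inverse x ~: Mv"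
 using assms by (auto simp: valuation_ring_def Mv_def v_inverse)

lemma unit_v: "x : Ov ==> x ~: Mv ==> v x = 0" by (auto simp: valuation_ring_def Mv_def)

lemma M_div: "x : Mv ==> y : Ov ==> y ~: Mv ==> x / y : Mv"
 using M_closed(5)[of "inverse y" x] unitD[of y] by (simp add: divide_inverse)

lemma O_div: "x : Ov ==> y : Ov ==> y ~: Mv ==> x / y : Ov"
 using O_closed(5)[of x "inverse y"] unitD[of y] by (simp add: divide_inverse)

lemma O_total: "x ~: Ov ==> inverse x : Mv"
 by (auto simp: valuation_ring_def Mv_def v_inverse)

definition "pp = (SOME p. p ~= 0 & v p = 1)"

lemma pp: "pp ~= 0" "v pp = 1" "pp : Ov" "pp : Mv"
proof -
 have "pp ~= 0 & v pp = 1"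
  unfolding pp_def using dv by (intro someI_ex[of "%p. p ~= 0 & v p = 1"]) (auto simp: discrete_valuation_def)
 thus "pp ~= 0" "v pp = 1" "pp : Ov" "pp : Mv" by (auto simp: valuation_ring_def Mv_def)
qed

lemma M_iff: "x : Mv \<longleftrightarrow> x / pp : Ov"
 using pp(1,2) v_divide[of x pp] by (cases "x = 0") (auto simp: valuation_ring_def Mv_def)

lemma pp_power_mult: "EX n. pp ^ n * x : Ov"
proof (cases "x = 0")
 case False
 hence "v (pp ^ nat \<bar>v x\<bar> * x) \<ge> 0" using pp by (simp add: v_mult v_power)
 thus ?thesis unfolding valuation_ring_def by blast
qed (auto simp: O_closed)

lemma nonzero_eq_pp_power: assumes "x : Ov" "x ~= 0" shows "EX n u. u : Ov & u ~: Mv & x = pp ^ n * u"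
proof -
 have "v (x / pp ^ nat (v x)) = 0" using assms pp v_divide[of x "pp ^ nat (v x)"] v_power[of pp "nat (v x)"]
  by (auto simp: valuation_ring_def)
 hence "x / pp ^ nat (v x) : Ov" "x / pp ^ nat (v x) ~: Mv" using assms pp by (auto simp: valuation_ring_def Mv_def)
 moreover have "x = pp ^ nat (v x) * (x / pp ^ nat (v x))" using pp by simp
 ultimately show ?thesis by blast
qed

text \<open>Divide by an entry of least valuation.\<close>

lemma scale_to_unit:
 assumes "finite I" "EX i:I. b i ~= 0"
 shows "EX a. a ~= 0 & (EX j:I. b j = a) & (ALL i:I. b i / a : Ov)"
proof -
 let ?I = "{i\<in>I. b i ~= 0}"
 have "finite ?I" "?I ~= {}" using assms by auto
 then obtain j where j: "j : ?I" "!!i. i : ?I ==> \<not> v (b i) < v (b j)"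
  using ex_is_arg_min_if_finite[of ?I "%i. v (b i)"] unfolding is_arg_min_def by blast
 have "b i / b j : Ov" if "i : I" for i
  using j that by (cases "b i = 0") (auto simp: valuation_ring_def v_divide not_less)
 hence "b j ~= 0 & (EX k:I. b k = b j) & (ALL i:I. b i / b j : Ov)" using j by auto
 thus ?thesis by blast
qed

text \<open>Elimination over the field, with the zero ideal as the prime, followed by rescaling. The
  relation holds exactly and has a coefficient 1, so it remains nontrivial modulo
  \<open>Mv\<close>.\<close>

lemma exact_relation:
 assumes "finite E" "finite I" "card E < card I"
 shows "EX b. (ALL i:I. b i : Ov) & (EX i:I. b i = 1) & (ALL e:E. (SUM i:I. b i * f i e) = 0)"
proof -
 have "is_prime UNIV {0 :: 'a}" by (auto simp: is_prime_def is_ideal_def)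
 from relation_mod_prime[OF sub_ring_UNIV this assms, of f] obtain b where
  b: "EX i:I. b i ~= 0" "ALL e:E. (SUM i:I. b i * f i e) = 0" by auto
 obtain a where a: "a ~= 0" "EX j:I. b j = a" "ALL i:I. b i / a : Ov"
  using scale_to_unit[OF assms(2) b(1)] by auto
 have "(SUM i:I. b i / a * f i e) = (SUM i:I. b i * f i e) / a" for e by (simp add: sum_divide_distrib)
 thus ?thesis using a b(2) by (intro exI[of _ "%i. b i / a"]) auto
qed

abbreviation S :: "'a pol5 set" where "S \<equiv> mpols_over Ov"
abbreviation N :: "'a pol5 set" where "N \<equiv> mpols_over Mv"

lemma sub_ring_S: "sub_ring S" by (rule sub_ring_mpols_over[OF sub_ring_O])

lemmas S_closed = sub_ringD[OF sub_ring_S]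
lemma S_gens: "mnm m : S" "mvar i : S" "c : Ov ==> sgl m c : S"
 by (rule mono_in[OF sub_ring_O] mvar_in[OF sub_ring_O] single_in[OF sub_ring_O]; assumption?)+

lemma mconst_S [simp]: "mconst c : S \<longleftrightarrow> c : Ov" by (simp add: O_closed)

lemma N_iff: "f : N \<longleftrightarrow> (EX g:S. f = mconst pp * g)"
proof
 assume f: "f : N"
 let ?g = "mconst (inverse pp) * f"
 have "inverse pp * coef f m : Ov" for m
  using f M_iff[of "coef f m"] by (simp add: mpols_over_def divide_inverse mult.commute)
 hence "?g : S" by (simp add: mpols_over_def)
 moreover have "f = mconst pp * ?g" using pp(1) by (intro poly_mapping_eqI) simp
 ultimately show "EX g:S. f = mconst pp * g" by blast
qed (use pp(4) M_closed(5) in \<open>auto simp: mpols_over_def\<close>)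

text \<open>Gauss's lemma. Dropping the coefficients in \<open>Mv\<close>, which is what
  \<open>u\<close> does, changes a polynomial only by an element of \<open>N\<close>; afterwards the
  product of the leading terms, for the linear order on exponents, cannot be cancelled.\<close>

lemma prime_N: "is_prime S N"
proof -
 have NS: "N \<subseteq> S" using M_closed(1) by (auto simp: mpols_over_def)
 have "r * a : N" if r: "r : S" and a: "a : N" for r a
 proof -
  obtain g where "g : S" "a = mconst pp * g" using a N_iff by blast
  hence "r * a = mconst pp * (r * g)" "r * g : S" using S_closed(5)[OF r] by auto
  thus ?thesis using N_iff by blast
 qed
 hence iN: "is_ideal S N" using NS M_closed(3) by (intro is_idealI) (auto simp: mpols_over_def lookup_add)
 have "a * b ~: N" if a: "a : S" "a ~: N" and b: "b : S" "b ~: N" for a b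
 proof -
  define A where "A a = {m : supp a. coef a m ~: Mv}" for a :: "'a pol5"
  define u where "u a = (SUM m:A a. sgl m (coef a m))" for a :: "'a pol5"
  have A: "finite (A a)" for a by (simp add: A_def)
  have cu: "coef (u a) m = (if coef a m : Mv then 0 else coef a m)" for a m
   unfolding u_def lookup_sum using A[of a] by (auto simp: lookup_single when_def A_def in_keys_iff)
  have u: "a - u a : N" "u a : S" if "a : S" for a
   using that M_closed(2) O_closed(1) unfolding mpols_over_def by (auto simp: lookup_minus cu)
  have ne: "A a ~= {}" "A b ~= {}" using a b by (auto simp: A_def mpols_over_def in_keys_iff) (metis zero_in_M)+
  let ?m = "Max (A a)" and ?n = "Max (A b)"
  have mn: "?m : A a" "?n : A b" using Max_in[OF A] ne by auto
  have uniq: "m + n = ?m + ?n \<longleftrightarrow> m = ?m & n = ?n" if "m : A a" "n : A b" for m n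
  proof -
   have "m <= ?m" "n <= ?n" using that A by auto
   thus ?thesis by (metis add_less_le_mono add_le_less_mono order.strict_iff_order less_irrefl)
  qed
  have "coef (u a * u b) (?m + ?n) = (SUM m:A a. SUM n:A b. if m = ?m & n = ?n then coef a ?m * coef b ?n else 0)"
   unfolding u_def sum_product mult_single lookup_sum
   by (intro sum.cong refl) (auto simp: lookup_single when_def uniq)
  also have "... = (SUM m:A a. if m = ?m then coef a ?m * coef b ?n else 0)"
   using mn A by (intro sum.cong refl) auto
  also have "... = coef a ?m * coef b ?n" using mn A by simp
  finally have "coef (u a * u b) (?m + ?n) ~: Mv"
   using M_prime[of "coef a ?m" "coef b ?n"] mn a b by (auto simp: A_def mpols_over_def)
  hence un: "u a * u b ~: N" by (auto simp: mpols_over_def)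
  have "a * b = u a * u b + (u a * (b - u b) + (a - u a) * b)" by (simp add: algebra_simps)
  moreover have "u a * (b - u b) + (a - u a) * b : N"
   using u a b is_idealD[OF sub_ring_S iN] by meson
  ultimately show ?thesis using un is_idealD(7)[OF sub_ring_S iN, of "a * b" "u a * (b - u b) + (a - u a) * b"] by auto
 qed
 moreover have "coef (1 :: 'a pol5) 0 ~: Mv" by simp
 hence "1 ~: N" unfolding mpols_over_def by blast
 ultimately show ?thesis using iN by (auto simp: is_prime_def)
qed

lemmas N_closed = is_idealD[OF sub_ring_S is_primeD(1)[OF prime_N]]
lemmas N_prime = is_primeD(3)[OF prime_N]

lemma mconst_N [simp]: "mconst c : N \<longleftrightarrow> c : Mv" by simp

end

section \<open>Algebraically closed residue field\<close>

locale dvr_closed = dvr +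
 assumes ac: "algebraically_closed (residue_field v)"
begin

text \<open>The reduction of \<open>p\<close> splits over the quotient ring, and a root is lifted
  back through the surjection \<open>h\<close>.\<close>

lemma root_mod_M:
 assumes p: "!!i. pcoeff p i : Ov" and n: "n \<ge> 1" "pcoeff p n ~: Mv"
 shows "EX a:Ov. Polynomial.poly p a : Mv"
proof -
 let ?R = "ring_on Ov"
 interpret L: algebraically_closed "residue_field v" by (rule ac)
 interpret R: cring ?R by (rule cring_ring_on[OF sub_ring_O])
 interpret M: ideal Mv ?R using prime_M ideal_ring_on_iff[OF sub_ring_O] by (simp add: is_prime_def)
 define h where "h a = Mv +>\<^bsub>?R\<^esub> a" for a
 have L: "residue_field v = ?R Quot Mv" by (simp add: residue_field_def Mv_def)
 have hom: "h : ring_hom ?R (residue_field v)" unfolding L h_def[abs_def] by (rule M.rcos_ring_hom)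
 have car: "carrier ?R = Ov" by (simp add: ring_on_def)
 have hc: "a : Ov ==> h a : carrier (residue_field v)" for a using ring_hom_closed[OF hom] car by auto
 have h0: "h a = \<zero>\<^bsub>residue_field v\<^esub> \<longleftrightarrow> a : Mv" if "a : Ov" for a
  using that car M.rcos_const_imp_mem M.a_rcos_const unfolding L h_def FactRing_def by auto
 have surj: "EX a:Ov. x = h a" if "x : carrier (residue_field v)" for x
  using that unfolding L FactRing_def h_def A_RCOSETS_def' car by auto
 \<comment> \<open>The degree of the reduction, possibly smaller than that of \<open>p\<close>; the
   coefficient at \<open>n\<close> shows that it is positive.\<close>
 define m where "m = Max {i. pcoeff p i ~: Mv}"
 have fin: "finite {i. pcoeff p i ~: Mv}"
  by (rule finite_subset[of _ "{..Polynomial.degree p}"]) (auto intro: le_degree)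
 have m: "pcoeff p m ~: Mv" "m \<ge> 1" and mm: "!!i. i > m ==> pcoeff p i : Mv"
  using Max_in[OF fin] n Max_ge[OF fin] unfolding m_def by (blast, force, force)
 \<comment> \<open>Univariate polynomials of HOL-Algebra are lists that begin with the leading
   coefficient, hence the reversed index list.\<close>
 define P where "P = map h (map (pcoeff p) (rev [0..<Suc m]))"
 have P: "P : carrier (poly_ring (residue_field v))"
  using m(1) h0[OF p] hc[OF p] unfolding P_def univ_poly_carrier[symmetric] polynomial_def by (auto simp: hd_map)
 have "size (L.roots P) = length P - 1" using L.roots_over_carrier[OF P] by (simp add: L.splitted_def)
 hence "L.roots P ~= {#}" using m(2) by (auto simp: P_def)
 then obtain x where "x \<in># L.roots P" by blast
 hence x: "x : carrier (residue_field v)" "L.eval P x = \<zero>\<^bsub>residue_field v\<^esub>"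
  using L.roots_mem_iff_is_root[OF P] by (auto simp: L.is_root_def)
 obtain a where a: "a : Ov" "x = h a" using surj[OF x(1)] by auto
 have sum: "(SUM i<k. pcoeff p i * a ^ i) : Ov" for k using p a by (auto intro!: O_closed)
 have hp: "h (a ^ k) = h a [^]\<^bsub>residue_field v\<^esub> k" for k
  by (induction k) (use ring_hom_one[OF hom] ring_hom_mult[OF hom, of _ a] a O_closed(7) in \<open>simp_all add: ring_on_def mult.commute[of a]\<close>)
 have "L.eval (map h (map (pcoeff p) (rev [0..<k]))) (h a) = h (SUM i<k. pcoeff p i * a ^ i)" for k
 proof (induction k)
  case 0 show ?case using h0[of 0] O_closed(1) by simp
 next
  case (Suc k)
  have "h (pcoeff p k * a ^ k + (SUM i<k. pcoeff p i * a ^ i)) =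
   h (pcoeff p k) \<otimes>\<^bsub>residue_field v\<^esub> h (a ^ k) \<oplus>\<^bsub>residue_field v\<^esub> h (SUM i<k. pcoeff p i * a ^ i)"
   using ring_hom_add[OF hom, of "pcoeff p k * a ^ k" "SUM i<k. pcoeff p i * a ^ i"]
    ring_hom_mult[OF hom, of "pcoeff p k" "a ^ k"] p a sum O_closed(5,7) by (simp add: ring_on_def)
  thus ?case using Suc by (simp add: hp add.commute)
 qed
 from this[of "Suc m"] x(2) a(2) h0[OF sum] have lo: "(SUM i<Suc m. pcoeff p i * a ^ i) : Mv"
  unfolding P_def by metis
 have "Polynomial.poly p a = (SUM i:{..<Suc m} \<union> {Suc m..<Suc m + Suc (Polynomial.degree p)}. pcoeff p i * a ^ i)"
  unfolding poly_altdef by (rule sum.mono_neutral_left) (auto simp: coeff_eq_0)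
 also have "... = (SUM i<Suc m. pcoeff p i * a ^ i) + (SUM i=Suc m..<Suc m + Suc (Polynomial.degree p). pcoeff p i * a ^ i)"
  by (rule sum.union_disjoint) auto
 also have "... : Mv" using mm a O_closed(7) by (intro M_closed(3)[OF lo] M_closed(8) M_closed(5)) auto
 finally show ?thesis using a by auto
qed

text \<open>If the reduction is not constant, a root of \<open>p - 1\<close> modulo
  \<open>Mv\<close> is a point where \<open>p\<close> takes a unit value.\<close>

lemma nonroot_mod_M:
 assumes p: "!!i. pcoeff p i : Ov" and n: "pcoeff p n ~: Mv"
 shows "EX a:Ov. Polynomial.poly p a ~: Mv"
proof (cases "\<exists>k\<ge>1. pcoeff p k ~: Mv")
 case True
 then obtain k where k: "k \<ge> 1" "pcoeff p k ~: Mv" by auto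
 have "EX a:Ov. Polynomial.poly (p - 1) a : Mv"
  using p k by (intro root_mod_M[of _ k]) (auto intro!: O_closed simp: coeff_1)
 then obtain a where "a : Ov" "Polynomial.poly p a - 1 : Mv" by auto
 thus ?thesis using M_closed(7)[of "Polynomial.poly p a" "Polynomial.poly p a - 1"] one_notin_M by auto
next
 case False
 hence "n = 0" using n by (cases n) auto
 thus ?thesis using n O_closed(1) by (intro bexI[of _ 0]) (auto simp: poly_0_coeff_0)
qed

text \<open>Fix a monomial \<open>m\<close> with unit coefficient and collect the monomials that
  agree with it outside \<open>x_i\<close> (\<open>cl\<close> forgets the exponent of
  \<open>x_i\<close>). Their coefficients form a one-variable polynomial \<open>q\<close>, nonzero
  modulo \<open>Mv\<close>; substituting a non-root of \<open>q\<close> keeps the coefficient at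
  \<open>cl m\<close> a unit.\<close>

lemma specialize_variable:
 assumes f: "f : S" "f ~: N"
 shows "EX a:Ov. meval mconst (mvar(i := mconst a)) f ~: N"
proof -
 define cl where "cl k = Poly_Mapping.update i 0 k" for k :: "5 \<Rightarrow>\<^sub>0 nat"
 have k_eq: "k = k'" if "cl k = cl k'" "coef k i = coef k' i" for k k'
  using that unfolding cl_def by (intro poly_mapping_eqI) (metis lookup_update)
 obtain m where m: "coef f m ~: Mv" using f by (auto simp: mpols_over_def)
 let ?K = "{k : supp f. cl k = cl m}"
 define q where "q = (SUM k:?K. Polynomial.monom (coef f k) (coef k i))"
 have co: "coef f k : Ov" for k using f by (auto simp: mpols_over_def)
 have mK: "m : ?K" using m by (auto simp: in_keys_iff)
 have "pcoeff q n : Ov" for n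
  unfolding q_def coeff_sum coeff_monom using co by (intro O_closed(8)) (auto simp: O_closed(1))
 moreover have "pcoeff q (coef m i) = (SUM k:?K. if k = m then coef f m else 0)"
  unfolding q_def coeff_sum coeff_monom by (intro sum.cong refl) (auto dest: k_eq)
 hence "pcoeff q (coef m i) ~: Mv" using mK m by simp
 ultimately obtain a where a: "a : Ov" "Polynomial.poly q a ~: Mv" using nonroot_mod_M by blast
 have mv: "mval (mvar(i := mconst a)) k = mconst (a ^ coef k i) * (mnm (cl k) :: 'a pol5)" for k
 proof -
  have "mval (mvar(i := mconst a)) k = mconst a ^ coef k i * (\<Prod>j\<in>UNIV - {i}. mvar j ^ coef k j :: 'a pol5)"
   unfolding mval_def by (subst prod.remove[of _ i]) (auto intro!: prod.cong)
  also have "(\<Prod>j\<in>UNIV - {i}. mvar j ^ coef k j :: 'a pol5) = (\<Prod>j\<in>UNIV. mvar j ^ coef (cl k) j)"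
   unfolding cl_def by (subst (2) prod.remove[of _ i]) (auto intro!: prod.cong simp: lookup_update)
  finally show ?thesis by (simp add: mono_eq_mval mval_def rhomD(8)[OF rhom_mconst])
 qed
 have "meval mconst (mvar(i := mconst a)) f = (SUM k:supp f. mconst (coef f k * a ^ coef k i) * mnm (cl k))"
  by (subst meval_alt[of "supp f"]) (auto simp: mv rhomD[OF rhom_mconst] mult.assoc)
 hence "coef (meval mconst (mvar(i := mconst a)) f) (cl m) =
   (SUM k:supp f. if cl k = cl m then coef f k * a ^ coef k i else 0)"
  by (auto simp: lookup_sum lookup_single when_def intro!: sum.cong)
 also have "... = Polynomial.poly q a"
  unfolding q_def poly_sum poly_monom by (rule sum.inter_filter[symmetric]) simp
 finally have "coef (meval mconst (mvar(i := mconst a)) f) (cl m) ~: Mv" using a(2) by simp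
 thus ?thesis using a(1) unfolding mpols_over_def by blast
qed

lemma exists_nonzero_point:
 assumes f: "f : S" "f ~: N"
 shows "EX w. (ALL i. w i : Ov) & meval (%a. a) w f ~: Mv"
proof -
 have id: "rhom (%a::'a. a)" by (simp add: rhom_def)
 have "EX w. (ALL i. w i : Ov) & meval mconst (%i. if i : V then mconst (w i) else mvar i) f ~: N" if "finite V" for V :: "5 set"
  using that
 proof (induction V)
  case empty
  thus ?case using f O_closed(1) by (intro exI[of _ "%_. 0"]) (auto simp: meval_id)
 next
  case (insert j V)
  then obtain w where w: "ALL i. w i : Ov"
   "meval mconst (%i. if i : V then mconst (w i) else mvar i) f ~: N" (is "?g ~: N") by auto
  have "?g : S" using w(1) f(1)
   by (intro meval_in[OF sub_ring_O sub_ring_S rhom_mconst]) (auto intro: S_gens)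
  then obtain a where a: "a : Ov" "meval mconst (mvar(j := mconst a)) ?g ~: N"
   using specialize_variable w(2) by blast
  have "meval mconst (mvar(j := mconst a)) ?g = meval mconst (%i. if i : insert j V then mconst ((w(j := a)) i) else mvar i) f"
   unfolding meval_meval[OF rhom_mconst] using insert.hyps
   by (intro arg_cong[where f = "%t. meval mconst t f"]) (auto simp: fun_eq_iff rhom_mconst)
  thus ?case using a w(1) by (intro exI[of _ "w(j := a)"]) auto
 qed
 from this[of UNIV] obtain w where w: "ALL i. w i : Ov" "meval mconst (%i. mconst (w i)) f ~: N" by auto
 have "meval mconst (%i. mconst (w i)) f = (mconst (meval (%a. a) w f) :: 'a pol5)"
  by (rule rhom_eqI[where \<beta> = "%f. mconst (meval (%a. a) w f)"])
   (auto simp: rhom_meval rhom_mconst id rhomD[OF rhom_mconst] rhomD[OF rhom_meval(1)[OF id]] intro!: rhom_def[THEN iffD2])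
 hence "meval (%a. a) w f ~: Mv" using w(2) by simp
 thus ?thesis using w(1) by blast
qed

end

lemma form_scale:
 fixes f :: "('v::finite, 'a::comm_ring_1) mpol"
 assumes "form_of_degree d f" "rhom h"
 shows "meval h (%i. a * w i) f = a ^ d * meval h w f"
proof -
 have "mval (%i. a * w i) m = a ^ d * mval w m" if "m : supp f" for m
 proof -
  have "mval (%i. a * w i) m = (\<Prod>i\<in>UNIV. a ^ coef m i) * mval w m"
   by (simp add: mval_def power_mult_distrib prod.distrib)
  also have "(\<Prod>i\<in>UNIV. a ^ coef m i) = a ^ d"
   using assms(1) that unfolding form_of_degree_def by (metis power_sum mon_deg_sum)
  finally show ?thesis .
 qed
 thus ?thesis
  using rhomD(4)[OF assms(2)]
  by (simp add: meval_alt[of "supp f"] sum_distrib_left mult.left_commute)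
qed

text \<open>Applying \<open>exists_nonzero_point\<close> to \<open>f x_r\<close> makes
  \<open>w r\<close> a unit as well; dividing the point by it changes the value of the form
  \<open>f\<close> only by a unit.\<close>

lemma (in dvr_closed) exists_nonzero_point_normalized:
 assumes f: "f : S" "f ~: N" "form_of_degree d f"
 shows "EX w. (ALL i. w i : Ov) & w r = 1 & meval (%a. a) w f ~: Mv"
proof -
 have id: "rhom (%a::'a. a)" by (simp add: rhom_def)
 have "coef (mvar r :: 'a pol5) (sgl r 1) = 1" by (simp add: mvar_def)
 hence "mvar r ~: N" using one_notin_M unfolding mpols_over_def by (smt (verit) mem_Collect_eq)
 hence "f * mvar r ~: N" "f * mvar r : S"
  using N_prime[OF f(1) S_gens(2)] f(2) S_closed(5)[OF f(1) S_gens(2)] by auto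
 then obtain w where w: "ALL i. w i : Ov" "meval (%a. a) w (f * mvar r) ~: Mv"
  using exists_nonzero_point by blast
 hence ne: "meval (%a. a) w f * w r ~: Mv" by (simp add: rhomD[OF rhom_meval(1)[OF id]] id)
 have fw: "meval (%a. a) w f : Ov" by (rule meval_in[OF sub_ring_O sub_ring_O id]) (use w f in auto)
 have wr: "w r ~: Mv" "meval (%a. a) w f ~: Mv" using ne M_closed(4)[OF fw, of "w r"] M_closed(5)[of "w r" "meval (%a. a) w f"] w(1) by auto
 let ?c = "inverse (w r)"
 have c: "?c : Ov" "?c ~: Mv" "w r ~= 0" using unitD[of "w r"] w(1) wr(1) by auto
 have "?c ^ d ~: Mv" using is_prime_power[OF sub_ring_O prime_M c(1)] c(2) by blast
 hence "meval (%a. a) (%i. ?c * w i) f ~: Mv"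
  using M_prime[of "?c ^ d", OF O_closed(7)[OF c(1)] fw] wr(2) by (auto simp: form_scale[OF f(3) id])
 thus ?thesis using c w(1) O_closed(5) by (intro exI[of _ "%i. ?c * w i"]) auto
qed

section \<open>Minimal tensors\<close>

text \<open>The value \<open>c i j k\<close> stands for the coefficient of \<open>x_k\<close> in the
  entry \<open>(i, j)\<close> of a model; see \<open>lform\<close>.\<close>

type_synonym 'a tensor = "5 => 5 => 5 => 'a"

definition alternating :: "'a::comm_ring_1 tensor => bool" where
 "alternating c \<longleftrightarrow> (ALL i j k. c j i k = - c i j k) & (ALL i k. c i i k = 0)"

definition row_act :: "'a::comm_ring_1 ^ 5 ^ 5 => 'a tensor => 'a tensor" where
 "row_act A c i j k = (SUM a:UNIV. SUM b:UNIV. A $ i $ a * A $ j $ b * c a b k)"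

text \<open>This is how the substitution of \<open>sum_i B_ij x_i\<close> for \<open>x_j\<close>
  acts on the coefficients of linear forms; see \<open>subst_lform\<close>.\<close>

definition col_act :: "'a::comm_ring_1 ^ 5 ^ 5 => 'a tensor => 'a tensor" where
 "col_act B c i j k = (SUM l:UNIV. B $ k $ l * c i j l)"

lemma sum_swap_4:
 fixes f :: "'i => 'i => 'i => 'i => 'r::comm_ring_1"
 shows "(SUM a:U. SUM d:U. SUM b:U. SUM e:U. f a b d e) = (SUM a:U. SUM b:U. SUM d:U. SUM e:U. f a b d e)"
  "(SUM a:U. SUM e:U. SUM b:U. SUM d:U. f a b d e) = (SUM a:U. SUM b:U. SUM d:U. SUM e:U. f a b d e)"
proof -
 show "(SUM a:U. SUM d:U. SUM b:U. SUM e:U. f a b d e) = (SUM a:U. SUM b:U. SUM d:U. SUM e:U. f a b d e)"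
  by (intro sum.cong refl sum.swap)
 have "(SUM e:U. SUM b:U. SUM d:U. f a b d e) = (SUM b:U. SUM d:U. SUM e:U. f a b d e)" for a
  by (subst sum.swap) (intro sum.cong refl sum.swap)
 thus "(SUM a:U. SUM e:U. SUM b:U. SUM d:U. f a b d e) = (SUM a:U. SUM b:U. SUM d:U. SUM e:U. f a b d e)" by simp
qed

lemma sum_mult_4: "(SUM a:U. SUM b:U. f a b) * (SUM d:U. SUM e:U. g d e) =
  (SUM a:U. SUM b:U. SUM d:U. SUM e:U. f a b * (g d e :: 'r::comm_ring_1))"
proof -
 have "(SUM a:U. SUM b:U. f a b) * (SUM d:U. SUM e:U. g d e) = (SUM a:U. SUM b:U. f a b * (SUM d:U. SUM e:U. g d e))"
  by (simp only: sum_distrib_right)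
 thus ?thesis by (simp only: sum_distrib_left)
qed

lemma sum_rotate_3: "(SUM b:U. SUM d:U. SUM e:U. f b d e) = (SUM d:U. SUM e:U. SUM b:U. f b d e)"
 by (rule trans[OF sum.swap], intro sum.cong refl sum.swap)

lemma sum_delta_mult: "(SUM l:UNIV. (if k = l then 1 else 0) * f l) = f k" "(SUM l:UNIV. (if l = k then b else 0) * f l) = b * f k"
 for f :: "'i::finite => 'r::comm_ring_1"
proof -
 have "(if k = l then 1 else 0) * f l = (if l = k then f l else 0)" "(if l = k then b else 0) * f l = (if l = k then b * f l else 0)" for l by auto
 thus "(SUM l:UNIV. (if k = l then 1 else 0) * f l) = f k" "(SUM l:UNIV. (if l = k then b else 0) * f l) = b * f k" by simp_all
qed

text \<open>The polarised Pfaffian; the indices need not be distinct or increasing.\<close>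

definition pf2 :: "(5 => 5 => 'r::comm_ring_1) => (5 => 5 => 'r) => 5 => 5 => 5 => 5 => 'r" where
 "pf2 x y p q r s = x p q * y r s - x p r * y q s + x p s * y q r"

text \<open>Each of the three products expands into a sum over all index quadruples, which is the
  reason for defining \<open>pf2\<close> without conditions on the indices; renaming bound indices
  aligns the three sums.\<close>

lemma pf2_congruence:
 fixes A :: "5 => 5 => 'r::comm_ring_1"
 assumes x: "!!p q. x' p q = (SUM a:UNIV. SUM b:UNIV. A p a * A q b * x a b)"
  and y: "!!p q. y' p q = (SUM a:UNIV. SUM b:UNIV. A p a * A q b * y a b)"
 shows "pf2 x' y' p q r s = (SUM a:UNIV. SUM b:UNIV. SUM d:UNIV. SUM e:UNIV. A p a * A q b * A r d * A s e * pf2 x y a b d e)"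
proof -
 have "x' p q * y' r s = (SUM a:UNIV. SUM b:UNIV. SUM d:UNIV. SUM e:UNIV. A p a * A q b * A r d * A s e * (x a b * y d e))"
  unfolding x y sum_mult_4 by (intro sum.cong refl) (simp add: mult_ac)
 moreover have "x' p r * y' q s = (SUM a:UNIV. SUM b:UNIV. SUM d:UNIV. SUM e:UNIV. A p a * A q b * A r d * A s e * (x a d * y b e))"
  unfolding x y sum_mult_4 by (subst (2) sum_swap_4(1)[symmetric]) (intro sum.cong refl, simp add: mult_ac)
 moreover have "x' p s * y' q r = (SUM a:UNIV. SUM b:UNIV. SUM d:UNIV. SUM e:UNIV. A p a * A q b * A r d * A s e * (x a e * y b d))"
  unfolding x y sum_mult_4 by (subst (2) sum_swap_4(2)[symmetric]) (intro sum.cong refl, simp add: mult_ac)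
 ultimately show ?thesis
  by (simp add: pf2_def right_diff_distrib distrib_left sum.distrib sum_subtractf)
qed

lemma row_act_mult: "row_act A (row_act A' c) = row_act (A ** A') c"
proof (intro ext)
 fix i j k
 have "row_act A (row_act A' c) i j k =
   (SUM a:UNIV. SUM b:UNIV. SUM d:UNIV. SUM e:UNIV. A $ i $ a * A $ j $ b * (A' $ a $ d * A' $ b $ e * c d e k))"
  by (simp add: row_act_def sum_distrib_left)
 also have "... = (SUM a:UNIV. SUM d:UNIV. SUM e:UNIV. SUM b:UNIV. A $ i $ a * A $ j $ b * (A' $ a $ d * A' $ b $ e * c d e k))"
  by (intro sum.cong refl sum_rotate_3)
 also have "... = (SUM d:UNIV. SUM e:UNIV. SUM a:UNIV. SUM b:UNIV. A $ i $ a * A $ j $ b * (A' $ a $ d * A' $ b $ e * c d e k))"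
  by (rule sum_rotate_3)
 also have "... = (SUM d:UNIV. SUM e:UNIV. (SUM a:UNIV. A $ i $ a * A' $ a $ d) * (SUM b:UNIV. A $ j $ b * A' $ b $ e) * c d e k)"
  unfolding sum_product unfolding sum_distrib_right by (intro sum.cong refl) (simp only: mult_ac)
 also have "... = row_act (A ** A') c i j k"
  by (simp add: row_act_def matrix_matrix_mult_def)
 finally show "row_act A (row_act A' c) i j k = row_act (A ** A') c i j k" .
qed

lemma col_act_mult: "col_act B (col_act B' c) = col_act (B ** B') c"
proof (intro ext)
 fix i j k
 have "col_act B (col_act B' c) i j k = (SUM l:UNIV. SUM m:UNIV. B $ k $ l * (B' $ l $ m * c i j m))"
  by (simp add: col_act_def sum_distrib_left)
 also have "... = (SUM m:UNIV. SUM l:UNIV. B $ k $ l * (B' $ l $ m * c i j m))" by (rule sum.swap)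
 also have "... = col_act (B ** B') c i j k"
  by (simp add: col_act_def matrix_matrix_mult_def sum_distrib_right mult.assoc)
 finally show "col_act B (col_act B' c) i j k = col_act (B ** B') c i j k" .
qed

lemma row_col_commute: "row_act A (col_act B c) = col_act B (row_act A c)"
proof (intro ext)
 fix i j k
 have "row_act A (col_act B c) i j k = (SUM a:UNIV. SUM b:UNIV. SUM l:UNIV. B $ k $ l * (A $ i $ a * A $ j $ b * c a b l))"
  unfolding row_act_def col_act_def sum_distrib_left by (intro sum.cong refl) (simp only: mult_ac)
 also have "... = (SUM l:UNIV. SUM a:UNIV. SUM b:UNIV. B $ k $ l * (A $ i $ a * A $ j $ b * c a b l))"
 proof -
  have "(SUM b:UNIV. SUM l:UNIV. B $ k $ l * (A $ i $ a * A $ j $ b * c a b l)) = (SUM l:UNIV. SUM b:UNIV. B $ k $ l * (A $ i $ a * A $ j $ b * c a b l))" for a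
   by (rule sum.swap)
  thus ?thesis by (simp only:) (rule sum.swap)
 qed
 also have "... = col_act B (row_act A c) i j k" by (simp add: row_act_def col_act_def sum_distrib_left)
 finally show "row_act A (col_act B c) i j k = col_act B (row_act A c) i j k" .
qed

lemma act_mat_1 [simp]: "row_act (mat 1) c = c" "col_act (mat 1) c = c"
 by (intro ext, simp add: row_act_def mat_def mult.assoc sum_distrib_left[symmetric] sum_delta_mult)
  (intro ext, simp add: col_act_def mat_def sum_delta_mult)

text \<open>In characteristic two a zero diagonal does not follow from skew-symmetry. It is obtained
  by cancelling the terms with \<open>b < a\<close> against those with \<open>a < b\<close>.\<close>

lemma alternating_row_act: assumes "alternating c" shows "alternating (row_act A c)"
proof -
 have sk: "row_act A c j i k = - row_act A c i j k" for i j k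
 proof -
  have "row_act A c j i k = (SUM b:UNIV. SUM a:UNIV. A $ j $ a * A $ i $ b * c a b k)"
   unfolding row_act_def by (rule sum.swap)
  also have "... = (SUM b:UNIV. SUM a:UNIV. - (A $ i $ b * A $ j $ a * c b a k))"
  proof (intro sum.cong refl)
   fix a b
   have "c a b k = - c b a k" using assms unfolding alternating_def by blast
   thus "A $ j $ a * A $ i $ b * c a b k = - (A $ i $ b * A $ j $ a * c b a k)" by simp
  qed
  finally show ?thesis by (simp only: row_act_def sum_negf)
 qed
 have "row_act A c i i k = 0" for i k
 proof -
  let ?g = "%a b. A $ i $ a * A $ i $ b * c a b k"
  have g: "?g b a = - ?g a b" "?g a a = 0" for a b
  proof -
   have "c b a k = - c a b k" "c a a k = 0" using assms unfolding alternating_def by blast+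
   thus "?g b a = - ?g a b" "?g a a = 0" by simp_all
  qed
  have split: "(SUM b:UNIV. ?g a b) = (SUM b:UNIV. if a < b then ?g a b else 0) + (SUM b:UNIV. if b < a then ?g a b else 0)" for a
   unfolding sum.distrib[symmetric]
  proof (intro sum.cong refl)
   fix b show "?g a b = (if a < b then ?g a b else 0) + (if b < a then ?g a b else 0)"
    using g(2)[of a] by (cases a b rule: linorder_cases) auto
  qed
  have "(SUM a:UNIV. SUM b:UNIV. if b < a then ?g a b else 0) = (SUM b:UNIV. SUM a:UNIV. if b < a then ?g a b else 0)" by (rule sum.swap)
  also have "... = (SUM b:UNIV. SUM a:UNIV. - (if b < a then ?g b a else 0))"
  proof (intro sum.cong refl)
   fix a b show "(if b < a then ?g a b else 0) = - (if b < a then ?g b a else 0)" using g(1)[of a b] by (cases "b < a") auto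
  qed
  finally have "(SUM a:UNIV. SUM b:UNIV. if b < a then ?g a b else 0) = - (SUM b:UNIV. SUM a:UNIV. if b < a then ?g b a else 0)"
   by (simp only: sum_negf)
  thus ?thesis unfolding row_act_def split sum.distrib by simp
 qed
 thus ?thesis using sk unfolding alternating_def by blast
qed

lemma alternating_col_act: assumes "alternating c" shows "alternating (col_act B c)"
proof -
 have c: "c j i k = - c i j k" "c i i k = 0" for i j k using assms unfolding alternating_def by blast+
 have "col_act B c j i k = - col_act B c i j k" for i j k
  unfolding col_act_def sum_negf[symmetric] by (intro sum.cong refl) (simp only: c(1)[of j i] mult_minus_right)
 moreover have "col_act B c i i k = 0" for i k unfolding col_act_def by (simp only: c(2) mult_zero_right sum.neutral_const)
 ultimately show ?thesis unfolding alternating_def by blast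
qed

text \<open>The elementary operation that adds multiples of one row, or of one variable, to all the
  others at once.\<close>

definition add_mat :: "5 => (5 => 'a) => 'a::comm_ring_1 ^ 5 ^ 5" where
 "add_mat r n = (\<chi> k l. if l = r then (if k = r then 1 else n k) else if k = l then 1 else 0)"

text \<open>Used as a substitution it exchanges evaluation for a coefficient: the value of a form at
  the point \<open>n\<close> becomes its coefficient at the pure power of \<open>x_r\<close>
  (\<open>subst_vec_mat_top\<close>).\<close>

definition vec_mat :: "5 => (5 => 'a) => 'a::comm_ring_1 ^ 5 ^ 5" where
 "vec_mat r n = (\<chi> k l. if k = r then n l else if k = l then 1 else 0)"

definition perm_mat :: "(5 => 5) => 'a::comm_ring_1 ^ 5 ^ 5" where
 "perm_mat \<sigma> = (\<chi> k l. if \<sigma> k = l then 1 else 0)"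

lemma det_add_mat: "det (add_mat r n :: 'a::field ^ 5 ^ 5) = 1"
proof -
 let ?x = "\<chi> i. if i = r then 1 else n i"
 have "add_mat r n = (\<chi> i j. if j = r then ((mat 1 :: 'a^5^5) *v ?x) $ i else (mat 1 :: 'a^5^5) $ i $ j)"
  by (simp add: vec_eq_iff add_mat_def) (simp add: mat_def)
 thus ?thesis using cramer_lemma[of r "mat 1 :: 'a^5^5" ?x] by simp
qed

lemma det_vec_mat: "det (vec_mat r n :: 'a::field ^ 5 ^ 5) = n r"
proof -
 let ?x = "\<chi> i. n i"
 have "transpose (vec_mat r n) = (\<chi> i j. if j = r then ((mat 1 :: 'a^5^5) *v ?x) $ i else (mat 1 :: 'a^5^5) $ i $ j)"
  by (simp add: vec_eq_iff vec_mat_def transpose_def) (auto simp: mat_def)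
 thus ?thesis using cramer_lemma[of r "mat 1 :: 'a^5^5" ?x] det_transpose[of "vec_mat r n :: 'a^5^5"] by simp
qed

lemma det_perm_mat: assumes "\<sigma> permutes UNIV" shows "det (perm_mat \<sigma> :: 'a::field ^ 5 ^ 5) = of_int (sign \<sigma>)"
proof -
 have "perm_mat \<sigma> = (\<chi> i. (mat 1 :: 'a^5^5) $ \<sigma> i)" by (simp add: vec_eq_iff perm_mat_def mat_def)
 thus ?thesis using det_permute_rows[OF assms, of "mat 1 :: 'a^5^5"] by simp
qed

lemma row_act_add_mat:
 assumes "alternating c" "n r = 0"
 shows "row_act (add_mat r n) c i j k = c i j k + n i * c r j k + n j * c i r k"
proof -
 have a: "add_mat r n $ i $ l = (if l = i then 1 else 0) + (if l = r then n i else 0)" for i l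
  using assms(2) by (auto simp: add_mat_def)
 have s: "(SUM l:UNIV. add_mat r n $ i $ l * f l) = f i + n i * f r" for f :: "5 => _" and i
  unfolding a distrib_right sum.distrib sum_delta_mult by simp
 have "row_act (add_mat r n) c i j k = (SUM a:UNIV. add_mat r n $ i $ a * (c a j k + n j * c a r k))"
  unfolding row_act_def mult.assoc sum_distrib_left[symmetric] s ..
 also have "... = c i j k + n j * c i r k + n i * (c r j k + n j * c r r k)" by (rule s)
 moreover have "c r r k = 0" using assms(1) unfolding alternating_def by blast
 ultimately show ?thesis by (simp add: algebra_simps)
qed

lemma col_act_add_mat: "n r = 0 ==> col_act (add_mat r n) c i j k = c i j k + n k * c i j r"
proof -
 assume "n r = 0"
 hence a: "add_mat r n $ k $ l = (if l = k then 1 else 0) + (if l = r then n k else 0)" for k l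
  by (auto simp: add_mat_def)
 show ?thesis unfolding col_act_def a distrib_right sum.distrib sum_delta_mult by simp
qed

lemma col_act_vec_mat: "col_act (vec_mat r n) c i j k = (if k = r then (SUM l:UNIV. n l * c i j l) else c i j k)"
 by (cases "k = r") (simp_all add: col_act_def vec_mat_def sum_delta_mult)

lemma row_act_vec_mat:
 assumes "j ~= r"
 shows "row_act (vec_mat r n) c r j k = (SUM a:UNIV. n a * c a j k)"
proof -
 have "vec_mat r n $ j $ b = (if j = b then 1 else 0)" "vec_mat r n $ r $ b = n b" for b using assms by (simp_all add: vec_mat_def)
 hence "row_act (vec_mat r n) c r j k = (SUM a:UNIV. SUM b:UNIV. n a * ((if j = b then 1 else 0) * c a b k))"
  by (simp only: row_act_def mult.assoc)
 thus ?thesis by (simp only: sum_distrib_left[symmetric] sum_delta_mult)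
qed

lemma col_act_perm_mat: "col_act (perm_mat \<sigma>) c i j k = c i j (\<sigma> k)"
 by (simp add: col_act_def perm_mat_def sum_delta_mult)

context dvr begin

definition integral :: "'a tensor => bool" where "integral c \<longleftrightarrow> (ALL i j k. c i j k : Ov)"

definition GLO :: "'a ^ 5 ^ 5 => bool" where
 "GLO A \<longleftrightarrow> (ALL i j. A $ i $ j : Ov) & det A : Ov & det A ~: Mv"

text \<open>The discriminant scales by \<open>(det A ^ 2 * det B) ^ 12\<close>, so its minimality
  among integral models amounts to this inequality, with \<open>A\<close> and \<open>B\<close>
  ranging over invertible matrices over the whole field.\<close>

definition minimal_tensor :: "'a tensor => bool" where
 "minimal_tensor c \<longleftrightarrow> alternating c & integral c &
  (ALL A B. det A ~= 0 --> det B ~= 0 --> integral (row_act A (col_act B c)) --> 0 <= v (det A ^ 2 * det B))"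

lemma det_in_O: "(!!i j. A $ i $ j : Ov) ==> det (A :: 'a^5^5) : Ov"
proof -
 assume *: "!!i j. A $ i $ j : Ov"
 have "of_int (sign p) : Ov" for p :: "5 => 5" using O_closed(2,3) by (auto simp: sign_def)
 thus ?thesis unfolding det_def using * by (intro O_closed(8) O_closed(5) O_closed(9)) auto
qed

lemma GLO_inverse:
 assumes "GLO A" shows "EX B. GLO B & A ** B = mat 1 & B ** A = mat 1"
proof -
 have A: "!!i j. A $ i $ j : Ov" "det A : Ov" "det A ~: Mv" "det A ~= 0"
  using assms unitD(1) by (auto simp: GLO_def)
 define x where "x j = (\<chi> k. det (\<chi> i l. if l = k then (axis j 1 :: 'a^5) $ i else A $ i $ l) / det A)" for j
 have x: "A *v x j = axis j 1" for j using cramer[OF A(4), of "x j" "axis j 1"] x_def by simp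
 define B where "B = (\<chi> k j. x j $ k)"
 have AB: "A ** B = mat 1"
 proof (subst vec_eq_iff, intro allI, subst vec_eq_iff, intro allI)
  fix i j
  have "(A ** B) $ i $ j = (A *v x j) $ i" by (simp add: matrix_matrix_mult_def matrix_vector_mult_def B_def)
  thus "(A ** B) $ i $ j = mat 1 $ i $ j" by (simp add: x axis_def mat_def)
 qed
 have "B $ k $ j : Ov" for k j
  using A O_closed(1,2) unfolding B_def x_def by (auto simp: axis_def intro!: O_div det_in_O)
 moreover have "det A * det B = 1" using AB by (metis det_mul det_I)
 hence "det B = inverse (det A)" using A(4) by (simp add: field_simps)
 ultimately have "GLO B" using unitD[OF A(2,3)] by (auto simp: GLO_def)
 thus ?thesis using AB matrix_left_right_inverse by blast
qed

lemma GLO_mats: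
 assumes "!!i. n i : Ov"
 shows "GLO (add_mat r n)" "n r ~: Mv ==> GLO (vec_mat r n)" "\<sigma> permutes UNIV ==> GLO (perm_mat \<sigma>)"
proof -
 show "GLO (add_mat r n)" unfolding GLO_def det_add_mat using assms O_closed(1,2) by (auto simp: add_mat_def)
 show "n r ~: Mv ==> GLO (vec_mat r n)" unfolding GLO_def det_vec_mat using assms O_closed(1,2) by (auto simp: vec_mat_def)
 have "- 1 ~: Mv" using M_closed(6)[of "- 1"] by auto
 hence "of_int (sign \<sigma>) ~: Mv" "of_int (sign \<sigma>) : Ov" using O_closed(2,3) by (auto simp: sign_def)
 thus "\<sigma> permutes UNIV ==> GLO (perm_mat \<sigma>)"
  unfolding GLO_def using O_closed(1,2) det_perm_mat[of \<sigma>, where 'a = 'a] by (auto simp: perm_mat_def)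
qed

lemma minimal_tensor_act:
 assumes c: "minimal_tensor c" and A: "GLO A" and B: "GLO B"
 shows "minimal_tensor (row_act A (col_act B c))"
proof -
 have "integral c" "alternating c" using c by (auto simp: minimal_tensor_def)
 hence 1: "alternating (row_act A (col_act B c))" "integral (row_act A (col_act B c))"
  using A B by (auto simp: integral_def GLO_def row_act_def col_act_def intro!: O_closed(8) O_closed(5) alternating_row_act alternating_col_act)
 have "0 <= v (det A' ^ 2 * det B')"
  if *: "det A' ~= 0" "det B' ~= 0" "integral (row_act A' (col_act B' (row_act A (col_act B c))))" for A' B'
 proof -
  have u: "det A ~= 0" "det B ~= 0" "v (det A) = 0" "v (det B) = 0" using A B unitD(1) unit_v by (auto simp: GLO_def)
  have "integral (row_act (A' ** A) (col_act (B' ** B) c))"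
   using *(3) by (simp add: row_act_mult[symmetric] col_act_mult[symmetric] row_col_commute)
  hence "0 <= v (det (A' ** A) ^ 2 * det (B' ** B))"
   using c * u unfolding minimal_tensor_def by (metis det_mul mult_eq_0_iff)
  thus ?thesis using * u by (simp add: det_mul v_mult v_power)
 qed
 thus ?thesis using 1 by (auto simp: minimal_tensor_def)
qed

lemmas minimal_row_act = minimal_tensor_act[where B = "mat 1", simplified]
lemmas minimal_col_act = minimal_tensor_act[where A = "mat 1", simplified]

lemma GLO_1 [simp]: "GLO (mat 1)" unfolding GLO_def det_I using O_closed(1,2) by (simp add: mat_def)

lemma minimal_add_row:
 assumes c: "minimal_tensor c" and "!!i. n i : Ov" "n r = 0"
 shows "minimal_tensor (%i j k. c i j k + n i * c r j k + n j * c i r k)"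
proof -
 have "row_act (add_mat r n) c = (%i j k. c i j k + n i * c r j k + n j * c i r k)"
  using row_act_add_mat[of c n r] assms by (intro ext) (auto simp: minimal_tensor_def)
 thus ?thesis using minimal_row_act[OF c GLO_mats(1)[of n r] GLO_1] assms(2) by simp
qed

lemma minimal_add_col:
 assumes c: "minimal_tensor c" and "!!i. n i : Ov" "n r = 0"
 shows "minimal_tensor (%i j k. c i j k + n k * c i j r)"
proof -
 have "col_act (add_mat r n) c = (%i j k. c i j k + n k * c i j r)"
  using col_act_add_mat[of n r c] assms by (intro ext) auto
 thus ?thesis using minimal_col_act[OF c GLO_1 GLO_mats(1)[of n r]] assms(2) by simp
qed

text \<open>Diagonal matrices with powers of \<open>pp\<close> turn minimality into an inequality
  between exponents. Each of the following exclusions exhibits weights with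
  \<open>2 sum \<alpha> + sum \<beta> = -1\<close>.\<close>

lemma minimal_weights:
 assumes c: "minimal_tensor c" and w: "!!i j k. c i j k ~= 0 ==> 0 <= v (c i j k) + \<alpha> i + \<alpha> j + \<beta> k"
 shows "0 <= 2 * sum \<alpha> UNIV + sum \<beta> UNIV"
proof -
 define D where "D \<alpha> = (\<chi> i j. if i = j then pp powi \<alpha> i else (0 :: 'a))" for \<alpha> :: "5 => int"
 have vp: "v (pp powi n) = n" for n
  using pp(1,2) by (auto simp: power_int_def v_power v_inverse)
 have p0: "pp powi n ~= 0" for n using pp(1) by simp
 have "det (D \<alpha>) = (\<Prod>i\<in>UNIV. pp powi \<alpha> i)" for \<alpha>
  by (subst det_diagonal) (auto simp: D_def)
 moreover have "(\<Prod>i\<in>I. pp powi \<alpha> i) ~= 0 & v (\<Prod>i\<in>I. pp powi \<alpha> i) = sum \<alpha> I" for \<alpha> and I :: "5 set"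
  by (induction I rule: infinite_finite_induct) (auto simp: v_mult vp pp(1))
 ultimately have d: "det (D \<alpha>) ~= 0" "v (det (D \<alpha>)) = sum \<alpha> UNIV" for \<alpha> by auto
 have "row_act (D \<alpha>) (col_act (D \<beta>) c) i j k = pp powi \<alpha> i * pp powi \<alpha> j * (pp powi \<beta> k * c i j k)" for i j k
 proof -
  have d: "(SUM l:UNIV. D \<alpha> $ k $ l * f l) = pp powi \<alpha> k * f k" for \<alpha> k and f :: "5 => 'a"
  proof -
   have "D \<alpha> $ k $ l * f l = (if l = k then pp powi \<alpha> k * f k else 0)" for l by (auto simp: D_def)
   thus ?thesis by simp
  qed
  show ?thesis unfolding row_act_def col_act_def d mult.assoc sum_distrib_left[symmetric] by (simp only: mult_ac)
 qed
 moreover have "pp powi \<alpha> i * pp powi \<alpha> j * (pp powi \<beta> k * c i j k) : Ov" for i j k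
  using w[of i j k] by (cases "c i j k = 0") (auto simp: valuation_ring_def v_mult pp(1) vp)
 ultimately have "integral (row_act (D \<alpha>) (col_act (D \<beta>) c))" by (simp add: integral_def)
 hence "0 <= v (det (D \<alpha>) ^ 2 * det (D \<beta>))" using c d by (auto simp: minimal_tensor_def)
 thus ?thesis using d by (simp add: v_mult v_power)
qed

lemma minimalD:
 assumes "minimal_tensor c"
 shows "c i j k : Ov" "c j i k = - c i j k" "c i i k = 0" "c i j k ~= 0 ==> 0 <= v (c i j k)"
  "c i j k : Mv ==> c i j k ~= 0 ==> 1 <= v (c i j k)"
proof -
 have c: "!!i j k. c i j k : Ov" "alternating c" using assms by (auto simp: minimal_tensor_def integral_def)
 show "c i j k : Ov" by (rule c(1))
 show "c j i k = - c i j k" "c i i k = 0" using c(2) unfolding alternating_def by blast+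
 show "c i j k ~= 0 ==> 0 <= v (c i j k)" "c i j k : Mv ==> c i j k ~= 0 ==> 1 <= v (c i j k)"
  using c(1)[of i j k] by (auto simp: valuation_ring_def Mv_def)
qed

lemma card_UNIV_5: "card (UNIV :: 5 set) = 5" by simp

lemma sum_indicator_5: "(SUM i:UNIV. if i : R then a else (b::int)) = int (card R) * a + (5 - int (card (R :: 5 set))) * b"
proof -
 have "card R <= 5" using card_mono[of UNIV R] by simp
 thus ?thesis by (simp add: sum.If_cases Compl_eq_Diff_UNIV card_Diff_subset of_nat_diff)
qed

lemma no_zero_column: assumes c: "minimal_tensor c" and z: "!!i j. c i j q : Mv" shows False
proof -
 have "0 <= 2 * sum (%i::5. 0 :: int) UNIV + sum (%k. if k : {q} then - 1 else 0 :: int) UNIV"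
 proof (rule minimal_weights[OF c, of "%_. 0"])
  fix i j k assume "c i j k ~= 0"
  thus "0 <= v (c i j k) + 0 + 0 + (if k : {q} then - 1 else 0)"
   using minimalD(4,5)[OF c, of i j k] z[of i j] by (cases "k = q") auto
 qed
 thus False unfolding sum_indicator_5 by simp
qed

lemma no_zero_block: assumes c: "minimal_tensor c" and R: "card R = 3" and z: "!!i j k. i : R ==> j : R ==> c i j k : Mv"
 shows False
proof -
 have "0 <= 2 * sum (%i. if i : R then 0 else 1) UNIV + sum (%_::5. - 1 :: int) UNIV"
 proof (rule minimal_weights[OF c])
  fix i j k assume "c i j k ~= 0"
  thus "0 <= v (c i j k) + (if i : R then 0 else 1) + (if j : R then 0 else 1) + - 1"
   using minimalD(4,5)[OF c, of i j k] z[of i j k] by (cases "i : R"; cases "j : R") auto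
 qed
 thus False unfolding sum_indicator_5 R by simp
qed

text \<open>Modulo \<open>Mv\<close> the row \<open>p\<close> consists of multiples of
  \<open>x_q\<close>. The weight -1 on this row counts twice and is paid for by 1 on
  \<open>x_q\<close>.\<close>

lemma no_rank1_row: assumes c: "minimal_tensor c" and z: "!!j k. k ~= q ==> c p j k : Mv" shows False
proof -
 have z': "c j p k : Mv" if "k ~= q" for j k using z[OF that, of j] minimalD(2)[OF c, of j p k] M_closed(6) by metis
 have "0 <= 2 * sum (%i. if i : {p} then - 1 else 0) UNIV + sum (%k. if k : {q} then 1 else 0 :: int) UNIV"
 proof (rule minimal_weights[OF c])
  fix i j k assume ne: "c i j k ~= 0"
  hence "\<not> (i = p & j = p)" using minimalD(3)[OF c] by auto
  thus "0 <= v (c i j k) + (if i : {p} then - 1 else 0) + (if j : {p} then - 1 else 0) + (if k : {q} then 1 else 0)"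
   using minimalD(4)[OF c ne] minimalD(5)[OF c _ ne] z[of k j] z'[of k i] by (cases "k = q"; cases "i = p"; cases "j = p") auto
 qed
 thus False unfolding sum_indicator_5 by simp
qed

text \<open>On the plane with coordinates \<open>K\<close> every bivector of the family has the form
  \<open>e_p \<and> u\<close>. Raising the row \<open>p\<close> costs 2, lowering the three
  variables gains 3.\<close>

lemma no_star_plane: assumes c: "minimal_tensor c" and K: "card K = 3" and z: "!!i j k. i ~= p ==> j ~= p ==> k : K ==> c i j k : Mv"
 shows False
proof -
 have "0 <= 2 * sum (%i. if i : {p} then 1 else 0) UNIV + sum (%k. if k : K then - 1 else 0 :: int) UNIV"
 proof (rule minimal_weights[OF c])
  fix i j k assume "c i j k ~= 0"
  thus "0 <= v (c i j k) + (if i : {p} then 1 else 0) + (if j : {p} then 1 else 0) + (if k : K then - 1 else 0)"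
   using minimalD(4,5)[OF c, of i j k] z[of i j k] by (cases "i = p"; cases "j = p"; cases "k : K") auto
 qed
 thus False unfolding sum_indicator_5 K by simp
qed

text \<open>On the plane with coordinates \<open>K\<close> every bivector lies in the exterior
  square of the span of \<open>R\<close>. Weight 1 on \<open>R\<close> would allow -2 on all of
  \<open>K\<close> but for the entry of the two remaining rows \<open>p, q\<close>, which gets no
  help from \<open>R\<close>; column operations therefore remove most of its coefficients
  first.\<close>

lemma no_dual_plane:
 assumes c: "minimal_tensor c" and R: "card R = 3" and K: "card K = 3"
  and z: "!!i j k. \<not> (i : R & j : R) ==> k : K ==> c i j k : Mv"
 shows False
proof -
 have "card (- R) = 2" "card (- K) = 2" using R K by (simp_all add: Compl_eq_Diff_UNIV card_Diff_subset)
 then obtain p q where pq: "- R = {p, q}" "p ~= q" by (auto simp: card_2_iff)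
 have out: "i = p & j = q \<or> i = q & j = p \<or> i = j" if "i ~: R" "j ~: R" for i j
 proof -
  have "i : {p, q}" "j : {p, q}" using that unfolding pq(1)[symmetric] by auto
  thus ?thesis by auto
 qed
 \<comment> \<open>The weights on \<open>R\<close> contribute 6, hence the total -7 demanded of
   \<open>\<beta>\<close>.\<close>
 have weights: False
  if d: "minimal_tensor d" and zd: "!!i j k. \<not> (i : R & j : R) ==> k : K ==> d i j k : Mv"
   and b: "!!k. - 2 <= \<beta> k" "!!k. k ~: K ==> - 1 <= \<beta> k" "!!k. d p q k ~= 0 ==> 0 <= v (d p q k) + \<beta> k"
   and s: "sum \<beta> UNIV = - 7" for d \<beta>
 proof -
  have "0 <= 2 * sum (%i. if i : R then 1 else 0) UNIV + sum \<beta> UNIV"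
  proof (rule minimal_weights[OF d])
   fix i j k assume ne: "d i j k ~= 0"
   note v = minimalD(4)[OF d ne] minimalD(5)[OF d _ ne]
   show "0 <= v (d i j k) + (if i : R then 1 else 0) + (if j : R then 1 else 0) + \<beta> k"
   proof (cases "i ~: R & j ~: R")
    case True
    have "v (d q p k) = v (d p q k)" using v_uminus[of "d p q k"] minimalD(2)[OF d, of q p k] by (cases "d p q k = 0") auto
    thus ?thesis using out[of i j] True b(3)[of k] ne minimalD(3)[OF d] minimalD(2)[OF d, of q p k] by auto
   next
    case False
    thus ?thesis using v zd[of i j k] b(1,2)[of k] by (cases "k : K"; cases "i : R"; cases "j : R") auto
   qed
  qed
  thus False unfolding sum_indicator_5 R s by simp
 qed
 show False
 proof (cases "EX r. c p q r ~: Mv")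
  case True
  then obtain r where r: "c p q r ~: Mv" by auto
  have pR: "p ~: R" using pq(1) by blast
  hence rK: "r ~: K" using z[of p q r] r by auto
  define n where "n k = (if k = r then 0 else - (c p q k / c p q r))" for k
  have n: "n k : Ov" for k using minimalD(1)[OF c] r by (auto simp: n_def O_closed(1) intro!: O_closed(3) O_div)
  have nK: "n k : Mv" if "k : K" for k
   using z[OF _ that, of p q] pR minimalD(1)[OF c] r that rK by (auto simp: n_def intro!: M_closed(6) M_div)
  let ?d = "%i j k. c i j k + n k * c i j r"
  obtain s where s: "- K = {r, s}" "r ~= s" 
  proof -
   obtain x y where xy: "- K = {x, y}" "x ~= y" using \<open>card (- K) = 2\<close> by (auto simp: card_2_iff)
   have "r : {x, y}" using rK unfolding xy(1)[symmetric] by simp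
   thus ?thesis using xy that by (auto simp: insert_commute)
  qed
  have d0: "?d p q k = 0" if "k ~= r" for k using that unitD(1)[OF minimalD(1)[OF c] r] by (simp add: n_def)
  show False
  proof (rule weights[of ?d "%k. if k : K then - 2 else if k = r then 0 else - 1"])
   show "minimal_tensor ?d" using minimal_add_col[OF c, of n r] n by (simp add: n_def)
   show "?d i j k : Mv" if "\<not> (i : R & j : R)" "k : K" for i j k
    using z[OF that] nK[OF that(2)] minimalD(1)[OF c] by (intro M_closed(3) M_closed(5)) auto
   show "0 <= v (?d p q k) + (if k : K then - 2 else if k = r then 0 else - 1)" if "?d p q k ~= 0" for k
   proof -
    have "k = r" using d0 that by blast
    thus ?thesis using minimalD(4)[OF c, of p q r] unitD(1)[OF minimalD(1)[OF c] r] rK by (simp add: n_def)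
   qed
   have "(SUM k:UNIV. if k : K then - 2 else if k = r then 0 else - 1) = (SUM k:K. - 2) + (SUM k:- K. if k = r then 0 else - 1 :: int)"
    by (simp add: sum.If_cases Compl_eq_Diff_UNIV[symmetric] Int_def)
   thus "(SUM k:UNIV. if k : K then - 2 else if k = r then 0 else - 1) = (- 7 :: int)" using K s by simp
  qed auto
 next
  case False
  \<comment> \<open>All coefficients of the entry \<open>(p, q)\<close> lie in \<open>Mv\<close>.
    Those in \<open>K\<close> are cleared by one of least valuation; if they are all zero, any
    \<open>k0\<close> will do. Weights -2 on the two cleared variables and -1 elsewhere give -7
    again.\<close>
  obtain k0 where k0: "k0 : K" "!!k. k : K ==> c p q k / c p q k0 : Ov" "c p q k0 = 0 ==> ALL k:K. c p q k = 0"
  proof (cases "EX k:K. c p q k ~= 0")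
   case True
   from scale_to_unit[OF _ this] obtain k0 where "k0 : K" "c p q k0 ~= 0" "ALL k:K. c p q k / c p q k0 : Ov" by auto
   thus ?thesis using that by blast
  next
   case False
   moreover obtain k0 where "k0 : K" using K by fastforce
   ultimately show ?thesis using that[of k0] O_closed(1) by auto
  qed
  define n where "n k = (if k : K - {k0} then - (c p q k / c p q k0) else 0)" for k
  have n: "n k : Ov" for k using k0(2) O_closed(1,3) by (auto simp: n_def)
  let ?d = "%i j k. c i j k + n k * c i j k0"
  have d0: "?d p q k = 0" if "k : K - {k0}" for k using that k0 by (auto simp: n_def)
  show False
  proof (rule weights[of ?d "%k. if k : K - {k0} then - 2 else - 1"])
   show d: "minimal_tensor ?d" using minimal_add_col[OF c, of n k0] n by (simp add: n_def)
   show "?d i j k : Mv" if "\<not> (i : R & j : R)" "k : K" for i j k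
    using z[OF that] z[OF that(1) k0(1)] n by (intro M_closed(3) M_closed(4)) auto
   show "0 <= v (?d p q k) + (if k : K - {k0} then - 2 else - 1)" if ne: "?d p q k ~= 0" for k
   proof -
    have "?d p q k : Mv" using False n by (intro M_closed(3) M_closed(4)) auto
    thus ?thesis using minimalD(5)[OF d _ ne] d0 ne by auto
   qed
   show "(SUM k:UNIV. if k : K - {k0} then - 2 else - 1) = (- 7 :: int)"
    unfolding sum_indicator_5 using K k0(1) by simp
  qed auto
 qed
qed

end

section \<open>Isotropic families of bivectors\<close>

context dvr begin

lemma GLO_mult: "GLO A ==> GLO B ==> GLO (A ** B)"
 unfolding GLO_def det_mul using M_prime[of "det A" "det B"] by (auto simp: matrix_matrix_mult_def intro!: O_closed(5,8))

lemma M_diff_iff: "x - y : Mv ==> x : Mv \<longleftrightarrow> y : Mv"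
 using M_closed(3)[of "x - y" y] M_closed(7)[of x "x - y"] by auto

text \<open>The product of two linear forms in the variables \<open>K\<close> vanishes modulo
  \<open>Mv\<close>. For \<open>k = l\<close> the second condition yields only twice a coefficient,
  so the squares are listed separately.\<close>

definition lin_prod_zero :: "5 set => (5 => 'a) => (5 => 'a) => bool" where
 "lin_prod_zero K p t \<longleftrightarrow> (ALL k:K. p k * t k : Mv) & (ALL k:K. ALL l:K. p k * t l + p l * t k : Mv)"

lemma lin_prod_zeroD:
 assumes "lin_prod_zero K p t" "k0 : K" "p k0 ~: Mv" "!!k. p k : Ov" "!!k. t k : Ov" "l : K"
 shows "t l : Mv"
proof -
 have t0: "t k0 : Mv" using assms M_prime[of "p k0" "t k0"] by (auto simp: lin_prod_zero_def)
 have "p k0 * t l + p l * t k0 : Mv" using assms by (auto simp: lin_prod_zero_def)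
 hence "p k0 * t l : Mv" using M_closed(7)[of "p k0 * t l + p l * t k0" "p l * t k0"] M_closed(4)[OF assms(4) t0] by simp
 thus ?thesis using assms M_prime[of "p k0" "t l"] by auto
qed

text \<open>If \<open>p s = q r\<close> for linear forms over the residue field, then the form \<open>p\<close>, being prime, divides \<open>q\<close> or \<open>r\<close>.\<close>

lemma linear_factor:
 fixes K :: "5 set"
 assumes O: "!!k. p k : Ov" "!!k. q k : Ov" "!!k. r k : Ov" "!!k. s k : Ov"
  and k0: "k0 : K" "p k0 ~: Mv"
  and d: "!!k. k : K ==> p k * s k - q k * r k : Mv"
  and o: "!!k l. k : K ==> l : K ==> p k * s l + p l * s k - (q k * r l + q l * r k) : Mv"
 shows "(EX a:Ov. ALL k:K. q k - a * p k : Mv) \<or> (EX a:Ov. ALL k:K. r k - a * p k : Mv)"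
proof -
 \<comment> \<open>Subtracting multiples of \<open>p\<close> clears the coefficients of
   \<open>q\<close> and \<open>r\<close> at \<open>k0\<close>; \<open>t\<close> is the matching
   correction of \<open>s\<close>, so that \<open>p t = q' r'\<close>. The coefficients involving
   \<open>k0\<close> then force \<open>t = 0\<close>, hence \<open>q' r' = 0\<close>.\<close>
 define a where "a = q k0 / p k0"
 define b where "b = r k0 / p k0"
 have ab: "a : Ov" "b : Ov" using O k0 by (auto simp: a_def b_def intro: O_div)
 define q' where "q' k = q k - a * p k" for k
 define r' where "r' k = r k - b * p k" for k
 define t where "t k = s k - (a * r' k + b * q' k + a * b * p k)" for k
 have O': "q' k : Ov" "r' k : Ov" "t k : Ov" for k
 proof -
  show 1: "q' k : Ov" "r' k : Ov" using O ab unfolding q'_def r'_def by (auto intro!: O_closed)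
  show "t k : Ov" unfolding t_def using O ab 1 by (intro O_closed(4,5,6)) auto
 qed
 have z: "q' k0 = 0" "r' k0 = 0" using unitD(1)[OF O(1) k0(2)] by (auto simp: q'_def r'_def a_def b_def)
 have d': "p k * t k - q' k * r' k : Mv" if "k : K" for k
  using d[OF that] by (simp add: t_def q'_def r'_def algebra_simps)
 have o': "p k * t l + p l * t k - (q' k * r' l + q' l * r' k) : Mv" if "k : K" "l : K" for k l
  using o[OF that] by (simp add: t_def q'_def r'_def algebra_simps)
 have "t k0 : Mv" using d'[OF k0(1)] z M_prime[of "p k0" "t k0"] O O' k0 by auto
 hence "p k0 * t l : Mv" if "l : K" for l
  using o'[OF k0(1) that] z M_closed(7)[of "p k0 * t l + p l * t k0" "p l * t k0"] M_closed(4)[OF O(1)] by simp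
 hence t: "t l : Mv" if "l : K" for l using that M_prime[of "p k0" "t l"] O O' k0 by auto
 have "lin_prod_zero K q' r'"
  unfolding lin_prod_zero_def using M_diff_iff[OF d'] M_diff_iff[OF o'] t O(1) M_closed(3,4) by auto
 hence "(ALL k:K. q' k : Mv) \<or> (ALL k:K. r' k : Mv)" using lin_prod_zeroD[of K q' r'] O' by blast
 thus ?thesis using ab unfolding q'_def r'_def by blast
qed

text \<open>The Pfaffians on the rows \<open>J\<close>, restricted to the variables
  \<open>K\<close>, vanish coefficientwise modulo \<open>Mv\<close>; \<open>coef_pfp\<close>
  identifies the two expressions with the coefficients of squares and of mixed monomials.\<close>

definition isotropic :: "'a tensor => 5 set => 5 set => bool" where
 "isotropic c J K \<longleftrightarrow> (ALL p:J. ALL q:J. ALL r:J. ALL s:J. ALL k:K.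
  pf2 (%i j. c i j k) (%i j. c i j k) p q r s : Mv &
  (ALL l:K. pf2 (%i j. c i j k) (%i j. c i j l) p q r s + pf2 (%i j. c i j l) (%i j. c i j k) p q r s : Mv))"

text \<open>A row operation inside \<open>J\<close> turns the Pfaffians on rows of \<open>J\<close>
  into combinations of such Pfaffians.\<close>

lemma isotropic_add_row:
 assumes c: "isotropic c J K" "minimal_tensor c" and n: "!!i. n i : Ov" "n r = 0" "!!i. i ~: J ==> n i = 0" and r: "r : J"
 shows "isotropic (%i j k. c i j k + n i * c r j k + n j * c i r k) J K"
proof -
 define d where "d = (%i j k. c i j k + n i * c r j k + n j * c i r k)"
 have dk: "(%i j. d i j k) p q = (SUM a:UNIV. SUM b:UNIV. add_mat r n $ p $ a * add_mat r n $ q $ b * (%i j. c i j k) a b)" for k p q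
  using row_act_add_mat[of c n r p q k] c(2) n(2) by (simp add: row_act_def d_def minimal_tensor_def)
 note e = pf2_congruence[OF dk dk]
 have A: "add_mat r n $ p $ a : Ov" "p : J ==> a ~: J ==> add_mat r n $ p $ a = 0" for p a
  using n r O_closed(1,2) by (auto simp: add_mat_def)
 have S: "(SUM a:UNIV. SUM b:UNIV. SUM x:UNIV. SUM y:UNIV. add_mat r n $ p $ a * add_mat r n $ q $ b * add_mat r n $ s $ x * add_mat r n $ t $ y * F a b x y) : Mv"
  if "p : J" "q : J" "s : J" "t : J" "!!a b x y. a : J ==> b : J ==> x : J ==> y : J ==> F a b x y : Mv" for p q s t F
 proof (intro M_closed(8))
  fix a b x y
  show "add_mat r n $ p $ a * add_mat r n $ q $ b * add_mat r n $ s $ x * add_mat r n $ t $ y * F a b x y : Mv"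
  proof (cases "a : J & b : J & x : J & y : J")
   case True
   thus ?thesis using that(5) A(1) by (intro M_closed(4) O_closed(5)) auto
  next
   case False
   hence "add_mat r n $ p $ a * add_mat r n $ q $ b * add_mat r n $ s $ x * add_mat r n $ t $ y = 0"
    using A(2) that(1-4) by (metis mult_zero_left mult_zero_right)
   thus ?thesis by (simp only: mult_zero_left zero_in_M)
  qed
 qed
 show ?thesis unfolding d_def[symmetric] isotropic_def
 proof (intro ballI conjI)
  fix p q s t k l assume *: "p : J" "q : J" "s : J" "t : J" "k : K"
  show "pf2 (%i j. d i j k) (%i j. d i j k) p q s t : Mv"
   unfolding e by (rule S[OF *(1-4)]) (use c(1) * in \<open>auto simp: isotropic_def\<close>)
  show "pf2 (%i j. d i j k) (%i j. d i j l) p q s t + pf2 (%i j. d i j l) (%i j. d i j k) p q s t : Mv" if "l : K"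
   unfolding e sum.distrib[symmetric] distrib_left[symmetric]
   by (rule S[OF *(1-4)]) (use c(1) * that in \<open>auto simp: isotropic_def\<close>)
 qed
qed

text \<open>As in symplectic reduction, the unit entry \<open>(a, b)\<close> clears the rest of both
  rows in the variable \<open>k0\<close>. Then the Pfaffian on \<open>a, b, i, j\<close>, polarised
  between \<open>k0\<close> and \<open>k\<close>, equals a unit times \<open>d i j k\<close> modulo
  \<open>Mv\<close>.\<close>

lemma isotropic_normal_form:
 assumes c: "minimal_tensor c" "isotropic c J K" and J: "a : J" "b : J" "a ~= b" and k0: "k0 : K" "c a b k0 ~: Mv"
 shows "EX A d. GLO A & d = row_act A c & minimal_tensor d & isotropic d J K & d a b k0 = c a b k0 &
  (ALL j:J - {a, b}. d a j k0 = 0 & d b j k0 = 0) & (ALL i:J - {a, b}. ALL j:J - {a, b}. ALL k:K. d i j k : Mv)"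
proof -
 define n where "n j = (if j : J - {a, b} then - (c a j k0 / c a b k0) else 0)" for j
 define c1 where "c1 = (%i j k. c i j k + n i * c b j k + n j * c i b k)"
 have n: "n i : Ov" "n b = 0" "n a = 0" "i ~: J ==> n i = 0" for i
  using minimalD(1)[OF c(1)] k0 by (auto simp: n_def O_closed(1) intro!: O_closed(3) O_div)
 have c1: "minimal_tensor c1" "isotropic c1 J K"
  unfolding c1_def using minimal_add_row[OF c(1), of n b] isotropic_add_row[OF c(2,1), of n b] n J by auto
 note u = unitD(1)[OF minimalD(1)[OF c(1)] k0(2)]
 have c1ab: "c1 a b k0 = c a b k0" using n(2,3) by (simp add: c1_def)
 have c1a: "c1 a j k0 = 0" if "j : J - {a, b}" for j using that n(3) u by (simp add: c1_def n_def)
 define m where "m j = (if j : J - {a, b} then c1 b j k0 / c1 a b k0 else 0)" for j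
 define d where "d = (%i j k. c1 i j k + m i * c1 a j k + m j * c1 i a k)"
 have m: "m i : Ov" "m b = 0" "m a = 0" "i ~: J ==> m i = 0" for i
  using minimalD(1)[OF c1(1)] minimalD(1)[OF c(1)] k0 c1ab by (auto simp: m_def O_closed(1) intro!: O_div)
 have d: "minimal_tensor d" "isotropic d J K"
  unfolding d_def using minimal_add_row[OF c1(1), of m a] isotropic_add_row[OF c1(2,1), of m a] m J by auto
 note z1 = minimalD(2,3)[OF c1(1)]
 have dab: "d a b k0 = c a b k0" using m(2,3) c1ab by (simp add: d_def)
 have da: "d a j k0 = 0" if "j : J - {a, b}" for j using that m(3) z1(2)[of a k0] c1a by (simp add: d_def)
 have db: "d b j k0 = 0" if "j : J - {a, b}" for j
  using that m(2) z1(1)[of b a k0] u c1ab by (simp add: d_def m_def)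
 have "d i j k : Mv" if ij: "i : J - {a, b}" "j : J - {a, b}" and k: "k : K" for i j k
 proof -
  have un: "d a b k0 ~: Mv" using dab k0 by simp
  have "pf2 (%i j. d i j k0) (%i j. d i j k0) a b i j : Mv" using d(2) J ij k0 by (auto simp: isotropic_def)
  hence "d a b k0 * d i j k0 : Mv" using da db ij by (simp add: pf2_def)
  hence 0: "d i j k0 : Mv" using M_prime[of "d a b k0" "d i j k0"] un minimalD(1)[OF d(1)] by auto
  have "pf2 (%i j. d i j k0) (%i j. d i j k) a b i j + pf2 (%i j. d i j k) (%i j. d i j k0) a b i j : Mv"
   using d(2) J ij k0 k by (auto simp: isotropic_def)
  hence "d a b k0 * d i j k + d a b k * d i j k0 : Mv" using da db ij by (simp add: pf2_def)
  hence "d a b k0 * d i j k : Mv"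
   using M_closed(7)[of "d a b k0 * d i j k + d a b k * d i j k0" "d a b k * d i j k0"] M_closed(4)[OF minimalD(1)[OF d(1)] 0] by simp
  thus ?thesis using M_prime[of "d a b k0" "d i j k"] un minimalD(1)[OF d(1)] by auto
 qed
 moreover have "d = row_act (add_mat a m) (row_act (add_mat b n) c)"
 proof -
  have "alternating c" "alternating c1" using c(1) c1(1) by (auto simp: minimal_tensor_def)
  hence "row_act (add_mat b n) c = c1" "row_act (add_mat a m) c1 = d"
   using row_act_add_mat[of c n b] row_act_add_mat[of c1 m a] n(2) m(3) unfolding c1_def d_def by blast+
  thus ?thesis by simp
 qed
 hence "d = row_act (add_mat a m ** add_mat b n) c" by (simp add: row_act_mult)
 moreover have "GLO (add_mat a m ** add_mat b n)" by (intro GLO_mult GLO_mats m n)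
 ultimately show ?thesis using d da db dab by (intro exI[of _ "add_mat a m ** add_mat b n"] exI[of _ d]) blast
qed

text \<open>A linear space of decomposable bivectors consists of multiples \<open>e \<and> u\<close> of a fixed vector, or lies
  in the exterior square of a 3-dimensional space.\<close>

lemma isotropic_classification:
 assumes c: "minimal_tensor c" "isotropic c J K" and J: "a0 : J"
 shows "EX d. minimal_tensor d &
  ((EX a:J. ALL i:J - {a}. ALL j:J - {a}. ALL k:K. d i j k : Mv) \<or>
  (\<exists>R\<subseteq>J. card R = 3 & (ALL i:J. ALL j:J. ALL k:K. \<not> (i : R & j : R) --> d i j k : Mv)))"
proof (cases "EX a:J. EX b:J. EX k:K. c a b k ~: Mv")
 case False
 thus ?thesis using c J by blast
next
 case True
 then obtain a b k0 where ab: "a : J" "b : J" "k0 : K" "c a b k0 ~: Mv" by blast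
 hence "a ~= b" using minimalD(3)[OF c(1)] by auto
 obtain d where d: "minimal_tensor d" "isotropic d J K" and dz: "!!i j k. i : J - {a, b} ==> j : J - {a, b} ==> k : K ==> d i j k : Mv"
  using isotropic_normal_form[OF c ab(1,2) \<open>a ~= b\<close> ab(3,4)] by (elim exE conjE) blast
 let ?J = "J - {a, b}"
 note O = minimalD(1)[OF d(1)] and sk = minimalD(2)[OF d(1)] and dg = minimalD(3)[OF d(1)]
 \<comment> \<open>As the block outside \<open>{a, b}\<close> vanishes, the Pfaffians on
   \<open>a, b, i, j\<close> become the 2-by-2 minors of the rows \<open>a\<close> and
   \<open>b\<close>, read as linear forms in \<open>K\<close>; \<open>min1\<close> and
   \<open>min2\<close> are their square and mixed coefficients.\<close>
 have min1: "d a i k * d b j k - d a j k * d b i k : Mv" if "i : ?J" "j : ?J" "k : K" for i j k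
 proof -
  have "pf2 (%i j. d i j k) (%i j. d i j k) a b i j : Mv" using d(2) ab that by (auto simp: isotropic_def)
  hence "d a b k * d i j k - (d a i k * d b j k - d a j k * d b i k) : Mv" by (simp add: pf2_def algebra_simps)
  thus ?thesis using M_diff_iff M_closed(4)[OF O dz[OF that]] by blast
 qed
 have min2: "d a i k * d b j l + d a i l * d b j k - (d a j k * d b i l + d a j l * d b i k) : Mv" if "i : ?J" "j : ?J" "k : K" "l : K" for i j k l
 proof -
  have "pf2 (%i j. d i j k) (%i j. d i j l) a b i j + pf2 (%i j. d i j l) (%i j. d i j k) a b i j : Mv"
   using d(2) ab that by (auto simp: isotropic_def)
  hence "(d a b k * d i j l + d a b l * d i j k) - (d a i k * d b j l + d a i l * d b j k - (d a j k * d b i l + d a j l * d b i k)) : Mv"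
   by (simp add: pf2_def algebra_simps)
  thus ?thesis using M_diff_iff M_closed(3)[OF M_closed(4)[OF O dz[OF that(1,2,4)]] M_closed(4)[OF O dz[OF that(1,2,3)]]] by blast
 qed
 have star: ?thesis if e: "minimal_tensor e" and "x : J" "y : J" "{x, y} = {a, b}" and ez: "!!i j k. i : ?J ==> j : ?J ==> k : K ==> e i j k : Mv"
  and "!!j k. j : ?J ==> k : K ==> e x j k : Mv" for e x y
 proof -
  have "e i j k : Mv" if "i : J - {y}" "j : J - {y}" "k : K" for i j k
  proof -
   have "i : ?J \<or> i = x" "j : ?J \<or> j = x" using that \<open>{x, y} = {a, b}\<close> by auto
   thus ?thesis
    using ez[of i j k] that(3) \<open>!!j k. j : ?J ==> k : K ==> e x j k : Mv\<close>[of j k] \<open>!!j k. j : ?J ==> k : K ==> e x j k : Mv\<close>[of i k]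
     minimalD(2)[OF e, of i x k] minimalD(3)[OF e, of x k] M_closed(6)[of "e x i k"] by auto
  qed
  thus ?thesis using e \<open>y : J\<close> by blast
 qed
 show ?thesis
 proof (cases "ALL j:?J. ALL k:K. d a j k : Mv")
  case True
  thus ?thesis using star[of d a b] d(1) dz ab by auto
 next
  case False
  then obtain j0 k1 where j0: "j0 : ?J" and k1: "k1 : K" "d a j0 k1 ~: Mv" by blast
  show ?thesis
  \<comment> \<open>A two-rowed matrix of linear forms with vanishing minors and a nonzero entry has
    proportional rows or proportional columns. The rows lead to the first alternative after one row
    operation, the columns to \<open>R = {a, b, j0}\<close>.\<close>
  proof (cases "EX x:Ov. ALL k:K. d b j0 k - x * d a j0 k : Mv")
   case True
   then obtain x where x: "x : Ov" "!!k. k : K ==> d b j0 k - x * d a j0 k : Mv" by blast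
   have bj: "d b j l - x * d a j l : Mv" if j: "j : ?J" and l: "l : K" for j l
   proof (rule lin_prod_zeroD[of K "%k. d a j0 k" "%k. d b j k - x * d a j k"])
    have r: "d a j k * (d b j0 l - x * d a j0 l) : Mv" if "l : K" for k l using M_closed(4)[OF O x(2)[OF that]] .
    have "d a j0 k * (d b j k - x * d a j k) : Mv" if "k : K" for k
     using M_closed(3)[OF min1[OF j0 j that] r[OF that, of k]] by (simp add: algebra_simps)
    moreover have "d a j0 k * (d b j l - x * d a j l) + d a j0 l * (d b j k - x * d a j k) : Mv" if "k : K" "l : K" for k l
     using M_closed(3)[OF min2[OF j0 j that] M_closed(3)[OF r[OF that(2), of k] r[OF that(1), of l]]] by (simp add: algebra_simps)
    ultimately show "lin_prod_zero K (d a j0) (%k. d b j k - x * d a j k)" by (simp add: lin_prod_zero_def)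
   qed (use k1 l O x(1) in \<open>auto intro!: O_closed(5,6)\<close>)
   define n where "n i = (if i = b then - x else 0)" for i
   define e where "e = (%i j k. d i j k + n i * d a j k + n j * d i a k)"
   have e: "minimal_tensor e" unfolding e_def using minimal_add_row[OF d(1), of n a] x(1) \<open>a ~= b\<close> O_closed(1,3) by (simp add: n_def)
   show ?thesis
   proof (rule star[of e b a])
    show "e i j k : Mv" if "i : ?J" "j : ?J" "k : K" for i j k using that dz by (simp add: e_def n_def)
    show "e b j k : Mv" if "j : ?J" "k : K" for j k using that bj[OF that] by (simp add: e_def n_def)
   qed (use e ab in auto)
  next
   case False
   have "EX y. y : Ov & (ALL k:K. d a j k - y * d a j0 k : Mv)" if j: "j : ?J" for j
    using linear_factor[of "d a j0" "d b j0" "d a j" "d b j" k1 K] O k1 min1[OF j0 j] min2[OF j0 j] False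
    by (auto simp: mult.commute add.commute)
   then obtain y where y: "!!j. j : ?J ==> y j : Ov" "!!j k. j : ?J ==> k : K ==> d a j k - y j * d a j0 k : Mv" by metis
   have bj: "d b j l - y j * d b j0 l : Mv" if j: "j : ?J" and l: "l : K" for j l
   proof (rule lin_prod_zeroD[of K "%k. d a j0 k" "%k. d b j k - y j * d b j0 k"])
    have r: "d b j0 l * (d a j k - y j * d a j0 k) : Mv" if "k : K" for k l using M_closed(4)[OF O y(2)[OF j that]] .
    have "d a j0 k * (d b j k - y j * d b j0 k) : Mv" if "k : K" for k
     using M_closed(3)[OF min1[OF j0 j that] r[OF that, of k]] by (simp add: algebra_simps)
    moreover have "d a j0 k * (d b j l - y j * d b j0 l) + d a j0 l * (d b j k - y j * d b j0 k) : Mv" if "k : K" "l : K" for k l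
     using M_closed(3)[OF min2[OF j0 j that] M_closed(3)[OF r[OF that(1), of l] r[OF that(2), of k]]] by (simp add: algebra_simps)
    ultimately show "lin_prod_zero K (d a j0) (%k. d b j k - y j * d b j0 k)" by (simp add: lin_prod_zero_def)
   qed (use k1 l O y(1) j in \<open>auto intro!: O_closed(5,6)\<close>)
   define n where "n i = (if i : ?J - {j0} then - y i else 0)" for i
   define e where "e = (%i j k. d i j k + n i * d j0 j k + n j * d i j0 k)"
   have n: "n i : Ov" for i using y(1) O_closed(1,3) by (auto simp: n_def)
   have e: "minimal_tensor e" unfolding e_def using minimal_add_row[OF d(1), of n j0] n by (simp add: n_def)
   have e1: "e a j k : Mv" "e b j k : Mv" "e j a k : Mv" "e j b k : Mv" if "j : ?J - {j0}" "k : K" for j k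
   proof -
    show "e a j k : Mv" "e b j k : Mv" using that y(2)[of j k] bj[of j k] by (auto simp: e_def n_def)
    thus "e j a k : Mv" "e j b k : Mv" using minimalD(2)[OF e, of j a k] minimalD(2)[OF e, of j b k] M_closed(6) by auto
   qed
   have e2: "e i j k : Mv" if "i : ?J" "j : ?J" "k : K" for i j k
    unfolding e_def using dz that j0 n by (intro M_closed(3,4)) auto
   have "e i j k : Mv" if "i : J" "j : J" "k : K" "\<not> (i : {a, b, j0} & j : {a, b, j0})" for i j k
    using that e1[of j k] e1[of i k] e2[of i j k] by auto
   moreover have "card {a, b, j0} = 3" "{a, b, j0} \<subseteq> J" using \<open>a ~= b\<close> j0 ab by auto
   ultimately show ?thesis using e by blast
  qed
 qed
qed

lemma no_isotropic_plane:
 assumes "minimal_tensor c" "isotropic c UNIV K" "card K = 3" shows False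
proof -
 obtain d where d: "minimal_tensor d" and
  "(EX a:UNIV. ALL i:UNIV - {a}. ALL j:UNIV - {a}. ALL k:K. d i j k : Mv) \<or>
  (\<exists>R\<subseteq>UNIV. card R = 3 & (ALL i:UNIV. ALL j:UNIV. ALL k:K. \<not> (i : R & j : R) --> d i j k : Mv))"
  using isotropic_classification[OF assms(1,2) UNIV_I] by blast
 thus False
 proof (elim disjE bexE exE conjE)
  fix a assume "ALL i:UNIV - {a}. ALL j:UNIV - {a}. ALL k:K. d i j k : Mv"
  thus False using no_star_plane[OF d assms(3), of a] by simp
 next
  fix R assume "card R = 3" "ALL i:UNIV. ALL j:UNIV. ALL k:K. \<not> (i : R & j : R) --> d i j k : Mv"
  thus False using no_dual_plane[OF d _ assms(3), of R] by simp
 qed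
qed

text \<open>The single entry is one linear form; a column operation makes it a multiple of one
  variable, which is the pattern of \<open>no_rank1_row\<close>.\<close>

lemma no_single_entry_row:
 assumes c: "minimal_tensor c" and z: "!!j k. j ~= q ==> c p j k : Mv" shows False
proof (cases "EX r. c p q r ~: Mv")
 case False
 hence "c p j k : Mv" for j k using z[of j k] by (cases "j = q") auto
 thus False using no_rank1_row[OF c] by blast
next
 case True
 then obtain r where r: "c p q r ~: Mv" by auto
 define n where "n k = (if k = r then 0 else - (c p q k / c p q r))" for k
 have n: "n k : Ov" for k using minimalD(1)[OF c] r by (auto simp: n_def O_closed(1) intro!: O_closed(3) O_div)
 let ?d = "%i j k. c i j k + n k * c i j r"
 have "?d p j k : Mv" if "k ~= r" for j k
 proof (cases "j = q")
  case True
  thus ?thesis using that unitD(1)[OF minimalD(1)[OF c] r] by (simp add: n_def)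
 next
  case False
  thus ?thesis using z n by (intro M_closed(3,4)) auto
 qed
 moreover have "minimal_tensor ?d" using minimal_add_col[OF c, of n r] n by (simp add: n_def)
 ultimately show False using no_rank1_row by blast
qed

text \<open>In the first alternative of the classification, removing \<open>a\<close> from
  \<open>J\<close> leaves a zero 3-by-3 block. In the second, the row of \<open>J\<close> outside
  \<open>R\<close> has its only entry in the one column outside \<open>J\<close>.\<close>

lemma no_isotropic_rows:
 assumes "minimal_tensor c" "isotropic c J UNIV" "card J = 4" shows False
proof -
 obtain a0 where a0: "a0 : J" using assms(3) by fastforce
 from isotropic_classification[OF assms(1,2) a0] obtain d where d: "minimal_tensor d" and alt:
  "(EX a:J. ALL i:J - {a}. ALL j:J - {a}. ALL k:UNIV. d i j k : Mv) \<or>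
  (\<exists>R\<subseteq>J. card R = 3 & (ALL i:J. ALL j:J. ALL k:UNIV. \<not> (i : R & j : R) --> d i j k : Mv))"
  by (elim exE conjE)
 from alt show False
 proof (elim disjE bexE exE conjE)
  fix a assume "a : J" "ALL i:J - {a}. ALL j:J - {a}. ALL k:UNIV. d i j k : Mv"
  thus False using no_zero_block[OF d, of "J - {a}"] assms(3) by simp
 next
  fix R assume R: "R \<subseteq> J" "card R = 3" and z: "ALL i:J. ALL j:J. ALL k:UNIV. \<not> (i : R & j : R) --> d i j k : Mv"
  have "R ~= J" using R assms(3) by auto
  then obtain p where p: "p : J" "p ~: R" using R by blast
  have "card (- J) = 1" using assms(3) by (simp add: Compl_eq_Diff_UNIV card_Diff_subset)
  then obtain q where "- J = {q}" by (auto simp: card_1_singleton_iff)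
  have jJ: "j : J" if "j ~= q" for j 
  proof (rule ccontr)
   assume "j ~: J"
   hence "j : - J" by simp
   thus False unfolding \<open>- J = {q}\<close> using that by simp
  qed
  have "d p j k : Mv" if "j ~= q" for j k using z[rule_format, OF p(1) jJ[OF that] UNIV_I] p(2) by blast
  thus False using no_single_entry_row[OF d, of q p] by blast
 qed
qed

end

section \<open>Existence of a point of rank two\<close>

lemma UNIV_5: "(UNIV :: 5 set) = {0, 1, 2, 3, 4}"
proof -
 have "card {0, 1, 2, 3, 4 :: 5} = 5" by simp
 thus ?thesis by (intro card_subset_eq[symmetric]) auto
qed

lemma sum_5: "(SUM i:(UNIV :: 5 set). f i) = f 0 + f 1 + f 2 + f 3 + (f 4 :: 'r::comm_monoid_add)"
 unfolding UNIV_5 by (simp add: add.assoc)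

lemma exhaust_5: "(i :: 5) = 0 \<or> i = 1 \<or> i = 2 \<or> i = 3 \<or> i = 4"
 using UNIV_5 by blast

lemma increasing_quadruples_5:
 assumes "(a::5) < b" "b < c" "c < d"
 shows "(a, b) = (0, 1) \<or> (a, b, c, d) = (0, 2, 3, 4) \<or> (a, b, c, d) = (1, 2, 3, 4)"
proof -
 have "Rep_bit1 a < Rep_bit1 b" "Rep_bit1 b < Rep_bit1 c" "Rep_bit1 c < Rep_bit1 d"
  using assms by (simp_all add: less_bit1_def)
 moreover have "0 <= Rep_bit1 x" "Rep_bit1 x < 5" for x :: 5
  using Rep_bit1[of x] by simp_all
 moreover have eq: "x = 0 \<longleftrightarrow> Rep_bit1 x = 0" "x = 1 \<longleftrightarrow> Rep_bit1 x = 1" "x = 2 \<longleftrightarrow> Rep_bit1 x = 2"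
  "x = 3 \<longleftrightarrow> Rep_bit1 x = 3" "x = 4 \<longleftrightarrow> Rep_bit1 x = 4" for x :: 5
  unfolding bit1.Rep_inject_sym by (simp_all add: bit1.Rep_numeral bit1.Rep_0 bit1.Rep_1)
 ultimately show ?thesis unfolding prod.inject eq by (smt (verit))
qed

definition alternating2 :: "(5 => 5 => 'r::comm_ring_1) => bool" where
 "alternating2 x \<longleftrightarrow> (ALL i j. x j i = - x i j) & (ALL i. x i i = 0)"

lemma pf2_swap:
 assumes "alternating2 x"
 shows "pf2 x x q p r s = - pf2 x x p q r s" "pf2 x x p r q s = - pf2 x x p q r s" "pf2 x x p q s r = - pf2 x x p q r s"
  "pf2 x x p p r s = 0" "pf2 x x p q q s = 0" "pf2 x x p q r r = 0"
proof -
 have x: "x j i = - x i j" "x i i = 0" for i j using assms unfolding alternating2_def by blast+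
 show "pf2 x x q p r s = - pf2 x x p q r s" using x(1)[of p q] by (simp add: pf2_def algebra_simps)
 show "pf2 x x p r q s = - pf2 x x p q r s" using x(1)[of q r] by (simp add: pf2_def algebra_simps)
 show "pf2 x x p q s r = - pf2 x x p q r s" using x(1)[of r s] by (simp add: pf2_def algebra_simps)
 show "pf2 x x p p r s = 0" "pf2 x x p q q s = 0" "pf2 x x p q r r = 0" by (simp_all add: pf2_def x(2))
qed

text \<open>The indices are sorted by insertion; a transposition costs a sign, and a repeated index
  gives 0.\<close>

lemma pf2_induct_increasing:
 assumes x: "alternating2 x" and Q: "Q 0" "!!a. Q a ==> Q (- a)"
  and inc: "!!a b c d. a < b ==> b < c ==> c < d ==> Q (pf2 x x a b c d)"
 shows "Q (pf2 x x p q r s)"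
proof -
 note sw = pf2_swap[OF x]
 have s1: "Q (pf2 x x p q r s)" if "Q (pf2 x x q p r s)" for p q r s using Q(2)[OF that] sw(1)[of q p r s] by simp
 have s2: "Q (pf2 x x p q r s)" if "Q (pf2 x x p r q s)" for p q r s using Q(2)[OF that] sw(2)[of p r q s] by simp
 have s3: "Q (pf2 x x p q r s)" if "Q (pf2 x x p q s r)" for p q r s using Q(2)[OF that] sw(3)[of p q s r] by simp
 have le: "Q (pf2 x x a b c d)" if "a <= b" "b <= c" "c <= d" for a b c d
  using that inc[of a b c d] Q(1) sw(4-6) by (metis order_le_less)
 have 1: "Q (pf2 x x p a b c)" if "a <= b" "b <= c" for p a b c
  using that le[of p a b c] s1[OF le[of a p b c]] s1[OF s2[OF le[of a b p c]]] s1[OF s2[OF s3[OF le[of a b c p]]]] by (metis linear)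
 have 2: "Q (pf2 x x p q b c)" if "b <= c" for p q b c
  using that 1[of q b c p] s2[OF 1[of b q c p]] s2[OF s3[OF 1[of b c q p]]] by (metis linear)
 show ?thesis using 2[of r s] s3[OF 2[of s r]] by (metis linear)
qed

context dvr begin

definition point_tensor :: "'a tensor => (5 => 'a) => 5 => 5 => 'a" where
 "point_tensor c w i j = (SUM k:UNIV. c i j k * w k)"

text \<open>Polynomials in a parameter \<open>t\<close>, and those that vanish modulo
  \<open>Mv\<close>; five of them parametrise a curve of points.\<close>

definition "Op = {p :: 'a Polynomial.poly. ALL n. pcoeff p n : Ov}"
definition "Mp = {p :: 'a Polynomial.poly. ALL n. pcoeff p n : Mv}"

lemma sub_ring_Op: "sub_ring Op"
 by (auto simp: sub_ring_def Op_def coeff_mult Polynomial.coeff_1 intro!: O_closed)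

lemma ideal_Mp: "is_ideal Op Mp"
 by (rule is_idealI) (auto simp: Op_def Mp_def coeff_mult intro!: M_closed(3,4,8) intro: M_closed(1))

lemmas Op_closed = sub_ringD[OF sub_ring_Op]
lemmas Mp_closed = is_idealD[OF sub_ring_Op ideal_Mp]

lemma poly_Op: assumes "a : Ov" shows "p : Op ==> Polynomial.poly p a : Ov" "p : Mp ==> Polynomial.poly p a : Mv"
 unfolding Op_def Mp_def poly_altdef using assms by (auto intro!: O_closed(5,7,8)) (auto intro!: M_closed(5,8) O_closed(7))

lemma pCons_Op: "pCons a p : Op \<longleftrightarrow> a : Ov & p : Op" "pCons a p : Mp \<longleftrightarrow> a : Mv & p : Mp"
 by (auto simp: Op_def Mp_def coeff_pCons split: nat.splits)

lemma smult_Op: "a : Ov ==> p : Op ==> Polynomial.smult a p : Op" "a : Ov ==> p : Mp ==> Polynomial.smult a p : Mp"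
 by (auto simp: Op_def Mp_def intro!: O_closed(5)) (auto intro!: M_closed(4))

lemma synthetic_div_Op: "p : Op ==> a : Ov ==> synthetic_div p a : Op"
proof (induction p)
 case 0 thus ?case by (simp add: Op_def O_closed)
next
 case (pCons c p)
 thus ?case using poly_Op(1)[of a p] by (simp add: pCons_Op)
qed

lemma monic_linear_mult_Mp:
 assumes F: "F : Op" and a: "a : Ov" and z: "[:- a, 1:] * F : Mp" shows "F : Mp"
proof (rule ccontr)
 assume n: "F ~: Mp"
 let ?A = "{i. pcoeff F i ~: Mv}"
 have fin: "finite ?A" by (rule finite_subset[of _ "{..Polynomial.degree F}"]) (auto intro: le_degree)
 have ne: "?A ~= {}" using n by (auto simp: Mp_def)
 define m where "m = Max ?A"
 have m: "pcoeff F m ~: Mv" using Max_in[OF fin ne] by (simp add: m_def)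
 have m1: "pcoeff F (Suc m) : Mv" using Max_ge[OF fin, of "Suc m"] by (fastforce simp: m_def[symmetric])
 have "pcoeff ([:- a, 1:] * F) (Suc m) = pcoeff F m - a * pcoeff F (Suc m)" by simp
 hence "pcoeff F m - a * pcoeff F (Suc m) : Mv" using z unfolding Mp_def by (metis mem_Collect_eq)
 thus False using M_diff_iff M_closed(4)[OF a m1] m by blast
qed

definition poly_tensor :: "'a tensor => (5 => 'a Polynomial.poly) => 5 => 5 => 'a Polynomial.poly" where
 "poly_tensor c x i j = (SUM k:UNIV. Polynomial.smult (c i j k) (x k))"

text \<open>A curve of points \<open>x(t)\<close>, nonzero modulo \<open>Mv\<close>, such that
  modulo \<open>Mv\<close> the vector \<open>(1, t, 0, 0, 0)\<close> lies in the kernel of the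
  alternating matrix at \<open>x(t)\<close>; \<open>pCons 0\<close> is multiplication by
  \<open>t\<close>.\<close>

definition pencil_solution :: "'a tensor => (5 => 'a Polynomial.poly) => bool" where
 "pencil_solution c x \<longleftrightarrow> (ALL k. x k : Op) & (EX k. x k ~: Mp) &
  (ALL i. poly_tensor c x i 0 + pCons 0 (poly_tensor c x i 1) : Mp)"

lemma poly_tensor_props:
 assumes c: "minimal_tensor c"
 shows "alternating2 (poly_tensor c x)" "(!!k. x k : Op) ==> poly_tensor c x i j : Op"
  "Polynomial.poly (poly_tensor c x i j) a = point_tensor c (%k. Polynomial.poly (x k) a) i j"
  "pcoeff (poly_tensor c x i j) n = point_tensor c (%k. pcoeff (x k) n) i j"
proof -
 have "poly_tensor c x j i = - poly_tensor c x i j" for i j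
  unfolding poly_tensor_def minimalD(2)[OF c, of j i] smult_minus_left sum_negf by (rule refl)
 moreover have "poly_tensor c x i i = 0" for i by (simp add: poly_tensor_def minimalD(3)[OF c])
 ultimately have "poly_tensor c x j i = - poly_tensor c x i j" "poly_tensor c x i i = 0" for i j by blast+
 thus "alternating2 (poly_tensor c x)" unfolding alternating2_def by blast
 show "(!!k. x k : Op) ==> poly_tensor c x i j : Op"
  unfolding poly_tensor_def by (intro Op_closed(8) smult_Op(1) minimalD(1)[OF c])
 show "Polynomial.poly (poly_tensor c x i j) a = point_tensor c (%k. Polynomial.poly (x k) a) i j"
  by (simp add: poly_tensor_def point_tensor_def poly_sum)
 show "pcoeff (poly_tensor c x i j) n = point_tensor c (%k. pcoeff (x k) n) i j"
  by (simp add: poly_tensor_def point_tensor_def coeff_sum)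
qed

text \<open>Degree at most 3 in \<open>t\<close> leaves 20 unknown coefficients. Row 1 gives 4
  equations because its diagonal entry vanishes, rows 2, 3 and 4 give 5 each, and row 0 is
  \<open>-t\<close> times row 1: 19 equations in all.\<close>

lemma pencil_solution_exists: assumes c: "minimal_tensor c" shows "EX x. pencil_solution c x"
proof -
 let ?I = "(UNIV :: 5 set) \<times> {..<4::nat}" and ?E = "{1} \<times> {..<4} \<union> {2, 3, 4} \<times> {..<5} :: (5 \<times> nat) set"
 define f where "f = (%(k, a::nat) (i, s). (if a = s then c i 0 k else 0) + (if Suc a = s then c i 1 k else 0))"
 have "card ?E = 19" by (subst card_Un_disjoint) (auto simp: card_cartesian_product)
 moreover have "card ?I = 20" by (simp add: card_cartesian_product)
 ultimately obtain b where b: "ALL i:?I. b i : Ov" "EX i:?I. b i = 1" and eq: "ALL e:?E. (SUM i:?I. b i * f i e) = 0"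
  using exact_relation[of ?E ?I f] by auto
 define x where "x k = (SUM a<4. Polynomial.monom (b (k, a)) a)" for k
 have cx: "pcoeff (x k) s = (if s < 4 then b (k, s) else 0)" for k s
  by (simp add: x_def coeff_sum)
 define L where "L i s = (SUM k:UNIV. c i 0 k * pcoeff (x k) s) + (if s = 0 then 0 else SUM k:UNIV. c i 1 k * pcoeff (x k) (s - 1))" for i s
 have L: "L i s = (SUM p:?I. b p * f p (i, s))" for i s
 proof -
  have "(SUM p:?I. b p * f p (i, s)) = (SUM k:UNIV. SUM a<4. (if a = s then c i 0 k * b (k, s) else 0) + (if Suc a = s then c i 1 k * b (k, s - 1) else 0))"
   unfolding sum.cartesian_product by (intro sum.cong refl) (auto simp: f_def)
  also have "... = (SUM k:UNIV. c i 0 k * pcoeff (x k) s + (if s = 0 then 0 else c i 1 k * pcoeff (x k) (s - 1)))"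
   unfolding sum.distrib cx by (cases s) (auto intro!: arg_cong2[where f = "(+)"] sum.cong)
  also have "... = L i s" by (simp add: L_def sum.distrib)
  finally show ?thesis ..
 qed
 have L0: "L i s = 0" if "i ~= 0" for i s
 proof (cases "(i, s) : ?E")
  case True thus ?thesis using eq L by simp
 next
  case False
  hence "s \<ge> 5 \<or> (i = 1 & s \<ge> 4)" using that exhaust_5[of i] by auto
  moreover have "(SUM k:UNIV. c i 1 k * pcoeff (x k) (s - 1)) = 0" if "s \<ge> 5 \<or> i = 1"
   using that minimalD(3)[OF c] by (elim disjE) (auto intro!: sum.neutral simp: cx)
  moreover have "pcoeff (x k) s = 0" if "s \<ge> 4" for k using that by (simp add: cx)
  ultimately show ?thesis by (auto simp: L_def)
 qed
 have "L 0 s = 0" for s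
 proof (cases s)
  case (Suc t)
  have "L 1 t = (SUM k:UNIV. c 1 0 k * pcoeff (x k) t)" using minimalD(3)[OF c] by (simp add: L_def)
  moreover have "L 0 s = (SUM k:UNIV. - (c 1 0 k * pcoeff (x k) t))"
   using minimalD(3)[OF c] minimalD(2)[OF c, of 0 1] Suc by (simp add: L_def)
  ultimately show ?thesis using L0[of 1 t] by (simp add: sum_negf)
 next
  case 0
  thus ?thesis using minimalD(3)[OF c] by (simp add: L_def)
 qed
 with L0 have "L i s = 0" for i s by (cases "i = 0") auto
 moreover have "pcoeff (poly_tensor c x i 0 + pCons 0 (poly_tensor c x i 1)) s = L i s" for i s
  by (cases s) (simp_all add: L_def poly_tensor_props(4)[OF c] point_tensor_def coeff_pCons)
 ultimately have "poly_tensor c x i 0 + pCons 0 (poly_tensor c x i 1) : Mp" for i by (simp add: Mp_def)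
 moreover have "x k : Op" for k using b(1) O_closed(1) by (auto simp: Op_def cx)
 moreover obtain k a where "a < 4" "b (k, a) = 1" using b(2) by auto
 hence "x k ~: Mp" by (auto simp: Mp_def cx intro!: exI[of _ a])
 ultimately show ?thesis unfolding pencil_solution_def by blast
qed

end

text \<open>Where an alternating 5-by-5 matrix has rank four, its Pfaffians span the kernel. Along a
  pencil solution they are therefore proportional to \<open>(1, t, 0, 0, 0)\<close>: all vanish
  except \<open>g\<close>, which omits row 0, and the one omitting row 1, which is
  \<open>t g\<close> up to sign. A root of \<open>g\<close>, or else the point at infinity, gives
  rank two.\<close>

lemma (in dvr_closed) exists_rank2_point:
 assumes c: "minimal_tensor c"
 shows "EX w. (ALL k. w k : Ov) & (EX k. w k ~: Mv) & (ALL p q r s. pf2 (point_tensor c w) (point_tensor c w) p q r s : Mv)"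
proof -
 \<comment> \<open>A solution of least degree vanishes neither at a finite parameter
   \<open>a\<close> nor at infinity modulo \<open>Mv\<close>: otherwise a factor
   \<open>t - a\<close> or the top coefficients could be removed.\<close>
 define Q where "Q n \<longleftrightarrow> (EX x. pencil_solution c x & (ALL k. Polynomial.degree (x k) <= n))" for n
 obtain x0 where x0: "pencil_solution c x0" using pencil_solution_exists[OF c] by auto
 have "Q (SUM k:UNIV. Polynomial.degree (x0 k))"
  unfolding Q_def by (rule exI[of _ x0], use x0 in \<open>auto intro!: member_le_sum\<close>)
 define n where "n = (LEAST n. Q n)"
 have "Q n" unfolding n_def by (rule LeastI) fact
 have min: "\<not> Q m" if "m < n" for m using that not_less_Least unfolding n_def by blast
 obtain x where x: "pencil_solution c x" and dx: "!!k. Polynomial.degree (x k) <= n" using \<open>Q n\<close> by (auto simp: Q_def)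
 note xO = x[unfolded pencil_solution_def, THEN conjunct1, rule_format]
 define E where "E = poly_tensor c x"
 have EO: "E i j : Op" for i j unfolding E_def by (rule poly_tensor_props(2)[OF c xO])
 have alt: "alternating2 E" unfolding E_def by (rule poly_tensor_props(1)[OF c])
 have sol: "E i 0 + pCons 0 (E i 1) : Mp" for i using x by (auto simp: pencil_solution_def E_def)
 have lin: "poly_tensor c (%k. f k + g k) i j = poly_tensor c f i j + poly_tensor c g i j" for f g i j
  by (simp add: poly_tensor_def smult_add_right sum.distrib)
 have rem_sol: "pencil_solution c y" if y: "!!k. y k : Op" "EX k. y k ~: Mp" and h: "h : Op" "!!F. F : Op ==> h * F : Mp ==> F : Mp"
  and z: "!!k. z k : Mp" and eq: "!!k. x k = h * y k + z k" for y z h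
 proof -
  have "h * (poly_tensor c y i 0 + pCons 0 (poly_tensor c y i 1)) : Mp" for i
  proof -
   have "poly_tensor c (%k. h * y k) i j = h * poly_tensor c y i j" for j by (simp add: poly_tensor_def sum_distrib_left)
   hence "E i 0 + pCons 0 (E i 1) = h * (poly_tensor c y i 0 + pCons 0 (poly_tensor c y i 1)) + (poly_tensor c z i 0 + pCons 0 (poly_tensor c z i 1))"
   proof -
    have "x = (%k. h * y k + z k)" using eq by auto
    hence e: "E i j = h * poly_tensor c y i j + poly_tensor c z i j" for j
     using lin[of "%k. h * y k" z i j] \<open>!!j. poly_tensor c (%k. h * y k) i j = h * poly_tensor c y i j\<close> by (simp add: E_def)
    have "EX T. ALL F. pCons 0 F = T * (F :: 'a Polynomial.poly)" by (rule exI[of _ "[:0, 1:]"]) simp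
    then obtain T where T: "!!F. pCons 0 F = T * (F :: 'a Polynomial.poly)" by blast
    show ?thesis unfolding e T by (simp add: algebra_simps)
   qed
   moreover have "poly_tensor c z i j : Mp" for j unfolding poly_tensor_def using z minimalD(1)[OF c] by (intro Mp_closed(8) smult_Op(2))
   hence "poly_tensor c z i 0 + pCons 0 (poly_tensor c z i 1) : Mp" by (intro Mp_closed(3)) (auto simp: pCons_Op)
   ultimately show ?thesis using sol[of i] Mp_closed(7) by (metis add_diff_cancel_right')
  qed
  moreover have "poly_tensor c y i 0 + pCons 0 (poly_tensor c y i 1) : Op" for i
   using poly_tensor_props(2)[OF c y(1)] by (intro Op_closed(4)) (auto simp: pCons_Op O_closed(1))
  ultimately show ?thesis using y h(2) by (auto simp: pencil_solution_def)
 qed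
 have nonvanishing: "EX k. Polynomial.poly (x k) a ~: Mv" if a: "a : Ov" for a
 proof (rule ccontr)
  assume "\<not> ?thesis"
  hence van: "Polynomial.poly (x k) a : Mv" for k by blast
  define y where "y k = synthetic_div (x k) a" for k
  have eq: "x k = [:- a, 1:] * y k + [:Polynomial.poly (x k) a:]" for k
   using synthetic_div_correct[of "x k" a] by (simp add: y_def algebra_simps)
  have yO: "y k : Op" for k unfolding y_def by (rule synthetic_div_Op[OF xO a])
  have cM: "[:Polynomial.poly (x k) a:] : Mp" for k using van by (simp add: pCons_Op Mp_closed(2))
  have lO: "[:- a, 1:] : Op" using a by (simp add: pCons_Op O_closed Op_closed(1))
  have "EX k. y k ~: Mp"
  proof (rule ccontr)
   assume "\<not> ?thesis"
   hence "x k : Mp" for k using eq[of k] Mp_closed(3)[OF Mp_closed(4)[OF lO] cM[of k], of "y k"] by auto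
   thus False using x by (auto simp: pencil_solution_def)
  qed
  hence "pencil_solution c y" using rem_sol[of y "[:- a, 1:]" "%k. [:Polynomial.poly (x k) a:]"] yO lO cM eq monic_linear_mult_Mp[OF _ a] by blast
  moreover have dy: "Polynomial.degree (y k) <= n - 1" for k using dx[of k] by (simp add: y_def degree_synthetic_div)
  ultimately have "Q (n - 1)" by (auto simp: Q_def)
  hence "n = 0" using min[of "n - 1"] by (cases n) auto
  hence "Polynomial.degree (x k) = 0" for k using dx[of k] by simp
  hence "x k = [:Polynomial.poly (x k) a:]" for k by (metis degree_eq_zeroE poly_const_conv)
  hence "x k : Mp" for k using cM[of k] by simp
  thus False using x by (auto simp: pencil_solution_def)
 qed
 have top: "EX k. pcoeff (x k) n ~: Mv"
 proof (rule ccontr)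
  assume "\<not> ?thesis"
  hence van: "pcoeff (x k) n : Mv" for k by blast
  define z where "z k = Polynomial.monom (pcoeff (x k) n) n" for k
  define y where "y k = x k - z k" for k
  have zM: "z k : Mp" for k using van by (auto simp: z_def Mp_def)
  have yO: "y k : Op" for k unfolding y_def using xO zM Mp_closed(1) by (intro Op_closed(6)) auto
  have "EX k. y k ~: Mp"
  proof (rule ccontr)
   assume "\<not> ?thesis"
   hence "x k : Mp" for k using Mp_closed(3)[OF _ zM[of k], of "y k"] by (auto simp: y_def)
   thus False using x by (auto simp: pencil_solution_def)
  qed
  moreover have eq: "x k = 1 * y k + z k" for k by (simp add: y_def)
  ultimately have ps: "pencil_solution c y" by (intro rem_sol[OF yO _ Op_closed(2) _ zM eq]) simp_all
  have yz: "pcoeff (y k) m = 0" if "m \<ge> n" for k m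
  proof (cases "m = n")
   case False
   hence "Polynomial.degree (x k) < m" using dx[of k] that by simp
   thus ?thesis using False by (simp add: y_def z_def coeff_eq_0)
  qed (simp add: y_def z_def)
  have n0: "n ~= 0"
  proof
   assume "n = 0"
   hence "y k = 0" for k using yz by (intro poly_eqI) simp
   thus False using \<open>EX k. y k ~: Mp\<close> Mp_closed(2) by simp
  qed
  have "Polynomial.degree (y k) <= n - 1" for k using yz n0 by (intro degree_le) auto
  hence "Q (n - 1)" using ps by (auto simp: Q_def)
  thus False using min[of "n - 1"] n0 by simp
 qed
 define t where "t = ([:0, 1:] :: 'a Polynomial.poly)"
 have t: "pCons 0 F = t * F" for F by (simp add: t_def)
 have tO: "t : Op" unfolding t_def by (simp add: pCons_Op O_closed Op_closed(1))
 have E0: "E 0 j + t * E 1 j : Mp" for j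
 proof -
  have "E 0 j + t * E 1 j = - (E j 0 + pCons 0 (E j 1))" using alt unfolding t alternating2_def by (metis (no_types) add_uminus_conv_diff minus_add_distrib mult_minus_right)
  thus ?thesis using Mp_closed(6)[OF sol[of j]] by simp
 qed
 have pf0: "pf2 E E 0 p q r + t * pf2 E E 1 p q r : Mp" for p q r
 proof -
  have "pf2 E E 0 p q r + t * pf2 E E 1 p q r = (E 0 p + t * E 1 p) * E q r - (E 0 q + t * E 1 q) * E p r + (E 0 r + t * E 1 r) * E p q"
   by (simp add: pf2_def algebra_simps)
  also have "... : Mp" by (rule Mp_closed(3)[OF Mp_closed(7)]; rule Mp_closed(5)[OF EO E0])
  finally show ?thesis .
 qed
 have pf01: "pf2 E E 0 1 q r : Mp" for q r using pf0[of 1 q r] pf2_swap(4)[OF alt] by simp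
 define g where "g = pf2 E E 1 2 3 4"
 have gO: "g : Op" unfolding g_def pf2_def using EO by (intro Op_closed(4,5,6))
 have dE: "Polynomial.degree (E i j) <= n" for i j
  unfolding E_def poly_tensor_def using dx by (intro degree_sum_le) (auto intro: order.trans[OF degree_smult_le])
 have dpf: "Polynomial.degree (pf2 E E p q r s) <= 2 * n" for p q r s
 proof -
  have "Polynomial.degree (E a b * E c d) <= 2 * n" for a b c d using degree_mult_le[of "E a b" "E c d"] dE[of a b] dE[of c d] by linarith
  thus ?thesis unfolding pf2_def by (intro degree_add_le degree_diff_le)
 qed
 have pfcoeff: "pcoeff (pf2 E E p q r s) (2 * n) = pf2 (point_tensor c (%k. pcoeff (x k) n)) (point_tensor c (%k. pcoeff (x k) n)) p q r s" for p q r s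
 proof -
  have "pcoeff (E a b * E c d) (2 * n) = pcoeff (E a b) n * pcoeff (E c d) n" for a b c d
  proof -
   have "pcoeff (E a b * E c d) (2 * n) = (SUM i<=2 * n. if i = n then pcoeff (E a b) n * pcoeff (E c d) n else 0)"
    unfolding coeff_mult
   proof (intro sum.cong refl)
    fix i
    have "pcoeff (E a b) i = 0" if "i > n" using that dE[of a b] by (intro coeff_eq_0) simp
    moreover have "pcoeff (E c d) (2 * n - i) = 0" if "i < n" using that dE[of c d] by (intro coeff_eq_0) simp
    moreover have "2 * n - n = n" by simp
    ultimately show "pcoeff (E a b) i * pcoeff (E c d) (2 * n - i) = (if i = n then pcoeff (E a b) n * pcoeff (E c d) n else 0)"
     by (cases i n rule: linorder_cases) auto
   qed
   thus ?thesis by simp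
  qed
  thus ?thesis by (simp add: pf2_def E_def poly_tensor_props(4)[OF c])
 qed
 have coeffM: "F : Mp ==> pcoeff F m : Mv" for F m by (auto simp: Mp_def)
 \<comment> \<open>The Pfaffian omitting row 1 has degree at most \<open>2 n\<close> and equals
   \<open>-t g\<close> modulo \<open>Mv\<close>, so \<open>g\<close> has degree below
   \<open>2 n\<close> there.\<close>
 have g2n: "pcoeff g (2 * n) : Mv"
 proof -
  have "pcoeff (pf2 E E 0 2 3 4) (Suc (2 * n)) = 0" using dpf[of 0 2 3 4] by (intro coeff_eq_0) simp
  thus ?thesis using coeffM[OF pf0[of 2 3 4], of "Suc (2 * n)"] unfolding t[symmetric] g_def by simp
 qed
 have alt_pt: "alternating2 (point_tensor c w)" for w
 proof -
  have "point_tensor c w j i = - point_tensor c w i j" for i j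
   unfolding point_tensor_def minimalD(2)[OF c, of j i] mult_minus_left sum_negf by (rule refl)
  moreover have "point_tensor c w i i = 0" for i by (simp add: point_tensor_def minimalD(3)[OF c])
  ultimately show ?thesis unfolding alternating2_def by blast
 qed
 have allpf: "pf2 (point_tensor c w) (point_tensor c w) p q r s : Mv"
  if "!!q r. pf2 (point_tensor c w) (point_tensor c w) 0 1 q r : Mv" "pf2 (point_tensor c w) (point_tensor c w) 0 2 3 4 : Mv"
   "pf2 (point_tensor c w) (point_tensor c w) 1 2 3 4 : Mv" for w p q r s
 proof (rule pf2_induct_increasing[OF alt_pt, where Q = "%y. y : Mv"])
  fix a b e f :: 5 assume "a < b" "b < e" "e < f"
  thus "pf2 (point_tensor c w) (point_tensor c w) a b e f : Mv" using increasing_quadruples_5[of a b e f] that by auto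
 qed (auto intro: M_closed(6))
 show ?thesis
 \<comment> \<open>If this coefficient vanishes modulo \<open>Mv\<close>, the top coefficients of
   \<open>x\<close> are the wanted point. Otherwise \<open>g\<close> has a unit coefficient at
   \<open>2 n - 1\<close>, which is positive, and hence a root.\<close>
 proof (cases "pcoeff (pf2 E E 0 2 3 4) (2 * n) : Mv")
  case True
  have "pf2 (point_tensor c (%k. pcoeff (x k) n)) (point_tensor c (%k. pcoeff (x k) n)) p q r s : Mv" for p q r s
   using allpf[of "%k. pcoeff (x k) n" p q r s] True g2n coeffM[OF pf01, of _ _ "2 * n"]
   unfolding pfcoeff[symmetric] g_def by blast
  thus ?thesis using top xO by (intro exI[of _ "%k. pcoeff (x k) n"]) (auto simp: Op_def)
 next
  case False
  have n0: "n ~= 0"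
  proof
   assume "n = 0"
   thus False using False coeffM[OF pf0[of 2 3 4], of 0] unfolding t[symmetric] by simp
  qed
  then obtain m where m: "2 * n = Suc (Suc m)" by (metis mult_2 add_Suc_right not0_implies_Suc add_Suc)
  have "pcoeff (pf2 E E 0 2 3 4) (2 * n) + pcoeff g (Suc m) : Mv"
   using coeffM[OF pf0[of 2 3 4], of "2 * n"] unfolding t[symmetric] m g_def by simp
  hence "pcoeff g (Suc m) ~: Mv"
   using False M_closed(7)[of "pcoeff (pf2 E E 0 2 3 4) (2 * n) + pcoeff g (Suc m)" "pcoeff g (Suc m)"] by auto
  then obtain a where a: "a : Ov" "Polynomial.poly g a : Mv"
   using root_mod_M[of g "Suc m"] gO by (auto simp: Op_def)
  define w where "w = (%k. Polynomial.poly (x k) a)"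
  have pw: "pf2 (point_tensor c w) (point_tensor c w) p q r s = Polynomial.poly (pf2 E E p q r s) a" for p q r s
   by (simp add: pf2_def E_def poly_tensor_props(3)[OF c] w_def)
  have "Polynomial.poly (pf2 E E 0 2 3 4) a + a * Polynomial.poly g a : Mv"
   using poly_Op(2)[OF a(1) pf0[of 2 3 4]] by (simp add: g_def t_def)
  hence "Polynomial.poly (pf2 E E 0 2 3 4) a : Mv"
   using M_closed(7)[OF _ M_closed(4)[OF a]] by fastforce
  moreover have "Polynomial.poly (pf2 E E 0 1 q r) a : Mv" for q r by (rule poly_Op(2)[OF a(1) pf01])
  ultimately have "pf2 (point_tensor c w) (point_tensor c w) p q r s : Mv" for p q r s
   using allpf[of w p q r s] a(2) unfolding pw g_def by blast
  thus ?thesis using nonvanishing[OF a(1)] poly_Op(1)[OF a(1) xO] by (intro exI[of _ w]) (auto simp: w_def)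
 qed
qed

section \<open>Graded growth of quotients\<close>

lemma finite_mon_deg: "finite {m :: 5 \<Rightarrow>\<^sub>0 nat. mon_deg m = D}"
proof -
 let ?h = "%m :: 5 \<Rightarrow>\<^sub>0 nat. (\<lambda>i\<in>UNIV. coef m i)"
 have "?h ` {m. mon_deg m = D} \<subseteq> UNIV \<rightarrow>\<^sub>E {..D}"
  by (auto simp: mon_deg_sum intro!: member_le_sum)
 hence "finite (?h ` {m. mon_deg m = D})" by (rule finite_subset) (auto intro: finite_PiE)
 moreover have "inj_on ?h {m. mon_deg m = D}" by (auto simp: inj_on_def restrict_UNIV intro!: poly_mapping_eqI dest: fun_cong)
 ultimately show ?thesis by (rule finite_imageD)
qed

text \<open>The exponent of \<open>x_1\<close> is determined by the other four, and of these only
  that of \<open>x_0\<close> can grow with \<open>D\<close>.\<close>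

lemma card_bounded_monomials:
 "card {m :: 5 \<Rightarrow>\<^sub>0 nat. mon_deg m = D & coef m 2 < a & coef m 3 < b & coef m 4 < c} <= (D + 1) * (a * (b * c))"
proof -
 let ?A = "{m :: 5 \<Rightarrow>\<^sub>0 nat. mon_deg m = D & coef m 2 < a & coef m 3 < b & coef m 4 < c}"
 let ?h = "%m :: 5 \<Rightarrow>\<^sub>0 nat. (coef m 0, coef m 2, coef m 3, coef m 4)"
 have "inj_on ?h ?A"
 proof (rule inj_onI)
  fix m n assume mn: "m : ?A" "n : ?A" "?h m = ?h n"
  hence "coef m 1 = coef n 1" by (simp add: mon_deg_sum sum_5)
  hence "coef m i = coef n i" for i using mn(3) exhaust_5[of i] by auto
  thus "m = n" by (rule poly_mapping_eqI)
 qed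
 moreover have "?h ` ?A \<subseteq> {..D} \<times> {..<a} \<times> {..<b} \<times> {..<c}" by (auto simp: mon_deg_sum sum_5)
 ultimately have "card ?A <= card ({..D} \<times> {..<a} \<times> {..<b} \<times> {..<c})"
  by (intro card_inj_on_le[of ?h]) auto
 thus ?thesis by (simp add: card_cartesian_product)
qed

definition vars_in :: "5 set => 'a::comm_ring_1 pol5 set" where
 "vars_in V = {f. ALL m. coef f m ~= 0 --> (ALL u. u ~: V --> coef m u = 0)}"

lemma sub_ring_vars_in: "sub_ring (vars_in V :: 'a::comm_ring_1 pol5 set)"
proof -
 have "p * q : vars_in V" if "p : vars_in V" "q : vars_in V" for p q :: "'a pol5"
 proof -
  have "coef m u = 0" if m: "coef (p * q) m ~= 0" and "u ~: V" for m u
  proof -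
   have "m : supp (p * q)" using m by (simp add: in_keys_iff)
   then obtain a b where "a : supp p" "b : supp q" "m = a + b" using keys_mult by blast
   thus ?thesis using \<open>p : vars_in V\<close> \<open>q : vars_in V\<close> \<open>u ~: V\<close> by (auto simp: vars_in_def in_keys_iff lookup_add)
  qed
  thus ?thesis by (auto simp: vars_in_def)
 qed
 moreover have "p + q : vars_in V" if "p : vars_in V" "q : vars_in V" for p q :: "'a pol5"
  using that by (auto simp: vars_in_def lookup_add) (metis add_0)
 moreover have "(0 :: 'a pol5) : vars_in V" "(1 :: 'a pol5) : vars_in V" "!!p :: 'a pol5. p : vars_in V ==> - p : vars_in V"
  by (simp_all add: vars_in_def lookup_one when_def)
 ultimately show ?thesis unfolding sub_ring_def by simp
qed

lemma vars_in_single: "c = 0 \<or> (ALL u. u ~: V --> coef m u = 0) ==> sgl m c : vars_in V"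
 by (auto simp: vars_in_def lookup_single when_def)

lemma vars_in_gens: "mconst c : vars_in V" "i : V ==> mvar i : vars_in V"
 unfolding mconst_def mvar_def by (rule vars_in_single, auto simp: lookup_single when_def)+

lemma vars_in_mono: "V \<subseteq> W ==> f : vars_in V ==> f : vars_in W"
 by (auto simp: vars_in_def)

lemma vars_in_form_part: "f : vars_in V ==> form_part d f : vars_in V"
 by (auto simp: vars_in_def coef_form_part)

definition subst :: "'a::comm_ring_1 ^ 5 ^ 5 => 'a pol5 => 'a pol5" where
 "subst B = meval mconst (%j. SUM i:UNIV. mconst (B $ i $ j) * mvar i)"

lemma rhom_subst: "rhom (subst B)" unfolding subst_def by (rule rhom_meval(1)[OF rhom_mconst])

lemma subst_gens [simp]: "subst B (mconst c) = mconst c" "subst B (mvar j) = (SUM i:UNIV. mconst (B $ i $ j) * mvar i)"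
 by (simp_all add: subst_def rhom_mconst)

lemma subst_subst: "subst B (subst B' f) = subst (B ** B') f"
proof (rule rhom_eqI[where \<alpha> = "%f. subst B (subst B' f)"])
 show "rhom (%f. subst B (subst B' f))" by (simp add: rhom_def rhomD[OF rhom_subst])
 fix j
 have "subst B (subst B' (mvar j)) = (SUM i:UNIV. SUM k:UNIV. mconst (B' $ i $ j) * (mconst (B $ k $ i) * mvar k))"
  by (simp add: rhomD[OF rhom_subst] sum_distrib_left)
 also have "... = (SUM k:UNIV. SUM i:UNIV. mconst (B' $ i $ j) * (mconst (B $ k $ i) * mvar k))" by (rule sum.swap)
 also have "... = (SUM k:UNIV. mconst ((B ** B') $ k $ j) * mvar k)"
  by (simp add: matrix_matrix_mult_def rhomD[OF rhom_mconst] sum_distrib_left mult_ac)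
 finally show "subst B (subst B' (mvar j)) = subst (B ** B') (mvar j)" by simp
qed (simp_all add: rhom_subst)

lemma subst_1: "subst (mat 1) f = f"
proof -
 have "(SUM i:UNIV. mconst ((mat 1 :: 'a^5^5) $ i $ j) * mvar i) = (mvar j :: 'a pol5)" for j
 proof -
  have "mconst ((mat 1 :: 'a^5^5) $ i $ j) = (if i = j then 1 else (0 :: 'a pol5))" for i
   by (simp add: mat_def rhomD[OF rhom_mconst])
  thus ?thesis by (simp add: sum_delta_mult)
 qed
 thus ?thesis by (simp add: subst_def meval_id)
qed

lemma form_subst_mat: "form_of_degree d f ==> form_of_degree d (subst B f)"
 unfolding subst_def by (rule form_subst) (assumption, intro form_sum form_mconst_mult form_mvar)

definition lform :: "'a::comm_ring_1 tensor => 5 => 5 => 'a pol5" where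
 "lform c i j = (SUM k:UNIV. mconst (c i j k) * mvar k)"

lemma subst_lform: "subst B (lform c i j) = lform (col_act B c) i j"
proof -
 have "subst B (lform c i j) = (SUM l:UNIV. SUM k:UNIV. mconst (c i j l) * (mconst (B $ k $ l) * mvar k))"
  by (simp add: lform_def rhomD[OF rhom_subst] sum_distrib_left)
 also have "... = (SUM k:UNIV. SUM l:UNIV. mconst (c i j l) * (mconst (B $ k $ l) * mvar k))" by (rule sum.swap)
 also have "... = lform (col_act B c) i j"
  by (simp add: lform_def col_act_def rhomD[OF rhom_mconst] sum_distrib_left mult_ac)
 finally show ?thesis .
qed

abbreviation pfp :: "'a::comm_ring_1 tensor => 5 => 5 => 5 => 5 => 'a pol5" where
 "pfp c \<equiv> pf2 (lform c) (lform c)"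

lemma rhom_pf2: "rhom h ==> h (pf2 x y p q r s) = pf2 (%i j. h (x i j)) (%i j. h (y i j)) p q r s"
 by (simp add: pf2_def rhomD)

lemma subst_pfp: "subst B (pfp c p q r s) = pfp (col_act B c) p q r s"
 by (simp add: rhom_pf2[OF rhom_subst] subst_lform)

lemma pfp_row_act: "pfp (row_act A c) p q r s =
 (SUM a:UNIV. SUM b:UNIV. SUM d:UNIV. SUM e:UNIV. mconst (A $ p $ a) * mconst (A $ q $ b) * mconst (A $ r $ d) * mconst (A $ s $ e) * pfp c a b d e)"
proof (rule pf2_congruence[where A = "%i j. mconst (A $ i $ j)"]; -)
 have *: "lform (row_act A c) i j = (SUM a:UNIV. SUM b:UNIV. mconst (A $ i $ a) * mconst (A $ j $ b) * lform c a b)" for i j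
 proof -
  have "lform (row_act A c) i j = (SUM k:UNIV. SUM a:UNIV. SUM b:UNIV. mconst (A $ i $ a) * mconst (A $ j $ b) * (mconst (c a b k) * mvar k))"
   by (simp add: lform_def row_act_def rhomD[OF rhom_mconst] sum_distrib_left mult_ac)
  also have "... = (SUM a:UNIV. SUM b:UNIV. SUM k:UNIV. mconst (A $ i $ a) * mconst (A $ j $ b) * (mconst (c a b k) * mvar k))"
   by (rule sum_rotate_3)
  finally show ?thesis by (simp only: lform_def sum_distrib_left)
 qed
 show "lform (row_act A c) i j = (SUM a:UNIV. SUM b:UNIV. mconst (A $ i $ a) * mconst (A $ j $ b) * lform c a b)" for i j by (rule *)
 show "lform (row_act A c) i j = (SUM a:UNIV. SUM b:UNIV. mconst (A $ i $ a) * mconst (A $ j $ b) * lform c a b)" for i j by (rule *)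
qed

context dvr begin

lemma subst_S: "(!!i j. B $ i $ j : Ov) ==> f : S ==> subst B f : S"
 unfolding subst_def by (rule meval_in[OF sub_ring_O sub_ring_S rhom_mconst]) (auto intro!: S_closed(8,5) S_gens)

lemma subst_N: "(!!i j. B $ i $ j : Ov) ==> f : N ==> subst B f : N"
 using subst_S[of B] unfolding N_iff by (auto simp: rhomD[OF rhom_subst])

text \<open>A substitute for the projective zero set of \<open>P\<close> having dimension at most
  one. The denominator \<open>s\<close> may depend on \<open>d\<close> and makes the notion
  accessible through a birational projection. Generators are indexed by numbers below
  \<open>C (d + 1)\<close>, so that a shorter list is padded.\<close>

definition bounded_growth :: "'a pol5 set => bool" where
 "bounded_growth P \<longleftrightarrow> (EX C. ALL d. EX s G. s : S & s ~: P & (ALL i. G i : S) &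
  (ALL f:S. form_of_degree d f --> (EX g. (ALL i. g i : Ov) & s * f - (SUM i<C * (d + 1). mconst (g i) * G i) : P)))"

lemma bounded_growthI:
 assumes "!!d. EX s G. s : S & s ~: P & finite G & G \<subseteq> S & card G <= C * (d + 1) &
  (ALL f:S. form_of_degree d f --> (EX g. (ALL e:G. g e : Ov) & s * f - (SUM e:G. mconst (g e) * e) : P))"
 shows "bounded_growth P"
 unfolding bounded_growth_def
proof (rule exI[of _ C], rule allI)
 fix d
 obtain s G where s: "s : S" "s ~: P" and G: "finite G" "G \<subseteq> S" "card G <= C * (d + 1)" and
  sp: "!!f. f : S ==> form_of_degree d f ==> EX g. (ALL e:G. g e : Ov) & s * f - (SUM e:G. mconst (g e) * e) : P"
  using assms[of d] by blast
 obtain h where h: "bij_betw h {..<card G} G" using ex_bij_betw_nat_finite[OF G(1)] by (auto simp: atLeast0LessThan)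
 define G' where "G' i = (if i < card G then h i else 0)" for i
 have "EX g. (ALL i. g i : Ov) & s * f - (SUM i<C * (d + 1). mconst (g i) * G' i) : P" if f: "f : S" "form_of_degree d f" for f
 proof -
  obtain g where g: "ALL e:G. g e : Ov" "s * f - (SUM e:G. mconst (g e) * e) : P" using sp[OF f] by auto
  define g' where "g' i = (if i < card G then g (h i) else 0)" for i
  have "(SUM i<C * (d + 1). mconst (g' i) * G' i) = (SUM i<card G. mconst (g (h i)) * h i)"
   using G(3) by (intro sum.mono_neutral_cong_right) (auto simp: G'_def g'_def)
  also have "... = (SUM e:G. mconst (g e) * e)" by (rule sum.reindex_bij_betw[OF h])
  finally show ?thesis using g h by (intro exI[of _ g']) (auto simp: g'_def O_closed(1) bij_betw_def)
 qed
 moreover have "G' i : S" for i using h G(2) S_closed(1) by (auto simp: G'_def bij_betw_def)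
 ultimately show "EX s G. s : S & s ~: P & (ALL i. G i : S) &
  (ALL f:S. form_of_degree d f --> (EX g. (ALL i. g i : Ov) & s * f - (SUM i<C * (d + 1). mconst (g i) * G i) : P))"
  using s by blast
qed

text \<open>There are \<open>(m + 1)^2\<close> forms of degree \<open>D m\<close>, but only
  \<open>C (D m + 1)\<close> generators. For large \<open>m\<close> the coordinate vectors are
  dependent, and \<open>exact_relation\<close> provides a dependence with a coefficient 1.\<close>

lemma bounded_growth_relation:
 assumes P: "is_prime S P" and b: "bounded_growth P"
  and h: "!!m a b. h m a b : S" "!!m a b. a <= m ==> b <= m ==> form_of_degree (D * m) (h m a b)"
 shows "EX m c. (ALL a b. c a b : Ov) & (EX a<=m. EX b<=m. c a b = 1) & (SUM a<=m. SUM b<=m. mconst (c a b) * h m a b) : P"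
proof -
 obtain C where C: "ALL d. EX s G. s : S & s ~: P & (ALL i. G i : S) &
  (ALL f:S. form_of_degree d f --> (EX g. (ALL i. g i : Ov) & s * f - (SUM i<C * (d + 1). mconst (g i) * G i) : P))"
  using b unfolding bounded_growth_def by blast
 \<comment> \<open>With this choice
   \<open>C (D m + 1) <= C (D + 1) (m + 1) = m (m + 1) < (m + 1)^2\<close>.\<close>
 define m where "m = C * (D + 1)"
 obtain s G where s: "s : S" "s ~: P" and G: "!!i. G i : S" and
  sp: "!!f. f : S ==> form_of_degree (D * m) f ==> EX g. (ALL i. g i : Ov) & s * f - (SUM i<C * (D * m + 1). mconst (g i) * G i) : P"
  using C[rule_format, of "D * m"] by blast
 let ?I = "{..m} \<times> {..m}" and ?n = "C * (D * m + 1)"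
 have "EX g. (ALL i. g i : Ov) & s * h m (fst ab) (snd ab) - (SUM i<?n. mconst (g i) * G i) : P" if "ab : ?I" for ab
  using that h by (intro sp) auto
 hence "ALL ab:?I. EX g. (ALL i. g i : Ov) & s * h m (fst ab) (snd ab) - (SUM i<?n. mconst (g i) * G i) : P" by blast
 from bchoice[OF this] obtain g where "ALL ab:?I. (ALL i. g ab i : Ov) & s * h m (fst ab) (snd ab) - (SUM i<?n. mconst (g ab i) * G i) : P" ..
 hence g: "!!ab i. ab : ?I ==> g ab i : Ov"
  "!!ab. ab : ?I ==> s * h m (fst ab) (snd ab) - (SUM i<?n. mconst (g ab i) * G i) : P" by blast+
 have "?n <= C * ((D + 1) * (m + 1))" by (intro mult_left_mono) (auto simp: algebra_simps)
 also have "... = m * (m + 1)" by (simp only: m_def mult.assoc)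
 also have "... < card ?I" by (simp add: card_cartesian_product)
 finally obtain c where c: "ALL i:?I. c i : Ov" "EX i:?I. c i = 1" "ALL e:{..<?n}. (SUM i:?I. c i * g i e) = 0"
  using exact_relation[of "{..<?n}" ?I g] by auto
 note d = is_idealD[OF sub_ring_S is_primeD(1)[OF P]]
 let ?h = "SUM i:?I. mconst (c i) * h m (fst i) (snd i)"
 have "(SUM i:?I. mconst (c i) * (s * h m (fst i) (snd i) - (SUM e<?n. mconst (g i e) * G e))) : P"
  using c(1) g(2) by (intro d(8) d(4)) auto
 also have "(SUM i:?I. mconst (c i) * (s * h m (fst i) (snd i) - (SUM e<?n. mconst (g i e) * G e))) =
   s * ?h - (SUM i:?I. SUM e<?n. mconst (c i * g i e) * G e)"
  by (simp add: right_diff_distrib sum_subtractf sum_distrib_left mult_ac rhomD[OF rhom_mconst])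
 also have "(SUM i:?I. SUM e<?n. mconst (c i * g i e) * G e) = (SUM e<?n. mconst (SUM i:?I. c i * g i e) * G e)"
  by (subst sum.swap) (simp add: rhomD[OF rhom_mconst] sum_distrib_right)
 also have "... = 0" using c(3) by (simp add: rhomD[OF rhom_mconst])
 finally have "s * ?h : P" by simp
 moreover have "?h : S" using c(1) h(1) by (intro S_closed(8,5)) auto
 ultimately have hP: "?h : P" using is_primeD(3)[OF P s(1)] s(2) by blast
 define c' where "c' a b = (if a <= m & b <= m then c (a, b) else 0)" for a b
 have "?h = (SUM a<=m. SUM b<=m. mconst (c' a b) * h m a b)"
  unfolding sum.cartesian_product by (intro sum.cong) (auto simp: c'_def)
 moreover have "ALL a b. c' a b : Ov" "EX a<=m. EX b<=m. c' a b = 1" using c(1,2) O_closed(1) by (auto simp: c'_def)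
 ultimately show ?thesis using hP by (intro exI[of _ m] exI[of _ c']) simp
qed

text \<open>The order in which the variables are eliminated.\<close>

definition above :: "5 => 5 => bool" where
 "above w u \<longleftrightarrow> w = 2 & u = 3 \<or> w = 2 & u = 4 \<or> w = 3 & u = 4"

text \<open>Since the variables \<open>above w\<close> are absent, reducing a power of
  \<open>x_w\<close> by such a form leaves their exponents alone and lowers that of
  \<open>x_w\<close>: the exponents of \<open>x_4, x_3, x_2\<close> decrease
  lexicographically.\<close>

definition monic_in :: "5 set => 5 => nat => 'a pol5 => bool" where
 "monic_in V w e f \<longleftrightarrow> f : S & f : vars_in V & form_of_degree e f & coef f (sgl w e) = 1 &
  (ALL m. coef f m ~= 0 --> m ~= sgl w e --> coef m w < e & (ALL u. above w u --> coef m u = 0))"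

definition spanned :: "'a pol5 set => (5 \<Rightarrow>\<^sub>0 nat) set => 'a pol5 set" where
 "spanned J B = {f. EX g. (ALL m. g m : Ov) & f - (SUM m:B. mconst (g m) * mnm m) : J}"

lemma spanned_closed:
 assumes J: "is_ideal S J"
 shows "f : J ==> f : spanned J B" "f : spanned J B ==> f' : spanned J B ==> f + f' : spanned J B"
  "a : Ov ==> f : spanned J B ==> mconst a * f : spanned J B" "finite B ==> m : B ==> mnm m : spanned J B"
  "(!!i. i : I ==> F i : spanned J B) ==> sum F I : spanned J B"
proof -
 note d = is_idealD[OF sub_ring_S J] and hc = rhomD[OF rhom_mconst]
 show J0: "f : J ==> f : spanned J B" for f
  unfolding spanned_def by (auto intro!: exI[of _ "%_. 0"] simp: O_closed(1) hc)
 show add: "f : spanned J B ==> f' : spanned J B ==> f + f' : spanned J B" for f f'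
 proof -
  assume "f : spanned J B" "f' : spanned J B"
  then obtain g g' where g: "ALL m. g m : Ov" "ALL m. g' m : Ov"
   "f - (SUM m:B. mconst (g m) * mnm m) : J" "f' - (SUM m:B. mconst (g' m) * mnm m) : J" by (auto simp: spanned_def)
  have e: "f + f' - (SUM m:B. mconst (g m + g' m) * mnm m) = f - (SUM m:B. mconst (g m) * mnm m) + (f' - (SUM m:B. mconst (g' m) * mnm m))"
   by (simp add: hc distrib_right sum.distrib)
  have "f + f' - (SUM m:B. mconst (g m + g' m) * mnm m) : J" unfolding e by (rule d(3)[OF g(3,4)])
  thus ?thesis using g(1,2) O_closed(4) unfolding spanned_def by (intro CollectI exI[of _ "%m. g m + g' m"]) auto
 qed
 show "a : Ov ==> f : spanned J B ==> mconst a * f : spanned J B"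
 proof -
  assume a: "a : Ov" and "f : spanned J B"
  then obtain g where g: "ALL m. g m : Ov" "f - (SUM m:B. mconst (g m) * mnm m) : J" by (auto simp: spanned_def)
  have "mconst a * f - (SUM m:B. mconst (a * g m) * mnm m) = mconst a * (f - (SUM m:B. mconst (g m) * mnm m))"
   by (simp add: hc right_diff_distrib sum_distrib_left mult.assoc)
  hence "mconst a * f - (SUM m:B. mconst (a * g m) * mnm m) : J" using d(4)[OF _ g(2), of "mconst a"] a by simp
  thus ?thesis using g(1) a O_closed(5) unfolding spanned_def by (intro CollectI exI[of _ "%m. a * g m"]) auto
 qed
 show "finite B ==> m : B ==> mnm m : spanned J B"
 proof -
  assume B: "finite B" "m : B"
  have "(SUM k:B. mconst (if k = m then 1 else 0) * mnm k) = (SUM k:B. if k = m then mnm m else (0 :: 'a pol5))"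
   by (intro sum.cong) (auto simp: hc)
  hence "mnm m - (SUM k:B. mconst (if k = m then 1 else 0) * mnm k) : J" using B d(2) by simp
  thus ?thesis unfolding spanned_def using O_closed(1,2) by (intro CollectI exI[of _ "%k. if k = m then 1 else 0"]) auto
 qed
 show "(!!i. i : I ==> F i : spanned J B) ==> sum F I : spanned J B"
  by (induction I rule: infinite_finite_induct) (simp_all add: add J0[OF d(2)])
qed

text \<open>Division with remainder: modulo \<open>F v\<close>, a monomial divisible by the
  \<open>e v\<close>-th power of \<open>x_v\<close> is a combination of lexicographically smaller
  monomials of the same degree.\<close>

lemma form_spanned:
 assumes J: "is_ideal S J" and U: "U \<subseteq> {2, 3, 4}" "U \<subseteq> V" and F: "!!v. v : U ==> F v : J & monic_in V v (e v) (F v)"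
  and f: "f : S" "f : vars_in V" "form_of_degree D f"
 shows "f : spanned J {m. mon_deg m = D & (ALL u. u ~: V --> coef m u = 0) & (ALL v:U. coef m v < e v)}" (is "f : spanned J ?B")
proof -
 note d = is_idealD[OF sub_ring_S J] and sp = spanned_closed[OF J, where B = ?B]
 have fin: "finite ?B" by (rule finite_subset[OF _ finite_mon_deg[of D]]) auto
 have lex: "wf (less_than <*lex*> less_than <*lex*> less_than)" by (intro wf_lex_prod wf_less_than)
 have "mon_deg m = D ==> (ALL u. u ~: V --> coef m u = 0) ==> mnm m : spanned J ?B" for m
 proof (induction "(coef m 4, coef m 3, coef m 2)" arbitrary: m rule: wf_induct_rule[OF lex])
  case (1 m)
  show ?case
  proof (cases "ALL v:U. coef m v < e v")
   case True thus ?thesis using 1 fin by (intro sp(4)) auto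
  next
   case False
   then obtain v where v: "v : U" "e v <= coef m v" by (auto simp: not_less)
   let ?s = "sgl v (e v)"
   define m' where "m' = m - ?s"
   have m: "m = m' + ?s" by (rule poly_mapping_eqI) (use v in \<open>auto simp: m'_def lookup_add lookup_minus lookup_single when_def\<close>)
   have mo: "monic_in V v (e v) (F v)" "F v : J" using F v by auto
   let ?K = "supp (F v)"
   have sK: "?s : ?K" using mo(1) by (auto simp: monic_in_def in_keys_iff)
   have Fe: "F v = mnm ?s + (SUM k:?K - {?s}. sgl k (coef (F v) k))"
    by (subst poly_sum_single[of "F v"], subst sum.remove[OF _ sK]) (use mo(1) in \<open>auto simp: monic_in_def\<close>)
   have "mnm m' * F v = mnm m' * (mnm ?s + (SUM k:?K - {?s}. sgl k (coef (F v) k)))"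
    by (rule arg_cong[OF Fe])
   also have "... = mnm m + (SUM k:?K - {?s}. mconst (coef (F v) k) * mnm (m' + k))"
    by (simp add: m distrib_left sum_distrib_left mult_single mconst_def)
   finally have e: "mnm m' * F v = mnm m + (SUM k:?K - {?s}. mconst (coef (F v) k) * mnm (m' + k))" .
   moreover have "mnm m' * F v : spanned J ?B" by (intro sp(1) d(4) S_gens mo(2))
   moreover have "(SUM k:?K - {?s}. mconst (- coef (F v) k) * mnm (m' + k)) : spanned J ?B"
   proof (intro sp(5) sp(3))
    fix k assume k: "k : ?K - {?s}"
    show "- coef (F v) k : Ov" using mo(1) by (auto simp: monic_in_def mpols_over_def intro: O_closed(3))
    have kp: "coef k v < e v" "!!u. above v u ==> coef k u = 0" "mon_deg k = e v" "!!u. u ~: V ==> coef k u = 0"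
     using mo(1) k by (auto simp: monic_in_def in_keys_iff form_of_degree_def vars_in_def)
    have ab: "coef ?s u = 0" if "above v u" for u using that by (auto simp: above_def lookup_single when_def)
    have "((coef (m' + k) 4, coef (m' + k) 3, coef (m' + k) 2), (coef m 4, coef m 3, coef m 2)) : less_than <*lex*> less_than <*lex*> less_than"
    proof -
     have "v = 2 \<or> v = 3 \<or> v = 4" using U(1) v(1) by auto
     thus ?thesis using kp(1) kp(2)[of 3] kp(2)[of 4] unfolding m by (auto simp: lookup_add above_def lookup_single when_def)
    qed
    thus "mnm (m' + k) : spanned J ?B"
     using 1(2,3) kp(3,4) v U(2) by (intro 1(1)) (auto simp: m lookup_add)
   qed
   ultimately have "mnm m' * F v + (SUM k:?K - {?s}. mconst (- coef (F v) k) * mnm (m' + k)) : spanned J ?B" by (intro sp(2))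
   thus ?thesis unfolding e by (simp add: rhomD[OF rhom_mconst] sum_negf)
  qed
 qed
 hence "(SUM m:supp f. mconst (coef f m) * mnm m) : spanned J ?B"
  using f by (intro sp(5) sp(3)) (auto simp: mpols_over_def form_of_degree_def vars_in_def in_keys_iff)
 moreover have "(SUM m:supp f. mconst (coef f m) * mnm m) = f"
  using poly_sum_single[of f] by (simp add: mconst_def mult_single)
 ultimately show ?thesis by simp
qed

text \<open>Because \<open>s x_2 = -t\<close> modulo \<open>P\<close>, multiplication by
  \<open>s^d\<close> turns a form of degree \<open>d\<close> into one of degree
  \<open>d (k + 1)\<close> without \<open>x_2\<close>. There \<open>G\<close> bounds the exponent of
  \<open>x_3\<close> and \<open>A\<close> that of \<open>x_4\<close>.\<close>

lemma bounded_growth_birational: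
 assumes P: "is_prime S P" and G: "G : P" "monic_in {0, 1, 3, 4} 3 a G" and A: "A : P" "monic_in {0, 1, 3, 4} 4 b A"
  and s: "s : S" "s ~: P" "s : vars_in {0, 1, 3, 4}" "form_of_degree k s"
  and t: "t : S" "t : vars_in {0, 1, 3, 4}" "form_of_degree (Suc k) t" and st: "s * mvar 2 + t : P"
 shows "bounded_growth P"
proof (rule bounded_growthI[where C = "(k + 1) * (a * b)"])
 fix d
 note iP = is_primeD(1)[OF P]
 note dd = is_idealD[OF sub_ring_S iP]
 let ?V = "{0, 1, 3, 4 :: 5}" and ?e = "%v::5. if v = 3 then a else b"
 let ?D = "d * (k + 1)"
 let ?B = "{m :: 5 \<Rightarrow>\<^sub>0 nat. mon_deg m = ?D & (ALL u. u ~: ?V --> coef m u = 0) & (ALL v:{3, 4}. coef m v < ?e v)}"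
 have red: "f : spanned P ?B" if "f : S" "f : vars_in ?V" "form_of_degree ?D f" for f
  by (rule form_spanned[OF iP, where F = "%v. if v = 3 then G else A"]) (use that G A in auto)
 have sub: "?B \<subseteq> {m. mon_deg m = ?D & coef m 2 < 1 & coef m 3 < a & coef m 4 < b}" by auto
 have fin: "finite ?B" by (rule finite_subset[OF _ finite_mon_deg[of ?D]]) auto
 have "card ?B <= (?D + 1) * (1 * (a * b))"
  using card_mono[OF finite_subset[OF _ finite_mon_deg[of ?D]] sub] card_bounded_monomials[of ?D 1 a b] by (fastforce simp: finite_mon_deg)
 also have "... <= (k + 1) * (a * b) * (d + 1)" by (simp add: algebra_simps)
 finally have cB: "card ?B <= (k + 1) * (a * b) * (d + 1)" .
 have sdP: "s ^ d ~: P" using is_prime_power[OF sub_ring_S P s(1)] s(2) by blast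
 note vi = sub_ringD[OF sub_ring_vars_in[of ?V]]
 \<comment> \<open>Each factor \<open>x_2\<close> absorbs one \<open>s\<close> and becomes
   \<open>-t\<close>, of degree \<open>k + 1\<close>; each other variable keeps an \<open>s\<close>
   beside it, again of total degree \<open>k + 1\<close>.\<close>
 have mon: "s ^ d * mnm m : spanned P ?B" if m: "mon_deg m = d" for m
 proof -
  let ?i = "coef m 2"
  define m' where "m' = m - sgl 2 ?i"
  have mm: "m = m' + sgl 2 ?i"
   by (rule poly_mapping_eqI) (auto simp: m'_def lookup_add lookup_minus lookup_single when_def)
  have m'2: "coef m' 2 = 0" by (simp add: m'_def lookup_minus)
  have deg: "mon_deg m' + ?i = d" using m by (subst (asm) mm) simp
  have x2: "mnm (sgl 2 ?i) = (mvar 2 ^ ?i :: 'a pol5)" by (simp add: mono_eq_mval mval_single)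
  have "mnm m = mnm m' * (mvar 2 ^ ?i :: 'a pol5)"
   unfolding x2[symmetric] mult_single using mm by simp
  hence e1: "s ^ d * mnm m = (s ^ mon_deg m' * mnm m') * (s * mvar 2) ^ ?i"
   by (simp add: power_mult_distrib deg[symmetric] power_add mult_ac)
  have pw: "(s * mvar 2) ^ i - (- t) ^ i : P" for i
  proof (induction i)
   case (Suc i)
   have "(s * mvar 2) ^ Suc i - (- t) ^ Suc i = (s * mvar 2) * ((s * mvar 2) ^ i - (- t) ^ i) + (s * mvar 2 + t) * (- t) ^ i"
    by (simp add: algebra_simps)
   thus ?case using Suc st s(1) t(1) by (metis dd(3,4,5) S_closed(3,5,7) S_gens(2))
  qed (simp add: dd(2))
  let ?h = "(s ^ mon_deg m' * mnm m') * (- t) ^ ?i"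
  have hS: "s ^ mon_deg m' * mnm m' : S" using s(1) by (intro S_closed(5,7) S_gens)
  have "s ^ d * mnm m - ?h = (s ^ mon_deg m' * mnm m') * ((s * mvar 2) ^ ?i - (- t) ^ ?i)" by (simp only: e1 right_diff_distrib)
  hence "s ^ d * mnm m - ?h : P" using dd(4)[OF hS pw] by simp
  moreover have "?h : spanned P ?B"
  proof (rule red)
   show "?h : S" by (intro S_closed(5)[OF hS] S_closed(7,3) t(1))
   have "coef m' u = 0" if "u ~: ?V" for u using that exhaust_5[of u] m'2 by auto
   hence "mnm m' : vars_in ?V" by (intro vars_in_single) auto
   thus "?h : vars_in ?V" using s(3) t(2) by (intro vi(5,7,3))
   have "form_of_degree (mon_deg m' * k + mon_deg m' + ?i * Suc k) ?h"
    using s(4) t(3) by (intro form_mult form_power form_uminus) (simp_all add: form_single)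
   moreover have "mon_deg m' * k + mon_deg m' + ?i * Suc k = ?D" unfolding deg[symmetric] by (simp add: algebra_simps)
   ultimately show "form_of_degree ?D ?h" by simp
  qed
  ultimately show ?thesis using spanned_closed(2)[OF iP, of ?h ?B "s ^ d * mnm m - ?h"] spanned_closed(1)[OF iP] by simp
 qed
 have main: "s ^ d * f : spanned P ?B" if f: "f : S" "form_of_degree d f" for f
 proof -
  have "s ^ d * f = (SUM m:supp f. mconst (coef f m) * (s ^ d * mnm m))"
   by (subst poly_sum_single[of f]) (simp add: sum_distrib_left mconst_def mult_single mult.left_commute flip: mult_single[of 0 _ _ 1, simplified])
  also have "... : spanned P ?B"
   using f by (intro spanned_closed(5,3)[OF iP] mon) (auto simp: mpols_over_def form_of_degree_def)
  finally show ?thesis .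
 qed
 let ?G = "(mnm ` ?B :: 'a pol5 set)"
 have inj: "inj_on (mnm :: _ => 'a pol5) ?B"
 proof (rule inj_onI)
  fix x y :: "5 \<Rightarrow>\<^sub>0 nat" assume "(mnm x :: 'a pol5) = mnm y"
  hence "coef (mnm x :: 'a pol5) y = coef (mnm y :: 'a pol5) y" by simp
  thus "x = y" by (auto simp: lookup_single when_def split: if_splits)
 qed
 have "EX g. (ALL e:?G. g e : Ov) & s ^ d * f - (SUM e:?G. mconst (g e) * e) : P" if f: "f : S" "form_of_degree d f" for f
 proof -
  obtain g where g: "ALL m. g m : Ov" "s ^ d * f - (SUM m:?B. mconst (g m) * mnm m) : P" using main[OF f] unfolding spanned_def by blast
  let ?g = "%e :: 'a pol5. g (the_inv_into ?B mnm e)"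
  have "(SUM e:?G. mconst (?g e) * e) = (SUM m:?B. mconst (g m) * mnm m)"
   unfolding sum.reindex[OF inj] o_def
  proof (intro sum.cong refl)
   fix m assume "m : ?B"
   hence "the_inv_into ?B mnm (mnm m :: 'a pol5) = m" by (rule the_inv_into_f_f[OF inj])
   thus "mconst (?g (mnm m)) * mnm m = mconst (g m) * (mnm m :: 'a pol5)" by (simp only:)
  qed
  hence "s ^ d * f - (SUM e:?G. mconst (?g e) * e) : P" using g(2) by (simp only:)
  thus ?thesis by (intro exI[of _ ?g] conjI ballI g(1)[rule_format])
 qed
 moreover have "card ?G <= (k + 1) * (a * b) * (d + 1)" using cB card_image_le[OF fin, of mnm] by (rule order.trans[rotated])
 moreover have "?G \<subseteq> S" using S_gens(1) by (rule image_subsetI)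
 ultimately show "EX s G. s : S & s ~: P & finite G & G \<subseteq> S & card G <= (k + 1) * (a * b) * (d + 1) &
  (ALL f:S. form_of_degree d f --> (EX g. (ALL e:G. g e : Ov) & s * f - (SUM e:G. mconst (g e) * e) : P))"
  by (intro exI[of _ "s ^ d"] exI[of _ ?G] conjI S_closed(7)[OF s(1)] sdP finite_imageI[OF fin] ballI impI)
qed

end

section \<open>The special fibre has dimension at most one\<close>

lemma form_lform: "form_of_degree 1 (lform c i j)" unfolding lform_def by (intro form_sum form_mconst_mult form_mvar)

lemma form_pfp: "form_of_degree 2 (pfp c p q r s)"
proof -
 have "form_of_degree 2 (lform c i j * lform c k l)" for i j k l using form_mult[OF form_lform form_lform] by (simp add: numeral_2_eq_2)
 thus ?thesis unfolding pf2_def by (intro form_add form_diff)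
qed

context dvr begin

lemma lform_S: "minimal_tensor c ==> lform c i j : S" unfolding lform_def by (intro S_closed(8,5) S_gens) (simp add: minimalD(1))

lemma pfp_S: "minimal_tensor c ==> pfp c p q r s : S" unfolding pf2_def by (intro S_closed(4,5,6) lform_S)

text \<open>The prime of a component of the special fibre of dimension at least two:
  \<open>N \<subseteq> P\<close> places it on the special fibre, and the failure of
  \<open>bounded_growth\<close> expresses its dimension.\<close>

definition big_prime :: "'a tensor => 'a pol5 set => bool" where
 "big_prime c P \<longleftrightarrow> minimal_tensor c & is_prime S P & N \<subseteq> P & \<not> bounded_growth P & (ALL p q r s. pfp c p q r s : P)"

definition pull :: "'a ^ 5 ^ 5 => 'a pol5 set => 'a pol5 set" where "pull B P = {f : S. subst B f : P}"

lemma big_prime_row: assumes "big_prime c P" "GLO A" shows "big_prime (row_act A c) P"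
proof -
 have "is_ideal S P" using assms(1) by (auto simp: big_prime_def is_prime_def)
 hence "pfp (row_act A c) p q r s : P" for p q r s
  unfolding pfp_row_act using assms by (intro is_idealD(8,4)[OF sub_ring_S] S_closed(5)) (auto simp: big_prime_def GLO_def)
 thus ?thesis using assms minimal_row_act[of c A] by (auto simp: big_prime_def)
qed

lemma big_prime_col:
 assumes b: "big_prime c P" and B: "GLO B" "GLO B'" "B ** B' = mat 1" "B' ** B = mat 1"
 shows "big_prime (col_act B' c) (pull B P)"
proof -
 have P: "is_prime S P" "N \<subseteq> P" "\<not> bounded_growth P" "minimal_tensor c" "!!p q r s. pfp c p q r s : P" using b by (auto simp: big_prime_def)
 note d = is_idealD[OF sub_ring_S is_primeD(1)[OF P(1)]] and h = rhomD[OF rhom_subst[of B]]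
 have BS: "f : S ==> subst B f : S" "f : S ==> subst B' f : S" for f using B by (auto simp: GLO_def intro: subst_S)
 have inv: "subst B (subst B' f) = f" for f by (simp add: subst_subst B(3) subst_1)
 have pr: "is_prime S (pull B P)"
  unfolding is_prime_def pull_def
  using BS S_closed is_primeD(2,3)[OF P(1)] by (auto simp: h intro!: is_idealI d(3,4) d(2))
 have "N \<subseteq> pull B P" using P(2) subst_N[of B] B(1) N_closed(1) by (auto simp: pull_def GLO_def)
 moreover have "\<not> bounded_growth (pull B P)"
 proof
  assume "bounded_growth (pull B P)"
  then obtain C where C: "!!d. EX s G. s : S & s ~: pull B P & (ALL i. G i : S) &
   (ALL f:S. form_of_degree d f --> (EX g. (ALL i. g i : Ov) & s * f - (SUM i<C * (d + 1). mconst (g i) * G i) : pull B P))"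
   unfolding bounded_growth_def by blast
  have "bounded_growth P" unfolding bounded_growth_def
  proof (rule exI[of _ C], rule allI)
   fix d
   obtain s G where s: "s : S" "s ~: pull B P" "!!i. G i : S" and
    sp: "!!f. f : S ==> form_of_degree d f ==> EX g. (ALL i. g i : Ov) & s * f - (SUM i<C * (d + 1). mconst (g i) * G i) : pull B P"
    using C[of d] by blast
   have "EX g. (ALL i. g i : Ov) & subst B s * f - (SUM i<C * (d + 1). mconst (g i) * subst B (G i)) : P" if f: "f : S" "form_of_degree d f" for f
   proof -
    obtain g where g: "ALL i. g i : Ov" "s * subst B' f - (SUM i<C * (d + 1). mconst (g i) * G i) : pull B P"
     using sp[OF BS(2)[OF f(1)] form_subst_mat[OF f(2)]] by blast
    have "subst B (s * subst B' f - (SUM i<C * (d + 1). mconst (g i) * G i)) : P" using g(2) by (simp add: pull_def)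
    thus ?thesis using g(1) by (intro exI[of _ g]) (simp add: h inv)
   qed
   thus "EX s G. s : S & s ~: P & (ALL i. G i : S) &
    (ALL f:S. form_of_degree d f --> (EX g. (ALL i. g i : Ov) & s * f - (SUM i<C * (d + 1). mconst (g i) * G i) : P))"
    using s BS(1) by (intro exI[of _ "subst B s"] exI[of _ "%i. subst B (G i)"]) (simp add: pull_def)
  qed
  thus False using P(3) by simp
 qed
 moreover have "pfp (col_act B' c) p q r s : pull B P" for p q r s
  using P(5) BS(2)[OF pfp_S[OF P(4)]] inv by (simp add: pull_def subst_pfp[symmetric])
 ultimately show ?thesis using pr minimal_col_act[OF P(4) GLO_1 B(2)] by (simp add: big_prime_def)
qed

text \<open>At the \<open>r\<close>-th coordinate point every monomial other than a pure power of
  \<open>x_r\<close> vanishes.\<close>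

lemma coef_top:
 fixes f :: "'a pol5"
 assumes "form_of_degree d f"
 shows "coef f (sgl r d) = meval (%a. a) (%i. if i = r then 1 else 0) f"
proof -
 let ?z = "%i::5. if i = r then 1 else (0::'a)"
 have mz: "mval ?z m = (if m = sgl r d then 1 else 0)" if "m : supp f" for m
 proof (cases "m = sgl r d")
  case True thus ?thesis by (simp add: mval_single)
 next
  case False
  have "EX i. i ~= r & coef m i ~= 0"
  proof (rule ccontr)
   assume "\<not> ?thesis"
   hence m: "m = sgl r (coef m r)" by (intro poly_mapping_eqI) (auto simp: lookup_single when_def)
   have "mon_deg m = d" using assms that by (auto simp: form_of_degree_def)
   hence "coef m r = d" by (subst (asm) m) simp
   thus False using m False by simp
  qed
  then obtain i where "i ~= r" "coef m i ~= 0" by blast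
  hence "mval ?z m = 0" unfolding mval_def by (intro prod_zero) (auto intro!: bexI[of _ i])
  thus ?thesis using False by simp
 qed
 have "meval (%a. a) ?z f = (SUM m:supp f. coef f m * mval ?z m)" by (rule meval_alt) auto
 also have "... = (SUM m:supp f. if m = sgl r d then coef f m else 0)"
  using mz by (intro sum.cong) auto
 finally show ?thesis by (auto simp: in_keys_iff)
qed

lemma meval_subst_vec_mat:
 fixes f :: "'a pol5"
 shows "meval (%a. a) z (subst (vec_mat r w) f) = meval (%a. a) (%j. z r * w j + (if j = r then 0 else z j)) f"
proof -
 have id: "rhom (%a::'a. a)" by (simp add: rhom_def)
 have "meval (%a. a) z (SUM i:UNIV. mconst (vec_mat r w $ i $ j) * mvar i) = z r * w j + (if j = r then 0 else z j)" for j
 proof -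
  have "meval (%a. a) z (SUM i:UNIV. mconst (vec_mat r w $ i $ j) * mvar i) = (SUM i:UNIV. vec_mat r w $ i $ j * z i)"
   by (simp add: rhomD[OF rhom_meval(1)[OF id]] id)
  also have "... = w j * z r + (SUM i:UNIV - {r}. vec_mat r w $ i $ j * z i)"
   by (subst sum.remove[of _ r]) (simp_all add: vec_mat_def)
  also have "(SUM i:UNIV - {r}. vec_mat r w $ i $ j * z i) = (SUM i:UNIV - {r}. if i = j then z j else 0)"
   by (intro sum.cong refl) (auto simp: vec_mat_def)
  finally show ?thesis by (simp add: mult.commute)
 qed
 thus ?thesis unfolding subst_def meval_meval[OF id] by simp
qed

text \<open>On points, the substitution maps the \<open>r\<close>-th coordinate point to
  \<open>w\<close> and fixes the other coordinate points. Making a form monic in \<open>x_r\<close>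
  therefore does not disturb leading coefficients already obtained in other variables.\<close>

lemma subst_vec_mat_top:
 fixes f :: "'a pol5"
 assumes "form_of_degree d f"
 shows "coef (subst (vec_mat r w) f) (sgl r d) = meval (%a. a) w f"
  "q ~= r ==> coef (subst (vec_mat r w) f) (sgl q d) = coef f (sgl q d)"
proof -
 show "coef (subst (vec_mat r w) f) (sgl r d) = meval (%a. a) w f"
  unfolding coef_top[OF form_subst_mat[OF assms]] meval_subst_vec_mat by (intro arg_cong[where f = "%t. meval (%a. a) t f"]) auto
 show "q ~= r ==> coef (subst (vec_mat r w) f) (sgl q d) = coef f (sgl q d)"
  unfolding coef_top[OF form_subst_mat[OF assms]] coef_top[OF assms] meval_subst_vec_mat by (intro arg_cong[where f = "%t. meval (%a. a) t f"]) auto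
qed

lemma subst_vec_mat_vars:
 assumes f: "f : vars_in V" and "r : V"
 shows "subst (vec_mat r w) f : vars_in V"
proof -
 note vi = sub_ringD[OF sub_ring_vars_in[of V]]
 have x: "(SUM i:UNIV. mconst (vec_mat r w $ i $ j) * mvar i) : vars_in V" if "j : V" for j
 proof (intro vi(8))
  fix i
  show "mconst (vec_mat r w $ i $ j) * mvar i : vars_in V"
  proof (cases "i = r \<or> i = j")
   case True thus ?thesis using that assms(2) by (intro vi(5) vars_in_gens) auto
  next
   case False thus ?thesis using vi(1) by (simp add: vec_mat_def rhomD[OF rhom_mconst])
  qed
 qed
 have "mconst (coef f m) * mval (%j. SUM i:UNIV. mconst (vec_mat r w $ i $ j) * mvar i) m : vars_in V" if "m : supp f" for m
  unfolding mval_def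
 proof (intro vi(5) vi(9) vars_in_gens)
  fix j
  show "(SUM i:UNIV. mconst (vec_mat r w $ i $ j) * mvar i) ^ coef m j : vars_in V"
  proof (cases "j : V")
   case True thus ?thesis by (intro vi(7) x)
  next
   case False
   hence "coef m j = 0" using f that by (auto simp: vars_in_def in_keys_iff)
   thus ?thesis using vi(2) by simp
  qed
 qed
 thus ?thesis unfolding subst_def
  by (subst meval_alt[of "supp f"]) (auto intro!: vi(8) simp: rhomD[OF rhom_mconst])
qed

lemma big_prime_move:
 assumes "big_prime c P" "GLO B" "GLO B'" "B ** B' = mat 1" "B' ** B = mat 1"
 shows "EX P'. big_prime (col_act B c) P' & (ALL f:S. subst B f : P' \<longleftrightarrow> f : P)"
 using big_prime_col[OF assms(1) assms(3,2) assms(5,4)] subst_S[of B] assms(2)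
 by (intro exI[of _ "pull B' P"]) (auto simp: pull_def subst_subst assms subst_1 GLO_def)

lemma mon_deg_1: assumes "mon_deg (m :: 5 \<Rightarrow>\<^sub>0 nat) = 1" obtains k where "m = sgl k 1"
proof -
 have "(SUM i:UNIV. coef m i) = Suc 0" using assms by (simp add: mon_deg_sum)
 then obtain k where k: "coef m k = Suc 0" "ALL b. k ~= b --> coef m b = 0" by (auto simp: sum_eq_Suc0_iff)
 hence "m = sgl k 1" by (intro poly_mapping_eqI) (auto simp: lookup_single when_def)
 thus ?thesis by (rule that)
qed

lemma linear_form_expand:
 assumes "form_of_degree 1 (l :: 'a pol5)"
 shows "l = (SUM k:UNIV. mconst (coef l (sgl k 1)) * mvar k)"
proof (rule poly_mapping_eqI)
 fix m
 have s: "coef (SUM k:UNIV. mconst (coef l (sgl k 1)) * mvar k) m =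
   (SUM k:UNIV. if sgl k 1 = m then coef l m else 0)"
  unfolding lookup_sum by (intro sum.cong) (auto simp: mvar_def lookup_single when_def)
 show "coef l m = coef (SUM k:UNIV. mconst (coef l (sgl k 1)) * mvar k) m"
 proof (cases "mon_deg m = 1")
  case True
  then obtain k where m: "m = sgl k 1" by (rule mon_deg_1)
  have "(sgl i (1::nat) = m) = (i = k)" for i unfolding m by (metis lookup_single_eq lookup_single_not_eq one_neq_zero)
  thus ?thesis unfolding s by simp
 next
  case False
  hence "coef l m = 0" using assms by (auto simp: form_of_degree_alt)
  thus ?thesis unfolding s by (simp cong: if_cong)
 qed
qed

lemma linear_form_unit_coef:
 assumes "form_of_degree 1 l" "l : S" "l ~: N" obtains p where "coef l (sgl p 1) ~: Mv"
proof -
 obtain m where m: "coef l m ~: Mv" using assms(3) by (auto simp: mpols_over_def)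
 hence "mon_deg m = 1" using assms(1) by (auto simp: form_of_degree_alt) (metis zero_in_M)
 thus ?thesis using m mon_deg_1 that by metis
qed

text \<open>\<open>C\<close> substitutes \<open>l\<close> for a variable \<open>x_p\<close> in which
  \<open>l\<close> has a unit coefficient, and \<open>T\<close> exchanges \<open>p\<close> and
  \<open>q\<close>; so the inverse of \<open>C\<close> followed by \<open>T\<close> sends
  \<open>l\<close> to \<open>x_q\<close>. Neither \<open>p\<close> nor \<open>q\<close> lies in
  \<open>Fx\<close>, whose variables stay fixed.\<close>

lemma coordinate_change:
 assumes b: "big_prime c P" and l: "l : S" "form_of_degree 1 l" "l : P" "l ~: N"
  and Fx: "q ~: Fx" "!!i. i : Fx ==> mvar i : P & coef l (sgl i 1) = 0"
 shows "EX c' P'. big_prime c' P' & mvar q : P' & (ALL i:Fx. mvar i : P')"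
proof -
 define n where "n k = coef l (sgl k 1)" for k
 obtain p where "coef l (sgl p 1) ~: Mv" by (rule linear_form_unit_coef[OF l(2,1,4)])
 hence p: "n p ~: Mv" unfolding n_def .
 have nO: "n k : Ov" for k using l(1) by (auto simp: n_def mpols_over_def)
 have pFx: "p ~: Fx" using p Fx(2) by (auto simp: n_def)
 define C where "C = transpose (vec_mat p n)"
 have C: "GLO C" using GLO_mats(2)[of n p] nO p by (auto simp: C_def GLO_def det_transpose) (simp add: transpose_def)
 then obtain D where D: "GLO D" "C ** D = mat 1" "D ** C = mat 1" using GLO_inverse by blast
 have Cp: "subst C (mvar p) = l"
  using linear_form_expand[OF l(2)] by (simp add: C_def transpose_def vec_mat_def n_def)
 have Cj: "subst C (mvar j) = mvar j" if "j ~= p" for j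
 proof -
  have "subst C (mvar j) = (SUM i:UNIV. (if i = j then 1 else 0) * mvar i)"
   unfolding subst_gens by (intro sum.cong refl) (use that in \<open>auto simp: C_def transpose_def vec_mat_def rhomD[OF rhom_mconst]\<close>)
  thus ?thesis by (simp add: sum_delta_mult)
 qed
 define T where "T = (perm_mat (Transposition.transpose p q) :: 'a^5^5)"
 have pt: "Transposition.transpose p q permutes UNIV" by (simp add: permutes_swap_id)
 have T: "GLO T" unfolding T_def by (rule GLO_mats(3)[of "%_. 0", OF O_closed(1) pt])
 have Tj: "subst T (mvar j) = mvar (Transposition.transpose p q j)" for j
 proof -
  have "subst T (mvar j) = (SUM i:UNIV. (if i = Transposition.transpose p q j then 1 else 0) * mvar i)"
  proof -
   have "(Transposition.transpose p q i = j) = (i = Transposition.transpose p q j)" for i by (metis transpose_involutory)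
   hence "mconst (T $ i $ j) = (if i = Transposition.transpose p q j then 1 else (0 :: 'a pol5))" for i
    by (simp add: T_def perm_mat_def rhomD[OF rhom_mconst])
   thus ?thesis by (simp only: subst_gens)
  qed
  thus ?thesis by (simp add: sum_delta_mult)
 qed
 obtain T' where T': "GLO T'" "T ** T' = mat 1" "T' ** T = mat 1" using GLO_inverse[OF T] by blast
 define B where "B = T ** D"
 define B' where "B' = C ** T'"
 have BB: "B ** B' = mat 1" "B' ** B = mat 1"
  unfolding B_def B'_def by (metis D(2,3) T'(2,3) matrix_mul_assoc matrix_mul_lid)+
 obtain P' where P': "big_prime (col_act B c) P'" "!!f. f : S ==> subst B f : P' \<longleftrightarrow> f : P"
  using big_prime_move[OF b _ _ BB] GLO_mult T D(1) C T'(1) unfolding B_def B'_def by blast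
 have "subst B (subst C f) = subst T f" for f
  unfolding B_def subst_subst by (metis D(3) matrix_mul_assoc matrix_mul_rid)
 hence "subst B l = mvar q" "!!i. i : Fx ==> subst B (mvar i) = mvar i"
  using Cp Cj Tj pFx Fx(1) by (metis transpose_apply_first, metis transpose_apply_other)
 thus ?thesis using P'(1) P'(2)[OF l(1)] l(3) P'(2)[OF S_gens(2)] Fx(2) by metis
qed

definition restr :: "5 set => 'a pol5 => 'a pol5" where
 "restr V = meval mconst (%i. if i : V then mvar i else 0)"

lemma rhom_restr: "rhom (restr V)" unfolding restr_def by (rule rhom_meval(1)[OF rhom_mconst])

lemma coef_restr: "coef (restr V f) m = (if ALL u. u ~: V --> coef m u = 0 then coef f m else 0)"
proof -
 have mv: "mval (%i. if i : V then mvar i else 0) k = (if ALL u. u ~: V --> coef k u = 0 then mnm k else (0 :: 'a pol5))" for k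
 proof (cases "ALL u. u ~: V --> coef k u = 0")
  case True
  thus ?thesis unfolding mono_eq_mval mval_def by (auto intro!: prod.cong)
 next
  case False
  then obtain u where "u ~: V" "coef k u ~= 0" by blast
  thus ?thesis unfolding mval_def using False by (auto intro!: prod_zero bexI[of _ u])
 qed
 have "restr V f = (SUM k:supp f. mconst (coef f k) * (if ALL u. u ~: V --> coef k u = 0 then mnm k else 0))"
  unfolding restr_def mv[symmetric] by (rule meval_alt) (auto simp: rhomD[OF rhom_mconst])
 hence "coef (restr V f) m = (SUM k:supp f. coef f k * coef (if ALL u. u ~: V --> coef k u = 0 then mnm k else 0) m)"
  by (simp only: lookup_sum coef_mconst_mult)
 also have "... = (SUM k:supp f. if k = m then (if ALL u. u ~: V --> coef m u = 0 then coef f m else 0) else 0)"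
  by (intro sum.cong refl) (auto simp: lookup_single when_def)
 finally have "coef (restr V f) m = (SUM k:supp f. if k = m then (if ALL u. u ~: V --> coef m u = 0 then coef f m else 0) else 0)" .
 thus ?thesis by (auto simp: in_keys_iff)
qed

lemma restr_props:
 "restr V f : vars_in V" "f : vars_in V ==> restr V f = f" "f : S ==> restr V f : S" "f : N ==> restr V f : N"
 "form_of_degree d f ==> form_of_degree d (restr V f)"
proof -
 show "restr V f : vars_in V" unfolding vars_in_def using coef_restr[of V f] by (auto split: if_splits)
 show "f : vars_in V ==> restr V f = f" by (rule poly_mapping_eqI) (auto simp: coef_restr vars_in_def)
 show "f : S ==> restr V f : S" "f : N ==> restr V f : N" using O_closed(1) by (auto simp: mpols_over_def coef_restr)
 show "form_of_degree d f ==> form_of_degree d (restr V f)" by (auto simp: form_of_degree_alt coef_restr split: if_splits)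
qed

lemma restr_cong: assumes P: "is_ideal S P" and x: "!!i. i ~: V ==> mvar i : P" and f: "f : S" shows "f - restr V f : P"
proof -
 note d = is_idealD[OF sub_ring_S P] and h = rhomD[OF rhom_restr[of V]]
 have "f : S & f - restr V f : P" using f sub_ring_O
 proof (induction rule: mpols_over_induct)
  case (const a) thus ?case using d(2) by (simp add: restr_def rhom_mconst)
 next
  case (var i) thus ?case using x d(2) S_gens(2) by (simp add: restr_def rhom_mconst)
 next
  case (add p q)
  have "p + q - restr V (p + q) = (p - restr V p) + (q - restr V q)" by (simp add: h)
  thus ?case using add d(3) S_closed(4) by metis
 next
  case (mult p q)
  have "p * q - restr V (p * q) = q * (p - restr V p) + restr V p * (q - restr V q)" by (simp add: h algebra_simps)
  thus ?case using mult d(3,4) S_closed(5) restr_props(3)[of p V] by metis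
 qed
 thus ?thesis by blast
qed

text \<open>The coordinates left after projecting \<open>x_2\<close> away, and after eliminating
  \<open>x_4\<close> as well.\<close>

abbreviation "V4 \<equiv> {0, 1, 3, 4 :: 5}"
abbreviation "V3 \<equiv> {0, 1, 3 :: 5}"

lemma monic_of_form:
 assumes f: "f : S" "f : vars_in V" "form_of_degree d f" and u: "coef f (sgl r d) ~: Mv"
  and V: "!!u. above r u ==> u ~: V" "V \<subseteq> W"
 shows "monic_in W r d (mconst (inverse (coef f (sgl r d))) * f)"
proof -
 let ?u = "coef f (sgl r d)"
 have uO: "?u : Ov" using f(1) by (auto simp: mpols_over_def)
 note un = unitD[OF uO u]
 have lt: "coef m r < d" if m: "coef f m ~= 0" "m ~= sgl r d" for m
 proof (rule ccontr)
  assume "\<not> ?thesis"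
  moreover have md: "mon_deg m = d" using f(3) m(1) by (auto simp: form_of_degree_alt)
  moreover have s: "mon_deg m = coef m r + (SUM i:UNIV - {r}. coef m i)" unfolding mon_deg_sum by (subst sum.remove[of _ r]) auto
  ultimately have "coef m r = d" "(SUM i:UNIV - {r}. coef m i) = 0" by linarith+
  moreover from this(2) have "coef m i = 0" if "i ~= r" for i using that by (simp add: sum_eq_0_iff)
  ultimately have "m = sgl r d"
   by (intro poly_mapping_eqI) (metis lookup_single_eq lookup_single_not_eq)
  thus False using m(2) by simp
 qed
 have "mconst (inverse ?u) * f : S" "mconst (inverse ?u) * f : vars_in W"
  using f un vars_in_mono[OF V(2) f(2)] by (auto intro!: S_closed(5) sub_ringD(5)[OF sub_ring_vars_in] vars_in_gens)
 moreover have "coef m u = 0" if "coef f m ~= 0" "above r u" for m u using f(2) V(1) that by (auto simp: vars_in_def)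
 ultimately show ?thesis unfolding monic_in_def using lt un(1) form_mconst_mult[OF f(3)] by auto
qed

text \<open>The relation \<open>s x\<^sub>2 + t\<close> makes the projection away from \<open>x\<^sub>2\<close> birational on the variety of \<open>P\<close>.\<close>

definition projection_data :: "'a pol5 set => 'a pol5 => 'a pol5 => nat => bool" where
 "projection_data P s t k \<longleftrightarrow> s : S & s ~: P & s : vars_in V4 & form_of_degree k s & t : S & t : vars_in V4 &
  form_of_degree (Suc k) t & s * mvar 2 + t : P"

lemma vec_mat_inverse:
 assumes "w r = 1" shows "vec_mat r w ** vec_mat r (%i. if i = r then 1 else - w i) = (mat 1 :: 'a^5^5)"
proof -
 let ?w = "%i. if i = r then 1 else - w i"
 have "(SUM m:UNIV. vec_mat r w $ k $ m * vec_mat r ?w $ m $ l) = (if k = l then 1 else 0)" for k l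
 proof (cases "k = r")
  case False
  thus ?thesis by (simp add: vec_mat_def sum_delta_mult)
 next
  case True
  have "(SUM m:UNIV. vec_mat r w $ k $ m * vec_mat r ?w $ m $ l) = ?w l + (SUM m:UNIV - {r}. vec_mat r w $ k $ m * vec_mat r ?w $ m $ l)"
   by (subst sum.remove[of _ r]) (simp_all add: vec_mat_def True assms)
  also have "(SUM m:UNIV - {r}. vec_mat r w $ k $ m * vec_mat r ?w $ m $ l) = (SUM m:UNIV - {r}. if m = l then w l else 0)"
   by (intro sum.cong refl) (auto simp: vec_mat_def True)
  finally show ?thesis using True by auto
 qed
 thus ?thesis by (simp add: vec_eq_iff matrix_matrix_mult_def mat_def)
qed

lemma shear:
 assumes b: "big_prime c P" and w: "!!i. w i : Ov" "w r = 1"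
 shows "EX P' B'. big_prime (col_act (vec_mat r w) c) P' & (ALL f:S. subst (vec_mat r w) f : P' \<longleftrightarrow> f : P) &
  GLO (vec_mat r w) & GLO B' & (ALL f. subst (vec_mat r w) (subst B' f) = f) & (ALL f. subst B' (subst (vec_mat r w) f) = f) &
  (ALL f V. f : vars_in V --> r : V --> subst B' f : vars_in V)"
proof -
 let ?w = "%i. if i = r then 1 else - w i"
 have G: "GLO (vec_mat r w)" "GLO (vec_mat r ?w)"
  using w O_closed(2,3) by (auto intro!: GLO_mats(2))
 have i: "vec_mat r w ** vec_mat r ?w = (mat 1 :: 'a^5^5)" "vec_mat r ?w ** vec_mat r w = (mat 1 :: 'a^5^5)"
  using vec_mat_inverse[of w r, OF w(2)] matrix_left_right_inverse by blast+
 obtain P' where P': "big_prime (col_act (vec_mat r w) c) P'" "ALL f:S. subst (vec_mat r w) f : P' \<longleftrightarrow> f : P"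
  using big_prime_move[OF b G i] by blast
 have "subst (vec_mat r w) (subst (vec_mat r ?w) f) = f" "subst (vec_mat r ?w) (subst (vec_mat r w) f) = f" for f
  by (simp_all only: subst_subst i subst_1)
 thus ?thesis
  by (intro exI[of _ P'] exI[of _ "vec_mat r ?w"] conjI allI impI P' G) (auto intro: subst_vec_mat_vars)
qed

lemma projection_data_shear:
 assumes "projection_data P s t k" "r : V4" "w 2 = 0" "GLO (vec_mat r w)" and e: "!!f. f : S ==> subst (vec_mat r w) f : P' \<longleftrightarrow> f : P"
 shows "projection_data P' (subst (vec_mat r w) s) (subst (vec_mat r w) t) k"
proof -
 let ?B = "vec_mat r w"
 have BS: "f : S ==> subst ?B f : S" for f using assms(4) by (auto simp: GLO_def intro: subst_S)
 have d: "s : S" "s ~: P" "s : vars_in V4" "form_of_degree k s" "t : S" "t : vars_in V4" "form_of_degree (Suc k) t" "s * mvar 2 + t : P"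
  using assms(1) by (auto simp: projection_data_def)
 have "subst ?B (mvar 2) = (SUM i:UNIV. (if i = 2 then 1 else 0) * mvar i)"
  unfolding subst_gens using assms(2,3) by (intro sum.cong refl) (auto simp: vec_mat_def rhomD[OF rhom_mconst])
 hence x2: "subst ?B (mvar 2) = mvar 2" by (simp add: sum_delta_mult)
 have "subst ?B (s * mvar 2 + t) : P'" using e[of "s * mvar 2 + t"] d S_closed(4,5) S_gens(2) by simp
 hence "subst ?B s * mvar 2 + subst ?B t : P'" by (simp only: rhomD[OF rhom_subst] x2)
 moreover have "subst ?B s ~: P'" using e[OF d(1)] d(2) by simp
 ultimately show ?thesis unfolding projection_data_def
  by (intro conjI BS d(1,5) subst_vec_mat_vars[OF _ assms(2)] d(3,6) form_subst_mat d(4,7))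
qed

end

context dvr_closed begin

lemma exists_nonzero_point_vars:
 assumes f: "f : S" "f ~: N" "form_of_degree d f" "f : vars_in V" and r: "r : V"
 shows "EX w. (ALL i. w i : Ov) & w r = 1 & (ALL i. i ~: V --> w i = 0) & meval (%a. a) w f ~: Mv"
proof -
 obtain w where w: "ALL i. w i : Ov" "w r = 1" "meval (%a. a) w f ~: Mv" using exists_nonzero_point_normalized[OF f(1-3)] by blast
 define w' where "w' i = (if i : V then w i else 0)" for i
 have "mval w' m = mval w m" if "m : supp f" for m
  unfolding mval_def using f(4) that by (intro prod.cong refl) (auto simp: w'_def vars_in_def in_keys_iff)
 hence "meval (%a. a) w' f = meval (%a. a) w f" by (simp add: meval_alt[of "supp f"])
 thus ?thesis using w r O_closed(1) by (intro exI[of _ w']) (auto simp: w'_def)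
qed

text \<open>If \<open>G\<close> were nonzero modulo \<open>N\<close>, a shear would make it monic in
  \<open>x_3\<close> while the coefficient of \<open>A\<close> at the power of \<open>x_4\<close>
  stays a unit; then \<open>bounded_growth_birational\<close> contradicts the size of
  \<open>P\<close>.\<close>

lemma no_form_in_three_variables:
 assumes b: "big_prime c P" and pd: "projection_data P s t k" and A: "A : P" "A : S" "A : vars_in V4" "form_of_degree e A"
  "coef A (sgl 4 e) ~: Mv" and G: "G : P" "G : S" "G : vars_in V3" "form_of_degree d G"
 shows "G : N"
proof (rule ccontr)
 assume "G ~: N"
 have V3: "3 : V3" by simp
 obtain w where w: "!!i. w i : Ov" "w 3 = 1" "!!i. i ~: V3 ==> w i = 0" "meval (%a. a) w G ~: Mv"
  using exists_nonzero_point_vars[OF G(2) \<open>G ~: N\<close> G(4,3) V3] by (elim exE conjE) (rule that; simp)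
 let ?B = "vec_mat 3 w"
 from shear[of c P w 3, OF b w(1) w(2)] obtain P' where P0: "big_prime (col_act ?B c) P'" "ALL f:S. subst ?B f : P' \<longleftrightarrow> f : P" "GLO ?B"
  by (elim exE conjE)
 note P' = P0(1) P0(2)[rule_format] P0(3)
 have BS: "f : S ==> subst ?B f : S" for f using P'(3) by (auto simp: GLO_def intro: subst_S)
 have pd': "projection_data P' (subst ?B s) (subst ?B t) k"
  by (rule projection_data_shear[OF pd _ _ P'(3) P'(2)]) (use w(3) in auto)
 have pr: "is_prime S P'" "\<not> bounded_growth P'" using P'(1) by (auto simp: big_prime_def)
 note di = is_idealD(4)[OF sub_ring_S is_primeD(1)[OF pr(1)]]
 have cG: "coef (subst ?B G) (sgl 3 d) ~: Mv" using w(4) by (simp add: subst_vec_mat_top(1)[OF G(4)])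
 have cA: "coef (subst ?B A) (sgl 4 e) ~: Mv" using A(5) by (simp add: subst_vec_mat_top(2)[OF A(4)])
 have mG: "monic_in V4 3 d (mconst (inverse (coef (subst ?B G) (sgl 3 d))) * subst ?B G)"
  by (rule monic_of_form[OF BS[OF G(2)] subst_vec_mat_vars[OF G(3)] form_subst_mat[OF G(4)] cG]) (auto simp: above_def)
 have mA: "monic_in V4 4 e (mconst (inverse (coef (subst ?B A) (sgl 4 e))) * subst ?B A)"
  by (rule monic_of_form[OF BS[OF A(2)] subst_vec_mat_vars[OF A(3)] form_subst_mat[OF A(4)] cA]) (auto simp: above_def)
 have iu: "mconst (inverse u) : S" if "u : Ov" "u ~: Mv" for u using unitD(2)[OF that] by simp
 have cO: "f : S ==> coef f m : Ov" for f m by (auto simp: mpols_over_def)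
 have "subst ?B G : P'" "subst ?B A : P'" using P'(2)[OF G(2)] P'(2)[OF A(2)] G(1) A(1) by auto
 note GP = di[OF iu[OF cO[OF BS[OF G(2)]] cG] this(1)] and AP = di[OF iu[OF cO[OF BS[OF A(2)]] cA] this(2)]
 have p: "subst ?B s : S" "subst ?B s ~: P'" "subst ?B s : vars_in V4" "form_of_degree k (subst ?B s)" "subst ?B t : S" "subst ?B t : vars_in V4"
  "form_of_degree (Suc k) (subst ?B t)" "subst ?B s * mvar 2 + subst ?B t : P'"
  using pd' unfolding projection_data_def by blast+
 have "bounded_growth P'" by (rule bounded_growth_birational[OF pr(1) GP mG AP mA p])
 thus False using pr(2) by simp
qed

end

section \<open>Quadrics of a large prime in four variables\<close>

context dvr begin

lemma quadric_split:
 assumes f: "f : S" "f : vars_in V4" "form_of_degree 2 f"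
 obtains g h where "g : S" "g : vars_in V3" "form_of_degree 1 g" "h : S" "h : vars_in V3" "form_of_degree 2 h"
  "f = mconst (coef f (sgl 4 2)) * mvar 4 ^ 2 + mvar 4 * g + h"
proof -
 define K where "K j = {m : supp f. coef m 4 = j}" for j
 define G where "G j = (SUM m:K j. sgl (m - sgl 4 j) (coef f m))" for j
 have key: "mon_deg m = 2" "coef m 2 = 0" if "m : supp f" for m
  using f that by (auto simp: form_of_degree_def vars_in_def in_keys_iff)
 have dec: "sgl 4 (coef m 4) + (m - sgl 4 (coef m 4)) = m" for m :: "5 \<Rightarrow>\<^sub>0 nat"
  by (rule poly_mapping_eqI) (auto simp: lookup_add lookup_minus lookup_single when_def)
 have x4: "mvar 4 ^ j = (sgl (sgl 4 j) 1 :: 'a pol5)" for j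
  by (simp add: mono_eq_mval mval_single)
 have c4: "coef m 4 : {0, 1, 2}" if "m : supp f" for m
  using key(1)[OF that] by (auto simp: mon_deg_sum sum_5)
 have "f = (SUM j:{0, 1, 2}. SUM m:K j. sgl m (coef f m))"
 proof -
  have im: "(%m. coef m 4) ` supp f \<subseteq> {0, 1, 2}" by (rule image_subsetI) (rule c4)
  have fin: "finite {0, 1, 2 :: nat}" by simp
  have "(SUM j:{0, 1, 2}. SUM m:K j. sgl m (coef f m)) = (SUM m:supp f. sgl m (coef f m))"
   unfolding K_def by (rule sum.group[OF finite_keys fin im])
  also have "... = f" by (rule poly_sum_single[symmetric])
  finally show ?thesis by (rule sym)
 qed
 also have "... = (SUM j:{0, 1, 2}. mvar 4 ^ j * G j)"
 proof (intro sum.cong refl)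
  fix j :: nat
  show "(SUM m:K j. sgl m (coef f m)) = mvar 4 ^ j * G j"
   unfolding G_def x4 sum_distrib_left mult_single mult_1
   by (intro sum.cong refl) (use dec in \<open>auto simp: K_def\<close>)
 qed
 also have "... = G 0 + mvar 4 * G 1 + mvar 4 ^ 2 * G 2" by (simp add: numeral_2_eq_2 add.assoc)
 also have "G 2 = mconst (coef f (sgl 4 2))"
 proof -
  have "m = sgl 4 2" if "m : K 2" for m
  proof (rule poly_mapping_eqI)
   fix i
   have "coef m 4 = 2" "coef m 0 + coef m 1 + coef m 2 + coef m 3 = 0"
    using that key(1)[of m] by (auto simp: K_def mon_deg_sum sum_5)
   thus "coef m i = coef (sgl 4 2) i" using exhaust_5[of i] by (auto simp: lookup_single when_def)
  qed
  hence "K 2 \<subseteq> {sgl 4 2}" by blast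
  hence "G 2 = (SUM m:{sgl 4 2}. sgl (m - sgl 4 2) (coef f m))"
   unfolding G_def by (intro sum.mono_neutral_left) (auto simp: K_def in_keys_iff)
  thus ?thesis by (simp add: mconst_def)
 qed
 finally have eq: "f = mconst (coef f (sgl 4 2)) * mvar 4 ^ 2 + mvar 4 * G 1 + G 0" by (simp add: ac_simps)
 have GS: "G j : S" for j unfolding G_def using f(1) by (intro S_closed(8) S_gens(3)) (auto simp: mpols_over_def)
 have GV: "G j : vars_in V3" for j
 proof (unfold G_def, intro sub_ringD(8)[OF sub_ring_vars_in] vars_in_single disjI2 allI impI)
  fix m u assume "m : K j" "u ~: V3"
  thus "coef (m - sgl 4 j) u = 0"
   using exhaust_5[of u] key(2)[of m] by (auto simp: K_def lookup_minus lookup_single when_def)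
 qed
 have Gf: "form_of_degree (2 - j) (G j)" for j
  unfolding G_def
 proof (intro form_sum, unfold form_single, rule disjI2)
  fix m assume m: "m : K j"
  have "mon_deg m = j + mon_deg (m - sgl 4 j)" using m dec[of m] by (metis (mono_tags, lifting) K_def mem_Collect_eq mon_deg_add mon_deg_single)
  thus "mon_deg (m - sgl 4 j) = 2 - j" using m key(1)[of m] by (auto simp: K_def)
 qed
 show ?thesis by (rule that[OF GS GV _ GS GV _ eq]) (use Gf[of 1] Gf[of 0] in auto)
qed

text \<open>Reduction modulo the linear form \<open>a\<close> is a substitution, so \<open>(a)\<close> is prime modulo the maximal ideal.\<close>

lemma linear_divides_square:
 assumes a: "a : S" "form_of_degree 1 a" "a ~: N" and b: "b : S" and h: "h : S" "b ^ 2 - a * h : N"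
 shows "EX \<tau>:S. b - a * \<tau> : N"
proof -
 obtain p where p: "coef a (sgl p 1) ~: Mv" using linear_form_unit_coef[OF a(2,1,3)] by blast
 define u where "u = coef a (sgl p 1)"
 have u: "u : Ov" "u ~: Mv" using p a(1) by (auto simp: u_def mpols_over_def)
 note un = unitD[OF u]
 define z where "z = (mvar(p := mvar p - mconst (inverse u) * a) :: 5 => 'a pol5)"
 define \<sigma> where "\<sigma> = meval mconst z"
 have rs: "rhom \<sigma>" unfolding \<sigma>_def by (rule rhom_meval(1)[OF rhom_mconst])
 note hs = rhomD[OF rs]
 have zS: "z i : S" for i using a(1) un(2) by (auto simp: z_def intro!: S_closed(5,6) S_gens)
 have \<sigma>S: "f : S ==> \<sigma> f : S" for f unfolding \<sigma>_def by (rule meval_in[OF sub_ring_O sub_ring_S rhom_mconst _ zS]) auto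
 have \<sigma>N: "f : N ==> \<sigma> f : N" for f unfolding N_iff using \<sigma>S by (auto simp: hs) (auto simp: \<sigma>_def rhom_mconst)
 have gens: "\<sigma> (mconst c) = mconst c" "\<sigma> (mvar i) = z i" for c i by (simp_all add: \<sigma>_def rhom_mconst)
 have "\<sigma> a = (SUM k:UNIV. mconst (coef a (sgl k 1)) * z k)"
  by (subst linear_form_expand[OF a(2)]) (simp add: hs gens)
 also have "... = (SUM k:UNIV. mconst (coef a (sgl k 1)) * mvar k + (if k = p then - a else 0))"
 proof (intro sum.cong refl)
  fix k
  have "mconst u * (mconst (inverse u) * a) = mconst (u * inverse u) * a" by (simp only: rhomD[OF rhom_mconst] mult.assoc)
  hence "mconst u * (mconst (inverse u) * a) = a" using un(1) by (simp add: rhomD[OF rhom_mconst])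
  thus "mconst (coef a (sgl k 1)) * z k = mconst (coef a (sgl k 1)) * mvar k + (if k = p then - a else 0)"
   by (cases "k = p") (simp_all add: z_def u_def right_diff_distrib)
 qed
 also have "... = a - a" unfolding sum.distrib linear_form_expand[OF a(2), symmetric] by simp
 finally have \<sigma>a: "\<sigma> a = 0" by simp
 have div: "EX \<tau>:S. f - \<sigma> f = a * \<tau>" if "f : S" for f
 proof -
  have "f : S & (EX \<tau>:S. f - \<sigma> f = a * \<tau>)" using that sub_ring_O
  proof (induction rule: mpols_over_induct)
   case (const c) thus ?case using S_closed(1) by (auto simp: gens intro!: bexI[of _ 0])
  next
   case (var i)
   have "mvar i - z i = a * (if i = p then mconst (inverse u) else 0)" by (simp add: z_def mult.commute)
   thus ?case using un(2) S_closed(1) S_gens(2) by (auto simp: gens intro!: bexI[of _ "if i = p then mconst (inverse u) else 0"])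
  next
   case (add f g)
   then obtain s t where "s : S" "t : S" "f - \<sigma> f = a * s" "g - \<sigma> g = a * t" by blast
   hence "f + g - \<sigma> (f + g) = a * (s + t)" "s + t : S" using S_closed(4) by (simp_all add: hs algebra_simps)
   thus ?case using add S_closed(4) by blast
  next
   case (mult f g)
   then obtain s t where st: "s : S" "t : S" "f - \<sigma> f = a * s" "g - \<sigma> g = a * t" by blast
   have "f * g - \<sigma> (f * g) = (f - \<sigma> f) * g + \<sigma> f * (g - \<sigma> g)" by (simp add: hs algebra_simps)
   also have "... = a * (s * g + \<sigma> f * t)" by (simp add: st algebra_simps)
   finally have "f * g - \<sigma> (f * g) = a * (s * g + \<sigma> f * t)" .
   moreover have "s * g + \<sigma> f * t : S" using mult st \<sigma>S[of f] by (intro S_closed(4,5)) auto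
   ultimately show ?case using mult S_closed(5)[of f g] by blast
  qed
  thus ?thesis by blast
 qed
 have "\<sigma> (b ^ 2 - a * h) : N" by (rule \<sigma>N[OF h(2)])
 hence "\<sigma> b ^ 2 : N" by (simp add: hs \<sigma>a)
 hence "\<sigma> b : N" using is_prime_power[OF sub_ring_S prime_N \<sigma>S[OF b]] by blast
 moreover obtain \<tau> where \<tau>: "\<tau> : S" "b - \<sigma> b = a * \<tau>" using div[OF b] by blast
 have "b - a * \<tau> = \<sigma> b" unfolding \<tau>(2)[symmetric] by simp
 ultimately show ?thesis using \<tau>(1) by (intro bexI[of _ \<tau>]) simp_all
qed

end

context dvr_closed begin

text \<open>Removing \<open>x_4^2\<close> from \<open>g\<close> by a multiple of \<open>f\<close>
  leaves \<open>h = x_4 h1 + h0\<close>. Elimination of \<open>x_4\<close> between \<open>f\<close>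
  and \<open>h\<close> gives a form \<open>G\<close> of \<open>P\<close> in three variables, so
  \<open>G\<close> lies in \<open>N\<close>; this makes \<open>h1\<close> a divisor of
  \<open>h0^2\<close>, hence of \<open>h0\<close>, modulo \<open>N\<close>. If \<open>h1\<close> is
  nonzero modulo \<open>N\<close>, then \<open>h\<close> is \<open>h1\<close> times a linear form,
  which lies in \<open>P\<close> against \<open>nolin\<close>.\<close>

lemma proportional_quadrics_monic:
 assumes b: "big_prime c P" and pd: "projection_data P s t k"
  and nolin: "!!l. l : S ==> l : vars_in V4 ==> form_of_degree 1 l ==> l : P ==> l : N"
  and f: "f : P" "f : S" "f : vars_in V4" "form_of_degree 2 f" and g: "g : P" "g : S" "g : vars_in V4" "form_of_degree 2 g"
  and u: "coef f (sgl 4 2) ~: Mv"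
 shows "EX \<alpha>:Ov. g - mconst \<alpha> * f : N"
proof -
 have pr: "is_prime S P" and NP: "N \<subseteq> P" using b by (auto simp: big_prime_def)
 note d = is_idealD[OF sub_ring_S is_primeD(1)[OF pr]] and vi = sub_ringD[OF sub_ring_vars_in]
 define \<alpha> where "\<alpha> = coef g (sgl 4 2) / coef f (sgl 4 2)"
 define w where "w = coef f (sgl 4 2)"
 have w: "w : Ov" "w ~: Mv" using f(2) u by (auto simp: w_def mpols_over_def)
 have \<alpha>: "\<alpha> : Ov" unfolding \<alpha>_def using f(2) g(2) u by (intro O_div) (auto simp: mpols_over_def)
 obtain f1 f0 where f1: "f1 : S" "f1 : vars_in V3" "form_of_degree 1 f1" and f0: "f0 : S" "f0 : vars_in V3" "form_of_degree 2 f0"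
  and fe: "f = mconst w * mvar 4 ^ 2 + mvar 4 * f1 + f0" using quadric_split[OF f(2-4)] unfolding w_def by blast
 define h where "h = g - mconst \<alpha> * f"
 have h: "h : P" "h : S" "h : vars_in V4" "form_of_degree 2 h"
  unfolding h_def using f g \<alpha> by (auto intro!: d(7,4) S_closed(5,6) vi(5,6) vars_in_gens form_diff form_mconst_mult)
 have "coef h (sgl 4 2) = 0" using unitD(1)[OF w] by (simp add: h_def lookup_minus \<alpha>_def w_def)
 then obtain h1 h0 where h1: "h1 : S" "h1 : vars_in V3" "form_of_degree 1 h1" and h0: "h0 : S" "h0 : vars_in V3" "form_of_degree 2 h0"
  and he: "h = mvar 4 * h1 + h0" using quadric_split[OF h(2-4)] by (metis add_0 mult_zero_left rhomD(4)[OF rhom_mconst])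
 have zero3: "G : N" if "G : P" "G : S" "G : vars_in V3" "form_of_degree e G" for G e
  by (rule no_form_in_three_variables[OF b pd f u that])
 have "h : N"
 proof (cases "h1 : N")
  case True
  have x1: "mvar 4 * h1 : N" by (rule N_closed(4)[OF S_gens(2) True])
  hence "h0 : P" using d(7)[OF h(1), of "mvar 4 * h1"] NP by (auto simp: he)
  hence "h0 : N" using zero3 h0 by blast
  thus ?thesis using x1 N_closed(3) by (simp add: he)
 next
  case False
  have V34: "x : vars_in V3 ==> x : vars_in V4" for x by (rule vars_in_mono[of V3]) auto
  have h1P: "h1 ~: P" using nolin[of h1] h1 V34 False by blast
  \<comment> \<open>The resultant of \<open>f\<close> and \<open>h\<close> with respect to
    \<open>x_4\<close>.\<close>
  define G where "G = mconst w * h0 ^ 2 - f1 * h1 * h0 + f0 * h1 ^ 2"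
  have "G = h1 ^ 2 * f - (mconst w * (mvar 4 * h1 - h0) + f1 * h1) * h" by (simp add: G_def fe he power2_eq_square algebra_simps)
  hence "G : P" using f(1,2) h(1) h1 h0 f1 w(1) by (auto intro!: d(7,4) S_closed(4,5,6,7) S_gens)
  moreover have "form_of_degree 4 G"
  proof -
   have *: "form_of_degree 4 (h0 ^ 2)" "form_of_degree 4 (f1 * h1 * h0)" "form_of_degree 4 (f0 * h1 ^ 2)"
    using form_power[OF h0(3), of 2] form_mult[OF form_mult[OF f1(3) h1(3)] h0(3)] form_mult[OF f0(3) form_power[OF h1(3), of 2]] by (simp_all add: eval_nat_numeral)
   show ?thesis unfolding G_def by (intro form_add form_diff form_mconst_mult *)
  qed
  moreover have "G : S" "G : vars_in V3" unfolding G_def using f1 f0 h1 h0 w(1)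
   by (auto intro!: S_closed(4,5,6,7) vi(4,5,6,7) vars_in_gens)
  ultimately have GN: "G : N" by (intro zero3)
  define H where "H = mconst (inverse w) * (f1 * h0 - f0 * h1)"
  have "h0 ^ 2 - h1 * H = mconst (inverse w) * G"
  proof -
   have "mconst (inverse w) * G = mconst (inverse w * w) * h0 ^ 2 - h1 * H"
    by (simp add: G_def H_def rhomD[OF rhom_mconst] power2_eq_square algebra_simps)
   thus ?thesis using unitD(1)[OF w] by (simp add: rhomD[OF rhom_mconst])
  qed
  hence "h0 ^ 2 - h1 * H : N" using N_closed(4)[OF _ GN, of "mconst (inverse w)"] unitD(2)[OF w] by simp
  moreover have "H : S" unfolding H_def using f1 f0 h1 h0 unitD(2)[OF w] by (auto intro!: S_closed(5,6))
  ultimately obtain \<tau> where \<tau>: "\<tau> : S" "h0 - h1 * \<tau> : N" using linear_divides_square[OF h1(1,3) False h0(1)] by blast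
  \<comment> \<open>Since \<open>h0\<close> and \<open>h1\<close> are forms of degrees 2 and 1 in
    three variables, the congruence survives when only the linear part of the quotient in these
    variables is kept.\<close>
  define \<tau>' where "\<tau>' = restr V3 (form_part 1 \<tau>)"
  have "form_part 2 (h0 - h1 * \<tau>) : N" by (rule form_part_in[OF zero_in_M \<tau>(2)])
  hence "h0 - h1 * form_part 1 \<tau> : N"
   unfolding form_part_diff form_part_mult[OF h1(3)] form_part_form[OF h0(3)] by (simp add: numeral_2_eq_2)
  hence "restr V3 (h0 - h1 * form_part 1 \<tau>) : N" by (rule restr_props(4))
  hence \<tau>N: "h0 - h1 * \<tau>' : N" using restr_props(2)[OF h0(2)] restr_props(2)[OF h1(2)] by (simp add: \<tau>'_def rhomD[OF rhom_restr])
  have \<tau>': "\<tau>' : S" "\<tau>' : vars_in V3" "form_of_degree 1 \<tau>'"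
   unfolding \<tau>'_def using form_part_in[OF O_closed(1) \<tau>(1), of 1] by (auto intro: restr_props)
  define l where "l = mvar 4 + \<tau>'"
  have l: "l : S" "l : vars_in V4" "form_of_degree 1 l"
   unfolding l_def using \<tau>' V34 by (auto intro!: S_closed(4) S_gens vi(4) vars_in_gens form_add form_mvar simp del: One_nat_def)
  have "h1 * l = h - (h0 - h1 * \<tau>')" by (simp add: l_def he algebra_simps)
  hence "h1 * l : P" using d(7)[OF h(1)] \<tau>N NP by auto
  hence "l : P" using is_primeD(3)[OF pr h1(1) l(1)] h1P by blast
  hence "l : N" by (rule nolin[OF l])
  moreover have "coef \<tau>' (sgl 4 1) = 0"
  proof (rule ccontr)
   assume "coef \<tau>' (sgl 4 1) ~= 0"
   moreover have "ALL m. coef \<tau>' m ~= 0 --> (ALL u. u ~: V3 --> coef m u = 0)" using \<tau>'(2) unfolding vars_in_def by simp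
   moreover have "4 ~: V3" by simp
   ultimately have "coef (sgl (4::5) (1::nat)) 4 = 0" by blast
   thus False by simp
  qed
  hence "coef l (sgl 4 1) = 1" by (simp add: l_def lookup_add mvar_def)
  ultimately show ?thesis using one_notin_M unfolding mpols_over_def by (smt (verit) mem_Collect_eq)
 qed
 thus ?thesis using \<alpha> by (auto simp: h_def)
qed

text \<open>A shear at a point where \<open>f\<close> is a unit makes the coefficient of
  \<open>x_4^2\<close> a unit. The point has \<open>w 2 = 0\<close>, so \<open>x_2\<close> and the
  projection are respected.\<close>

lemma proportional_quadrics:
 assumes b: "big_prime c P" and pd: "projection_data P s t k"
  and nolin: "!!l. l : S ==> l : vars_in V4 ==> form_of_degree 1 l ==> l : P ==> l : N"
  and f: "f : P" "f : S" "f : vars_in V4" "form_of_degree 2 f" and g: "g : P" "g : S" "g : vars_in V4" "form_of_degree 2 g"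
  and fN: "f ~: N"
 shows "EX \<alpha>:Ov. g - mconst \<alpha> * f : N"
proof -
 have V4: "4 : V4" by simp
 obtain w where w: "!!i. w i : Ov" "w 4 = 1" "!!i. i ~: V4 ==> w i = 0" "meval (%a. a) w f ~: Mv"
  using exists_nonzero_point_vars[OF f(2) fN f(4,3) V4] by (elim exE conjE) (rule that; simp)
 let ?B = "vec_mat 4 w"
 from shear[of c P w 4, OF b w(1) w(2)] obtain P' B' where P0: "big_prime (col_act ?B c) P'" "ALL f:S. subst ?B f : P' \<longleftrightarrow> f : P" "GLO ?B" "GLO B'"
  and i0: "ALL f. subst ?B (subst B' f) = f" "ALL f. subst B' (subst ?B f) = f" and v0: "ALL f V. f : vars_in V --> 4 : V --> subst B' f : vars_in V"
  by (elim exE conjE)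
 note P' = P0(1) P0(2)[rule_format] P0(3,4) and inv = i0[rule_format] and vB' = v0[rule_format]
 have BS: "f : S ==> subst ?B f : S" "f : S ==> subst B' f : S" "f : N ==> subst ?B f : N" "f : N ==> subst B' f : N" for f
  using P'(3,4) by (auto simp: GLO_def intro: subst_S subst_N)
 have pd': "projection_data P' (subst ?B s) (subst ?B t) k"
  by (rule projection_data_shear[OF pd V4 _ P'(3) P'(2)]) (use w(3) in auto)
 have nolin': "l : N" if l: "l : S" "l : vars_in V4" "form_of_degree 1 l" "l : P'" for l
 proof -
  have "subst B' l : P" using P'(2)[OF BS(2)[OF l(1)]] l(4) by (simp add: inv)
  hence "subst B' l : N" by (intro nolin BS(2) l(1) vB'[OF l(2) V4] form_subst_mat l(3))
  hence "subst ?B (subst B' l) : N" by (rule BS(3))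
  thus ?thesis by (simp add: inv)
 qed
 have "EX \<alpha>:Ov. subst ?B g - mconst \<alpha> * subst ?B f : N"
 proof (rule proportional_quadrics_monic[OF P'(1) pd' nolin'])
  show "coef (subst ?B f) (sgl 4 2) ~: Mv" using w(4) by (simp add: subst_vec_mat_top(1)[OF f(4)])
 qed (use f g P'(2) BS subst_vec_mat_vars[OF _ V4] form_subst_mat in auto)
 then obtain \<alpha> where "\<alpha> : Ov" "subst ?B (g - mconst \<alpha> * f) : N" by (auto simp: rhomD[OF rhom_subst])
 thus ?thesis using BS(4)[of "subst ?B (g - mconst \<alpha> * f)"] by (auto simp: inv)
qed

end

section \<open>Signed Pfaffians and their coefficients\<close>

lemma single_pair_eq_iff:
 "sgl a (1::nat) + sgl b 1 = sgl k 1 + sgl l 1 \<longleftrightarrow> a = k & b = l \<or> a = l & b = k"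
proof
 assume e: "sgl a (1::nat) + sgl b 1 = sgl k 1 + sgl l 1"
 have *: "(if a = x then 1 else 0) + (if b = x then 1 else 0) = (if k = x then 1 else 0) + (if l = x then 1 else (0::nat))" for x
  using arg_cong[OF e, of "%m. coef m x"] unfolding lookup_add lookup_single when_def .
 have "a = k \<or> a = l" using *[of a] by (rule contrapos_pp) auto
 thus "a = k & b = l \<or> a = l & b = k"
 proof
  assume "a = k" thus ?thesis using *[of b] by (simp split: if_splits)
 next
  assume "a = l" thus ?thesis using *[of b] by (simp split: if_splits)
 qed
qed (auto simp: add.commute)

text \<open>The Pfaffian that omits row \<open>i\<close>, with indices modulo 5. The cyclic order
  supplies the usual alternating signs, so that \<open>pf5 x\<close> is a kernel vector of
  \<open>x\<close> (\<open>pf5_syzygy\<close>).\<close>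

definition pf5 :: "(5 => 5 => 'r::comm_ring_1) => 5 => 'r" where
 "pf5 x i = pf2 x x (i + 1) (i + 2) (i + 3) (i + 4)"

lemma pf5_values:
 "pf5 x 0 = pf2 x x 1 2 3 4" "pf5 x 1 = pf2 x x 2 3 4 0" "pf5 x 2 = pf2 x x 3 4 0 1" "pf5 x 3 = pf2 x x 4 0 1 2" "pf5 x 4 = pf2 x x 0 1 2 3"
proof -
 have e: "(5::5) = 0" "(6::5) = 1" "(7::5) = 2" "(8::5) = 3" by simp_all
 show "pf5 x 0 = pf2 x x 1 2 3 4" "pf5 x 1 = pf2 x x 2 3 4 0" "pf5 x 2 = pf2 x x 3 4 0 1" "pf5 x 3 = pf2 x x 4 0 1 2" "pf5 x 4 = pf2 x x 0 1 2 3"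
  by (simp_all add: pf5_def) (simp_all only: e)
qed

lemma alternating2_skew:
 assumes "alternating2 x"
 shows "x 1 0 = - x 0 1" "x 2 0 = - x 0 2" "x 3 0 = - x 0 3" "x 4 0 = - x 0 4" "x 2 1 = - x 1 2" "x 3 1 = - x 1 3" "x 4 1 = - x 1 4"
  "x 3 2 = - x 2 3" "x 4 2 = - x 2 4" "x 4 3 = - x 3 4" "x i i = 0"
 using assms unfolding alternating2_def by blast+

lemma pf5_syzygy: assumes "alternating2 x" shows "(SUM j:UNIV. x i j * pf5 x j) = 0"
proof -
 note sk = alternating2_skew[OF assms]
 show ?thesis using exhaust_5[of i]
  by (elim disjE; hypsubst) (simp_all only: sum_5 pf5_values pf2_def sk; simp add: algebra_simps)+
qed

lemma pf2_from_pf5: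
 assumes x: "alternating2 x" and Q: "Q 0" "!!a. Q a ==> Q (- a)" and P: "!!i. Q (pf5 x i)"
 shows "Q (pf2 x x p q r s)"
proof (rule pf2_induct_increasing[OF x, where Q = Q])
 note sk = alternating2_skew[OF x]
 fix a b c d :: 5 assume inc: "a < b" "b < c" "c < d"
 have c: "pf2 x x 0 1 2 3 = pf5 x 4" "pf2 x x 0 1 2 4 = - pf5 x 3" "pf2 x x 0 1 3 4 = pf5 x 2"
  "pf2 x x 0 2 3 4 = - pf5 x 1" "pf2 x x 1 2 3 4 = pf5 x 0"
  unfolding pf5_values pf2_def by (simp_all only: sk) (simp_all add: algebra_simps)
 note sw = pf2_swap[OF x]
 have "Q (pf2 x x 0 1 c d)" if "(c, d) : {(2, 3), (2, 4), (3, 4)}" for c d using that c P Q(2) by auto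
 moreover have "(c, d) : {(2, 3), (2, 4), (3, 4)}" if ab: "a = 0" "b = 1"
 proof -
  have r: "Rep_bit1 b < Rep_bit1 c" "Rep_bit1 c < Rep_bit1 d" using inc by (simp_all add: less_bit1_def)
  have "Rep_bit1 (1::5) = 1" by (simp add: bit1.Rep_1)
  moreover have "0 <= Rep_bit1 x" "Rep_bit1 x < 5" for x :: 5 using Rep_bit1[of x] by simp_all
  moreover have eq: "x = 2 \<longleftrightarrow> Rep_bit1 x = 2" "x = 3 \<longleftrightarrow> Rep_bit1 x = 3" "x = 4 \<longleftrightarrow> Rep_bit1 x = 4" for x :: 5
   unfolding bit1.Rep_inject_sym by (simp_all add: bit1.Rep_numeral)
  ultimately show ?thesis using r ab unfolding insert_iff prod.inject eq empty_iff by (smt (verit))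
 qed
 ultimately show "Q (pf2 x x a b c d)"
  using increasing_quadruples_5[OF inc] c(4,5) P[of 0] Q(2)[OF P[of 1]] by auto
qed (use Q in auto)

lemma pf2_same_rows:
 assumes x: "alternating2 x" and Q: "Q 0" "!!a. Q a ==> Q (- a)" and q: "Q (pf2 x x a b c d)"
  and pqrs: "p : {a, b, c, d}" "q : {a, b, c, d}" "r : {a, b, c, d}" "s : {a, b, c, d}"
 shows "Q (pf2 x x p q r s)"
proof -
 note sw = pf2_swap[OF x]
 define R where "R p q r s \<longleftrightarrow> Q (pf2 x x p q r s)" for p q r s
 have s1: "R p q r s ==> R q p r s" for p q r s unfolding R_def by (metis Q(2) sw(1))
 have s2: "R p q r s ==> R p r q s" for p q r s unfolding R_def by (metis Q(2) sw(2))
 have s3: "R p q r s ==> R p q s r" for p q r s unfolding R_def by (metis Q(2) sw(3))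
 have s4: "R p p r s" "R p q q s" "R p q r r" for p q r s unfolding R_def sw(4,5,6) by (rule Q(1))+
 note s = s1 s2 s3 s4
 have R: "R a b c d" using q by (simp add: R_def)
 have "EX b' c' d'. R p b' c' d' & {a, b, c, d} = {p, b', c', d'}"
 proof -
  from pqrs(1) consider "p = a" | "p = b" | "p = c" | "p = d" by blast
  thus ?thesis
  proof cases
   case 1 thus ?thesis using R by blast
  next
   case 2 thus ?thesis using s1[OF R] by (intro exI[of _ a] exI[of _ c] exI[of _ d]) auto
  next
   case 3 thus ?thesis using s1[OF s2[OF R]] by (intro exI[of _ a] exI[of _ b] exI[of _ d]) auto
  next
   case 4 thus ?thesis using s1[OF s2[OF s3[OF R]]] by (intro exI[of _ a] exI[of _ b] exI[of _ c]) auto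
  qed
 qed
 then obtain b' c' d' where 1: "R p b' c' d'" "{a, b, c, d} = {p, b', c', d'}" by blast
 have "R p q p s" for q s using s(2)[OF s(4)] .
 hence pp: "R p q r p" "R p q p s" for q r s using s(3) by blast+
 have "EX c'' d''. R p q c'' d'' & {a, b, c, d} = {p, q, c'', d''} \<or> q = p"
 proof -
  from pqrs(2) consider "q = p" | "q = b'" | "q = c'" | "q = d'" unfolding 1(2) by blast
  thus ?thesis
  proof cases
   case 3 thus ?thesis unfolding 1(2) using s2[OF 1(1)] by (intro exI[of _ b'] exI[of _ d']) auto
  next
   case 4 thus ?thesis unfolding 1(2) using s2[OF s3[OF 1(1)]] by (intro exI[of _ b'] exI[of _ c']) auto
  qed (use 1 in blast)+
 qed
 thus ?thesis
 proof (elim exE disjE conjE)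
  assume "q = p" thus ?thesis using s(4) by (simp add: R_def)
 next
  fix c'' d'' assume 2: "R p q c'' d''" "{a, b, c, d} = {p, q, c'', d''}"
  have "R p q r s" using pqrs(3,4) 2(1) s(3)[OF 2(1)] s(4,5,6) pp s(3)[OF s(5)] unfolding 2(2)
   by (elim insertE emptyE; hypsubst; assumption?; (rule s(4) s(5) s(6) pp s(3)[OF s(5)])?)
  thus ?thesis by (simp add: R_def)
 qed
qed

context dvr begin

lemma alternating2_lform: assumes "minimal_tensor c" shows "alternating2 (lform c)"
proof -
 have "lform c j i = - lform c i j" for i j
  unfolding lform_def minimalD(2)[OF assms, of j i] rhomD(5)[OF rhom_mconst] mult_minus_left sum_negf by (rule refl)
 moreover have "lform c i i = 0" for i by (simp add: lform_def minimalD(3)[OF assms] rhomD[OF rhom_mconst])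
 ultimately show ?thesis unfolding alternating2_def by blast
qed

lemma coef_pfp:
 "coef (pfp c p q r s) (sgl k 1 + sgl l 1) =
  (if k = l then pf2 (%i j. c i j k) (%i j. c i j k) p q r s
  else pf2 (%i j. c i j k) (%i j. c i j l) p q r s + pf2 (%i j. c i j l) (%i j. c i j k) p q r s)"
proof -
 let ?m = "sgl k 1 + sgl l (1::nat)"
 have pr: "coef (lform c i j * lform c i' j') ?m = (if k = l then c i j k * c i' j' k else c i j k * c i' j' l + c i j l * c i' j' k)" for i j i' j'
 proof -
  have "lform c i j * lform c i' j' = (SUM a:UNIV. SUM b:UNIV. sgl (sgl a 1 + sgl b 1) (c i j a * c i' j' b))"
   by (simp add: lform_def sum_product mconst_def mvar_def mult_single)
  hence "coef (lform c i j * lform c i' j') ?m = (SUM a:UNIV. SUM b:UNIV. if a = k & b = l \<or> a = l & b = k then c i j a * c i' j' b else 0)"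
   by (simp only: lookup_sum lookup_single when_def single_pair_eq_iff)
  also have "... = (SUM a:UNIV. (if a = k then c i j k * c i' j' l else 0) + (if a = l & k ~= l then c i j l * c i' j' k else 0))"
  proof (intro sum.cong refl)
   fix a
   have "(if a = k & b = l \<or> a = l & b = k then c i j a * c i' j' b else 0) =
    (if b = l then (if a = k then c i j k * c i' j' l else 0) else 0) + (if b = k then (if a = l & k ~= l then c i j l * c i' j' k else 0) else 0)" for b by auto
   thus "(SUM b:UNIV. if a = k & b = l \<or> a = l & b = k then c i j a * c i' j' b else 0) =
    (if a = k then c i j k * c i' j' l else 0) + (if a = l & k ~= l then c i j l * c i' j' k else 0)"
    by (simp only: sum.distrib) simp
  qed
  also have "... = c i j k * c i' j' l + (if k ~= l then c i j l * c i' j' k else 0)"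
  proof -
   have "(if a = l & k ~= l then c i j l * c i' j' k else 0) = (if a = l then (if k ~= l then c i j l * c i' j' k else 0) else 0)" for a by auto
   thus ?thesis by (simp only: sum.distrib) simp
  qed
  finally show ?thesis by auto
 qed
 show ?thesis unfolding pf2_def lookup_add lookup_minus pr by (cases "k = l") (simp_all add: algebra_simps)
qed

lemma isotropicI:
 assumes "!!p q r s. p : J ==> q : J ==> r : J ==> s : J ==> restr K (pfp c p q r s) : N"
 shows "isotropic c J K"
proof -
 have cc: "coef (pfp c p q r s) (sgl k 1 + sgl l 1) : Mv"
  if "p : J" "q : J" "r : J" "s : J" "k : K" "l : K" for p q r s k l
 proof -
  have *: "coef (restr K (pfp c p q r s)) (sgl k 1 + sgl l 1) : Mv"
   using assms[OF that(1-4)] unfolding mpols_over_def by blast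
  have "ALL u. u ~: K --> coef (sgl k 1 + sgl l (1::nat)) u = 0"
   using that(5,6) by (auto simp: lookup_add lookup_single when_def)
  from * show ?thesis unfolding coef_restr if_P[OF \<open>ALL u. u ~: K --> coef (sgl k 1 + sgl l (1::nat)) u = 0\<close>] .
 qed
 have 1: "pf2 (%i j. c i j k) (%i j. c i j k) p q r s : Mv" if "p : J" "q : J" "r : J" "s : J" "k : K" for p q r s k
  using cc[OF that that(5)] unfolding coef_pfp by simp
 show ?thesis unfolding isotropic_def
 proof (intro ballI conjI 1)
  fix p q r s k l assume *: "p : J" "q : J" "r : J" "s : J" "k : K" "l : K"
  show "pf2 (%i j. c i j k) (%i j. c i j l) p q r s + pf2 (%i j. c i j l) (%i j. c i j k) p q r s : Mv"
   using cc[OF *] M_closed(3)[OF 1[OF *(1-5)] 1[OF *(1-5)]] unfolding coef_pfp by (cases "k = l") simp_all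
 qed
qed

text \<open>The Pfaffians with indices among these four rows are 0 or this one up to sign, so the
  rows would be isotropic in all variables, which \<open>no_isotropic_rows\<close> forbids.\<close>

lemma isotropic_rows_of_pfaffian:
 assumes c: "minimal_tensor c" and z: "pfp c a b d e : N" and dist: "card {a, b, d, e} = 4"
 shows False
proof (rule no_isotropic_rows[OF c _ dist])
 show "isotropic c {a, b, d, e} UNIV"
 proof (rule isotropicI)
  fix p q r s assume pqrs: "p : {a, b, d, e}" "q : {a, b, d, e}" "r : {a, b, d, e}" "s : {a, b, d, e}"
  have "pfp c p q r s : N"
   by (rule pf2_same_rows[OF alternating2_lform[OF c], where Q = "%y. y : N", OF N_closed(2) _ z pqrs]) (rule N_closed(6))
  thus "restr UNIV (pfp c p q r s) : N" by (rule restr_props(4))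
 qed
qed

lemma lform_split: "lform c i j = restr V4 (lform c i j) + mconst (c i j 2) * mvar 2"
proof -
 have "restr V4 (lform c i j) = (SUM k:UNIV. mconst (c i j k) * (if k : V4 then mvar k else 0))"
  by (simp add: lform_def rhomD[OF rhom_restr]) (simp add: restr_def rhom_mconst)
 also have "... + mconst (c i j 2) * mvar 2 = lform c i j" by (simp add: lform_def sum_5 algebra_simps)
 finally show ?thesis ..
qed

lemma coef_lform: "coef (lform c i j) (sgl k 1) = c i j k"
proof -
 have "l = k" if e: "sgl l (1::nat) = sgl k 1" for l
  using arg_cong[OF e, of "%m. coef m l"] by (simp add: lookup_single when_def split: if_splits)
 hence inj: "sgl l (1::nat) = sgl k 1 \<longleftrightarrow> l = k" for l by metis
 have "coef (lform c i j) (sgl k 1) = (SUM l:UNIV. if l = k then c i j k else 0)"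
  unfolding lform_def lookup_sum coef_mconst_mult mvar_def lookup_single when_def inj by (intro sum.cong refl) auto
 thus ?thesis by simp
qed

lemma lform_N: "lform c i j : N ==> c i j k : Mv"
 using coef_lform[of c i j k] unfolding mpols_over_def by (metis (no_types, lifting) mem_Collect_eq)

lemma projection_data_trivial: assumes "mvar 2 : P" "1 ~: P" shows "projection_data P 1 0 0"
proof -
 have "1 : (vars_in V4 :: 'a pol5 set)" "0 : (vars_in V4 :: 'a pol5 set)" by (rule sub_ringD[OF sub_ring_vars_in])+
 moreover have "form_of_degree 0 (1 :: 'a pol5)" using form_mconst[of "1 :: 'a"] unfolding rhomD(1)[OF rhom_mconst] .
 ultimately show ?thesis unfolding projection_data_def using assms S_closed(1,2) by simp
qed

end

section \<open>Exclusion of large primes by the linear forms they contain\<close>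

context dvr_closed begin

text \<open>Modulo \<open>x_2\<close> and \<open>x_4\<close> the Pfaffians are forms of
  \<open>P\<close> in three variables, hence zero modulo \<open>N\<close>: the plane
  \<open>x_2 = x_4 = 0\<close> is isotropic.\<close>

lemma no_big_prime_two_linear: assumes b: "big_prime c P" and x: "mvar 2 : P" "mvar 4 : P" shows False
proof -
 have pr: "is_prime S P" "minimal_tensor c" "!!p q r s. pfp c p q r s : P" "1 ~: P" using b by (auto simp: big_prime_def is_prime_def)
 note iP = is_primeD(1)[OF pr(1)]
 have "projection_data P 1 0 0" by (rule projection_data_trivial[OF x(1) pr(4)])
 moreover have "coef (mvar 4 :: 'a pol5) (sgl 4 1) ~: Mv" by (simp add: mvar_def)
 moreover have "mvar 4 : vars_in V4" by (rule vars_in_gens) simp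
 ultimately have z: "G : N" if "G : P" "G : S" "G : vars_in V3" "form_of_degree d G" for G d
  using no_form_in_three_variables[OF b _ x(2) S_gens(2) _ form_mvar] that by blast
 have out: "mvar i : P" if "i ~: V3" for i using that exhaust_5[of i] x by auto
 have "restr V3 (pfp c p q r s) : N" for p q r s
 proof (rule z)
  have "pfp c p q r s - restr V3 (pfp c p q r s) : P" by (rule restr_cong[OF iP out pfp_S[OF pr(2)]])
  from is_idealD(7)[OF sub_ring_S iP pr(3)[of p q r s] this] show "restr V3 (pfp c p q r s) : P" by simp
 qed (use restr_props form_pfp pfp_S[OF pr(2)] in blast)+
 hence "isotropic c UNIV V3" by (intro isotropicI)
 thus False by (rule no_isotropic_plane[OF pr(2)]) simp
qed

text \<open>On \<open>x_2 = 0\<close> the Pfaffians are multiples, with factors \<open>u i\<close>,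
  of one quadric modulo \<open>N\<close>. Cancelling the quadric in the syzygy of the Pfaffians
  shows that the combination of rows with coefficients \<open>u\<close> vanishes on
  \<open>x_2 = 0\<close>; a row operation then produces a row of multiples of
  \<open>x_2\<close>.\<close>

lemma no_big_prime_one_linear:
 assumes b: "big_prime c P" and x: "mvar 2 : P"
  and nolin: "!!l. l : S ==> l : vars_in V4 ==> form_of_degree 1 l ==> l : P ==> l : N"
 shows False
proof -
 have pr: "is_prime S P" "minimal_tensor c" "!!p q r s. pfp c p q r s : P" "1 ~: P" using b by (auto simp: big_prime_def is_prime_def)
 note iP = is_primeD(1)[OF pr(1)]
 note pd = projection_data_trivial[OF x pr(4)]
 have out: "mvar i : P" if "i ~: V4" for i using that exhaust_5[of i] x by auto
 define q where "q i = restr V4 (pf5 (lform c) i)" for i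
 have qi: "q i : P" "q i : S" "q i : vars_in V4" "form_of_degree 2 (q i)" for i
 proof -
  have "pf5 (lform c) i - q i : P" unfolding q_def pf5_def by (rule restr_cong[OF iP out pfp_S[OF pr(2)]])
  from is_idealD(7)[OF sub_ring_S iP pr(3)[of "i + 1" "i + 2" "i + 3" "i + 4"] this[unfolded pf5_def]] show "q i : P" by simp
  show "q i : S" "q i : vars_in V4" "form_of_degree 2 (q i)"
   unfolding q_def pf5_def using restr_props form_pfp pfp_S[OF pr(2)] by blast+
 qed
 show False
 proof (cases "ALL i. q i : N")
  case True
  \<comment> \<open>A hyperplane on which all Pfaffians vanish contains an isotropic plane.\<close>
  have "restr V3 (pfp c p r s t) : N" for p r s t
  proof (rule pf2_from_pf5[OF alternating2_lform[OF pr(2)], where Q = "%y. restr V3 y : N"])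
   fix i
   have "restr V3 (pf5 (lform c) i) = restr V3 (q i)" unfolding q_def by (rule poly_mapping_eqI) (auto simp: coef_restr)
   thus "restr V3 (pf5 (lform c) i) : N" using True restr_props(4) by simp
  qed (simp_all add: rhomD[OF rhom_restr] N_closed(2,6))
  hence "isotropic c UNIV V3" by (intro isotropicI)
  thus False by (rule no_isotropic_plane[OF pr(2)]) simp
 next
  case False
  then obtain i0 where i0: "q i0 ~: N" by blast
  have "ALL i. EX \<alpha>:Ov. q i - mconst \<alpha> * q i0 : N" using proportional_quadrics[OF b pd nolin qi qi i0] by blast
  then obtain u where u: "!!i. u i : Ov" "!!i. q i - mconst (u i) * q i0 : N" by metis
  have "u i0 ~: Mv"
  proof
   assume "u i0 : Mv"
   hence "mconst (u i0) * q i0 : N" using N_closed(5)[OF qi(2)] by simp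
   thus False using N_closed(3)[OF u(2)[of i0]] i0 by fastforce
  qed
  have "(SUM j:UNIV. mconst (u j) * restr V4 (lform c i j)) : N" for i
  proof -
   have "restr V4 (SUM j:UNIV. lform c i j * pf5 (lform c) j) = 0" by (simp add: pf5_syzygy[OF alternating2_lform[OF pr(2)]] rhomD[OF rhom_restr])
   hence "(SUM j:UNIV. restr V4 (lform c i j) * q j) = 0" by (simp add: rhomD[OF rhom_restr] q_def)
   moreover have "(SUM j:UNIV. restr V4 (lform c i j) * (q j - mconst (u j) * q i0)) =
    (SUM j:UNIV. restr V4 (lform c i j) * q j) - q i0 * (SUM j:UNIV. mconst (u j) * restr V4 (lform c i j))"
    unfolding sum_distrib_left sum_subtractf[symmetric] by (intro sum.cong refl) (simp add: algebra_simps)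
   ultimately have "q i0 * (SUM j:UNIV. mconst (u j) * restr V4 (lform c i j)) = - (SUM j:UNIV. restr V4 (lform c i j) * (q j - mconst (u j) * q i0))"
    by simp
   also have "... : N" using u(2) restr_props(3)[OF lform_S[OF pr(2)]] by (intro N_closed(6,8,4))
   finally have "q i0 * (SUM j:UNIV. mconst (u j) * restr V4 (lform c i j)) : N" .
   moreover have "(SUM j:UNIV. mconst (u j) * restr V4 (lform c i j)) : S"
    using u(1) restr_props(3)[OF lform_S[OF pr(2)]] by (intro S_closed(8,5)) auto
   ultimately show ?thesis using N_prime[OF qi(2)] i0 by blast
  qed
  hence sum: "(SUM j:UNIV. u j * c i j k) : Mv" if "k ~= 2" for i k
  proof -
   have cr: "coef (restr V4 (lform c i j)) (sgl k 1) = c i j k" for j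
   proof -
    have "ALL u. u ~: V4 --> coef (sgl k (1::nat)) u = 0"
     using that exhaust_5[of k] by (auto simp: lookup_single when_def)
    thus ?thesis unfolding coef_restr coef_lform by (rule if_P)
   qed
   have "coef (SUM j:UNIV. mconst (u j) * restr V4 (lform c i j)) (sgl k 1) : Mv"
    using \<open>!!i. (SUM j:UNIV. mconst (u j) * restr V4 (lform c i j)) : N\<close>[of i] unfolding mpols_over_def by blast
   thus ?thesis by (simp only: lookup_sum coef_mconst_mult cr)
  qed
  define d where "d = row_act (vec_mat i0 u) c"
  have d: "minimal_tensor d" unfolding d_def by (rule minimal_row_act[OF pr(2) _ GLO_1]) (rule GLO_mats(2)[where n = u and r = i0, OF u(1) \<open>u i0 ~: Mv\<close>])
  have "d i0 j k : Mv" if "k ~= 2" for j k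
  proof (cases "j = i0")
   case True thus ?thesis using minimalD(3)[OF d] by simp
  next
   case False
   have "d i0 j k = (SUM a:UNIV. u a * c a j k)" unfolding d_def by (rule row_act_vec_mat[OF False])
   also have "... = - (SUM a:UNIV. u a * c j a k)"
    unfolding sum_negf[symmetric] by (intro sum.cong refl) (simp only: minimalD(2)[OF pr(2), of _ j] mult_minus_right)
   also have "... : Mv" by (rule M_closed(6)[OF sum[OF that]])
   finally show ?thesis .
  qed
  thus False using no_rank1_row[OF d] by blast
 qed
qed

end

context dvr begin

lemma no_linear_form_move:
 assumes b: "big_prime c P" and B: "GLO B" and nolin: "!!l. l : S ==> form_of_degree 1 l ==> l : P ==> l : N"
 shows "EX P'. big_prime (col_act B c) P' & (ALL l:S. form_of_degree 1 l --> l : P' --> l : N)"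
proof -
 from GLO_inverse[OF B] obtain B' where B': "GLO B'" "B ** B' = mat 1" "B' ** B = mat 1" by blast
 from big_prime_move[OF b B B'] obtain P' where P': "big_prime (col_act B c) P'" "ALL f:S. subst B f : P' \<longleftrightarrow> f : P" by blast
 have O: "!!i j. B $ i $ j : Ov" "!!i j. B' $ i $ j : Ov" using B B'(1) by (simp_all add: GLO_def)
 have "l : N" if l: "l : S" "form_of_degree 1 l" "l : P'" for l
 proof -
  have e: "subst B (subst B' l) = l" by (simp only: subst_subst B'(2) subst_1)
  have s: "subst B' l : S" by (rule subst_S[OF O(2) l(1)])
  hence "subst B' l : P" using P'(2) l(3) e by metis
  hence "subst B' l : N" using nolin[OF s form_subst_mat[OF l(2)]] by blast
  thus ?thesis using subst_N[OF O(1)] e by metis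
 qed
 thus ?thesis using P'(1) by blast
qed

end

context dvr_closed begin

text \<open>Once the point of rank two is the coordinate point of \<open>x_2\<close>, row operations
  leave \<open>x_2\<close> only in the entry \<open>(a, b)\<close> modulo \<open>Mv\<close>. A
  Pfaffian on \<open>a, b\<close> and two other rows is then linear in \<open>x_2\<close> and
  provides the projection. The Pfaffians on \<open>a, e1, e2, e3\<close> and
  \<open>b, e1, e2, e3\<close> are free of \<open>x_2\<close>, hence proportional unless one is
  zero; after a row operation one of them vanishes, which is excluded.\<close>

lemma no_big_prime_no_linear:
 assumes b0: "big_prime c0 P0" and nolin0: "!!l. l : S ==> form_of_degree 1 l ==> l : P0 ==> l : N"
 shows False
proof -
 have c0: "minimal_tensor c0" using b0 by (simp add: big_prime_def)
 from exists_rank2_point[OF c0] obtain w r0 where w: "!!k. w k : Ov" "w r0 ~: Mv"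
  and iso: "!!p q r s. pf2 (point_tensor c0 w) (point_tensor c0 w) p q r s : Mv" by blast
 \<comment> \<open>The matrix \<open>vec_mat r0 w\<close> makes \<open>w\<close> the
   \<open>r0\<close>-th coordinate point, and the transposition turns this into the coordinate point
   of \<open>x_2\<close>.\<close>
 define \<sigma> where "\<sigma> = Transposition.transpose r0 (2::5)"
 have \<sigma>: "\<sigma> permutes UNIV" "\<sigma> 2 = r0" unfolding \<sigma>_def by (simp_all add: permutes_swap_id)
 have G1: "GLO (vec_mat r0 w)" by (rule GLO_mats(2)[where n = w and r = r0, OF w])
 have G2: "GLO (perm_mat \<sigma> :: 'a^5^5)" by (rule GLO_mats(3)[where n = w, OF w(1) \<sigma>(1)])
 from no_linear_form_move[OF b0 G1 nolin0] obtain P1 where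
  P1: "big_prime (col_act (vec_mat r0 w) c0) P1" "!!l. l : S ==> form_of_degree 1 l ==> l : P1 ==> l : N" by blast
 define c where "c = col_act (perm_mat \<sigma>) (col_act (vec_mat r0 w) c0)"
 from no_linear_form_move[OF P1(1) G2 P1(2)] obtain P where
  P: "big_prime c P" and nolin: "!!l. l : S ==> form_of_degree 1 l ==> l : P ==> l : N" unfolding c_def by blast
 have c: "minimal_tensor c" using P by (simp add: big_prime_def)
 have c2: "(%i j. c i j 2) = point_tensor c0 w"
  unfolding c_def col_act_perm_mat \<sigma>(2) col_act_vec_mat point_tensor_def by (simp add: mult.commute)
 have "isotropic c UNIV {2}"
 proof -
  have "2 * pf2 (point_tensor c0 w) (point_tensor c0 w) p q r s : Mv" for p q r s
   using M_closed(3)[OF iso[of p q r s] iso[of p q r s]] unfolding mult_2 .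
  thus ?thesis unfolding isotropic_def using iso by (auto simp: c2)
 qed
 moreover have "EX a b. c a b 2 ~: Mv" using no_zero_column[OF c, of 2] by blast
 then obtain a b where ab: "c a b 2 ~: Mv" by blast
 moreover have "a ~= b" using ab minimalD(3)[OF c] by auto
 ultimately have "EX A d. GLO A & d = row_act A c & minimal_tensor d & isotropic d UNIV {2} & d a b 2 = c a b 2 &
  (ALL j:UNIV - {a, b}. d a j 2 = 0 & d b j 2 = 0) & (ALL i:UNIV - {a, b}. ALL j:UNIV - {a, b}. ALL k:{2}. d i j k : Mv)"
  using isotropic_normal_form[OF c, where J = UNIV and K = "{2}" and a = a and b = b and ?k0.0 = 2] by blast
 then obtain A d where A: "GLO A" "d = row_act A c" and d: "minimal_tensor d" and dab: "d a b 2 ~: Mv"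
  and d0: "ALL j:UNIV - {a, b}. d a j 2 = 0 & d b j 2 = 0" and dM: "ALL i:UNIV - {a, b}. ALL j:UNIV - {a, b}. d i j 2 : Mv"
  using ab by (elim exE conjE) auto
 have big: "big_prime d P" unfolding A(2) by (rule big_prime_row[OF P A(1)])
 have pr: "is_prime S P" "!!p q r s. pfp d p q r s : P" "1 ~: P" "N \<subseteq> P" using big by (auto simp: big_prime_def is_prime_def)
 note iP = is_idealD[OF sub_ring_S is_primeD(1)[OF pr(1)]]
 have "card (UNIV - {a, b} :: 5 set) = 3" using \<open>a ~= b\<close> by (simp add: card_Diff_subset card_UNIV_5)
 then obtain e1 e2 e3 where R: "UNIV - {a, b} = {e1, e2, e3}" and e: "e1 ~= e2" "e1 ~= e3" "e2 ~= e3"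
  unfolding card_3_iff by blast
 have eab: "e1 ~= a" "e2 ~= a" "e3 ~= a" "e1 ~= b" "e2 ~= b" "e3 ~= b" using R by blast+
 define L where "L i j = restr V4 (lform d i j)" for i j
 define n where "n i j = mconst (d i j 2) * mvar (2::5)" for i j
 have L: "L i j : S" "L i j : vars_in V4" "form_of_degree 1 (L i j)" for i j
  unfolding L_def using restr_props lform_S[OF d] form_lform by blast+
 have ln: "lform d i j = L i j + n i j" for i j unfolding L_def n_def by (rule lform_split)
 have nN: "n i j : N" if "d i j 2 : Mv" for i j unfolding n_def using that by (intro N_closed(5)[OF S_gens(2)]) simp
 have nR: "n p q : N" if "p : {e1, e2, e3}" "q : {e1, e2, e3}" for p q using nN dM that unfolding R by blast
 have n0: "n a p = 0" "n b p = 0" if "p : {e1, e2, e3}" for p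
  using d0 that unfolding R n_def by (auto simp: rhomD(4)[OF rhom_mconst])
 have "EX p:{e1, e2, e3}. EX q:{e1, e2, e3}. L p q ~: N"
 proof (rule ccontr)
  assume no: "\<not> ?thesis"
  have "d p q k : Mv" if "p : {e1, e2, e3}" "q : {e1, e2, e3}" for p q k
  proof (rule lform_N, unfold ln, rule N_closed(3)[OF _ nR[OF that]])
   show "L p q : N" using no that by blast
  qed
  thus False using no_zero_block[OF d, of "{e1, e2, e3}"] e by simp
 qed
 then obtain p q where pq: "p : {e1, e2, e3}" "q : {e1, e2, e3}" "L p q ~: N" by blast
 \<comment> \<open>Up to \<open>N\<close>, the Pfaffian on \<open>a, b, p, q\<close> is
   \<open>s x_2 + t\<close>.\<close>
 define s where "s = mconst (d a b 2) * L p q"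
 define t where "t = L a b * L p q - L a p * L b q + L a q * L b p"
 have dO: "d a b 2 : Ov" by (rule minimalD(1)[OF d])
 have "mconst (d a b 2) ~: P"
 proof
  assume "mconst (d a b 2) : P"
  hence "mconst (inverse (d a b 2)) * mconst (d a b 2) : P" using unitD(2)[OF dO dab] by (intro iP(4)) simp_all
  thus False using pr(3) unitD(1)[OF dO dab] by (simp add: rhomD(3)[OF rhom_mconst, symmetric] rhomD(1)[OF rhom_mconst])
 qed
 moreover have "L p q ~: P" using nolin[OF L(1) L(3)] pq(3) by blast
 ultimately have sP: "s ~: P" unfolding s_def using is_primeD(3)[OF pr(1) _ L(1), of "mconst (d a b 2)" p q] dO by auto
 have sS: "s : S" "s : vars_in V4" "form_of_degree 1 s"
  unfolding s_def using dO by (intro S_closed(5) L sub_ringD(5)[OF sub_ring_vars_in] vars_in_gens form_mconst_mult; simp)+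
 have tS: "t : S" "t : vars_in V4" unfolding t_def
  by (intro S_closed(4,5,6) L sub_ringD(4,5,6)[OF sub_ring_vars_in])+
 have t2: "form_of_degree 2 t"
  unfolding t_def using form_mult[OF L(3) L(3)] by (intro form_add form_diff) (simp_all add: numeral_2_eq_2)
 have "s * mvar 2 + t = pfp d a b p q - lform d a b * n p q"
  unfolding pf2_def s_def t_def ln n0[OF pq(1)] n0[OF pq(2)] by (simp add: n_def algebra_simps)
 also have "... : P" using nR[OF pq(1,2)] pr(4) by (intro iP(7) pr(2) iP(4)[OF lform_S[OF d]]) blast
 finally have pd: "projection_data P s t 1"
  unfolding projection_data_def using sS tS t2 sP by (simp add: numeral_2_eq_2)
 define Q where "Q y = restr V4 (pfp d y e1 e2 e3)" for y
 have Qd: "pfp d y e1 e2 e3 - Q y : N" if "y : {a, b}" for y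
 proof -
  have n0y: "n y e1 = 0" "n y e2 = 0" "n y e3 = 0" using n0 that by auto
  have "Q y = L y e1 * L e2 e3 - L y e2 * L e1 e3 + L y e3 * L e1 e2"
   unfolding Q_def pf2_def L_def by (simp add: rhomD[OF rhom_restr])
  hence "pfp d y e1 e2 e3 - Q y = L y e1 * n e2 e3 - L y e2 * n e1 e3 + L y e3 * n e1 e2"
   unfolding pf2_def ln n0y by (simp add: algebra_simps)
  also have "... : N" by (intro N_closed(3,7) N_closed(4)[OF L(1)] nR) simp_all
  finally show ?thesis .
 qed
 have Q: "Q y : P" "Q y : S" "Q y : vars_in V4" "form_of_degree 2 (Q y)" if "y : {a, b}" for y
 proof -
  have "pfp d y e1 e2 e3 - (pfp d y e1 e2 e3 - Q y) : P" by (rule iP(7)[OF pr(2) subsetD[OF pr(4) Qd[OF that]]])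
  thus "Q y : P" by simp
  show "Q y : S" "Q y : vars_in V4" "form_of_degree 2 (Q y)"
   unfolding Q_def using restr_props form_pfp pfp_S[OF d] by blast+
 qed
 have card4: "card {a, e1, e2, e3} = 4" "card {b, e1, e2, e3} = 4" using e eab by auto
 show False
 proof (cases "Q a : N")
  case True
  hence "pfp d a e1 e2 e3 : N" using N_closed(3)[OF Qd[of a] True] by simp
  thus False by (rule isotropic_rows_of_pfaffian[OF d _ card4(1)])
 next
  case False
  have "EX \<alpha>:Ov. Q b - mconst \<alpha> * Q a : N"
   by (rule proportional_quadrics[OF big pd nolin Q(1) Q(2) Q(3) Q(4) Q(1) Q(2) Q(3) Q(4) False]) simp_all
  then obtain \<alpha> where \<alpha>: "\<alpha> : Ov" "Q b - mconst \<alpha> * Q a : N" by blast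
  define m where "m i = (if i = b then - \<alpha> else 0)" for i
  define d' where "d' = (%i j k. d i j k + m i * d a j k + m j * d i a k)"
  have d': "minimal_tensor d'" unfolding d'_def
   by (rule minimal_add_row[OF d]) (use \<alpha>(1) \<open>a ~= b\<close> O_closed(1,3) in \<open>auto simp: m_def\<close>)
  have lb: "lform d' b y = lform d b y - mconst \<alpha> * lform d a y" if "y ~= b" for y
   unfolding lform_def d'_def m_def using that
   by (simp add: rhomD[OF rhom_mconst] sum_subtractf[symmetric] sum_distrib_left left_diff_distrib mult.assoc)
  have ly: "lform d' y z = lform d y z" if "y ~= b" "z ~= b" for y z
   unfolding lform_def d'_def m_def using that by simp
  have "pfp d' b e1 e2 e3 = pfp d b e1 e2 e3 - mconst \<alpha> * pfp d a e1 e2 e3"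
   unfolding pf2_def using eab by (simp add: lb ly algebra_simps)
  also have "... = (pfp d b e1 e2 e3 - Q b) - mconst \<alpha> * (pfp d a e1 e2 e3 - Q a) + (Q b - mconst \<alpha> * Q a)" by (simp add: algebra_simps)
  also have "... : N" using \<alpha> by (intro N_closed(3,7) N_closed(4) Qd \<alpha>(2)) simp_all
  finally show False by (rule isotropic_rows_of_pfaffian[OF d' _ card4(2)])
 qed
qed

lemma no_big_prime: "\<not> big_prime c P"
proof
 assume b: "big_prime c P"
 show False
 proof (cases "EX l. l : S & form_of_degree 1 l & l : P & l ~: N")
  case False thus False using no_big_prime_no_linear[OF b] by blast
 next
  case True
  then obtain l where l: "l : S" "form_of_degree 1 l" "l : P" "l ~: N" by blast
  have "EX c' P'. big_prime c' P' & mvar 2 : P' & (ALL i:{}. mvar i : P')"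
   by (rule coordinate_change[OF b l]) simp_all
  then obtain c' P' where b': "big_prime c' P'" "mvar 2 : P'" by blast
  show False
  proof (cases "EX l. l : S & l : vars_in V4 & form_of_degree 1 l & l : P' & l ~: N")
   case False thus False using no_big_prime_one_linear[OF b'] by blast
  next
   case True
   then obtain l where l: "l : S" "form_of_degree 1 l" "l : P'" "l ~: N" "l : vars_in V4" by blast
   have "coef l (sgl 2 1) = 0"
   proof (rule ccontr)
    assume "coef l (sgl 2 1) ~= 0"
    hence "ALL u. u ~: V4 --> coef (sgl 2 (1::nat)) u = 0" using l(5) unfolding vars_in_def by blast
    from this[THEN spec, of 2] show False by (simp add: lookup_single)
   qed
   hence "EX c'' P''. big_prime c'' P'' & mvar 4 : P'' & (ALL i:{2}. mvar i : P'')"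
    using b'(2) by (intro coordinate_change[OF b'(1) l(1-4)]) simp_all
   thus False using no_big_prime_two_linear by blast
  qed
 qed
qed

end

section \<open>The Pfaffian ideal: elimination, normalisation and growth of its quotient\<close>

definition pf_comb :: "'a::comm_ring_1 tensor => (5 => 'a pol5) => 'a pol5" where
 "pf_comb c z = (SUM i:UNIV. z i * pf5 (lform c) i)"

lemma pf_comb_linear:
 "pf_comb c (%i. z i + z' i) = pf_comb c z + pf_comb c z'" "pf_comb c (%i. r * z i) = r * pf_comb c z"
 "pf_comb c (%i. z i - z' i) = pf_comb c z - pf_comb c z'" "pf_comb c (%i. 0) = 0"
 by (simp_all add: pf_comb_def sum.distrib sum_subtractf distrib_right left_diff_distrib sum_distrib_left mult.assoc)

lemma ideal_pf_comb:
 fixes c :: "'k::comm_ring_1 tensor"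
 assumes R: "sub_ring R" and c: "!!i. pf5 (lform c) i : mpols_over R"
 shows "is_ideal (mpols_over R) {pf_comb c z | z. ALL i. z i : mpols_over R}"
proof -
 note T = sub_ringD[OF sub_ring_mpols_over[OF R, where 'v = 5]]
 show ?thesis
 proof (rule is_idealI)
  show "{pf_comb c z | z. ALL i. z i : mpols_over R} \<subseteq> mpols_over R" unfolding pf_comb_def using c by (auto intro!: T(8) T(5))
  show "0 : {pf_comb c z | z. ALL i. z i : mpols_over R}" using pf_comb_linear(4)[of c] T(1) by (intro CollectI exI[of _ "%_. 0"]) simp
  fix a assume "a : {pf_comb c z | z. ALL i. z i : mpols_over R}"
  then obtain z where z: "a = pf_comb c z" "ALL i. z i : mpols_over R" by blast
  show "r * a : {pf_comb c z | z. ALL i. z i : mpols_over R}" if "r : mpols_over R" for r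
   using z T(5)[OF that] by (intro CollectI exI[of _ "%i. r * z i"]) (simp add: pf_comb_linear)
  fix b assume "b : {pf_comb c z | z. ALL i. z i : mpols_over R}"
  then obtain z' where z': "b = pf_comb c z'" "ALL i. z' i : mpols_over R" by blast
  show "a + b : {pf_comb c z | z. ALL i. z i : mpols_over R}"
   using z z' T(4) by (intro CollectI exI[of _ "%i. z i + z' i"]) (simp add: pf_comb_linear)
 qed
qed

lemma form_pf5: "form_of_degree 2 (pf5 (lform c) i)" unfolding pf5_def by (rule form_pfp)

lemma form_part_pf_comb:
 "form_part d (pf_comb c z) = pf_comb c (%i. if 2 <= d then form_part (d - 2) (z i) else 0)"
proof -
 have "form_part d (z i * pf5 (lform c) i) = (if 2 <= d then form_part (d - 2) (z i) else 0) * pf5 (lform c) i" for i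
  using form_part_mult[OF form_pf5, of d c i "z i"] by (simp add: mult.commute)
 thus ?thesis by (simp add: pf_comb_def form_part_sum)
qed

context dvr begin

text \<open>Explicit combinations of the five signed Pfaffians are easier to lift and to contract
  than a generated ideal; \<open>pfaffian_ideal_eq\<close> identifies the two. The ideal
  \<open>pfN\<close> is that of the special fibre, pulled back to \<open>S\<close>.\<close>

definition pfI :: "'a tensor => 'a pol5 set" where "pfI c = {pf_comb c z | z. ALL i. z i : S}"
definition pfN :: "'a tensor => 'a pol5 set" where "pfN c = {f + g | f g. f : pfI c & g : N}"

lemma pf5_S: "minimal_tensor c ==> pf5 (lform c) i : S" unfolding pf5_def by (rule pfp_S)

lemma ideal_pfI: "minimal_tensor c ==> is_ideal S (pfI c)"
 unfolding pfI_def by (rule ideal_pf_comb[OF sub_ring_O pf5_S])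

lemma ideal_add: assumes I: "is_ideal S I" and J: "is_ideal S J" shows "is_ideal S {f + g | f g. f : I & g : J}"
proof (rule is_idealI)
 note I = is_idealD[OF sub_ring_S I] and J = is_idealD[OF sub_ring_S J]
 show "{f + g | f g. f : I & g : J} \<subseteq> S" using I(1) J(1) S_closed(4) by blast
 show "0 : {f + g | f g. f : I & g : J}" using I(2) J(2) by force
 show "a + b : {f + g | f g. f : I & g : J}" if ab: "a : {f + g | f g. f : I & g : J}" "b : {f + g | f g. f : I & g : J}" for a b
 proof -
  from ab obtain f g f' g' where "a = f + g" "b = f' + g'" "f : I" "g : J" "f' : I" "g' : J" by blast
  thus ?thesis using I(3) J(3) by (intro CollectI exI[of _ "f + f'"] exI[of _ "g + g'"]) (simp add: algebra_simps)
 qed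
 show "r * a : {f + g | f g. f : I & g : J}" if ra: "r : S" "a : {f + g | f g. f : I & g : J}" for r a
 proof -
  from ra obtain f g where "a = f + g" "f : I" "g : J" by blast
  thus ?thesis using I(4)[OF ra(1)] J(4)[OF ra(1)] by (intro CollectI exI[of _ "r * f"] exI[of _ "r * g"]) (simp add: algebra_simps)
 qed
qed

lemma ideal_pfN: "minimal_tensor c ==> is_ideal S (pfN c)"
 unfolding pfN_def by (rule ideal_add[OF ideal_pfI is_primeD(1)[OF prime_N]])

lemma pfI_pfN: "f : pfI c ==> f : pfN c" unfolding pfN_def using N_closed(2) by force

lemma N_pfN: assumes "minimal_tensor c" "f : N" shows "f : pfN c"
 unfolding pfN_def using is_idealD(2)[OF sub_ring_S ideal_pfI[OF assms(1)]] assms(2) by force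

lemma form_part_pfI: "f : pfI c ==> form_part d f : pfI c"
proof -
 assume "f : pfI c"
 then obtain z where "f = pf_comb c z" "ALL i. z i : S" unfolding pfI_def by blast
 moreover have "form_part k (z i) : S" if "ALL i. z i : S" for k i using form_part_in[OF O_closed(1)] that by blast
 ultimately show ?thesis unfolding pfI_def using S_closed(1)
  by (intro CollectI exI[of _ "%i. if 2 <= d then form_part (d - 2) (z i) else 0"]) (simp add: form_part_pf_comb)
qed

lemma form_part_pfN: "f : pfN c ==> form_part d f : pfN c"
 unfolding pfN_def using form_part_pfI form_part_in[of Mv] form_part_add by fastforce

lemma pf5_pfI: "pf5 (lform c) i : pfI c"
proof -
 have "pf_comb c (%j. if j = i then 1 else 0) = (SUM j:UNIV. if j = i then pf5 (lform c) i else 0)"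
  unfolding pf_comb_def by (intro sum.cong refl) auto
 hence "pf5 (lform c) i = pf_comb c (%j. if j = i then 1 else 0)" by simp
 thus ?thesis unfolding pfI_def using S_closed(1,2) by (intro CollectI exI[of _ "%j. if j = i then 1 else 0"]) simp
qed

lemma pfp_pfI: assumes "minimal_tensor c" shows "pfp c p q r s : pfI c"
proof (rule pf2_from_pf5[OF alternating2_lform[OF assms], where Q = "%y. y : pfI c"])
 note I = is_idealD[OF sub_ring_S ideal_pfI[OF assms]]
 show "0 : pfI c" by (rule I(2))
 show "- a : pfI c" if "a : pfI c" for a by (rule I(6)[OF that])
qed (rule pf5_pfI)

end

context dvr_closed begin

text \<open>Otherwise the polynomials in \<open>x_0, x_1, x_w\<close> that are nonzero modulo
  \<open>N\<close> form a multiplicative set missing \<open>pfN c\<close>. A prime avoiding it is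
  big, because its quotient contains a polynomial ring in three variables over the residue field,
  whose graded pieces grow quadratically.\<close>

lemma elimination_form:
 assumes c: "minimal_tensor c" and w: "w ~= 0" "w ~= 1"
 shows "EX F e. F : S & F : vars_in {0, 1, w} & form_of_degree e F & F ~: N & F : pfN c"
proof (rule ccontr)
 assume no: "\<not> ?thesis"
 let ?T = "{f : S. f : vars_in {0, 1, w} & f ~: N}"
 have "pfN c \<inter> ?T = {}"
 proof (rule equals0I)
  fix f assume f: "f : pfN c \<inter> ?T"
  have "EX d. form_part d f ~: N"
  proof (rule ccontr)
   assume "\<not> ?thesis"
   hence "(SUM d:mon_deg ` supp f. form_part d f) : N" by (intro N_closed(8)) blast
   thus False using f sum_form_parts[of f] by simp
  qed
  then obtain d where d: "form_part d f ~: N" by blast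
  moreover have "form_part d f : S" "form_part d f : vars_in {0, 1, w}" "form_part d f : pfN c"
   using f form_part_in[OF O_closed(1)] vars_in_form_part form_part_pfN by blast+
  ultimately show False using no form_form_part[of d f] by blast
 qed
 moreover have "1 ~: N" using is_primeD(2)[OF prime_N] .
 moreover have "a * b : ?T" if "a : ?T" "b : ?T" for a b
  using that N_prime[of a b] S_closed(5)[of a b] sub_ringD(5)[OF sub_ring_vars_in, of a "{0, 1, w}" b] by blast
 ultimately have "EX P. is_prime S P & pfN c \<subseteq> P & P \<inter> ?T = {}"
  using S_closed(2) sub_ringD(2)[OF sub_ring_vars_in, of "{0, 1, w}"]
  by (intro exists_prime_avoiding[OF sub_ring_S ideal_pfN[OF c]]) blast+
 then obtain P where P: "is_prime S P" "pfN c \<subseteq> P" "P \<inter> ?T = {}" by blast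
 have "\<not> bounded_growth P"
 proof
  assume bg: "bounded_growth P"
  \<comment> \<open>The degree \<open>2 m\<close> leaves a nonnegative exponent for
    \<open>x_w\<close> whenever \<open>a, b <= m\<close>.\<close>
  define \<mu> where "\<mu> m a b = sgl 0 a + sgl 1 b + sgl w (2 * m - a - b)" for m a b :: nat
  define h where "h m a b = (mnm (\<mu> m a b) :: 'a pol5)" for m a b
  have inj: "\<mu> m a b = \<mu> m a' b' \<longleftrightarrow> a = a' & b = b'" for m a b a' b'
  proof
   assume e: "\<mu> m a b = \<mu> m a' b'"
   from arg_cong[OF e, of "%k. coef k 0"] arg_cong[OF e, of "%k. coef k 1"] show "a = a' & b = b'"
    using w unfolding \<mu>_def by (simp add: lookup_add lookup_single when_def)
  qed simp
  have hS: "h m a b : S" "h m a b : vars_in {0, 1, w}" for m a b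
   unfolding h_def by (rule S_gens(1), rule vars_in_single) (simp add: \<mu>_def lookup_add lookup_single when_def)
  have fd: "form_of_degree (2 * m) (h m a b)" if "a <= m" "b <= m" for m a b
   using that unfolding h_def form_single \<mu>_def by simp
  have "EX m c. (ALL a b. c a b : Ov) & (EX a<=m. EX b<=m. c a b = 1) & (SUM a<=m. SUM b<=m. mconst (c a b) * h m a b) : P"
   by (rule bounded_growth_relation[OF P(1) bg, where h = h and D = 2]) (rule hS(1) | erule (1) fd)+
  then obtain m g where g: "!!a b. g a b : Ov" "EX a<=m. EX b<=m. g a b = 1"
   "(SUM a<=m. SUM b<=m. mconst (g a b) * h m a b) : P" by blast
  let ?f = "SUM a<=m. SUM b<=m. mconst (g a b) * h m a b"
  from g(2) obtain a0 b0 where ab: "a0 <= m" "b0 <= m" "g a0 b0 = 1" by blast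
  have "coef ?f (\<mu> m a0 b0) = (SUM a<=m. SUM b<=m. if a = a0 & b = b0 then g a b else 0)"
   unfolding lookup_sum coef_mconst_mult h_def lookup_single when_def inj by (intro sum.cong refl) auto
  also have "... = (SUM a<=m. if a = a0 then (SUM b<=m. if b = b0 then g a b else 0) else 0)"
   by (intro sum.cong refl) auto
  also have "... = 1" using ab by simp
  finally have "?f ~: N" using one_notin_M unfolding mpols_over_def by (metis (no_types, lifting) mem_Collect_eq)
  moreover have "?f : S" using g(1) by (intro S_closed(8,5) hS(1)) simp
  moreover have "?f : vars_in {0, 1, w}"
   by (intro sub_ringD(8,5)[OF sub_ring_vars_in] hS(2) vars_in_gens)
  ultimately show False using g(3) P(3) by blast
 qed
 hence "big_prime c P" unfolding big_prime_def using c P pfI_pfN[OF pfp_pfI[OF c]] N_pfN[OF c] by blast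
 thus False using no_big_prime by blast
qed

end

context dvr begin

lemma subst_pf_comb: "subst B (pf_comb c z) = pf_comb (col_act B c) (%i. subst B (z i))"
 by (simp add: pf_comb_def rhomD[OF rhom_subst] pf5_def subst_pfp del: subst_gens)

lemma subst_pfI:
 assumes B: "GLO B" and f: "f : pfI c" shows "subst B f : pfI (col_act B c)"
proof -
 from f obtain z where z: "f = pf_comb c z" "ALL i. z i : S" unfolding pfI_def by blast
 have "subst B (z i) : S" for i using subst_S[of B "z i"] B z(2) by (simp add: GLO_def)
 thus ?thesis unfolding pfI_def z(1) subst_pf_comb by (intro CollectI exI[of _ "%i. subst B (z i)"]) simp
qed

lemma subst_pfN:
 assumes B: "GLO B" and f: "f : pfN c" shows "subst B f : pfN (col_act B c)"
proof -
 from f obtain g n where g: "f = g + n" "g : pfI c" "n : N" unfolding pfN_def by blast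
 have "subst B n : N" using subst_N[of B n] B g(3) by (simp add: GLO_def)
 thus ?thesis unfolding pfN_def g(1) rhomD(2)[OF rhom_subst] using subst_pfI[OF B g(2)] by blast
qed

text \<open>Nakayama's lemma in a single degree. The finitely many monomials outside
  \<open>B\<close> are discarded one at a time: such a monomial equals \<open>pp a\<close> times
  itself plus terms spanned by the others, and \<open>1 - pp a\<close> is a unit.\<close>

lemma nakayama:
 assumes J: "is_ideal S J" and gr: "!!f k. f : J ==> form_part k f : J" and B: "B \<subseteq> {m. mon_deg m = d}"
  and h: "!!f. f : S ==> form_of_degree d f ==> f : spanned {f + g | f g. f : J & g : N} B"
  and f: "f : S" "form_of_degree d f"
 shows "f : spanned J B"
proof -
 note sp = spanned_closed[OF J]
 have step: "ALL f. f : S --> form_of_degree d f --> f : spanned J B"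
  if "finite E" "E \<subseteq> {m. mon_deg m = d}" "E \<inter> B = {}" "ALL f. f : S --> form_of_degree d f --> f : spanned J (B \<union> E)" for E
  using that
 proof (induction E rule: finite_induct)
  case (insert m E)
  have fin: "finite (B \<union> E)" using finite_subset[OF B finite_mon_deg] insert.hyps by simp
  have m: "mon_deg m = d" "m ~: B \<union> E" "B \<union> insert m E = insert m (B \<union> E)" using insert by auto
  have span: "(SUM k:B \<union> E. mconst (g k) * mnm k) : spanned J (B \<union> E)" if "!!k. g k : Ov" for g
   by (intro sp(5) sp(3)[OF that] sp(4)[OF fin])
  have spanB: "(SUM k:B. mconst (g k) * mnm k) : spanned J (B \<union> E)" if "!!k. g k : Ov" for g
   by (intro sp(5) sp(3)[OF that] sp(4)[OF fin]) simp
  have ins: "EX a:Ov. f - mconst a * mnm m : spanned J (B \<union> E)" if f: "f : S" "form_of_degree d f" for f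
  proof -
   have "f : spanned J (insert m (B \<union> E))" using insert.prems(3) f m(3) by simp
   then obtain g where g: "!!k. g k : Ov" "f - (SUM k:insert m (B \<union> E). mconst (g k) * mnm k) : J" unfolding spanned_def by blast
   have "f - mconst (g m) * mnm m = (f - (SUM k:insert m (B \<union> E). mconst (g k) * mnm k)) + (SUM k:B \<union> E. mconst (g k) * mnm k)"
    using fin m(2) by simp
   also have "... : spanned J (B \<union> E)" by (rule sp(2)[OF sp(1)[OF g(2)] span[OF g(1)]])
   finally show ?thesis using g(1) by blast
  qed
  have fm: "form_of_degree d (mnm m :: 'a pol5)" unfolding form_single using m(1) by simp
  from h[OF S_gens(1) fm] obtain g j n where g: "!!k. g k : Ov" "mnm m - (SUM k:B. mconst (g k) * mnm k) = j + n" "j : J" "n : N"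
   unfolding spanned_def by blast
  have "form_of_degree d (mnm m - (SUM k:B. mconst (g k) * mnm k))"
   using B by (intro form_diff fm form_sum form_mconst_mult) (auto simp: form_single)
  hence e1: "mnm m - (SUM k:B. mconst (g k) * mnm k) = form_part d j + form_part d n"
   using form_part_form[of d "mnm m - (SUM k:B. mconst (g k) * mnm k)" d] unfolding g(2) form_part_add by simp
  have "form_part d n : N" by (rule form_part_in[OF zero_in_M g(4)])
  then obtain q where q: "q : S" "form_part d n = mconst pp * q" unfolding N_iff by blast
  have "form_of_degree d q" using form_form_part[of d n] pp(1) unfolding q(2) form_of_degree_alt by simp
  from ins[OF q(1) this] obtain a where a: "a : Ov" "q - mconst a * mnm m : spanned J (B \<union> E)" by blast
  define u where "u = 1 - pp * a"
  have ppa: "pp * a : Mv" using M_closed(5)[OF a(1) pp(4)] .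
  have u: "u : Ov" "u ~: Mv" unfolding u_def
   using O_closed(6)[OF O_closed(2) M_closed(1)[OF ppa]] M_closed(3)[OF ppa, of "1 - pp * a"] one_notin_M by auto
  have "mconst u * mnm m = (SUM k:B. mconst (g k) * mnm k) + form_part d j + mconst pp * (q - mconst a * mnm m)"
   using e1 unfolding q(2) u_def by (simp add: rhomD[OF rhom_mconst] algebra_simps)
  also have "... : spanned J (B \<union> E)" by (intro sp(2) spanB g(1) sp(1) gr g(3) sp(3) pp(3) a(2))
  finally have "mconst (inverse u) * (mconst u * mnm m) : spanned J (B \<union> E)" by (rule sp(3)[OF unitD(2)[OF u]])
  hence mm: "mnm m : spanned J (B \<union> E)" using unitD(1)[OF u]
   by (simp add: mult.assoc[symmetric] rhomD(3)[OF rhom_mconst, symmetric] rhomD(1)[OF rhom_mconst])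
  have "f : spanned J (B \<union> E)" if f: "f : S" "form_of_degree d f" for f
  proof -
   from ins[OF f] obtain a where a: "a : Ov" "f - mconst a * mnm m : spanned J (B \<union> E)" by blast
   from sp(2)[OF a(2) sp(3)[OF a(1) mm]] show ?thesis by simp
  qed
  thus ?case using insert by auto
 qed simp
 let ?M = "{m :: 5 \<Rightarrow>\<^sub>0 nat. mon_deg m = d}"
 have MB: "B \<union> (?M - B) = ?M" using B by auto
 have "g : spanned J (B \<union> (?M - B))" if g: "g : S" "form_of_degree d g" for g
 proof -
  have "(SUM m:supp g. mconst (coef g m) * mnm m) : spanned J ?M"
   using g by (intro sp(5) sp(3) sp(4)[OF finite_mon_deg]) (auto simp: mpols_over_def form_of_degree_def)
  moreover have "g = (SUM m:supp g. mconst (coef g m) * mnm m)"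
   unfolding single_conv[symmetric] by (rule poly_sum_single)
  ultimately show ?thesis unfolding MB by metis
 qed
 thus ?thesis using step[of "?M - B"] finite_mon_deg[of d] f by auto
qed

end

context dvr_closed begin

text \<open>The shear moves a point at which the elimination form is a unit to the coordinate point
  of \<open>x_r\<close>.\<close>

lemma shear_to_monic:
 assumes c: "minimal_tensor c" and r: "r ~= 0" "r ~= 1"
 shows "EX w F e. GLO (vec_mat r w) & minimal_tensor (col_act (vec_mat r w) c) & F : S & F : vars_in {0, 1, r} & form_of_degree e F &
  coef F (sgl r e) ~: Mv & F : pfN (col_act (vec_mat r w) c)"
proof -
 from elimination_form[OF c r] obtain F e where F: "F : S" "F : vars_in {0, 1, r}" "form_of_degree e F" "F ~: N" "F : pfN c" by blast
 from exists_nonzero_point_vars[OF F(1) F(4) F(3) F(2), of r] obtain w where w: "ALL i. w i : Ov" "w r = 1" "meval (%a. a) w F ~: Mv" by blast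
 have G: "GLO (vec_mat r w)" by (rule GLO_mats(2)[where n = w and r = r]) (use w in auto)
 have "minimal_tensor (col_act (vec_mat r w) c)" by (rule minimal_col_act[OF c GLO_1 G])
 moreover have "subst (vec_mat r w) F : S" using subst_S[of "vec_mat r w" F] G F(1) by (simp add: GLO_def)
 moreover have "subst (vec_mat r w) F : vars_in {0, 1, r}" by (rule subst_vec_mat_vars[OF F(2)]) simp
 moreover have "form_of_degree e (subst (vec_mat r w) F)" by (rule form_subst_mat[OF F(3)])
 moreover have "coef (subst (vec_mat r w) F) (sgl r e) ~: Mv" using subst_vec_mat_top(1)[OF F(3)] w(3) by simp
 moreover have "subst (vec_mat r w) F : pfN (col_act (vec_mat r w) c)" by (rule subst_pfN[OF G F(5)])
 ultimately show ?thesis using G by blast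
qed

text \<open>Noether normalisation of the special fibre over \<open>x_0, x_1\<close>. The order 4, 3,
  2 matters: the last shear may bring \<open>x_2\<close> into the form for \<open>x_3\<close>, but
  nothing brings in \<open>x_4\<close>, as \<open>monic_in\<close> requires; and leading
  coefficients survive the later shears.\<close>

lemma good_coordinates:
 assumes c: "minimal_tensor c"
 shows "EX B F e. GLO B & (ALL v:{2, 3, 4}. F v : pfN (col_act B c) & monic_in UNIV v (e v) (F v))"
proof -
 have n4: "(4::5) ~= 0" "(4::5) ~= 1" and n3: "(3::5) ~= 0" "(3::5) ~= 1" and n2: "(2::5) ~= 0" "(2::5) ~= 1" by simp_all
 from shear_to_monic[OF c n4] obtain w4 F4 e4 where 4: "GLO (vec_mat 4 w4)" "minimal_tensor (col_act (vec_mat 4 w4) c)" "F4 : S"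
  "form_of_degree e4 F4" "coef F4 (sgl 4 e4) ~: Mv" "F4 : pfN (col_act (vec_mat 4 w4) c)" by blast
 define c4 where "c4 = col_act (vec_mat 4 w4) c"
 from shear_to_monic[OF 4(2) n3] obtain w3 F3 e3 where 3: "GLO (vec_mat 3 w3)" "minimal_tensor (col_act (vec_mat 3 w3) c4)" "F3 : S"
  "form_of_degree e3 F3" "coef F3 (sgl 3 e3) ~: Mv" "F3 : pfN (col_act (vec_mat 3 w3) c4)" "F3 : vars_in {0, 1, 3}"
  unfolding c4_def by blast
 define c3 where "c3 = col_act (vec_mat 3 w3) c4"
 from shear_to_monic[OF 3(2) n2] obtain w2 F2 e2 where 2: "GLO (vec_mat 2 w2)" "minimal_tensor (col_act (vec_mat 2 w2) c3)" "F2 : S"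
  "form_of_degree e2 F2" "coef F2 (sgl 2 e2) ~: Mv" "F2 : pfN (col_act (vec_mat 2 w2) c3)" "F2 : vars_in {0, 1, 2}"
  unfolding c3_def by blast
 define c2 where "c2 = col_act (vec_mat 2 w2) c3"
 let ?s3 = "subst (vec_mat 3 w3)" and ?s2 = "subst (vec_mat 2 w2)"
 have O: "!!i j. vec_mat 3 w3 $ i $ j : Ov" "!!i j. vec_mat 2 w2 $ i $ j : Ov" using 3(1) 2(1) by (simp_all add: GLO_def)
 define G where "G = (%v::5. if v = 2 then F2 else if v = 3 then ?s2 F3 else ?s2 (?s3 F4))"
 define e where "e = (%v::5. if v = 2 then e2 else if v = 3 then e3 else e4)"
 define V where "V v = (if v = 2 then {0, 1, 2} else if v = 3 then {0, 1, 2, 3} else (UNIV :: 5 set))" for v :: 5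
 have GS: "G v : S" for v unfolding G_def using 2(3) subst_S[OF O(2) 3(3)] subst_S[OF O(2) subst_S[OF O(1) 4(3)]] by simp
 have Gf: "form_of_degree (e v) (G v)" for v unfolding G_def e_def using 2(4) form_subst_mat[OF 3(4)] form_subst_mat[OF form_subst_mat[OF 4(4)]] by simp
 have GV: "G v : vars_in (V v)" for v
 proof -
  have "?s2 F3 : vars_in {0, 1, 2, 3}" by (rule subst_vec_mat_vars[OF vars_in_mono[OF _ 3(7)]]) auto
  moreover have "f : vars_in UNIV" for f :: "'a pol5" by (simp add: vars_in_def)
  ultimately show ?thesis using 2(7) by (simp add: G_def V_def)
 qed
 have Gt: "coef (G v) (sgl v (e v)) ~: Mv" if "v : {2, 3, 4}" for v
 proof -
  have "coef (?s2 F3) (sgl 3 e3) = coef F3 (sgl 3 e3)" by (rule subst_vec_mat_top(2)[OF 3(4)]) simp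
  moreover have "coef (?s2 (?s3 F4)) (sgl 4 e4) = coef F4 (sgl 4 e4)"
   using subst_vec_mat_top(2)[OF form_subst_mat[OF 4(4)], of 4 2 w2] subst_vec_mat_top(2)[OF 4(4), of 4 3 w3] by simp
  ultimately show ?thesis using that 2(5) 3(5) 4(5) by (auto simp: G_def e_def)
 qed
 have GN: "G v : pfN c2" for v
  unfolding G_def c2_def using 2(6) subst_pfN[OF 2(1) 3(6)] subst_pfN[OF 2(1) subst_pfN[OF 3(1) 4(6)]] by (simp add: c3_def c4_def)
 define F where "F v = mconst (inverse (coef (G v) (sgl v (e v)))) * G v" for v
 have mc2: "minimal_tensor c2" using 2(2) by (simp add: c2_def)
 have "F v : pfN (col_act (vec_mat 2 w2 ** (vec_mat 3 w3 ** vec_mat 4 w4)) c) & monic_in UNIV v (e v) (F v)" if v: "v : {2, 3, 4}" for v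
 proof
  have cB: "c2 = col_act (vec_mat 2 w2 ** (vec_mat 3 w3 ** vec_mat 4 w4)) c" by (simp add: c2_def c3_def c4_def col_act_mult)
  have "coef (G v) (sgl v (e v)) : Ov" using GS[of v] by (simp add: mpols_over_def)
  from unitD(2)[OF this Gt[OF v]] show "F v : pfN (col_act (vec_mat 2 w2 ** (vec_mat 3 w3 ** vec_mat 4 w4)) c)"
   unfolding F_def cB[symmetric] by (intro is_idealD(4)[OF sub_ring_S ideal_pfN[OF mc2] _ GN]) simp
  have ab: "u ~: V v" if "above v u" for u using that unfolding above_def V_def by (elim disjE conjE) simp_all
  show "monic_in UNIV v (e v) (F v)" unfolding F_def by (rule monic_of_form[OF GS GV Gf Gt[OF v] ab]) simp_all
 qed
 hence "ALL v:{2, 3, 4}. F v : pfN (col_act (vec_mat 2 w2 ** (vec_mat 3 w3 ** vec_mat 4 w4)) c) & monic_in UNIV v (e v) (F v)" by (rule ballI)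
 moreover have "GLO (vec_mat 2 w2 ** (vec_mat 3 w3 ** vec_mat 4 w4))" by (intro GLO_mult 2(1) 3(1) 4(1))
 ultimately show ?thesis by (intro exI conjI)
qed

text \<open>In good coordinates the monomials with bounded exponents span modulo \<open>pfN\<close>,
  hence modulo \<open>pfI\<close> by \<open>nakayama\<close>; the inverse substitution carries them
  back to generators for the given model.\<close>

lemma pfaffian_quotient_growth:
 assumes c: "minimal_tensor c"
 shows "EX C. ALL d. EX G. finite G & G \<subseteq> S & card G <= C * (d + 1) &
  (ALL f:S. form_of_degree d f --> (EX g. (ALL e:G. g e : Ov) & f - (SUM e:G. mconst (g e) * e) : pfI c))"
proof -
 from good_coordinates[OF c] obtain B F e where B: "GLO B" and F0: "ALL v:{2, 3, 4}. F v : pfN (col_act B c) & monic_in UNIV v (e v) (F v)"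
  by (elim exE conjE)
 note F = bspec[OF F0]
 from GLO_inverse[OF B] obtain B' where B': "GLO B'" "B ** B' = mat 1" "B' ** B = mat 1" by blast
 have O: "!!i j. B $ i $ j : Ov" "!!i j. B' $ i $ j : Ov" using B B'(1) by (simp_all add: GLO_def)
 define c' where "c' = col_act B c"
 have c': "minimal_tensor c'" unfolding c'_def by (rule minimal_col_act[OF c GLO_1 B])
 have cc: "col_act B' c' = c" unfolding c'_def col_act_mult B'(3) by simp
 have ss: "subst B' (subst B f) = f" for f unfolding subst_subst B'(3) subst_1 ..
 define M where "M d = {m :: 5 \<Rightarrow>\<^sub>0 nat. mon_deg m = d & coef m 2 < e 2 & coef m 3 < e 3 & coef m 4 < e 4}" for d
 have sp: "f : spanned (pfI c') (M d)" if f: "f : S" "form_of_degree d f" for f d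
 proof (rule nakayama[OF ideal_pfI[OF c'] form_part_pfI _ _ f])
  show "M d \<subseteq> {m. mon_deg m = d}" by (auto simp: M_def)
  fix f assume f: "f : S" "form_of_degree d f"
  have "f : vars_in UNIV" by (simp add: vars_in_def)
  have "f : spanned (pfN c') {m. mon_deg m = d & (ALL u. u ~: UNIV --> coef m u = 0) & (ALL v:{2, 3, 4}. coef m v < e v)}"
   by (rule form_spanned[OF ideal_pfN[OF c'] subset_refl subset_UNIV F[folded c'_def] f(1) \<open>f : vars_in UNIV\<close> f(2)])
  thus "f : spanned {f + g | f g. f : pfI c' & g : N} (M d)" unfolding pfN_def[symmetric] by (simp add: M_def)
 qed
 have "EX G. finite G & G \<subseteq> S & card G <= (e 2 * (e 3 * e 4)) * (d + 1) &
  (ALL f:S. form_of_degree d f --> (EX g. (ALL e:G. g e : Ov) & f - (SUM e:G. mconst (g e) * e) : pfI c))" for d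
 proof (intro exI[of _ "(%m. subst B' (mnm m)) ` M d"] conjI ballI impI)
  have fin: "finite (M d)" by (rule finite_subset[OF _ finite_mon_deg[of d]]) (auto simp: M_def)
  thus "finite ((%m. subst B' (mnm m)) ` M d)" by simp
  show "(%m. subst B' (mnm m)) ` M d \<subseteq> S" using subst_S[OF O(2) S_gens(1)] by blast
  show "card ((%m. subst B' (mnm m)) ` M d) <= e 2 * (e 3 * e 4) * (d + 1)"
   by (rule order_trans[OF card_image_le[OF fin]]) (use card_bounded_monomials[of d "e 2" "e 3" "e 4"] in \<open>simp add: M_def mult.commute\<close>)
  fix f assume f: "f : S" "form_of_degree d f"
  from sp[OF subst_S[OF O(1) f(1)] form_subst_mat[OF f(2)]] obtain g where
   g: "ALL m. g m : Ov" "subst B f - (SUM m:M d. mconst (g m) * mnm m) : pfI c'" unfolding spanned_def by blast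
  have inj: "inj_on (%m. subst B' (mnm m)) (M d)"
  proof (rule inj_onI)
   fix m m' assume "subst B' (mnm m) = subst B' (mnm m')"
   from arg_cong[OF this, of "subst B"] have "(mnm m :: 'a pol5) = mnm m'" unfolding subst_subst B'(2) subst_1 .
   from arg_cong[OF this, of "%p. coef p m"] show "m = m'" by (simp add: lookup_single when_def split: if_splits)
  qed
  have "subst B' (subst B f - (SUM m:M d. mconst (g m) * mnm m)) : pfI c" using subst_pfI[OF B'(1) g(2)] unfolding cc .
  also have "subst B' (subst B f - (SUM m:M d. mconst (g m) * mnm m)) = f - (SUM m:M d. mconst (g m) * subst B' (mnm m))"
   by (simp only: rhomD[OF rhom_subst] ss subst_gens(1))
  also have "(SUM m:M d. mconst (g m) * subst B' (mnm m)) =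
   (SUM e:(%m. subst B' (mnm m)) ` M d. mconst (g (inv_into (M d) (%m. subst B' (mnm m)) e)) * e)"
   unfolding sum.reindex[OF inj] o_def by (intro sum.cong refl) (simp only: inv_into_f_f[OF inj])
  finally show "EX g. (ALL e:(%m. subst B' (mnm m)) ` M d. g e : Ov) & f - (SUM e:(%m. subst B' (mnm m)) ` M d. mconst (g e) * e) : pfI c"
   using g(1) by (intro exI[of _ "%e. g (inv_into (M d) (%m. subst B' (mnm m)) e)"]) simp
 qed
 thus ?thesis by blast
qed

end

section \<open>Syzygies of the Pfaffians\<close>

text \<open>The Pfaffian adjoint of the block on rows 1 to 4, bordered by zeros: the block times its
  adjoint is \<open>pf5 y 0\<close> times the identity.\<close>

definition cofactor4 :: "(5 => 5 => 'r::comm_ring_1) => 5 => 5 => 'r" where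
 "cofactor4 y s t =
  (if (s, t) = (1, 2) then - y 3 4 else if (s, t) = (1, 3) then y 2 4 else if (s, t) = (1, 4) then - y 2 3
  else if (s, t) = (2, 1) then y 3 4 else if (s, t) = (2, 3) then - y 1 4 else if (s, t) = (2, 4) then y 1 3
  else if (s, t) = (3, 1) then - y 2 4 else if (s, t) = (3, 2) then y 1 4 else if (s, t) = (3, 4) then - y 1 2
  else if (s, t) = (4, 1) then y 2 3 else if (s, t) = (4, 2) then - y 1 3 else if (s, t) = (4, 3) then y 1 2 else 0)"

lemma cofactor4_skew: "cofactor4 y t s = - cofactor4 y s t"
proof -
 have "ALL t. cofactor4 y t s = - cofactor4 y s t" using exhaust_5[of s]
  by (elim disjE; hypsubst; intro allI) (simp_all add: cofactor4_def)
 thus ?thesis by blast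
qed

text \<open>Row 0 of \<open>y\<close> lies outside the adjoint block; multiplied with the adjoint it
  gives the negatives of the remaining Pfaffians, which is the correction term.\<close>

lemma cofactor4_identity:
 assumes "alternating2 y"
 shows "(SUM s:UNIV. y a s * cofactor4 y s b) = (if a = b then pf5 y 0 else 0) - (if a = 0 then pf5 y b else 0)"
proof -
 note sk = alternating2_skew[OF assms]
 have v: "cofactor4 y 0 b = 0" "cofactor4 y s 0 = 0" "cofactor4 y 1 1 = 0" "cofactor4 y 2 2 = 0" "cofactor4 y 3 3 = 0" "cofactor4 y 4 4 = 0"
  "cofactor4 y 1 2 = - y 3 4" "cofactor4 y 1 3 = y 2 4" "cofactor4 y 1 4 = - y 2 3"
  "cofactor4 y 2 1 = y 3 4" "cofactor4 y 2 3 = - y 1 4" "cofactor4 y 2 4 = y 1 3"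
  "cofactor4 y 3 1 = - y 2 4" "cofactor4 y 3 2 = y 1 4" "cofactor4 y 3 4 = - y 1 2"
  "cofactor4 y 4 1 = y 2 3" "cofactor4 y 4 2 = - y 1 3" "cofactor4 y 4 3 = y 1 2" for s b
  by (simp_all add: cofactor4_def)
 have n: "(0::5) ~= 1" "(0::5) ~= 2" "(0::5) ~= 3" "(0::5) ~= 4" "(1::5) ~= 2" "(1::5) ~= 3" "(1::5) ~= 4" "(2::5) ~= 3" "(2::5) ~= 4" "(3::5) ~= 4"
  by simp_all
 have "ALL b. (SUM s:UNIV. y a s * cofactor4 y s b) = (if a = b then pf5 y 0 else 0) - (if a = 0 then pf5 y b else 0)"
 proof
  fix b
  show "(SUM s:UNIV. y a s * cofactor4 y s b) = (if a = b then pf5 y 0 else 0) - (if a = 0 then pf5 y b else 0)"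
   using exhaust_5[of a] exhaust_5[of b]
   by (elim disjE; hypsubst) (simp_all only: sum_5 v pf5_values pf2_def sk n n[symmetric] if_True if_False simp_thms; simp add: algebra_simps)+
 qed
 thus ?thesis by blast
qed

text \<open>The middle map of the complex whose outer maps are the Pfaffian vector
  \<open>pf5\<close> and \<open>pf_comb\<close>.\<close>

definition syz :: "'a::comm_ring_1 tensor => (5 => 'a pol5) => 5 => 'a pol5" where
 "syz c y a = (SUM k:UNIV. lform c a k * y k)"

lemma syz_linear:
 "syz c (%k. u k + w k) a = syz c u a + syz c w a" "syz c (%k. u k - w k) a = syz c u a - syz c w a"
 "syz c (%k. r * u k) a = r * syz c u a" "syz c (%k. SUM i:I. U i k) a = (SUM i:I. syz c (U i) a)"
 by (simp_all add: syz_def sum.distrib sum_subtractf distrib_left right_diff_distrib sum_distrib_left mult.left_commute sum.swap[of _ I])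

lemma coef_var_power_mult:
 "coef (mvar x ^ n * q) m = (if n <= coef m x then coef (q :: ('v::finite, 'a::comm_ring_1) mpol) (m - sgl x n) else 0)"
proof -
 have p: "mvar x ^ n = (sgl (sgl x n) 1 :: ('v, 'a) mpol)" by (simp add: mono_eq_mval mval_single)
 show ?thesis
 proof (cases "n <= coef m x")
  case True
  hence "m = sgl x n + (m - sgl x n)"
   by (intro poly_mapping_eqI) (auto simp: lookup_add lookup_minus lookup_single when_def)
  thus ?thesis unfolding p using coef_mult_single[of "sgl x n" 1 q "m - sgl x n"] True by simp
 next
  case False
  hence "!!k. m ~= sgl x n + k" by (auto simp: lookup_add)
  thus ?thesis unfolding p using coef_mult_single_not[of m "sgl x n" 1 q] False by simp
 qed
qed

context dvr begin

lemma divide_by_variable_power: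
 assumes f: "f : S"
 shows "EX q r. q : S & r : S & f = mvar x ^ n * q + r & (ALL m. coef r m = (if coef m x < n then coef f m else 0)) &
  (ALL m. coef q m = coef f (m + sgl x n))"
proof -
 define q where "q = Abs_poly_mapping (%m. coef f (m + sgl x n))"
 define r where "r = Abs_poly_mapping (%m. if coef m x < n then coef f m else 0)"
 have "finite ((%m. m + sgl x n) -` supp f)" by (intro finite_vimageI finite_keys injI) simp
 hence "finite {m. coef f (m + sgl x n) ~= 0}" by (rule rev_finite_subset) (auto simp: in_keys_iff)
 hence q: "coef q m = coef f (m + sgl x n)" for m unfolding q_def by (subst lookup_Abs_poly_mapping) auto
 have "finite {m. (if coef m x < n then coef f m else 0) ~= 0}" by (rule finite_subset[OF _ finite_keys[of f]]) (auto simp: in_keys_iff)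
 hence r: "coef r m = (if coef m x < n then coef f m else 0)" for m unfolding r_def by (subst lookup_Abs_poly_mapping) auto
 have m: "m - sgl x n + sgl x n = m" if "n <= coef m x" for m :: "5 \<Rightarrow>\<^sub>0 nat"
  using that by (intro poly_mapping_eqI) (auto simp: lookup_add lookup_minus lookup_single when_def)
 have "f = mvar x ^ n * q + r"
  by (rule poly_mapping_eqI) (auto simp: lookup_add coef_var_power_mult q r m)
 moreover have "q : S" "r : S" using f O_closed(1) unfolding mpols_over_def by (auto simp: q r)
 ultimately show ?thesis using q r by blast
qed

text \<open>The quotient of \<open>S\<close> by this prime is the polynomial ring over the residue
  field in the variables \<open>V\<close>. Exactness is first proved for \<open>{2, 3, 4}\<close>
  and then for larger sets.\<close>

definition JV :: "5 set => 'a pol5 set" where "JV V = {f : S. restr V f : N}"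

lemma prime_JV: "is_prime S (JV V)"
proof -
 have "is_ideal S (JV V)"
  unfolding JV_def using N_closed(2,3) N_closed(4)[OF restr_props(3)] S_closed(1,4,5)
  by (intro is_idealI) (auto simp: rhomD[OF rhom_restr])
 moreover have "1 ~: JV V" using is_primeD(2)[OF prime_N] by (simp add: JV_def rhomD[OF rhom_restr])
 moreover have "a : JV V \<or> b : JV V" if "a : S" "b : S" "a * b : JV V" for a b
  using that N_prime[OF restr_props(3) restr_props(3), of a b V V] by (auto simp: JV_def rhomD[OF rhom_restr])
 ultimately show ?thesis unfolding is_prime_def by blast
qed

lemmas JV_closed = is_idealD[OF sub_ring_S is_primeD(1)[OF prime_JV]]
lemmas JV_prime = is_primeD(3)[OF prime_JV]

lemma JV_iff: "f : S ==> f : JV V \<longleftrightarrow> (ALL m. (ALL u. u ~: V --> coef m u = 0) --> coef f m : Mv)"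
 unfolding JV_def mem_Collect_eq[of f] by (auto simp: mpols_over_def coef_restr)

lemma mvar_JV: "u : V ==> mvar u ~: JV V"
proof -
 assume "u : V"
 hence "ALL w. w ~: V --> coef (sgl u (1::nat)) w = 0" by (auto simp: lookup_single when_def)
 thus ?thesis unfolding JV_iff[OF S_gens(2)] unfolding mvar_def using one_notin_M by (metis lookup_single_eq)
qed

text \<open>The powers of two variables form a regular sequence: for a monomial \<open>m\<close>
  with exponent of \<open>Xx\<close> below \<open>n\<close>, compare coefficients at
  \<open>m Y^n\<close>.\<close>

lemma regular_two:
 assumes V: "Xx : V" "Y : V" "Xx ~= Y" and s: "\<alpha> : S" "\<beta> : S" and h: "mvar Xx ^ n * \<beta> - mvar Y ^ n * \<alpha> : JV V"
 shows "EX \<alpha>':S. \<alpha> - mvar Xx ^ n * \<alpha>' : JV V"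
proof -
 from divide_by_variable_power[OF s(1), of Xx n] obtain q r where q: "q : S" "r : S" "\<alpha> = mvar Xx ^ n * q + r"
  "ALL m. coef r m = (if coef m Xx < n then coef \<alpha> m else 0)" by (elim exE conjE)
 have hS: "mvar Xx ^ n * \<beta> - mvar Y ^ n * \<alpha> : S" using h by (simp add: JV_def)
 have "r : JV V" unfolding JV_iff[OF q(2)]
 proof (intro allI impI)
  fix m :: "5 \<Rightarrow>\<^sub>0 nat" assume m: "ALL u. u ~: V --> coef m u = 0"
  show "coef r m : Mv"
  proof (cases "coef m Xx < n")
   case True
   let ?m = "m + sgl Y n"
   have "ALL u. u ~: V --> coef ?m u = 0" using m V by (auto simp: lookup_add lookup_single when_def)
   hence "coef (mvar Xx ^ n * \<beta> - mvar Y ^ n * \<alpha>) ?m : Mv" using h unfolding JV_iff[OF hS] by blast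
   moreover have "coef ?m Xx = coef m Xx" "n <= coef ?m Y" using V(3) by (simp_all add: lookup_add lookup_single when_def)
   ultimately have "- coef \<alpha> m : Mv" using True by (simp add: lookup_minus coef_var_power_mult)
   thus ?thesis using q(4) True M_closed(6) by fastforce
  qed (use q(4) in simp)
 qed
 thus ?thesis using q(1,3) by (intro bexI[of _ q]) simp_all
qed

text \<open>The same comparison at \<open>m Z^n\<close>, for monomials \<open>m\<close> in which the
  exponents of \<open>Xx\<close> and \<open>Y\<close> are both below \<open>n\<close>.\<close>

lemma regular_three:
 assumes V: "Xx : V" "Y : V" "Z : V" "Xx ~= Y" "Xx ~= Z" "Y ~= Z" and s: "\<gamma> : S" "\<delta> : S" "\<epsilon> : S"
  and h: "mvar Z ^ n * \<gamma> - mvar Y ^ n * \<delta> + mvar Xx ^ n * \<epsilon> : JV V"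
 shows "EX \<gamma>1:S. EX \<gamma>2:S. \<gamma> - mvar Xx ^ n * \<gamma>1 - mvar Y ^ n * \<gamma>2 : JV V"
proof -
 from divide_by_variable_power[OF s(1), of Xx n] obtain q r where q: "q : S" "r : S" "\<gamma> = mvar Xx ^ n * q + r"
  "ALL m. coef r m = (if coef m Xx < n then coef \<gamma> m else 0)" by (elim exE conjE)
 from divide_by_variable_power[OF q(2), of Y n] obtain q' r' where q': "q' : S" "r' : S" "r = mvar Y ^ n * q' + r'"
  "ALL m. coef r' m = (if coef m Y < n then coef r m else 0)" by (elim exE conjE)
 have hS: "mvar Z ^ n * \<gamma> - mvar Y ^ n * \<delta> + mvar Xx ^ n * \<epsilon> : S" using h by (simp add: JV_def)
 have "r' : JV V" unfolding JV_iff[OF q'(2)]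
 proof (intro allI impI)
  fix m :: "5 \<Rightarrow>\<^sub>0 nat" assume m: "ALL u. u ~: V --> coef m u = 0"
  show "coef r' m : Mv"
  proof (cases "coef m Xx < n & coef m Y < n")
   case True
   let ?m = "m + sgl Z n"
   have "ALL u. u ~: V --> coef ?m u = 0" using m V by (auto simp: lookup_add lookup_single when_def)
   hence "coef (mvar Z ^ n * \<gamma> - mvar Y ^ n * \<delta> + mvar Xx ^ n * \<epsilon>) ?m : Mv" using h unfolding JV_iff[OF hS] by blast
   moreover have "coef ?m Xx = coef m Xx" "coef ?m Y = coef m Y" "n <= coef ?m Z" using V(5,6) by (simp_all add: lookup_add lookup_single when_def)
   ultimately have "coef \<gamma> m : Mv" using True by (simp add: lookup_minus lookup_add coef_var_power_mult)
   thus ?thesis using q(4) q'(4) True by simp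
  qed (use q(4) q'(4) in auto)
 qed
 moreover have "\<gamma> - mvar Xx ^ n * q - mvar Y ^ n * q' = r'" using q(3) q'(3) by simp
 ultimately show ?thesis using q(1) q'(1) by metis
qed

text \<open>A rotation of the indices by \<open>i\<close> carries \<open>cofactor4_identity\<close>
  to the Pfaffian that omits row \<open>i\<close>.\<close>

lemma pfaffian_cofactors:
 assumes c: "minimal_tensor c"
 shows "EX \<Lambda>. (ALL k b. \<Lambda> k b : S) & (ALL k b. \<Lambda> b k = - \<Lambda> k b) &
  (ALL a b. (SUM k:UNIV. lform c a k * \<Lambda> k b) = (if a = b then pf5 (lform c) i else 0) - (if a = i then pf5 (lform c) b else 0))"
proof -
 define y where "y s t = lform c (i + s) (i + t)" for s t
 have y: "alternating2 y" using alternating2_lform[OF c] unfolding y_def alternating2_def by blast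
 have pf: "pf5 y b = pf5 (lform c) (i + b)" for b by (simp add: pf5_def pf2_def y_def add.assoc)
 have "cofactor4 y s t : S" for s t
  unfolding cofactor4_def y_def using lform_S[OF c] S_closed(1,3) by simp
 moreover have "(SUM k:UNIV. lform c a k * cofactor4 y (k - i) (b - i)) = (if a = b then pf5 (lform c) i else 0) - (if a = i then pf5 (lform c) b else 0)" for a b
 proof -
  have "(SUM k:UNIV. lform c a k * cofactor4 y (k - i) (b - i)) = (SUM s:UNIV. y (a - i) s * cofactor4 y s (b - i))"
   by (rule sum.reindex_bij_witness[of _ "%s. i + s" "%k. k - i"]) (simp_all add: y_def)
  thus ?thesis unfolding cofactor4_identity[OF y] pf by simp
 qed
 moreover have "cofactor4 y (b - i) (k - i) = - cofactor4 y (k - i) (b - i)" for k b by (rule cofactor4_skew)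
 ultimately show ?thesis by (intro exI[of _ "%k b. cofactor4 y (k - i) (b - i)"]) blast
qed

lemma syz_S: "minimal_tensor c ==> (!!k. y k : S) ==> syz c y a : S"
 unfolding syz_def by (intro S_closed(8,5) lform_S)

lemma pf_comb_S: "minimal_tensor c ==> (!!k. y k : S) ==> pf_comb c y : S"
 unfolding pf_comb_def by (intro S_closed(8,5) pf5_S)

lemma syz_pf5: "minimal_tensor c ==> syz c (pf5 (lform c)) a = 0"
 unfolding syz_def by (rule pf5_syzygy[OF alternating2_lform])

lemma pf_comb_syz: assumes c: "minimal_tensor c" shows "pf_comb c (syz c y) = 0"
proof -
 have sk: "lform c a k = - lform c k a" for a k using alternating2_lform[OF c] unfolding alternating2_def by blast
 have "pf_comb c (syz c y) = (SUM k:UNIV. SUM a:UNIV. lform c a k * y k * pf5 (lform c) a)"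
  unfolding pf_comb_def syz_def sum_distrib_right by (rule sum.swap)
 also have "... = (SUM k:UNIV. - y k * syz c (pf5 (lform c)) k)"
  unfolding syz_def sum_distrib_left
  by (intro sum.cong refl) (subst sk, simp add: ac_simps)
 finally show ?thesis by (simp add: syz_pf5[OF c])
qed

text \<open>The cofactor matrix is a homotopy for multiplication by a single Pfaffian, so this
  Pfaffian multiplies a syzygy into the image of the middle map; the coefficients \<open>u\<close>
  combine the five cases.\<close>

lemma pfaffian_annihilates:
 assumes c: "minimal_tensor c" and J: "is_ideal S J" and z: "!!i. z i : S" "pf_comb c z : J"
  and u: "!!i. u i : S" and w: "w : S" "w - pf_comb c u : J"
 shows "EX y. (ALL k. y k : S) & (ALL a. w * z a - syz c y a : J)"
proof -
 note J = is_idealD[OF sub_ring_S J]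
 have "EX y. (ALL k. y k : S) & (ALL a. pf5 (lform c) i * z a - syz c y a : J)" for i
 proof -
  from pfaffian_cofactors[OF c, of i] obtain \<Lambda> where L: "ALL k b. \<Lambda> k b : S"
   "!!a b. (SUM k:UNIV. lform c a k * \<Lambda> k b) = (if a = b then pf5 (lform c) i else 0) - (if a = i then pf5 (lform c) b else 0)" by blast
  define y where "y k = (SUM b:UNIV. \<Lambda> k b * z b)" for k
  have "syz c y a = (SUM b:UNIV. SUM k:UNIV. lform c a k * \<Lambda> k b * z b)" for a
   unfolding syz_def y_def sum_distrib_left by (subst sum.swap) (simp add: mult.assoc)
  also have "... a = (SUM b:UNIV. (if b = a then pf5 (lform c) i * z a else 0) - (if a = i then z b * pf5 (lform c) b else 0))" for a
   unfolding sum_distrib_right[symmetric] L(2) by (intro sum.cong refl) (auto simp: algebra_simps)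
  finally have "syz c y a = pf5 (lform c) i * z a - (if a = i then pf_comb c z else 0)" for a
   by (auto simp: sum_subtractf pf_comb_def)
  hence "pf5 (lform c) i * z a - syz c y a : J" for a using z(2) J(2) by simp
  moreover have "y k : S" for k unfolding y_def using L(1) z(1) by (intro S_closed(8,5)) auto
  ultimately show ?thesis by blast
 qed
 then obtain Y where Y: "!!i k. Y i k : S" "!!i a. pf5 (lform c) i * z a - syz c (Y i) a : J" by metis
 define y where "y k = (SUM i:UNIV. u i * Y i k)" for k
 have "w * z a - syz c y a : J" for a
 proof -
  have "w * z a - syz c y a = z a * (w - pf_comb c u) + (SUM i:UNIV. u i * (pf5 (lform c) i * z a - syz c (Y i) a))"
   unfolding y_def syz_linear(3,4) pf_comb_def by (simp add: right_diff_distrib sum_subtractf sum_distrib_left sum_distrib_right ac_simps)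
  also have "... : J" by (intro J(3,8) J(4)[OF z(1) w(2)] J(4)[OF u Y(2)])
  finally show ?thesis .
 qed
 moreover have "y k : S" for k unfolding y_def by (intro S_closed(8,5) u Y(1))
 ultimately show ?thesis by blast
qed

text \<open>The same homotopy one place earlier in the complex: on the kernel of the middle map it
  yields \<open>p_i y_b = p_b y_i\<close> for the Pfaffians \<open>p\<close>.\<close>

lemma kernel_proportional:
 assumes c: "minimal_tensor c" and J: "is_ideal S J" and y: "!!k. y k : S" "!!a. syz c y a : J"
  and u: "!!i. u i : S" and w: "w : S" "w - pf_comb c u : J"
 shows "w * y b - (SUM i:UNIV. u i * y i) * pf5 (lform c) b : J"
proof -
 note J = is_idealD[OF sub_ring_S J]
 have "pf5 (lform c) i * y b - pf5 (lform c) b * y i : J" for i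
 proof -
  from pfaffian_cofactors[OF c, of i] obtain \<Lambda> where L: "ALL k b. \<Lambda> k b : S" "!!k b. \<Lambda> b k = - \<Lambda> k b"
   "!!a b. (SUM k:UNIV. lform c a k * \<Lambda> k b) = (if a = b then pf5 (lform c) i else 0) - (if a = i then pf5 (lform c) b else 0)" by blast
  have sk: "lform c a k = - lform c k a" for a k using alternating2_lform[OF c] unfolding alternating2_def by blast
  have "(SUM a:UNIV. \<Lambda> b a * syz c y a) = (SUM k:UNIV. SUM a:UNIV. \<Lambda> b a * (lform c a k * y k))"
   unfolding syz_def sum_distrib_left by (rule sum.swap)
  also have "... = (SUM k:UNIV. (SUM a:UNIV. lform c k a * \<Lambda> a b) * y k)"
   unfolding sum_distrib_right by (intro sum.cong refl) (subst L(2), subst sk, simp add: ac_simps)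
  also have "... = (SUM k:UNIV. (if k = b then pf5 (lform c) i * y b else 0) - (if k = i then pf5 (lform c) b * y i else 0))"
   unfolding L(3) by (intro sum.cong refl) (auto simp: left_diff_distrib)
  also have "... = pf5 (lform c) i * y b - pf5 (lform c) b * y i" by (simp add: sum_subtractf)
  finally show ?thesis using J(8)[of UNIV "%a. \<Lambda> b a * syz c y a"] J(4) L(1) y(2) by simp
 qed
 hence "y b * (w - pf_comb c u) + (SUM i:UNIV. u i * (pf5 (lform c) i * y b - pf5 (lform c) b * y i)) : J"
  by (intro J(3,8) J(4)[OF y(1) w(2)] J(4)[OF u])
 also have "y b * (w - pf_comb c u) + (SUM i:UNIV. u i * (pf5 (lform c) i * y b - pf5 (lform c) b * y i)) =
  w * y b - (SUM i:UNIV. u i * y i) * pf5 (lform c) b"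
  unfolding pf_comb_def by (simp add: right_diff_distrib sum_subtractf sum_distrib_left sum_distrib_right ac_simps)
 finally show ?thesis .
qed

text \<open>
  The ideal contains \<open>x\<^sub>2\<^sup>n, x\<^sub>3\<^sup>n, x\<^sub>4\<^sup>n\<close> and multiplies every syzygy into the image of \<open>\<Phi>\<close>; comparing
  preimages pairwise gives multiples of the Pfaffian vector, which a Koszul relation removes.
\<close>

lemma exact_base:
 assumes c: "minimal_tensor c" and u: "!!x i. u x i : S" "!!x. x : {2, 3, 4} ==> mvar x ^ n - pf_comb c (u x) : JV {2, 3, 4}"
  and z: "!!i. z i : S" "pf_comb c z : JV {2, 3, 4}"
 shows "EX y. (ALL k. y k : S) & (ALL a. z a - syz c y a : JV {2, 3, 4})"
proof -
 define J where "J = JV {2, 3, 4}"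
 define p where "p = pf5 (lform c)"
 define Xx where "Xx = (mvar 2 :: 'a pol5) ^ n" define Y where "Y = (mvar 3 :: 'a pol5) ^ n" define Z where "Z = (mvar 4 :: 'a pol5) ^ n"
 have iJ: "is_ideal S J" unfolding J_def by (rule is_primeD(1)[OF prime_JV])
 have J3: "a + b : J" and J7: "a - b : J" if "a : J" "b : J" for a b using is_idealD(3,7)[OF sub_ring_S iJ] that by blast+
 have J4: "r * a : J" if "r : S" "a : J" for r a using is_idealD(4)[OF sub_ring_S iJ] that by blast
 have Jp: "a : J \<or> b : J" if "a * b : J" "a : S" "b : S" for a b using JV_prime that unfolding J_def by blast
 have XS: "Xx : S" "Y : S" "Z : S" unfolding Xx_def Y_def Z_def by (intro S_closed(7) S_gens(2))+
 have XJ: "Xx ~: J" unfolding Xx_def J_def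
  using is_prime_power[OF sub_ring_S prime_JV S_gens(2)] mvar_JV[of 2 "{2, 3, 4}"] by auto
 have uX: "Xx - pf_comb c (u 2) : J" "Y - pf_comb c (u 3) : J" "Z - pf_comb c (u 4) : J"
  unfolding Xx_def Y_def Z_def J_def using u(2) by auto
 have pS: "p i : S" for i unfolding p_def by (rule pf5_S[OF c])
 obtain b0 where b0: "p b0 ~: J"
 proof (rule ccontr)
  assume "\<not> thesis"
  hence "!!i. p i : J" using that by blast
  hence "pf_comb c (u 2) : J" unfolding pf_comb_def p_def[symmetric] by (intro is_idealD(8)[OF sub_ring_S iJ] J4 u(1))
  from J3[OF uX(1) this] show False using XJ by simp
 qed
 have cancel: "t : J" if "t * p b0 : J" "t : S" for t using Jp[OF that(1) that(2) pS] b0 by blast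
 \<comment> \<open>The kernel of the middle map is generated by the Pfaffian vector:
   \<open>\<alpha>\<close> and \<open>\<beta>\<close> are the factors belonging to \<open>Xx\<close>
   and \<open>Y\<close>, and regularity makes \<open>\<alpha>\<close> divisible by
   \<open>Xx\<close>.\<close>
 have ker: "EX \<gamma>:S. ALL b. s b - \<gamma> * p b : J" if s: "!!k. s k : S" "!!a. syz c s a : J" for s
 proof -
  define \<alpha> where "\<alpha> = (SUM i:UNIV. u 2 i * s i)" define \<beta> where "\<beta> = (SUM i:UNIV. u 3 i * s i)"
  have ab: "\<alpha> : S" "\<beta> : S" unfolding \<alpha>_def \<beta>_def by (intro S_closed(8,5) u(1) s(1))+
  have 1: "Xx * s b - \<alpha> * p b : J" for b unfolding \<alpha>_def p_def by (rule kernel_proportional[OF c iJ s u(1) XS(1) uX(1)])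
  have 2: "Y * s b - \<beta> * p b : J" for b unfolding \<beta>_def p_def by (rule kernel_proportional[OF c iJ s u(1) XS(2) uX(2)])
  have "(Xx * \<beta> - Y * \<alpha>) * p b0 = Y * (Xx * s b0 - \<alpha> * p b0) - Xx * (Y * s b0 - \<beta> * p b0)" by (simp add: algebra_simps)
  also have "... : J" by (intro J7 J4 XS 1 2)
  finally have "Xx * \<beta> - Y * \<alpha> : J" by (rule cancel) (intro S_closed(5,6) XS ab)
  hence "EX \<alpha>':S. \<alpha> - Xx * \<alpha>' : J" unfolding Xx_def Y_def J_def by (intro regular_two[OF _ _ _ ab]) simp_all
  then obtain \<alpha>' where a': "\<alpha>' : S" "\<alpha> - Xx * \<alpha>' : J" by blast
  have "s b - \<alpha>' * p b : J" for b
  proof -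
   have "Xx * (s b - \<alpha>' * p b) = (Xx * s b - \<alpha> * p b) + p b * (\<alpha> - Xx * \<alpha>')" by (simp add: algebra_simps)
   also have "... : J" by (intro J3 1 J4 pS a'(2))
   finally show ?thesis using Jp[OF _ XS(1) S_closed(6)[OF s(1)[of b] S_closed(5)[OF a'(1) pS[of b]]]] XJ by blast
  qed
  thus ?thesis using a'(1) by blast
 qed
 from pfaffian_annihilates[OF c iJ z(1) z(2)[folded J_def] u(1) XS(1) uX(1)] obtain a where a: "!!k. a k : S" "!!i. Xx * z i - syz c a i : J" by blast
 from pfaffian_annihilates[OF c iJ z(1) z(2)[folded J_def] u(1) XS(2) uX(2)] obtain b where b: "!!k. b k : S" "!!i. Y * z i - syz c b i : J" by blast
 from pfaffian_annihilates[OF c iJ z(1) z(2)[folded J_def] u(1) XS(3) uX(3)] obtain d where d: "!!k. d k : S" "!!i. Z * z i - syz c d i : J" by blast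
 \<comment> \<open>Two preimages, multiplied crosswise, differ by an element of the kernel.\<close>
 have pair: "EX \<gamma>:S. ALL k. (W' * a k - W * b k) - \<gamma> * p k : J"
  if "W : S" "W' : S" "!!k. a k : S" "!!k. b k : S" "!!i. W * z i - syz c a i : J" "!!i. W' * z i - syz c b i : J" for W W' a b
 proof (rule ker)
  show "W' * a k - W * b k : S" for k using that by (intro S_closed(5,6))
  show "syz c (%k. W' * a k - W * b k) i : J" for i
  proof -
   have "syz c (%k. W' * a k - W * b k) i = W * (W' * z i - syz c b i) - W' * (W * z i - syz c a i)"
    unfolding syz_linear by (simp add: algebra_simps)
   also have "... : J" by (rule J7[OF J4[OF that(1) that(6)] J4[OF that(2) that(5)]])
   finally show ?thesis .
  qed
 qed
 from pair[OF XS(1) XS(2) a(1) b(1) a(2) b(2)] obtain \<gamma> where g: "\<gamma> : S" "!!k. (Y * a k - Xx * b k) - \<gamma> * p k : J" by blast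
 from pair[OF XS(1) XS(3) a(1) d(1) a(2) d(2)] obtain \<delta> where dl: "\<delta> : S" "!!k. (Z * a k - Xx * d k) - \<delta> * p k : J" by blast
 from pair[OF XS(2) XS(3) b(1) d(1) b(2) d(2)] obtain \<epsilon> where ep: "\<epsilon> : S" "!!k. (Z * b k - Y * d k) - \<epsilon> * p k : J" by blast
 \<comment> \<open>The three crosswise differences satisfy an identity; cancelling
   \<open>p b0\<close> makes it a relation between their factors.\<close>
 have "(Z * \<gamma> - Y * \<delta> + Xx * \<epsilon>) * p b0 = Y * ((Z * a b0 - Xx * d b0) - \<delta> * p b0) - Z * ((Y * a b0 - Xx * b b0) - \<gamma> * p b0) - Xx * ((Z * b b0 - Y * d b0) - \<epsilon> * p b0)"
  by (simp add: algebra_simps)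
 also have "... : J" by (intro J7 J4 XS g(2) dl(2) ep(2))
 finally have "Z * \<gamma> - Y * \<delta> + Xx * \<epsilon> : J" by (rule cancel) (intro S_closed(4,5,6) XS g(1) dl(1) ep(1))
 hence "EX \<gamma>1:S. EX \<gamma>2:S. \<gamma> - Xx * \<gamma>1 - Y * \<gamma>2 : J"
  unfolding Xx_def Y_def Z_def J_def by (intro regular_three[OF _ _ _ _ _ _ g(1) dl(1) ep(1)]) simp_all
 then obtain \<gamma>1 \<gamma>2 where g12: "\<gamma>1 : S" "\<gamma>2 : S" "\<gamma> - Xx * \<gamma>1 - Y * \<gamma>2 : J" by blast
 \<comment> \<open>Subtracting \<open>\<gamma>2 p\<close> from \<open>a\<close> and adding
   \<open>\<gamma>1 p\<close> to \<open>b\<close> achieves \<open>Y a = Xx b\<close>, so the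
   corrected \<open>a\<close> is divisible by \<open>Xx\<close>.\<close>
 have "EX a':S. (a k - \<gamma>2 * p k) - Xx * a' : J" for k
 proof -
  have "Xx * (- b k - \<gamma>1 * p k) - Y * - (a k - \<gamma>2 * p k) = ((Y * a k - Xx * b k) - \<gamma> * p k) + p k * (\<gamma> - Xx * \<gamma>1 - Y * \<gamma>2)"
   by (simp add: algebra_simps)
  also have "... : J" by (intro J3 J4 pS g(2) g12(3))
  finally have "- (Xx * (- b k - \<gamma>1 * p k) - Y * - (a k - \<gamma>2 * p k)) : J" by (rule is_idealD(6)[OF sub_ring_S iJ])
  hence "Xx * (- (- b k - \<gamma>1 * p k)) - Y * (a k - \<gamma>2 * p k) : J" by (simp add: algebra_simps)
  thus ?thesis unfolding Xx_def Y_def J_def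
   by (intro regular_two[where Xx = 2 and Y = 3 and \<beta> = "- (- b k - \<gamma>1 * p k)"]) (simp_all add: S_closed(3,4,5,6) a(1) b(1) g12 pS)
 qed
 then obtain a' where a': "!!k. a' k : S" "!!k. (a k - \<gamma>2 * p k) - Xx * a' k : J" by metis
 have "z i - syz c a' i : J" for i
 proof -
  have "syz c (%k. (a k - \<gamma>2 * p k) - Xx * a' k) i = syz c a i - Xx * syz c a' i"
   unfolding syz_linear p_def syz_pf5[OF c] by simp
  hence "Xx * (z i - syz c a' i) = (Xx * z i - syz c a i) + syz c (%k. (a k - \<gamma>2 * p k) - Xx * a' k) i" by (simp add: algebra_simps)
  also have "... : J" unfolding syz_def[of c "%k. (a k - \<gamma>2 * p k) - Xx * a' k"]
   by (intro J3 a(2) is_idealD(8)[OF sub_ring_S iJ] J4 lform_S[OF c] a'(2))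
  finally show ?thesis using Jp[OF _ XS(1) S_closed(6)[OF z(1)[of i] syz_S[OF c, of a' i, OF a'(1)]]] XJ by blast
 qed
 thus ?thesis using a'(1) unfolding J_def by blast
qed

text \<open>Restricted to syzygies whose entries are forms of a common degree, because
  \<open>exact_forms_insert\<close> is an induction on that degree.\<close>

definition exact_forms :: "'a tensor => 5 set => bool" where
 "exact_forms c V \<longleftrightarrow> (ALL d z. (ALL i. z i : S & form_of_degree d (z i)) --> pf_comb c z : JV V -->
  (EX y. (ALL k. y k : S) & (ALL a. z a - syz c y a : JV V)))"

text \<open>A graded Nakayama argument for \<open>x_u\<close>: a preimage for the smaller set of
  variables leaves an error divisible by \<open>x_u\<close>, and the quotient is again a syzygy, of
  degree one less.\<close>

lemma exact_forms_insert:
 assumes c: "minimal_tensor c" and V: "exact_forms c V"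
 shows "exact_forms c (insert u V)"
proof -
 have "EX y. (ALL k. y k : S) & (ALL a. z a - syz c y a : JV (insert u V))"
  if z: "!!i. z i : S" "!!i. form_of_degree d (z i)" "pf_comb c z : JV (insert u V)" for d z
  using z
 proof (induction d arbitrary: z rule: less_induct)
  case (less d z)
  have zS: "pf_comb c z : S" by (rule pf_comb_S[OF c less.prems(1)])
  have "pf_comb c z : JV V" using less.prems(3) unfolding JV_iff[OF zS] by blast
  then obtain y where y: "!!k. y k : S" "!!a. z a - syz c y a : JV V" using V less.prems(1,2) unfolding exact_forms_def by blast
  \<comment> \<open>Keeping only the part of degree \<open>d - 1\<close>, which is 0 for
    \<open>d = 0\<close>, makes the error \<open>g\<close> a form of degree
    \<open>d\<close>.\<close>
  define y' where "y' k = (if 1 <= d then form_part (d - 1) (y k) else 0)" for k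
  have y'S: "y' k : S" for k unfolding y'_def using form_part_in[OF O_closed(1) y(1)] S_closed(1) by simp
  define g where "g a = z a - syz c y' a" for a
  have gS: "g a : S" for a unfolding g_def by (intro S_closed(6) less.prems(1) syz_S[OF c] y'S)
  have "form_part d (syz c y a) = syz c y' a" for a
   unfolding syz_def form_part_sum form_part_mult[OF form_lform] y'_def by (intro sum.cong refl) simp
  hence ga: "g a = form_part d (z a - syz c y a)" for a
   unfolding g_def form_part_diff using form_part_form[OF less.prems(2)[of a], of d] by simp
  have zyS: "z a - syz c y a : S" for a by (intro S_closed(6) less.prems(1) syz_S[OF c] y(1))
  have gV: "g a : JV V" for a
   using y(2)[of a] unfolding JV_iff[OF gS] JV_iff[OF zyS] unfolding ga coef_form_part by simp
  have "EX q r. q : S & r : S & g a = mvar u ^ 1 * q + r & (ALL m. coef r m = (if coef m u < 1 then coef (g a) m else 0)) &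
   (ALL m. coef q m = coef (g a) (m + sgl u 1))" for a by (rule divide_by_variable_power[OF gS])
  then obtain q r where qr: "!!a. q a : S" "!!a. r a : S" "!!a. g a = mvar u ^ 1 * q a + r a"
   "!!a m. coef (r a) m = (if coef m u < 1 then coef (g a) m else 0)" "!!a m. coef (q a) m = coef (g a) (m + sgl u 1)"
   by metis
  have rV: "r a : JV (insert u V)" for a unfolding JV_iff[OF qr(2)]
  proof (intro allI impI)
   fix m :: "5 \<Rightarrow>\<^sub>0 nat" assume m: "ALL w. w ~: insert u V --> coef m w = 0"
   show "coef (r a) m : Mv"
   proof (cases "coef m u < 1")
    case True
    hence "ALL w. w ~: V --> coef m w = 0" using m by (metis insert_iff less_one)
    thus ?thesis using gV[of a] True unfolding JV_iff[OF gS] qr(4) by simp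
   qed (simp add: qr(4))
  qed
  have gd: "form_of_degree d (g a)" for a unfolding ga by simp
  have qd: "mon_deg m + 1 = d" if "coef (q a) m ~= 0" for a m
   using gd[of a] that unfolding qr(5) form_of_degree_alt by fastforce
  show ?case
  proof (cases d)
   case 0
   hence "q a = 0" for a using qd by (intro poly_mapping_eqI) fastforce
   hence "g a : JV (insert u V)" for a using qr(3) rV by simp
   thus ?thesis using y'S unfolding g_def by blast
  next
   case (Suc d')
   have qf: "form_of_degree d' (q a)" for a using qd Suc unfolding form_of_degree_alt by fastforce
   have "mvar u * pf_comb c q = pf_comb c (%a. mvar u * q a)" by (simp add: pf_comb_linear)
   also have "(%a. mvar u * q a) = (%a. (z a - syz c y' a) - r a)" using qr(3) unfolding g_def by (intro ext) (simp add: algebra_simps)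
   also have "pf_comb c ... = pf_comb c z - pf_comb c r" unfolding pf_comb_linear using pf_comb_syz[OF c, of y'] by simp
   also have "... : JV (insert u V)" unfolding pf_comb_def[of c r]
    by (intro JV_closed(7,8) less.prems(3) JV_closed(5)[OF pf5_S[OF c]] rV)
   finally have "pf_comb c q : JV (insert u V)"
    using JV_prime[OF S_gens(2) pf_comb_S[OF c, of q, OF qr(1)], of u "insert u V"] mvar_JV[of u "insert u V"] by simp
   from less.IH[OF _ qr(1) qf this] Suc obtain y'' where y'': "!!k. y'' k : S" "!!a. q a - syz c y'' a : JV (insert u V)" by auto
   have "z a - syz c (%k. y' k + mvar u * y'' k) a = r a + mvar u * (q a - syz c y'' a)" for a
    using qr(3)[of a] unfolding syz_linear g_def by (simp add: algebra_simps)
   moreover have "r a + mvar u * (q a - syz c y'' a) : JV (insert u V)" for a by (intro JV_closed(3) rV JV_closed(4)[OF S_gens(2)] y''(2))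
   moreover have "y' k + mvar u * y'' k : S" for k by (intro S_closed(4,5) y'S y''(1) S_gens(2))
   ultimately show ?thesis by (intro exI[of _ "%k. y' k + mvar u * y'' k"]) simp
  qed
 qed
 thus ?thesis unfolding exact_forms_def by blast
qed

end

context dvr_closed begin

text \<open>If \<open>pp f = pf_comb c z\<close>, then \<open>z\<close> is a syzygy modulo
  \<open>N\<close>, so exactness gives \<open>z = syz c y + pp q\<close>. The first summand is
  annihilated by \<open>pf_comb\<close>, and \<open>pp\<close> cancels. This is carried out degree
  by degree.\<close>

lemma pfaffian_quotient_torsion_free_good:
 assumes c: "minimal_tensor c" and F: "!!v. v : {2, 3, 4} ==> F v : pfN c & monic_in UNIV v (e v) (F v)"
  and f: "f : S" "mconst pp * f : pfI c"
 shows "f : pfI c"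
proof -
 \<comment> \<open>In this degree every monomial with exponents below the \<open>e v\<close>
   involves \<open>x_0\<close> or \<open>x_1\<close>. So the power \<open>x^n\<close> of each
   variable lies in the Pfaffian ideal modulo \<open>JV {2, 3, 4}\<close>.\<close>
 define n where "n = e 2 + e 3 + e 4"
 have "EX u. (ALL i. u i : S) & mvar x ^ n - pf_comb c u : JV {2, 3, 4}" for x
 proof -
  have xS: "mvar x ^ n : S" by (intro S_closed(7) S_gens(2))
  have xf: "form_of_degree n (mvar x ^ n :: 'a pol5)" using form_power[OF form_mvar, of n x] by simp
  have xv: "mvar x ^ n : vars_in (UNIV :: 5 set)" by (simp add: vars_in_def)
  let ?M = "{m. mon_deg m = n & (ALL u. u ~: UNIV --> coef m u = 0) & (ALL v:{2, 3, 4}. coef m v < e v)}"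
  have "mvar x ^ n : spanned (pfN c) ?M"
   by (rule form_spanned[OF ideal_pfN[OF c] subset_refl subset_UNIV F xS xv xf])
  then obtain g where g: "ALL m. g m : Ov" "mvar x ^ n - (SUM m:?M. mconst (g m) * mnm m) : pfN c" unfolding spanned_def by blast
  from g(2) obtain w nn where w: "mvar x ^ n - (SUM m:?M. mconst (g m) * mnm m) = w + nn" "w : pfI c" "nn : N" unfolding pfN_def by blast
  from w(2) obtain u where u: "w = pf_comb c u" "ALL i. u i : S" unfolding pfI_def by blast
  have "mvar x ^ n - pf_comb c u = (SUM m:?M. mconst (g m) * mnm m) + nn" using w(1) u(1) by (simp add: algebra_simps)
  also have "... : JV {2, 3, 4}"
  proof (intro JV_closed(3,8))
   fix m assume m: "m : ?M"
   have "\<not> (coef m 0 = 0 & coef m 1 = 0)"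
    using m unfolding mem_Collect_eq mon_deg_sum sum_5 n_def by (simp; linarith)
   moreover have "coef m 0 = 0 & coef m 1 = 0" if "ALL u. u ~: {2, 3, 4} --> coef m u = 0"
    using that[THEN spec, of 0] that[THEN spec, of 1] by simp
   ultimately have "\<not> (ALL u. u ~: {2, 3, 4} --> coef m u = 0)" by blast
   hence nM: "coef (mnm m :: 'a pol5) m' : Mv" if "ALL u. u ~: {2, 3, 4} --> coef m' u = 0" for m'
    using that by (auto simp: lookup_single when_def)
   have "mnm m : JV {2, 3, 4}" unfolding JV_iff[OF S_gens(1)] using nM by blast
   thus "mconst (g m) * mnm m : JV {2, 3, 4}" using g(1) by (intro JV_closed(4)) simp_all
  next
   show "nn : JV {2, 3, 4}" using w(3) N_closed(1) restr_props(4) unfolding JV_def by blast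
  qed
  finally show ?thesis using u(2) by blast
 qed
 then obtain u where u: "!!x i. u x i : S" "!!x. mvar x ^ n - pf_comb c (u x) : JV {2, 3, 4}" by metis
 have "exact_forms c {2, 3, 4}"
  unfolding exact_forms_def by (intro allI impI exact_base[OF c u]) simp_all
 from exact_forms_insert[OF c exact_forms_insert[OF c this, of 1], of 0] have "exact_forms c (insert 0 (insert 1 {2, 3, 4}))" .
 moreover have "insert 0 (insert 1 {2, 3, 4}) = (UNIV :: 5 set)" by (simp add: UNIV_5)
 ultimately have ex: "exact_forms c UNIV" by simp
 have JN: "JV UNIV = N" unfolding JV_def using restr_props(2)[of _ UNIV] N_closed(1) by (auto simp: vars_in_def)
 have part: "form_part d f : pfI c" for d
 proof -
  have pf: "mconst pp * form_part d f : pfI c"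
   using form_part_pfI[OF f(2), of d] form_part_mult[OF form_mconst, of d pp f] by simp
  from f(2) obtain z0 where z0: "mconst pp * f = pf_comb c z0" "ALL i. z0 i : S" unfolding pfI_def by blast
  define z where "z i = (if 2 <= d then form_part (d - 2) (z0 i) else 0)" for i
  have z: "mconst pp * form_part d f = pf_comb c z"
   using arg_cong[OF z0(1), of "form_part d"] form_part_mult[OF form_mconst, of d pp f] by (simp add: form_part_pf_comb z_def[abs_def])
  have zS: "z i : S" "form_of_degree (d - 2) (z i)" for i
   unfolding z_def using form_part_in[OF O_closed(1), of "z0 i"] z0(2) S_closed(1) by simp_all
  have fS: "form_part d f : S" by (rule form_part_in[OF O_closed(1) f(1)])
  have "pf_comb c z : JV UNIV" unfolding JN z[symmetric] using pp(4) by (intro N_closed(5)[OF fS]) simp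
  then obtain y where y: "!!k. y k : S" "!!a. z a - syz c y a : N" using ex zS unfolding exact_forms_def JN by blast
  have "ALL a. EX q:S. z a - syz c y a = mconst pp * q" using y(2) unfolding N_iff by blast
  then obtain q where q: "!!a. q a : S" "!!a. z a - syz c y a = mconst pp * q a" by metis
  have "mconst pp * form_part d f = pf_comb c (%a. z a - syz c y a)" unfolding z pf_comb_linear(3) using pf_comb_syz[OF c, of y] by simp
  also have "... = mconst pp * pf_comb c q" unfolding q(2) pf_comb_linear(2) ..
  finally have e: "mconst pp * form_part d f = mconst pp * pf_comb c q" .
  have "form_part d f = pf_comb c q"
  proof (rule poly_mapping_eqI)
   fix m show "coef (form_part d f) m = coef (pf_comb c q) m"
    using arg_cong[OF e, of "%h. coef h m"] pp(1) by simp
  qed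
  thus ?thesis unfolding pfI_def using q(1) by blast
 qed
 have "(SUM d:mon_deg ` supp f. form_part d f) : pfI c" by (rule is_idealD(8)[OF sub_ring_S ideal_pfI[OF c] part])
 thus ?thesis using sum_form_parts[of f] by simp
qed

lemma pfaffian_quotient_torsion_free:
 assumes c: "minimal_tensor c" and f: "f : S" "mconst pp * f : pfI c"
 shows "f : pfI c"
proof -
 from good_coordinates[OF c] obtain B F e where B: "GLO B" and F: "ALL v:{2, 3, 4}. F v : pfN (col_act B c) & monic_in UNIV v (e v) (F v)"
  by (elim exE conjE)
 from GLO_inverse[OF B] obtain B' where B': "GLO B'" "B ** B' = mat 1" "B' ** B = mat 1" by blast
 have O: "!!i j. B $ i $ j : Ov" using B by (simp add: GLO_def)
 have c': "minimal_tensor (col_act B c)" by (rule minimal_col_act[OF c GLO_1 B])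
 have "mconst pp * subst B f : pfI (col_act B c)" using subst_pfI[OF B f(2)] by (simp only: rhomD(3)[OF rhom_subst] subst_gens(1))
 from subst_pfI[OF B'(1) pfaffian_quotient_torsion_free_good[OF c' bspec[OF F] subst_S[OF O f(1)] this]]
 show ?thesis unfolding col_act_mult subst_subst B'(3) subst_1 by simp
qed

end

section \<open>Points and stalks of projective schemes\<close>

lemma form_part_product:
 fixes a b :: "('v::finite, 'k::comm_ring_1) mpol"
 shows "form_part n (a * b) = (SUM k<=n. form_part k a * form_part (n - k) b)"
proof -
 let ?D = "mon_deg ` supp a"
 let ?g = "%d. if d <= n then form_part d a * form_part (n - d) b else 0"
 have z: "form_part d a = 0" if "d ~: ?D" for d
  by (rule poly_mapping_eqI) (use that in \<open>auto simp: coef_form_part in_keys_iff\<close>)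
 have "form_part n (a * b) = form_part n (SUM d:?D. form_part d a * b)"
  unfolding sum_distrib_right[symmetric] sum_form_parts[symmetric] ..
 also have "... = (SUM d:?D. ?g d)" unfolding form_part_sum form_part_mult[OF form_form_part] ..
 also have "... = (SUM d:?D \<union> {..n}. ?g d)" by (intro sum.mono_neutral_left) (auto simp: z)
 also have "... = (SUM d:{..n}. ?g d)" by (intro sum.mono_neutral_right) auto
 finally show ?thesis by simp
qed

definition graded :: "'k::comm_ring_1 pol5 set => bool" where "graded J \<longleftrightarrow> (ALL f:J. ALL d. form_part d f : J)"

text \<open>The largest homogeneous ideal inside a prime is prime: for \<open>a\<close> and
  \<open>b\<close> outside it, take the lowest degrees in which their parts are not in
  \<open>P\<close>, and look at the product in the sum of these degrees.\<close>

lemma homogeneous_prime_part: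
 fixes R :: "'k::comm_ring_1 set"
 assumes R: "sub_ring R" and P: "is_prime (mpols_over R) P"
 defines "Q \<equiv> {f : mpols_over R. ALL d. form_part d f : P}"
 shows "is_prime (mpols_over R) Q" "graded Q" "Q \<subseteq> P"
proof -
 let ?T = "mpols_over R :: 'k pol5 set"
 note T = sub_ring_mpols_over[OF R, where 'v = 5]
 note Tc = sub_ringD[OF T] and iP = is_idealD[OF T is_primeD(1)[OF P]]
 have fp: "f : ?T ==> form_part d f : ?T" for f d by (rule form_part_in[OF sub_ringD(1)[OF R]])
 have idl: "is_ideal ?T Q"
 proof (rule is_idealI)
  show "r * a : Q" if "r : ?T" "a : Q" for r a
   using that fp by (auto simp: Q_def form_part_product intro!: Tc(5) iP(8) iP(4))
 qed (auto simp: Q_def form_part_add intro!: Tc(1,4) iP(2,3))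
 show sub: "Q \<subseteq> P"
 proof
  fix f assume "f : Q"
  hence "(SUM d:mon_deg ` supp f. form_part d f) : P" unfolding Q_def by (intro iP(8)) blast
  thus "f : P" using sum_form_parts[of f] by simp
 qed
 have "a : Q \<or> b : Q" if ab: "a : ?T" "b : ?T" "a * b : Q" for a b
 proof (rule ccontr)
  assume "\<not> ?thesis"
  hence ex: "EX d. form_part d a ~: P" "EX d. form_part d b ~: P" using ab unfolding Q_def by auto
  define d where "d = (LEAST d. form_part d a ~: P)" define e where "e = (LEAST d. form_part d b ~: P)"
  have d: "form_part d a ~: P" "!!k. k < d ==> form_part k a : P" unfolding d_def using LeastI_ex[OF ex(1)] not_less_Least by blast+
  have e: "form_part e b ~: P" "!!k. k < e ==> form_part k b : P" unfolding e_def using LeastI_ex[OF ex(2)] not_less_Least by blast+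
  have rest: "(SUM k:{..d + e} - {d}. form_part k a * form_part (d + e - k) b) : P"
  proof (rule iP(8))
   fix k assume "k : {..d + e} - {d}"
   then consider "k < d" | "d + e - k < e" by force
   thus "form_part k a * form_part (d + e - k) b : P"
   proof cases
    case 1 thus ?thesis using iP(5)[OF fp[OF ab(2)] d(2)] by blast
   next
    case 2 thus ?thesis using iP(4)[OF fp[OF ab(1)] e(2)] by blast
   qed
  qed
  have "form_part (d + e) (a * b) : P" using ab(3) unfolding Q_def by blast
  also have "form_part (d + e) (a * b) = form_part d a * form_part e b + (SUM k:{..d + e} - {d}. form_part k a * form_part (d + e - k) b)"
   unfolding form_part_product by (subst sum.remove[of _ d]) auto
  finally have "form_part d a * form_part e b : P" using iP(7)[OF _ rest] by fastforce
  thus False using is_primeD(3)[OF P fp[OF ab(1)] fp[OF ab(2)]] d(1) e(1) by blast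
 qed
 thus "is_prime ?T Q" unfolding is_prime_def using idl sub is_primeD(2)[OF P] by blast
 show "graded Q" unfolding graded_def
 proof (intro ballI allI)
  fix f d assume f: "f : Q"
  have "form_part e (form_part d f) : P" for e
   unfolding form_part_form[OF form_form_part] using f iP(2) by (simp add: Q_def)
  thus "form_part d f : Q" using f fp by (simp add: Q_def)
 qed
qed

lemma exists_homogeneous_prime:
 fixes R :: "'k::comm_ring_1 set"
 assumes R: "sub_ring R" and J: "is_ideal (mpols_over R) J" "graded J"
  and M: "M \<subseteq> mpols_over R" "1 : M" "!!a b. a : M ==> b : M ==> a * b : M" "J \<inter> M = {}"
 shows "EX P. is_prime (mpols_over R) P & graded P & J \<subseteq> P & P \<inter> M = {}"
proof -
 note T = sub_ring_mpols_over[OF R, where 'v = 5]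
 from exists_prime_avoiding[OF T J(1) M] obtain P where P: "is_prime (mpols_over R) P" "J \<subseteq> P" "P \<inter> M = {}" by blast
 let ?Q = "{f : mpols_over R. ALL d. form_part d f : P}"
 have "J \<subseteq> ?Q" using J P(2) is_idealD(1)[OF T J(1)] unfolding graded_def by blast
 thus ?thesis using homogeneous_prime_part[OF R P(1)] P(3) by blast
qed

text \<open>Instantiated twice: for the Pfaffian ideal over the valuation ring, and for its
  extension over the algebraic closure of the field.\<close>

locale graded_ideal =
 fixes R :: "'k::field set" and I :: "'k pol5 set"
 assumes R: "sub_ring R" and I: "is_ideal (mpols_over R) I" and gr: "graded I"
begin

abbreviation T :: "'k pol5 set" where "T \<equiv> mpols_over R"

lemmas sub_ring_T = sub_ring_mpols_over[OF R, where 'v = 5]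
lemmas T_closed = sub_ringD[OF sub_ring_T]
lemmas I_closed = is_idealD[OF sub_ring_T I]

abbreviation "pts \<equiv> proj_points R I"
abbreviation "spc \<equiv> proj_space R I"

lemma proj_points_iff: "P : pts \<longleftrightarrow> is_prime T P & graded P & I \<subseteq> P & (EX i. mvar i ~: P)"
 unfolding proj_points_def homogeneous_ideal_def graded_def
 using primeideal_ring_on_iff[OF sub_ring_T] ideal_ring_on_iff[OF sub_ring_T] is_primeD(1) by auto

lemma topspace_proj_space: "topspace (spc) = pts"
proof -
 have "openin (spc) (pts)"
  unfolding openin_proj_space proj_open_def using T_closed(2) is_primeD(2) proj_points_iff by (intro exI[of _ "{1}"]) auto
 moreover have "U \<subseteq> pts" if "openin (spc) U" for U
  using that unfolding openin_proj_space proj_open_def by blast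
 ultimately show ?thesis by (intro subset_antisym openin_subset) (auto simp: topspace_def)
qed

lemma closedin_proj_space: "closedin (spc) Z \<longleftrightarrow> (\<exists>J\<subseteq>T. Z = {P : pts. J \<subseteq> P})"
proof
 assume Z: "closedin (spc) Z"
 then obtain J where J: "J \<subseteq> T" "pts - Z = {P : pts. \<not> J \<subseteq> P}"
  unfolding closedin_def openin_proj_space proj_open_def topspace_proj_space by blast
 have "Z \<subseteq> pts" using closedin_subset[OF Z] topspace_proj_space by simp
 hence "Z = {P : pts. J \<subseteq> P}" using J(2) by blast
 thus "\<exists>J\<subseteq>T. Z = {P : pts. J \<subseteq> P}" using J(1) by blast
next
 assume "\<exists>J\<subseteq>T. Z = {P : pts. J \<subseteq> P}"
 then obtain J where J: "J \<subseteq> T" "Z = {P : pts. J \<subseteq> P}" by blast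
 show "closedin (spc) Z"
  unfolding closedin_def openin_proj_space proj_open_def topspace_proj_space using J by (intro conjI exI[of _ J]) auto
qed

definition generic_point :: "'k pol5 set set => 'k pol5 set" where "generic_point Z = {f : T. ALL P:Z. f : P}"

text \<open>If the intersection of the points of \<open>Z\<close> contained a product but neither
  factor, the loci of the two factors would decompose \<open>Z\<close>.\<close>

lemma generic_point:
 assumes cl: "closedin (spc) Z" and irr: "irreducible_space (subtopology (spc) Z)"
 shows "generic_point Z : pts" "Z = {P : pts. generic_point Z \<subseteq> P}"
proof -
 from cl obtain J where J: "J \<subseteq> T" "Z = {P : pts. J \<subseteq> P}" unfolding closedin_proj_space by blast
 have Zp: "Z \<subseteq> pts" using J(2) by blast
 hence top: "topspace (subtopology (spc) Z) = Z" by (auto simp: topspace_proj_space)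
 have sub: "closedin (subtopology (spc) Z) A \<longleftrightarrow> closedin (spc) A & A \<subseteq> Z" for A
  by (rule closedin_closed_subtopology[OF cl])
 have Z0: "Z ~= {}" using irr top unfolding irreducible_space_def by simp
 let ?g = "generic_point Z"
 have pr: "is_prime T P" "graded P" "I \<subseteq> P" if "P : Z" for P using that Zp proj_points_iff by blast+
 have idl: "is_ideal T ?g"
  unfolding generic_point_def by (rule is_idealI) (use is_idealD[OF sub_ring_T is_primeD(1)[OF pr(1)]] T_closed in auto)
 have "a : ?g \<or> b : ?g" if ab: "a : T" "b : T" "a * b : ?g" for a b
 proof -
  have cl1: "closedin (subtopology (spc) Z) {P : Z. x : P}" if "x : T" for x
  proof -
   have "{P : Z. x : P} = {P : pts. insert x J \<subseteq> P}" using J(2) by blast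
   moreover have "insert x J \<subseteq> T" using J(1) that by blast
   ultimately have "closedin (spc) {P : Z. x : P}" unfolding closedin_proj_space by (intro exI[of _ "insert x J"] conjI)
   thus ?thesis unfolding sub by blast
  qed
  have "a : P \<or> b : P" if "P : Z" for P using is_primeD(3)[OF pr(1)[OF that] ab(1,2)] ab(3) that unfolding generic_point_def by blast
  hence "Z = {P : Z. a : P} \<union> {P : Z. b : P}" by blast
  hence "{P : Z. a : P} = Z \<or> {P : Z. b : P} = Z"
   using irr cl1[OF ab(1)] cl1[OF ab(2)] unfolding irreducible_space_def top by blast
  thus ?thesis using ab(1,2) unfolding generic_point_def by blast
 qed
 moreover have "1 ~: ?g" using Z0 is_primeD(2)[OF pr(1)] unfolding generic_point_def by blast
 moreover have "graded ?g" using pr(2) form_part_in[OF sub_ringD(1)[OF R]] unfolding generic_point_def graded_def by blast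
 moreover have "I \<subseteq> ?g" using pr(3) I_closed(1) unfolding generic_point_def by blast
 moreover have "EX i. mvar i ~: ?g" using Z0 Zp proj_points_iff unfolding generic_point_def by blast
 ultimately show "?g : pts" unfolding proj_points_iff is_prime_def using idl by blast
 show "Z = {P : pts. ?g \<subseteq> P}"
 proof
  have "J \<subseteq> ?g" using J unfolding generic_point_def by blast
  thus "{P : pts. ?g \<subseteq> P} \<subseteq> Z" using J(2) by blast
  show "Z \<subseteq> {P : pts. ?g \<subseteq> P}" using Zp unfolding generic_point_def by blast
 qed
qed

lemma irreducible_closure:
 assumes P: "P : pts"
 defines "Z \<equiv> {P' : pts. P \<subseteq> P'}"
 shows "closedin (spc) Z" "irreducible_space (subtopology (spc) Z)"
proof -
 have PT: "P \<subseteq> T" using P proj_points_iff is_idealD(1)[OF sub_ring_T is_primeD(1)] by blast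
 show cl: "closedin (spc) Z" unfolding closedin_proj_space Z_def using PT by blast
 have top: "topspace (subtopology (spc) Z) = Z" by (auto simp: topspace_proj_space Z_def)
 have PZ: "P : Z" using P by (simp add: Z_def)
 have full: "A = Z" if "closedin (spc) A" "A \<subseteq> Z" "P : A" for A
 proof -
  from that(1) obtain J where "A = {P : pts. J \<subseteq> P}" unfolding closedin_proj_space by blast
  hence "Z \<subseteq> A" using that(3) unfolding Z_def by blast
  thus ?thesis using that(2) by blast
 qed
 show "irreducible_space (subtopology (spc) Z)"
  unfolding irreducible_space_def top closedin_closed_subtopology[OF cl]
 proof (intro conjI allI impI)
  show "Z ~= {}" using PZ by blast
  fix A B assume *: "closedin (spc) A & A \<subseteq> Z" "closedin (spc) B & B \<subseteq> Z" "Z = A \<union> B"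
  hence "P : A \<or> P : B" using PZ by blast
  thus "A = Z \<or> B = Z" using full *(1,2) by blast
 qed
qed

text \<open>Taking closures and generic points exchanges chains of points with reversed chains of
  irreducible closed sets.\<close>

lemma space_dim_eq_2:
 assumes P: "P0 : pts" "P1 : pts" "P2 : pts" "P0 \<subset> P1" "P1 \<subset> P2"
  and no: "!!q0 q1 q2 q3. q0 : pts ==> q1 : pts ==> q2 : pts ==> q3 : pts ==>
   q0 \<subset> q1 ==> q1 \<subset> q2 ==> q2 \<subset> q3 ==> False"
 shows "space_dim (spc) = 2"
proof -
 let ?C = "{Z. closedin (spc) Z & irreducible_space (subtopology (spc) Z)}"
 let ?A = "{enat n | n. EX c. (ALL i<=n. c i : ?C) & (ALL i<n. c i \<subset> c (Suc i))}"
 let ?Z = "%P. {P' : pts. P \<subseteq> P'}"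
 define c where "c i = (if i = 0 then ?Z P2 else if i = 1 then ?Z P1 else ?Z P0)" for i :: nat
 have "c i : ?C" for i unfolding c_def using irreducible_closure P(1-3) by simp
 moreover have "c i \<subset> c (Suc i)" if "i < 2" for i
 proof -
  have "?Z P2 \<subset> ?Z P1" "?Z P1 \<subset> ?Z P0" using P by blast+
  moreover from that have "i = 0 \<or> i = 1" by linarith
  ultimately show ?thesis unfolding c_def by (elim disjE) simp_all
 qed
 ultimately have ge: "enat 2 : ?A" by blast
 have le: "x <= enat 2" if x: "x : ?A" for x
 proof (rule ccontr)
  assume nle: "\<not> x <= enat 2"
  from x obtain n c where n: "x = enat n" "ALL i<=n. c i : ?C" "ALL i<n. c i \<subset> c (Suc i)" by blast
  hence n3: "3 <= n" using nle by simp
  have c: "c 0 : ?C" "c 1 : ?C" "c 2 : ?C" "c 3 : ?C" using n(2) n3 by auto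
  have s: "c 0 \<subset> c 1" "c 1 \<subset> c 2" "c 2 \<subset> c 3" using n(3) n3 by (auto simp: numeral_2_eq_2 numeral_3_eq_3)
  have mono: "generic_point Z' \<subset> generic_point Z" if "Z : ?C" "Z' : ?C" "Z \<subset> Z'" for Z Z'
  proof -
   have "generic_point Z' \<subseteq> generic_point Z" using that(3) unfolding generic_point_def by blast
   moreover have "generic_point Z' ~= generic_point Z"
    using generic_point(2)[of Z] generic_point(2)[of Z'] that by auto
   ultimately show ?thesis by blast
  qed
  have "generic_point (c k) : pts" if "c k : ?C" for k using generic_point(1)[of "c k"] that by blast
  from no[OF this[OF c(4)] this[OF c(3)] this[OF c(2)] this[OF c(1)] mono[OF c(3,4) s(3)] mono[OF c(2,3) s(2)] mono[OF c(1,2) s(1)]]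
  show False .
 qed
 have "Sup ?A = enat 2"
 proof (rule antisym)
  show "Sup ?A <= enat 2" by (rule Sup_least) (rule le)
  show "enat 2 <= Sup ?A" by (rule Sup_upper[OF ge])
 qed
 thus ?thesis unfolding space_dim_def chain_dim_def by (simp add: numeral_eq_enat)
qed

lemma space_dim_1E:
 assumes "space_dim (spc) = 1"
 obtains P0 P1 where "P0 : pts" "P1 : pts" "P0 \<subset> P1"
proof -
 let ?C = "{Z. closedin (spc) Z & irreducible_space (subtopology (spc) Z)}"
 let ?A = "{enat n | n. EX c. (ALL i<=n. c i : ?C) & (ALL i<n. c i \<subset> c (Suc i))}"
 have "EX x:?A. \<not> x <= 0"
 proof (rule ccontr)
  assume "\<not> ?thesis"
  hence "Sup ?A <= 0" by (intro Sup_least) blast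
  thus False using assms unfolding space_dim_def chain_dim_def by simp
 qed
 then obtain n c where n: "\<not> enat n <= 0" "ALL i<=n. c i : ?C" "ALL i<n. c i \<subset> c (Suc i)" by blast
 hence n1: "1 <= n" by (simp add: zero_enat_def)
 have c: "c 0 : ?C" "c 1 : ?C" "c 0 \<subset> c 1" using n(2,3) n1 by auto
 have "generic_point (c 1) \<subset> generic_point (c 0)"
  using c generic_point(2)[of "c 0"] generic_point(2)[of "c 1"] unfolding generic_point_def by auto
 thus ?thesis using that generic_point(1)[of "c 0"] generic_point(1)[of "c 1"] c by blast
qed

lemma irreducible_proj_space_iff: "irreducible_space (spc) \<longleftrightarrow> (EX Q:pts. ALL P:pts. Q \<subseteq> P)"
proof
 have st: "subtopology (spc) (pts) = spc" using subtopology_topspace[of "spc"] topspace_proj_space by simp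
 assume irr: "irreducible_space (spc)"
 have cl: "closedin (spc) (pts)" using closedin_topspace[of "spc"] unfolding topspace_proj_space .
 show "EX Q:pts. ALL P:pts. Q \<subseteq> P"
  using generic_point[OF cl] irr unfolding st by blast
next
 have st: "subtopology (spc) (pts) = spc" using subtopology_topspace[of "spc"] topspace_proj_space by simp
 assume "EX Q:pts. ALL P:pts. Q \<subseteq> P"
 then obtain Q where Q: "Q : pts" "{P : pts. Q \<subseteq> P} = pts" by blast
 show "irreducible_space (spc)" using irreducible_closure(2)[OF Q(1)] unfolding Q(2) st .
qed

end

section \<open>Arithmetic of fractions in a stalk\<close>

locale graded_ideal_point = graded_ideal +
 fixes P :: "'a pol5 set"
 assumes P: "P : pts"
begin

abbreviation "fracs \<equiv> fractions R P"
abbreviation "frc \<equiv> fraction R I P"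
abbreviation "stk \<equiv> stalk R I P"

definition den :: "'a pol5 => bool" where "den h \<longleftrightarrow> h : T & h ~: P & (EX d. form_of_degree d h)"

lemma point: "is_prime T P" "graded P" "I \<subseteq> P" "EX i. mvar i ~: P" using P proj_points_iff by blast+

lemma den_1: "den 1" using is_primeD(2)[OF point(1)] T_closed(2) form_mconst[of "1 :: 'a", where 'v = 5]
 unfolding den_def rhomD(1)[OF rhom_mconst] by blast

lemma den_mult: "den g ==> den h ==> den (g * h)"
 using is_primeD(3)[OF point(1)] T_closed(5) form_mult unfolding den_def by blast

lemma den_power: "den g ==> den (g ^ n)" by (induction n) (simp_all add: den_1 den_mult)

lemma den_T: "den g ==> g : T" by (simp add: den_def)

lemma fractionsI: "f : T ==> den g ==> form_of_degree d f ==> form_of_degree d g ==> (f, g) : fracs"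
 unfolding fractions_def den_def by blast

lemma fractionsD: "(f, g) : fracs ==> f : T" "(f, g) : fracs ==> den g"
 "(f, g) : fracs ==> EX d. form_of_degree d f & form_of_degree d g"
 unfolding fractions_def den_def by blast+

lemma fraction_mem: "(f', g') : frc f g \<longleftrightarrow> (f', g') : fracs & (EX h. den h & h * (f * g' - f' * g) : I)"
 unfolding fraction_def den_def by blast

lemma fractions_closed:
 assumes "(f, g) : fracs" "(f', g') : fracs"
 shows "(f * f', g * g') : fracs" "(f * g' + f' * g, g * g') : fracs"
proof -
 from fractionsD(3)[OF assms(1)] fractionsD(3)[OF assms(2)] obtain d d' where
  d: "form_of_degree d f" "form_of_degree d g" "form_of_degree d' f'" "form_of_degree d' g'" by blast
 note t = fractionsD(1)[OF assms(1)] fractionsD(1)[OF assms(2)] fractionsD(2)[OF assms(1)] fractionsD(2)[OF assms(2)]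
 show "(f * f', g * g') : fracs"
  by (rule fractionsI[OF T_closed(5)[OF t(1,2)] den_mult[OF t(3,4)] form_mult[OF d(1,3)] form_mult[OF d(2,4)]])
 show "(f * g' + f' * g, g * g') : fracs"
  using form_add[OF form_mult[OF d(1,4)] form_mult[OF d(3,2), unfolded add.commute[of d']]] form_mult[OF d(2,4)]
  by (intro fractionsI[of _ _ "d + d'"] T_closed(4,5) den_mult den_T t)
qed

text \<open>Transitivity of equality of fractions; the extra factor \<open>g\<close> in the
  multiplier makes the third difference a combination of the two given ones.\<close>

lemma fraction_subset:
 assumes a: "(f, g) : fracs" "(f1, g1) : fracs" and h1: "den h1" "h1 * (f * g1 - f1 * g) : I"
 shows "frc f g \<subseteq> frc f1 g1"
proof (rule subrelI)
 fix f' g' assume "(f', g') : frc f g"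
 then obtain h where h: "(f', g') : fracs" "den h" "h * (f * g' - f' * g) : I" unfolding fraction_mem by blast
 have "h * h1 * g * (f1 * g' - f' * g1) = h1 * g1 * (h * (f * g' - f' * g)) - h * g' * (h1 * (f * g1 - f1 * g))" by (simp add: algebra_simps)
 also have "... : I" by (intro I_closed(7) I_closed(4) T_closed(5) den_T h1 h(2,3) fractionsD(2)[OF a(2)] fractionsD(2)[OF h(1)])
 finally show "(f', g') : frc f1 g1"
  unfolding fraction_mem using h(1) den_mult[OF den_mult[OF h(2) h1(1)] fractionsD(2)[OF a(1)]] by blast
qed

lemma fraction_eq_iff:
 assumes a: "(f, g) : fracs" "(f1, g1) : fracs"
 shows "frc f g = frc f1 g1 \<longleftrightarrow> (EX h. den h & h * (f * g1 - f1 * g) : I)"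
proof
 assume "frc f g = frc f1 g1"
 moreover have "(f1, g1) : frc f1 g1" unfolding fraction_mem using a(2) den_1 I_closed(2) by auto
 ultimately show "EX h. den h & h * (f * g1 - f1 * g) : I" unfolding fraction_mem[symmetric] using fraction_mem by blast
next
 assume "EX h. den h & h * (f * g1 - f1 * g) : I"
 then obtain h where h: "den h" "h * (f * g1 - f1 * g) : I" by blast
 have "h * (f1 * g - f * g1) : I" using I_closed(6)[OF h(2)] by (simp add: algebra_simps)
 from fraction_subset[OF a h] fraction_subset[OF a(2,1) h(1) this] show "frc f g = frc f1 g1" by blast
qed

lemma fraction_self: "(f, g) : fracs ==> (f, g) : frc f g"
 unfolding fraction_mem using den_1 I_closed(2) by auto

text \<open>The operations of a stalk are unions over all representatives; independence of the
  representatives collapses such a union to one class.\<close>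

lemma UN_fraction_const:
 assumes "(f, g) : fracs" "(f', g') : fracs"
  and c: "!!f1 g1 f1' g1'. (f1, g1) : frc f g ==> (f1', g1') : frc f' g' ==> F f1 g1 f1' g1' = C"
 shows "(\<Union>(f1, g1)\<in>frc f g. \<Union>(f1', g1')\<in>frc f' g'. F f1 g1 f1' g1') = C"
 using fraction_self[OF assms(1)] fraction_self[OF assms(2)] c by fast

lemma stalk_mult:
 assumes a: "(f, g) : fracs" "(f', g') : fracs"
 shows "frc f g \<otimes>\<^bsub>stk\<^esub> frc f' g' = frc (f * f') (g * g')"
 unfolding stalk_def monoid.simps
proof (simp, rule UN_fraction_const[OF a])
 fix f1 g1 f1' g1' assume m: "(f1, g1) : frc f g" "(f1', g1') : frc f' g'"
 then obtain h h' where h: "(f1, g1) : fracs" "(f1', g1') : fracs" "den h" "den h'" "h * (f * g1 - f1 * g) : I" "h' * (f' * g1' - f1' * g') : I"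
  unfolding fraction_mem by blast
 have "h * h' * (f1 * f1' * (g * g') - f * f' * (g1 * g1')) = - (h' * f' * g1' * (h * (f * g1 - f1 * g)) + h * f1 * g * (h' * (f' * g1' - f1' * g')))"
  by (simp add: algebra_simps)
 also have "... : I" by (intro I_closed(6,3) I_closed(4) T_closed(5) den_T h fractionsD(1)[OF a(2)] fractionsD(2)[OF h(2)] fractionsD(1)[OF h(1)] fractionsD(2)[OF a(1)])
 finally show "frc (f1 * f1') (g1 * g1') = frc (f * f') (g * g')"
  unfolding fraction_eq_iff[OF fractions_closed(1)[OF h(1,2)] fractions_closed(1)[OF a]] using den_mult[OF h(3,4)] by blast
qed

lemma stalk_add:
 assumes a: "(f, g) : fracs" "(f', g') : fracs"
 shows "frc f g \<oplus>\<^bsub>stk\<^esub> frc f' g' = frc (f * g' + f' * g) (g * g')"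
 unfolding stalk_def ring.simps
proof (simp, rule UN_fraction_const[OF a])
 fix f1 g1 f1' g1' assume m: "(f1, g1) : frc f g" "(f1', g1') : frc f' g'"
 then obtain h h' where h: "(f1, g1) : fracs" "(f1', g1') : fracs" "den h" "den h'" "h * (f * g1 - f1 * g) : I" "h' * (f' * g1' - f1' * g') : I"
  unfolding fraction_mem by blast
 have "h * h' * ((f1 * g1' + f1' * g1) * (g * g') - (f * g' + f' * g) * (g1 * g1')) =
  - (h' * g' * g1' * (h * (f * g1 - f1 * g)) + h * g * g1 * (h' * (f' * g1' - f1' * g')))"
  by (simp add: algebra_simps)
 also have "... : I" by (intro I_closed(6,3) I_closed(4) T_closed(5) den_T h fractionsD(2)[OF a(2)] fractionsD(2)[OF h(2)] fractionsD(2)[OF h(1)] fractionsD(2)[OF a(1)])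
 finally show "frc (f1 * g1' + f1' * g1) (g1 * g1') = frc (f * g' + f' * g) (g * g')"
  unfolding fraction_eq_iff[OF fractions_closed(2)[OF h(1,2)] fractions_closed(2)[OF a]] using den_mult[OF h(3,4)] by blast
qed

lemma fractions_0_1: "(0, 1) : fracs" "(1, 1) : fracs"
proof -
 have "form_of_degree 0 (1 :: 'a pol5)" using form_mconst[of "1 :: 'a", where 'v = 5] unfolding rhomD(1)[OF rhom_mconst] .
 thus "(0, 1) : fracs" "(1, 1) : fracs" using fractionsI[OF _ den_1] T_closed(1,2) form_0 by blast+
qed

lemma stalk_carrier: "carrier (stk) = (%(f, g). frc f g) ` fracs"
 "\<zero>\<^bsub>stk\<^esub> = frc 0 1" "\<one>\<^bsub>stk\<^esub> = frc 1 1"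
 by (simp_all add: stalk_def)

lemma stalk_zero_iff: "(f, g) : fracs ==> frc f g = \<zero>\<^bsub>stk\<^esub> \<longleftrightarrow> (EX h. den h & h * f : I)"
 unfolding stalk_carrier fraction_eq_iff[OF _ fractions_0_1(1)] by simp

lemma fractions_power: "(f, g) : fracs ==> (f ^ n, g ^ n) : fracs"
 by (induction n) (simp_all add: fractions_0_1 fractions_closed(1))

lemma stalk_power: "(f, g) : fracs ==> frc f g [^]\<^bsub>stk\<^esub> n = frc (f ^ n) (g ^ n)" for n :: nat
proof (induction n)
 case (Suc n)
 thus ?case using stalk_mult[OF fractions_power[OF Suc.prems, of n] Suc.prems]
  by (simp add: nat_pow_def mult.commute)
qed (simp add: nat_pow_def stalk_carrier)

lemma exists_denominator: "EX g. den g & form_of_degree d g & (EX i. g = mvar i ^ d)"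
proof -
 from point(4) obtain i where i: "mvar i ~: P" by blast
 hence "den (mvar i)" unfolding den_def using mvar_in[OF R, of i] by (auto intro: form_mvar)
 thus ?thesis using den_power[of "mvar i" d] form_power[OF form_mvar, of d i] by auto
qed

lemma reduced_stalkD:
 assumes red: "reduced_ring (stk)" and f: "f : T" "form_of_degree d f" and h: "den h" "h * f ^ n : I"
 shows "EX h. den h & h * f : I"
proof -
 from exists_denominator[of d] obtain g where g: "den g" "form_of_degree d g" by blast
 have fg: "(f, g) : fracs" by (rule fractionsI[OF f(1) g(1) f(2) g(2)])
 have "frc f g [^]\<^bsub>stk\<^esub> n = \<zero>\<^bsub>stk\<^esub>"
  unfolding stalk_power[OF fg] stalk_zero_iff[OF fractions_power[OF fg]] using h by blast
 moreover have "frc f g : carrier (stk)" unfolding stalk_carrier using fg by force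
 ultimately have "frc f g = \<zero>\<^bsub>stk\<^esub>" using red unfolding reduced_ring_def by blast
 thus ?thesis unfolding stalk_zero_iff[OF fg] .
qed

lemma reduced_stalkI:
 assumes "!!f h n d. f : T ==> form_of_degree d f ==> den h ==> h * f ^ n : I ==> EX h. den h & h * f : I"
 shows "reduced_ring (stk)"
 unfolding reduced_ring_def
proof (intro ballI allI impI)
 fix x and n :: nat assume x: "x : carrier (stk)" "x [^]\<^bsub>stk\<^esub> n = \<zero>\<^bsub>stk\<^esub>"
 then obtain f g where fg: "(f, g) : fracs" "x = frc f g" unfolding stalk_carrier by auto
 show "x = \<zero>\<^bsub>stk\<^esub>"
  using x(2) assms[OF fractionsD(1)[OF fg(1)]] fractionsD(3)[OF fg(1)] unfolding fg(2) stalk_power[OF fg(1)] stalk_zero_iff[OF fractions_power[OF fg(1)]] stalk_zero_iff[OF fg(1)] by blast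
qed

end

text \<open>In other words, the generic point is the saturation of the ideal.\<close>

lemma (in graded_ideal) integral_scheme_saturation:
 assumes int: "integral_scheme R I" and G: "!!P. P : pts ==> f : P" and f: "f : T" "form_of_degree d f"
 shows "EX n. mvar i ^ n * f : I"
proof (rule ccontr)
 assume no: "\<not> ?thesis"
 \<comment> \<open>The annihilator of \<open>f\<close> modulo \<open>I\<close>. As it contains no
   power of \<open>x_i\<close>, a homogeneous prime above it is a point at which \<open>f\<close> is
   nonzero in the stalk.\<close>
 define L where "L = {h : T. h * f : I}"
 have L: "is_ideal T L" unfolding L_def
  by (rule is_idealI) (use T_closed I_closed f(1) in \<open>auto simp: distrib_right mult.assoc\<close>)
 have grL: "graded L" unfolding graded_def L_def
 proof (intro ballI allI, clarify, rule conjI)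
  fix h k assume h: "h : T" "h * f : I"
  show "form_part k h : T" by (rule form_part_in[OF sub_ringD(1)[OF R] h(1)])
  have "form_part (d + k) (f * h) = f * form_part k h" unfolding form_part_mult[OF f(2)] by simp
  thus "form_part k h * f : I" using gr h(2) unfolding graded_def by (metis mult.commute)
 qed
 have M: "range ((^) (mvar i)) \<subseteq> T" "1 : range ((^) (mvar i :: 'k pol5))" "L \<inter> range ((^) (mvar i)) = {}"
  using T_closed(7)[OF mvar_in[OF R]] no rangeI[of "(^) (mvar i)" 0] by (auto simp: L_def)
 have mm: "a * b : range ((^) (mvar i))" if "a : range ((^) (mvar i))" "b : range ((^) (mvar i))" for a b :: "'k pol5"
  using that by (auto simp: power_add[symmetric])
 from exists_homogeneous_prime[OF R L grL M(1,2) mm M(3)] obtain P where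
  P: "is_prime T P" "graded P" "L \<subseteq> P" "P \<inter> range ((^) (mvar i)) = {}" by blast
 have iP: "mvar i ~: P" using P(4) rangeI[of "(^) (mvar i)" 1] by auto
 have IL: "I \<subseteq> L" unfolding L_def using I_closed(1) I_closed(5)[OF f(1)] by blast
 have PP: "P : pts" unfolding proj_points_iff using P IL iP by blast
 have LP: "L \<subseteq> P" by (rule P(3))
 interpret graded_ideal_point R I P by unfold_locales (rule PP)
 \<comment> \<open>If these products avoided \<open>I\<close>, some point would not contain
   \<open>f\<close>. As \<open>f\<close> lies in every point, \<open>f\<close> is nilpotent in the
   stalk at \<open>P\<close>, which reducedness then turns into zero.\<close>
 define M where "M = {f ^ m * h | m h. den h}"
 have nil: "I \<inter> M ~= {}"
 proof
  assume IM: "I \<inter> M = {}"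
  have 1: "1 : M" unfolding M_def by (intro CollectI exI[of _ 0] exI[of _ 1]) (simp add: den_1)
  have MT: "M \<subseteq> T" unfolding M_def using T_closed(5,7) f(1) den_T by blast
  have mmM: "a * b : M" if "a : M" "b : M" for a b
  proof -
   from that obtain m h m' h' where "a = f ^ m * h" "b = f ^ m' * h'" "den h" "den h'" unfolding M_def by blast
   thus ?thesis unfolding M_def using den_mult[of h h'] by (intro CollectI exI[of _ "m + m'"] exI[of _ "h * h'"]) (simp add: power_add algebra_simps)
  qed
  from exists_homogeneous_prime[OF R I gr MT 1 mmM IM] obtain P' where P': "is_prime T P'" "graded P'" "I \<subseteq> P'" "P' \<inter> M = {}" by blast
  have "mvar i : M" unfolding M_def
   by (intro CollectI exI[of _ 0] exI[of _ "mvar i"]) (use iP mvar_in[OF R] form_mvar in \<open>auto simp: den_def\<close>)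
  hence "P' : pts" unfolding proj_points_iff using P' by blast
  moreover have "f : M" unfolding M_def using den_1 by (intro CollectI exI[of _ 1] exI[of _ 1]) simp
  ultimately show False using G P'(4) by blast
 qed
 then obtain m h where h: "den h" "f ^ m * h : I" unfolding M_def by blast
 have "reduced_ring (stalk R I P)" using int PP unfolding integral_scheme_def by blast
 from reduced_stalkD[OF this f h(1), of m] h(2) obtain h' where "den h'" "h' * f : I" by (auto simp: mult.commute)
 thus False using LP unfolding L_def den_def by blast
qed

section \<open>Dimension of the Pfaffian scheme\<close>

text \<open>Dividing by \<open>f^a0\<close>, which is not in \<open>p\<close>, leaves
  \<open>t a0\<close> plus a multiple of \<open>f\<close> in \<open>p\<close>; and \<open>f\<close>
  lies in \<open>p'\<close>.\<close>

lemma lowest_term: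
 assumes R: "sub_ring R" and p: "is_prime R p" "is_prime R p'" "p \<subseteq> p'" and f: "f : R" "f : p'" "f ~: p" and t: "!!a. t a : R"
  and s: "(SUM a<=m. t a * f ^ a) : p" and a0: "a0 <= m" "!!a. a < a0 ==> t a : p"
 shows "t a0 : p'"
proof -
 note Rc = sub_ringD[OF R]
 note ip = is_idealD[OF R is_primeD(1)[OF p(1)]] and ip' = is_idealD[OF R is_primeD(1)[OF p(2)]]
 have split: "{..m} = {..<a0} \<union> ({a0} \<union> {a0<..m})" using a0(1) by auto
 define r where "r = (SUM a:{a0<..m}. t a * f ^ (a - a0 - 1))"
 have rS: "r : R" unfolding r_def by (intro Rc(8,5,7) t f(1))
 have "(SUM a<=m. t a * f ^ a) = (SUM a<a0. t a * f ^ a) + (t a0 * f ^ a0 + (SUM a:{a0<..m}. t a * f ^ a))"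
  unfolding split by (subst sum.union_disjoint; (subst sum.union_disjoint)?) auto
 also have "(SUM a:{a0<..m}. t a * f ^ a) = f ^ a0 * (f * r)"
  unfolding r_def sum_distrib_left
 proof (intro sum.cong refl)
  fix a assume "a : {a0<..m}"
  hence "a = a0 + (1 + (a - a0 - 1))" by simp
  hence "f ^ a = f ^ a0 * (f * f ^ (a - a0 - 1))" by (metis power_add power_one_right)
  thus "t a * f ^ a = f ^ a0 * (f * (t a * f ^ (a - a0 - 1)))" by (simp add: ac_simps)
 qed
 finally have "f ^ a0 * (t a0 + f * r) = (SUM a<=m. t a * f ^ a) - (SUM a<a0. t a * f ^ a)" by (simp add: algebra_simps)
 also have "... : p" by (intro ip(7,8) s ip(5)[OF Rc(7)[OF f(1)]] a0(2)) simp
 finally have "f ^ a0 : p \<or> t a0 + f * r : p" by (rule is_primeD(3)[OF p(1) Rc(7)[OF f(1)] Rc(4)[OF t Rc(5)[OF f(1) rS]]])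
 hence "t a0 + f * r : p'" using is_prime_power[OF R p(1) f(1)] f(3) p(3) by blast
 from ip'(7)[OF this ip'(5)[OF rS f(2)]] show ?thesis by simp
qed

context dvr begin

lemma prime_constants:
 assumes p: "is_prime S p" and a: "a : Ov"
 shows "a ~: Mv ==> mconst a ~: p" "mconst pp ~: p ==> mconst a : p ==> a = 0"
proof -
 note ip = is_idealD[OF sub_ring_S is_primeD(1)[OF p]]
 have u: "mconst a ~: p" if "a ~: Mv" "a : Ov" for a
 proof
  assume "mconst a : p"
  hence "mconst (inverse a) * mconst a : p" using unitD(2)[OF that(2,1)] by (intro ip(4)) simp_all
  thus False using is_primeD(2)[OF p] unitD(1)[OF that(2,1)] by (simp add: rhomD(3)[OF rhom_mconst, symmetric] rhomD(1)[OF rhom_mconst])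
 qed
 show "mconst a ~: p" if "a ~: Mv" by (rule u[OF that a])
 show "a = 0" if pp: "mconst pp ~: p" "mconst a : p"
 proof (rule ccontr)
  assume "a ~= 0"
  from nonzero_eq_pp_power[OF a this] obtain n w where w: "w : Ov" "w ~: Mv" "a = pp ^ n * w" by blast
  have "mconst pp ^ n * mconst w : p" using pp(2) unfolding w(3) rhomD(3,8)[OF rhom_mconst] .
  hence "mconst pp ^ n : p \<or> mconst w : p" using is_primeD(3)[OF p] S_closed(7)[of "mconst pp" n] pp(1) w(1) dvr.pp(3)[OF dvr_axioms] by simp
  thus False using u[OF w(2,1)] is_prime_power[OF sub_ring_S p, of "mconst pp" n] pp(1) dvr.pp(3)[OF dvr_axioms] by auto
 qed
qed

lemma form_in_difference:
 assumes p: "is_prime S p" "graded p'" "p \<subset> p'" "p' \<subseteq> S"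
 shows "EX f d. f : p' & f ~: p & form_of_degree d f"
proof -
 from p(3) obtain f where f: "f : p'" "f ~: p" by blast
 have "EX d. form_part d f ~: p"
 proof (rule ccontr)
  assume "\<not> ?thesis"
  hence "(SUM d:mon_deg ` supp f. form_part d f) : p" by (intro is_idealD(8)[OF sub_ring_S is_primeD(1)[OF p(1)]]) blast
  thus False using f(2) sum_form_parts[of f] by simp
 qed
 thus ?thesis using p(2) f(1) form_form_part unfolding graded_def by blast
qed

end

context dvr_closed begin

text \<open>Choose forms \<open>f\<close> in \<open>p1\<close> outside \<open>p0\<close> and
  \<open>h\<close> in \<open>p3\<close> outside \<open>p2\<close>. The products
  \<open>f^a h^b x_i^k\<close> of a fixed degree are too numerous for linear growth and satisfy a
  relation modulo \<open>p0\<close>. Extracting the lowest power of \<open>f\<close>, then that of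
  \<open>h\<close>, leaves a constant in \<open>p3\<close> outside \<open>p2\<close>. By
  \<open>c01\<close> and \<open>c23\<close> the strict steps are not caused by constants;
  \<open>pp\<close> may still enter between \<open>p1\<close> and \<open>p2\<close>.\<close>

lemma no_long_chain:
 assumes c: "minimal_tensor c" and pr: "is_prime S p0" "is_prime S p1" "is_prime S p2" "is_prime S p3" and g: "graded p1" "graded p3"
  and ch: "pfI c \<subseteq> p0" "p0 \<subset> p1" "p1 \<subseteq> p2" "p2 \<subset> p3" and i: "mvar i ~: p3"
  and c01: "!!a. a : Ov ==> mconst a : p1 ==> mconst a : p0" and c23: "!!a. a : Ov ==> mconst a : p3 ==> mconst a : p2"
 shows False
proof -
 have sub: "p1 \<subseteq> S" "p3 \<subseteq> S" using is_idealD(1)[OF sub_ring_S is_primeD(1)] pr by blast+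
 from form_in_difference[OF pr(1) g(1) ch(2) sub(1)] obtain f e1 where f: "f : p1" "f ~: p0" "form_of_degree e1 f" by blast
 from form_in_difference[OF pr(3) g(2) ch(4) sub(2)] obtain h e2 where h: "h : p3" "h ~: p2" "form_of_degree e2 h" by blast
 have fS: "f : S" "h : S" using f h sub by blast+
 define k where "k m a b = (e1 + e2) * m - e1 * a - e2 * b" for m a b
 define H where "H m a b = f ^ a * (h ^ b * mvar i ^ k m a b)" for m a b
 have HS: "H m a b : S" for m a b unfolding H_def by (intro S_closed(5,7) fS S_gens(2))
 have Hf: "form_of_degree ((e1 + e2) * m) (H m a b)" if "a <= m" "b <= m" for m a b
 proof -
  have "(e1 + e2) * m = a * e1 + (b * e2 + k m a b * 1)"
   unfolding k_def add_mult_distrib mult_1_right mult.commute[of a e1] mult.commute[of b e2]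
   using mult_le_mono2[OF that(1), of e1] mult_le_mono2[OF that(2), of e2] by linarith
  thus ?thesis unfolding H_def using form_mult[OF form_power[OF f(3), of a] form_mult[OF form_power[OF h(3), of b] form_power[OF form_mvar, of "k m a b" i]]] by simp
 qed
 from pfaffian_quotient_growth[OF c] obtain C where C: "ALL d. EX G. finite G & G \<subseteq> S & card G <= C * (d + 1) &
  (ALL f:S. form_of_degree d f --> (EX g. (ALL e:G. g e : Ov) & f - (SUM e:G. mconst (g e) * e) : pfI c))" by blast
 have "bounded_growth p0"
 proof (rule bounded_growthI[of p0 C])
  fix d
  from C[rule_format, of d] obtain G where G: "finite G" "G \<subseteq> S" "card G <= C * (d + 1)"
   "ALL f:S. form_of_degree d f --> (EX g. (ALL e:G. g e : Ov) & f - (SUM e:G. mconst (g e) * e) : pfI c)" by (elim exE conjE)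
  have "EX g. (ALL e:G. g e : Ov) & 1 * f - (SUM e:G. mconst (g e) * e) : p0" if "f : S" "form_of_degree d f" for f
   using G(4)[rule_format, OF that] ch(1) unfolding mult_1 by blast
  thus "EX s G. s : S & s ~: p0 & finite G & G \<subseteq> S & card G <= C * (d + 1) &
   (ALL f:S. form_of_degree d f --> (EX g. (ALL e:G. g e : Ov) & s * f - (SUM e:G. mconst (g e) * e) : p0))"
   using G(1-3) S_closed(2) is_primeD(2)[OF pr(1)] by (intro exI[of _ 1] exI[of _ G]) simp
 qed
 hence "EX m c. (ALL a b. c a b : Ov) & (EX a<=m. EX b<=m. c a b = 1) & (SUM a<=m. SUM b<=m. mconst (c a b) * H m a b) : p0"
  by (intro bounded_growth_relation[OF pr(1), where D = "e1 + e2"]) (assumption | rule HS | erule (1) Hf)+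
 then obtain m q where q: "!!a b. q a b : Ov" "EX a<=m. EX b<=m. q a b = 1" "(SUM a<=m. SUM b<=m. mconst (q a b) * H m a b) : p0" by blast
 define t where "t a = (SUM b<=m. mconst (q a b) * (h ^ b * mvar i ^ k m a b))" for a
 have tS: "t a : S" for a unfolding t_def using q(1) by (intro S_closed(8,5,7) fS S_gens(2)) simp
 have "(SUM a<=m. SUM b<=m. mconst (q a b) * H m a b) = (SUM a<=m. t a * f ^ a)"
  unfolding t_def H_def sum_distrib_right by (intro sum.cong refl) (simp add: ac_simps)
 hence ts: "(SUM a<=m. t a * f ^ a) : p0" using q(3) by simp
 define A where "A a \<longleftrightarrow> a <= m & (EX b<=m. mconst (q a b) ~: p0)" for a
 have "EX a. A a" unfolding A_def using q(2) prime_constants(1)[OF pr(1) O_closed(2) one_notin_M] by metis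
 define a0 where "a0 = (LEAST a. A a)"
 have a0: "A a0" "!!a. a < a0 ==> \<not> A a" unfolding a0_def using LeastI_ex[OF \<open>EX a. A a\<close>] not_less_Least by blast+
 have low: "t a : p0" if "a < a0" for a
 proof -
  have "mconst (q a b) : p0" if "b <= m" for b using a0 \<open>a < a0\<close> that unfolding A_def by fastforce
  thus ?thesis unfolding t_def by (intro is_idealD(8)[OF sub_ring_S is_primeD(1)[OF pr(1)]] is_idealD(5)[OF sub_ring_S is_primeD(1)[OF pr(1)]] S_closed(5,7) fS S_gens(2)) simp
 qed
 have "t a0 : p1" using a0(1) by (intro lowest_term[OF sub_ring_S pr(1,2) _ fS(1) f(1,2) tS ts _ low]) (use ch(2) in \<open>auto simp: A_def\<close>)
 obtain b1 where b1: "b1 <= m" "mconst (q a0 b1) ~: p1" using a0(1) c01 q(1) unfolding A_def by blast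
 have "EX r. (ALL b. r b : Ov) & (EX b<=m. mconst (r b) ~: p2) & (SUM b<=m. mconst (r b) * (h ^ b * mvar i ^ k m a0 b)) : p1"
 \<comment> \<open>Some coefficient must be kept outside \<open>p2\<close>. If \<open>pp\<close> is
   in \<open>p1\<close>, a coefficient outside \<open>p1\<close> is a unit; otherwise dividing by a
   coefficient of least valuation produces a coefficient 1.\<close>
 proof (cases "mconst pp : p1")
  case True
  have "q a0 b1 ~: Mv"
  proof
   assume "q a0 b1 : Mv"
   hence "mconst (q a0 b1) : N" by simp
   then obtain w where "w : S" "mconst (q a0 b1) = mconst pp * w" unfolding N_iff by blast
   thus False using b1(2) is_idealD(5)[OF sub_ring_S is_primeD(1)[OF pr(2)] _ True] by simp
  qed
  thus ?thesis using q(1) b1(1) \<open>t a0 : p1\<close> prime_constants(1)[OF pr(3) q(1)] unfolding t_def by blast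
 next
  case False
  have "EX b:{..m}. q a0 b ~= 0" using b1 is_idealD(2)[OF sub_ring_S is_primeD(1)[OF pr(2)]] by (metis atMost_iff rhomD(4)[OF rhom_mconst])
  from scale_to_unit[OF finite_atMost this] obtain u j where u: "u ~= 0" "j <= m" "q a0 j = u" "!!b. b <= m ==> q a0 b / u : Ov" by auto
  define r where "r b = (if b <= m then q a0 b / u else 0)" for b
  have rO: "r b : Ov" for b unfolding r_def using u(4) O_closed(1) by simp
  have sS: "(SUM b<=m. mconst (r b) * (h ^ b * mvar i ^ k m a0 b)) : S" using rO by (intro S_closed(8,5,7) fS S_gens(2)) simp
  have "t a0 = mconst u * (SUM b<=m. mconst (r b) * (h ^ b * mvar i ^ k m a0 b))"
   unfolding t_def sum_distrib_left mult.assoc[symmetric] rhomD(3)[OF rhom_mconst, symmetric]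
   by (intro sum.cong refl) (use u(1) in \<open>simp add: r_def\<close>)
  moreover have "mconst u ~: p1" using prime_constants(2)[OF pr(2) q(1)[of a0 j] False] u(1,3) by blast
  ultimately have "(SUM b<=m. mconst (r b) * (h ^ b * mvar i ^ k m a0 b)) : p1"
   using \<open>t a0 : p1\<close> is_primeD(3)[OF pr(2) _ sS, of "mconst u"] q(1)[of a0 j] u(3) by auto
  moreover have "mconst (r j) ~: p2" using prime_constants(1)[OF pr(3) O_closed(2) one_notin_M] u(1,2,3) by (simp add: r_def)
  ultimately show ?thesis using rO u(2) by blast
 qed
 then obtain r where r: "!!b. r b : Ov" "EX b<=m. mconst (r b) ~: p2" "(SUM b<=m. mconst (r b) * (h ^ b * mvar i ^ k m a0 b)) : p1" by blast
 define w where "w b = mconst (r b) * mvar i ^ k m a0 b" for b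
 have wS: "w b : S" for b unfolding w_def using r(1) by (intro S_closed(5,7) S_gens(2)) simp
 have ws: "(SUM b<=m. w b * h ^ b) : p2" using r(3) ch(3) by (auto simp: w_def ac_simps)
 define b0 where "b0 = (LEAST b. b <= m & mconst (r b) ~: p2)"
 have b0: "b0 <= m & mconst (r b0) ~: p2" "!!b. b < b0 ==> \<not> (b <= m & mconst (r b) ~: p2)"
  unfolding b0_def using LeastI_ex[of "%b. b <= m & mconst (r b) ~: p2"] r(2) not_less_Least by blast+
 have "w b : p2" if "b < b0" for b
 proof -
  have "mconst (r b) : p2" using b0 that by fastforce
  thus ?thesis unfolding w_def by (intro is_idealD(5)[OF sub_ring_S is_primeD(1)[OF pr(3)]] S_closed(7) S_gens(2))
 qed
 from lowest_term[OF sub_ring_S pr(3,4) _ fS(2) h(1,2) wS ws _ this] have "w b0 : p3" using b0(1) ch(4) by blast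
 hence "mconst (r b0) : p3"
  unfolding w_def using is_primeD(3)[OF pr(4) _ S_closed(7)[OF S_gens(2)]] is_prime_power[OF sub_ring_S pr(4) S_gens(2)] i r(1) by (metis mconst_S)
 thus False using c23[OF r(1)] b0(1) by blast
qed

lemma graded_ideal_pfI: assumes c: "minimal_tensor c" shows "graded_ideal Ov (pfI c)"
 by unfold_locales (use sub_ring_O ideal_pfI[OF c] form_part_pfI in \<open>auto simp: graded_def\<close>)

abbreviation opts :: "'a tensor => 'a pol5 set set" where "opts c \<equiv> proj_points Ov (pfI c)"

text \<open>The uniformiser enters at no more than one of the three strict inclusions; the other two
  are given to \<open>no_long_chain\<close>.\<close>

lemma no_point_chain:
 assumes c: "minimal_tensor c" and q: "q0 : opts c" "q1 : opts c" "q2 : opts c" "q3 : opts c"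
  and ch: "q0 \<subset> q1" "q1 \<subset> q2" "q2 \<subset> q3"
 shows False
proof -
 interpret gi: graded_ideal Ov "pfI c" by (rule graded_ideal_pfI[OF c])
 have p: "is_prime S q" "graded q" "pfI c \<subseteq> q" "EX i. mvar i ~: q" if "q : opts c" for q using that gi.proj_points_iff by blast+
 have zero: "mconst a : p" if "is_prime S p'" "mconst pp ~: p'" "a : Ov" "mconst a : p'" "is_prime S p" for a p p'
  using prime_constants(2)[OF that(1,3,2,4)] is_idealD(2)[OF sub_ring_S is_primeD(1)[OF that(5)]] by (simp add: rhomD(4)[OF rhom_mconst])
 have full: "mconst a : p" if "is_prime S p" "is_prime S p'" "mconst pp : p" "a : Ov" "mconst a : p'" for a p p'
 proof -
  have "a : Mv" using prime_constants(1)[OF that(2,4)] that(5) by blast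
  hence "mconst a : N" by simp
  then obtain w where "w : S" "mconst a = mconst pp * w" unfolding N_iff by blast
  thus ?thesis using is_idealD(5)[OF sub_ring_S is_primeD(1)[OF that(1)] _ that(3)] by simp
 qed
 from p(4)[OF q(3)] p(4)[OF q(4)] obtain i2 i3 where i: "mvar i2 ~: q2" "mvar i3 ~: q3" by blast
 show False
 proof (cases "mconst pp : q1")
  case True
  hence "mconst pp : q2" using ch(2) by blast
  thus False
   by (intro no_long_chain[OF c p(1)[OF q(2)] p(1)[OF q(3)] p(1)[OF q(3)] p(1)[OF q(4)] p(2)[OF q(3)] p(2)[OF q(4)] p(3)[OF q(2)] ch(2) subset_refl ch(3) i(2)])
    (erule (1) full[OF p(1)[OF q(2)] p(1)[OF q(3)] True] full[OF p(1)[OF q(3)] p(1)[OF q(4)]])+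
 next
  case n1: False
  show False
  proof (cases "mconst pp : q2")
   case True
   show False
    by (intro no_long_chain[OF c p(1)[OF q(1)] p(1)[OF q(2)] p(1)[OF q(3)] p(1)[OF q(4)] p(2)[OF q(2)] p(2)[OF q(4)] p(3)[OF q(1)] ch(1) psubset_imp_subset[OF ch(2)] ch(3) i(2)])
     (erule (1) zero[OF p(1)[OF q(2)] n1 _ _ p(1)[OF q(1)]] full[OF p(1)[OF q(3)] p(1)[OF q(4)] True])+
  next
   case n2: False
   show False
    by (intro no_long_chain[OF c p(1)[OF q(1)] p(1)[OF q(2)] p(1)[OF q(2)] p(1)[OF q(3)] p(2)[OF q(2)] p(2)[OF q(3)] p(3)[OF q(1)] ch(1) subset_refl ch(2) i(1)])
     (erule (1) zero[OF p(1)[OF q(2)] n1 _ _ p(1)[OF q(1)]] zero[OF p(1)[OF q(3)] n2 _ _ p(1)[OF q(2)]])+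
  qed
 qed
qed

text \<open>If \<open>Q + N\<close> contained a power of every variable, it would contain all forms
  of some degree, and by \<open>nakayama\<close> with no generators so would \<open>Q\<close>, which
  is a point. Hence powers of some variable can be avoided by a homogeneous prime above
  \<open>Q + N\<close>.\<close>

lemma exists_special_point_above:
 assumes c: "minimal_tensor c" and Q: "Q : opts c" "mconst pp ~: Q"
 shows "EX P:opts c. Q \<subset> P"
proof -
 interpret gi: graded_ideal Ov "pfI c" by (rule graded_ideal_pfI[OF c])
 have q: "is_prime S Q" "graded Q" "pfI c \<subseteq> Q" "EX i. mvar i ~: Q" using Q(1) gi.proj_points_iff by blast+
 note iq = is_idealD[OF sub_ring_S is_primeD(1)[OF q(1)]]
 define J where "J = {f + g | f g. f : Q & g : N}"
 have J: "is_ideal S J" unfolding J_def by (rule ideal_add[OF is_primeD(1)[OF q(1)] is_primeD(1)[OF prime_N]])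
 note iJ = is_idealD[OF sub_ring_S J]
 have grJ: "graded J" unfolding graded_def
 proof (intro ballI allI)
  fix f d assume "f : J"
  then obtain a b where "f = a + b" "a : Q" "b : N" unfolding J_def by blast
  thus "form_part d f : J" unfolding J_def using q(2) form_part_in[OF zero_in_M] form_part_add unfolding graded_def by blast
 qed
 have "EX i. ALL n. mvar i ^ n ~: J"
 proof (rule ccontr)
  assume "\<not> ?thesis"
  then obtain e where e: "!!i. mvar i ^ e i : J" by metis
  \<comment> \<open>Pigeonhole: a monomial of degree \<open>d + 1\<close> has an exponent of at
    least \<open>e i\<close> for some \<open>i\<close>.\<close>
  define d where "d = (SUM i:UNIV. e i)"
  have mon: "mnm m : J" if m: "mon_deg m = Suc d" for m :: "5 \<Rightarrow>\<^sub>0 nat"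
  proof -
   have "EX i. e i <= coef m i"
   proof (rule ccontr)
    assume "\<not> ?thesis"
    hence "(SUM i:UNIV. coef m i) <= (SUM i:UNIV. e i)" by (intro sum_mono) (simp add: less_imp_le not_le)
    thus False using m unfolding mon_deg_sum d_def by simp
   qed
   then obtain i where "e i <= coef m i" by blast
   hence mi: "m = sgl i (e i) + (m - sgl i (e i))"
    by (intro poly_mapping_eqI) (auto simp: lookup_add lookup_minus lookup_single when_def)
   have "(mnm m :: 'a pol5) = mvar i ^ e i * mnm (m - sgl i (e i))"
    by (subst mi) (simp only: mono_eq_mval mval_add mval_single)
   thus ?thesis using iJ(5)[OF S_gens(1) e] by simp
  qed
  have all: "f : J" if f: "f : S" "form_of_degree (Suc d) f" for f
  proof -
   have cf: "coef f m : Ov" for m using f(1) by (simp add: mpols_over_def)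
   have "(SUM m:supp f. mconst (coef f m) * mnm m) : J"
    using f(2) by (intro iJ(8) iJ(4) mon) (auto simp: cf form_of_degree_def)
   moreover have "f = (SUM m:supp f. mconst (coef f m) * mnm m)" unfolding single_conv[symmetric] by (rule poly_sum_single)
   ultimately show ?thesis by metis
  qed
  have "f : spanned Q {}" if f: "f : S" "form_of_degree (Suc d) f" for f
  proof (rule nakayama[OF is_primeD(1)[OF q(1)] _ _ _ f])
   show "form_part k g : Q" if "g : Q" for g k using q(2) that unfolding graded_def by blast
   show "g : spanned {f + g | f g. f : Q & g : N} {}" if "g : S" "form_of_degree (Suc d) g" for g
    unfolding J_def[symmetric] by (rule spanned_closed(1)[OF J all[OF that]])
  qed simp
  from this[OF S_closed(7)[OF S_gens(2)] form_power[OF form_mvar, of "Suc d", unfolded mult_1_right]]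
  have "mvar i ^ Suc d : Q" for i unfolding spanned_def by (simp del: power_Suc)
  thus False using is_prime_power[OF sub_ring_S q(1) S_gens(2)] q(4) by blast
 qed
 then obtain i where i: "!!n. mvar i ^ n ~: J" by blast
 have M: "range ((^) (mvar i)) \<subseteq> S" "1 : range ((^) (mvar i :: 'a pol5))" "J \<inter> range ((^) (mvar i)) = {}"
  using S_closed(7)[OF S_gens(2)] i rangeI[of "(^) (mvar i)" 0] by auto
 have mm: "a * b : range ((^) (mvar i))" if "a : range ((^) (mvar i))" "b : range ((^) (mvar i))" for a b :: "'a pol5"
  using that by (auto simp: power_add[symmetric])
 from exists_homogeneous_prime[OF sub_ring_O J grJ M(1,2) mm M(3)] obtain P where
  P: "is_prime S P" "graded P" "J \<subseteq> P" "P \<inter> range ((^) (mvar i)) = {}" by blast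
 have "mvar i ~: P" using P(4) rangeI[of "(^) (mvar i)" 1] by auto
 moreover have QJ: "Q \<subseteq> J" unfolding J_def using N_closed(2) by force
 ultimately have "P : opts c" unfolding gi.proj_points_iff using P q(3) by blast
 moreover have "mconst pp : J" unfolding J_def using iq(2) pp(4) by force
 ultimately show ?thesis using P(3) QJ Q(2) by blast
qed

end

section \<open>Comparison with the geometric generic fibre\<close>

definition mac :: "'a::field pol5 => 'a alg_closure pol5" where "mac = Poly_Mapping.map to_ac"

lemma coef_mac: "coef (mac p) m = to_ac (coef p m)"
 by (simp add: mac_def Poly_Mapping.map.rep_eq when_def)

lemma rhom_mac: "rhom (mac :: 'a::field pol5 => _)"
proof -
 have r: "rhom (%a. mconst (to_ac a) :: 'a alg_closure pol5)" by (simp add: rhom_def rhomD[OF rhom_mconst])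
 have "mac p = meval (%a. mconst (to_ac a)) mvar p" for p :: "'a pol5"
 proof (rule poly_mapping_eqI)
  fix m
  have e: "meval (%a. mconst (to_ac a)) mvar p = (SUM k:supp p. mconst (to_ac (coef p k)) * mnm k)"
   unfolding mono_eq_mval by (rule meval_alt) (simp_all add: rhomD[OF rhom_mconst])
  have "coef (meval (%a. mconst (to_ac a)) mvar p) m = (SUM k:supp p. if k = m then to_ac (coef p m) else 0)"
   unfolding e lookup_sum coef_mconst_mult lookup_single when_def by (intro sum.cong refl) auto
  thus "coef (mac p) m = coef (meval (%a. mconst (to_ac a)) mvar p) m" by (simp add: coef_mac in_keys_iff)
 qed
 hence "(mac :: 'a pol5 => _) = meval (%a. mconst (to_ac a)) mvar" by (intro ext)
 from rhom_meval(1)[OF r, where s = mvar] show ?thesis unfolding \<open>(mac :: 'a pol5 => _) = meval (%a. mconst (to_ac a)) mvar\<close> .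
qed

lemma mac_gens: "mac (mconst a) = mconst (to_ac a)" "mac (mvar i) = mvar i" "mac (mnm m) = mnm m"
 by (rule poly_mapping_eqI, simp add: coef_mac mconst_def mvar_def lookup_single when_def)+

lemma form_part_mac: "form_part d (mac f) = mac (form_part d f)"
 by (rule poly_mapping_eqI) (simp add: coef_form_part coef_mac)

abbreviation tac :: "'a::field tensor => 'a alg_closure tensor" where "tac c \<equiv> %i j k. to_ac (c i j k)"

lemma lform_mac: "lform (tac c) i j = mac (lform c i j)"
 by (simp add: lform_def rhomD[OF rhom_mac] mac_gens)

lemma pf5_mac: "pf5 (lform (tac c)) i = mac (pf5 (lform c) i)"
 unfolding pf5_def rhom_pf2[OF rhom_mac] lform_mac ..

lemma pf_comb_mac: "pf_comb (tac c) (%i. mac (z i)) = mac (pf_comb c z)"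
 by (simp add: pf_comb_def pf5_mac rhomD[OF rhom_mac])

interpretation ac: vector_space "%(a::'a::field) (x::'a alg_closure). to_ac a * x"
 by unfold_locales (simp_all add: algebra_simps)

text \<open>Extend \<open>{1}\<close> to a basis of the closure over the field. This linear
  retraction does the work of faithful flatness of the field extension.\<close>

lemma exists_retraction:
 "EX \<rho> :: 'a::field alg_closure => 'a. (ALL x y. \<rho> (x + y) = \<rho> x + \<rho> y) & (ALL a x. \<rho> (to_ac a * x) = a * \<rho> x) & \<rho> 1 = 1"
proof -
 interpret s: vector_space "(*) :: 'a => 'a => 'a" by unfold_locales (simp_all add: algebra_simps)
 interpret pr: vector_space_pair "%(a::'a) (x::'a alg_closure). to_ac a * x" "(*) :: 'a => 'a => 'a" ..
 have "ac.independent {1 :: 'a alg_closure}" by simp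
 from pr.linear_independent_extend[OF this, of "%_. 1"] obtain g where
  g: "Vector_Spaces.linear (%(a::'a) (x::'a alg_closure). to_ac a * x) (*) g" "g 1 = 1" by auto
 interpret g: Vector_Spaces.linear "%(a::'a) (x::'a alg_closure). to_ac a * x" "(*)" g by (rule g(1))
 show ?thesis using g.add g.scale g(2) by blast
qed

lemma coef_var_mult:
 "coef (mvar x * q) m = (if 1 <= coef m x then coef (q :: ('v::finite, 'a::comm_ring_1) mpol) (m - sgl x 1) else 0)"
 using coef_var_power_mult[of x 1 q m] by simp

text \<open>Applied to coefficients, the retraction is linear over polynomials with coefficients in
  the small field, so it carries a combination of the Pfaffians over the closure to one over the
  field.\<close>

lemma pf_comb_contraction:
 assumes "mac f = pf_comb (tac c) z" shows "EX z'. f = pf_comb c z'"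
proof -
 from exists_retraction[where 'a = 'a] obtain \<rho> :: "'a alg_closure => 'a" where
  \<rho>: "!!x y. \<rho> (x + y) = \<rho> x + \<rho> y" "!!a x. \<rho> (to_ac a * x) = a * \<rho> x" "\<rho> 1 = 1" by blast
 have \<rho>0: "\<rho> 0 = 0" and \<rho>a: "\<rho> (to_ac a) = a" for a using \<rho>(2)[of 0 0] \<rho>(2)[of a 1] \<rho>(3) by simp_all
 define r where "r = (Poly_Mapping.map \<rho> :: 'a alg_closure pol5 => 'a pol5)"
 have cr: "coef (r w) m = \<rho> (coef w m)" for w m unfolding r_def by (simp add: Poly_Mapping.map.rep_eq when_def \<rho>0)
 have add: "r (w + w') = r w + r w'" for w w' by (rule poly_mapping_eqI) (simp add: cr lookup_add \<rho>(1))
 have rp: "r (mac p * w) = p * r w" for p w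
 proof (induction p arbitrary: w rule: mpol_induct)
  case (const a) show ?case by (rule poly_mapping_eqI) (simp add: mac_gens cr \<rho>(2))
 next
  case (var i)
  show ?case by (rule poly_mapping_eqI) (simp add: mac_gens cr \<rho>0 coef_var_mult)
 next
  case (add p q) thus ?case by (simp add: rhomD[OF rhom_mac] distrib_right \<open>!!w w'. r (w + w') = r w + r w'\<close>)
 next
  case (mult p q) thus ?case by (simp add: rhomD[OF rhom_mac] mult.assoc)
 qed
 have "f = r (mac f)" by (rule poly_mapping_eqI) (simp add: cr coef_mac \<rho>a)
 also have "... = (SUM i:UNIV. r (mac (pf5 (lform c) i) * z i))"
  unfolding assms pf_comb_def pf5_mac sum_5 add by (simp add: mult.commute)
 finally show ?thesis unfolding rp pf_comb_def by (intro exI[of _ "%i. r (z i)"]) (simp add: mult.commute)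
qed

text \<open>Elements are adjoined one at a time: the powers of \<open>a\<close> below the degree of
  an equation for \<open>a\<close>, times the old set, span a space that is also stable under
  \<open>a\<close>.\<close>

lemma algebraic_finite_span:
 assumes "finite C"
 shows "EX B :: 'a::field alg_closure set. finite B & 1 : ac.span B & (ALL c:C. ALL b:B. c * b : ac.span B)"
 using assms
proof (induction C rule: finite_induct)
 case empty show ?case by (intro exI[of _ "{1}"]) (simp add: ac.span_base)
next
 case (insert a C)
 then obtain B :: "'a alg_closure set" where B: "finite B" "1 : ac.span B" "!!c b. c : C ==> b : B ==> c * b : ac.span B" by blast
 obtain p :: "'a Polynomial.poly" where p: "p ~= 0" "Polynomial.poly (map_poly to_ac p) a = 0" by (rule alg_closure_algebraic)
 define n where "n = Polynomial.degree p"
 define B' where "B' = (%(k, b). a ^ k * b) ` ({..<n} \<times> B)"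
 have sm: "x * y : ac.span D" if "y : ac.span E" "!!b. b : E ==> x * b : ac.span D" for x y D E
  using that(1)
 proof (induction rule: ac.span_induct_alt)
  case (step c u v)
  have "x * (to_ac c * u + v) = to_ac c * (x * u) + x * v" by (simp add: algebra_simps)
  thus ?case using ac.span_add[OF ac.span_scale[OF that(2)[OF step(1)], of c] step(2)] by simp
 qed (simp add: ac.span_zero)
 have gen: "a ^ k * b : ac.span B'" if "k < n" "b : B" for k b unfolding B'_def using that by (intro ac.span_base) force
 have low: "a ^ k * x : ac.span B'" if "k < n" "x : ac.span B" for k x using sm[OF that(2)] gen[OF that(1)] by blast
 have lc: "pcoeff p n ~= 0" unfolding n_def using p(1) by simp
 have mp: "Polynomial.poly (map_poly to_ac p) a = (SUM k<=n. to_ac (pcoeff p k) * a ^ k)"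
  unfolding poly_altdef n_def by (simp add: coeff_map_poly degree_map_poly)
 have n0: "0 < n"
 proof (rule ccontr)
  assume "\<not> 0 < n"
  thus False using p(2) lc unfolding mp by simp
 qed
 have top: "a ^ n * b : ac.span B'" if b: "b : B" for b
 proof -
  have "(SUM k<n. to_ac (pcoeff p k) * a ^ k) + to_ac (pcoeff p n) * a ^ n = 0"
   using p(2) unfolding mp by (simp add: lessThan_Suc_atMost[symmetric])
  hence "a ^ n = to_ac (- inverse (pcoeff p n)) * (SUM k<n. to_ac (pcoeff p k) * a ^ k)"
   using lc by (simp add: field_simps eq_neg_iff_add_eq_0)
  hence "a ^ n * b = to_ac (- inverse (pcoeff p n)) * (SUM k<n. to_ac (pcoeff p k) * (a ^ k * b))"
   by (simp only: sum_distrib_left sum_distrib_right mult.assoc)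
  also have "... : ac.span B'" using gen b by (intro ac.span_scale ac.span_sum) auto
  finally show ?thesis .
 qed
 have "a * (a ^ k * b) : ac.span B'" if "k < n" "b : B" for k b
  using gen[of "Suc k" b] top[of b] that by (cases "Suc k = n") (auto simp: mult.assoc[symmetric])
 moreover have "c * (a ^ k * b) : ac.span B'" if "c : C" "k < n" "b : B" for c k b
  using low[OF that(2) B(3)[OF that(1,3)]] by (simp add: ac_simps)
 moreover have "1 : ac.span B'" using low[OF n0 B(2)] by simp
 moreover have "finite B'" unfolding B'_def using B(1) by simp
 ultimately show ?case unfolding B'_def by (intro exI[of _ "(%(k, b). a ^ k * b) ` ({..<n} \<times> B)"]) auto
qed

text \<open>Incomparability for an integral extension, by linear algebra. The powers of
  \<open>f\<close> lie in \<open>W\<close>, which has \<open>card B\<close> generators over the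
  small polynomial ring; so \<open>card B + 1\<close> of them are dependent modulo the contraction
  of \<open>G\<close>, and \<open>lowest_term\<close> puts the lowest surviving coefficient into
  \<open>P\<close>.\<close>

lemma contraction_strict:
 fixes G P :: "'a::field alg_closure pol5 set"
 assumes G: "is_prime UNIV G" and P: "is_prime UNIV P" and GP: "G \<subset> P"
 shows "EX h. mac h : P & mac h ~: G"
proof -
 from GP obtain f where f: "f : P" "f ~: G" by blast
 note iG = is_idealD[OF sub_ring_UNIV is_primeD(1)[OF G]]
 from algebraic_finite_span[of "coef f ` supp f"] obtain B :: "'a alg_closure set" where
  B: "finite B" "1 : ac.span B" "!!m b. m : supp f ==> b : B ==> coef f m * b : ac.span B" by auto
 define W where "W = {SUM b:B. mac (M b) * mconst b | M. True}"
 have W0: "0 : W" unfolding W_def by (intro CollectI exI[of _ "%_. 0"]) (simp add: rhomD[OF rhom_mac])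
 have Wadd: "x + y : W" if "x : W" "y : W" for x y
 proof -
  from that obtain M M' where "x = (SUM b:B. mac (M b) * mconst b)" "y = (SUM b:B. mac (M' b) * mconst b)" unfolding W_def by blast
  thus ?thesis unfolding W_def by (intro CollectI exI[of _ "%b. M b + M' b"]) (simp add: rhomD[OF rhom_mac] distrib_right sum.distrib)
 qed
 have Wmult: "mac p * x : W" if "x : W" for p x
 proof -
  from that obtain M where "x = (SUM b:B. mac (M b) * mconst b)" unfolding W_def by blast
  thus ?thesis unfolding W_def by (intro CollectI exI[of _ "%b. p * M b"]) (simp add: rhomD[OF rhom_mac] mult.assoc sum_distrib_left)
 qed
 have Wsum: "sum g D : W" if "!!d. d : D ==> g d : W" for g and D :: "'d set"
  using that by (induction D rule: infinite_finite_induct) (auto intro: W0 Wadd)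
 have Wspan: "mconst x : W" if "x : ac.span B" for x
 proof -
  from that obtain u where "x = (SUM b:B. to_ac (u b) * b)" unfolding ac.span_finite[OF B(1)] by blast
  thus ?thesis unfolding W_def by (intro CollectI exI[of _ "%b. mconst (u b)"]) (simp add: mac_gens rhomD[OF rhom_mconst])
 qed
 have Wf: "f * x : W" if "x : W" for x
 proof -
  from that obtain M where M: "x = (SUM b:B. mac (M b) * mconst b)" unfolding W_def by blast
  have "f * mconst b : W" if b: "b : B" for b
  proof -
   have "f = (SUM m:supp f. mconst (coef f m) * mnm m)" unfolding single_conv[symmetric] by (rule poly_sum_single)
   from arg_cong[OF this, of "%x. x * mconst b"] have "f * mconst b = (SUM m:supp f. mconst (coef f m) * mnm m * mconst b)"
    unfolding sum_distrib_right .
   also have "... = (SUM m:supp f. mac (mnm m) * mconst (coef f m * b))"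
    by (intro sum.cong refl) (simp add: mac_gens rhomD(3)[OF rhom_mconst] ac_simps)
   also have "... : W" by (intro Wsum Wmult Wspan B(3) b)
   finally show ?thesis .
  qed
  hence "(SUM b:B. mac (M b) * (f * mconst b)) : W" by (intro Wsum Wmult)
  thus ?thesis unfolding M by (simp add: sum_distrib_left ac_simps)
 qed
 have "f ^ j : W" for j
 proof (induction j)
  case 0 thus ?case using Wspan[OF B(2)] by (simp add: rhomD(1)[OF rhom_mconst])
 qed (simp add: Wf)
 hence "ALL j. EX M. f ^ j = (SUM b:B. mac (M b) * mconst b)" unfolding W_def by blast
 then obtain M where M: "!!j. f ^ j = (SUM b:B. mac (M j b) * mconst b)" by metis
 define q where "q = {h. mac h : G}"
 have q: "is_prime UNIV q" unfolding is_prime_def is_ideal_def q_def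
  using iG is_primeD(2,3)[OF G] by (auto simp: rhomD[OF rhom_mac])
 have "EX t. (ALL j:{..card B}. t j : UNIV) & (EX j:{..card B}. t j ~: q) & (ALL e:B. (SUM j:{..card B}. t j * M j e) : q)"
  by (rule relation_mod_prime[OF sub_ring_UNIV q B(1)]) simp_all
 then obtain t where t: "EX j<=card B. t j ~: q" "!!e. e : B ==> (SUM j<=card B. t j * M j e) : q" by auto
 have "(SUM j<=card B. mac (t j) * f ^ j) = (SUM e:B. mac (SUM j<=card B. t j * M j e) * mconst e)"
  unfolding M rhomD[OF rhom_mac] sum_distrib_left sum_distrib_right mult.assoc by (rule sum.swap)
 also have "... : G" using t(2) unfolding q_def by (intro iG(8) iG(5)) auto
 finally have s: "(SUM j<=card B. mac (t j) * f ^ j) : G" .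
 define j0 where "j0 = (LEAST j. j <= card B & t j ~: q)"
 have j0: "j0 <= card B & t j0 ~: q" "!!j. j < j0 ==> \<not> (j <= card B & t j ~: q)"
  unfolding j0_def using LeastI_ex[of "%j. j <= card B & t j ~: q"] t(1) not_less_Least by blast+
 have low: "mac (t j) : G" if "j < j0" for j using j0 that unfolding q_def by fastforce
 have "mac (t j0) : P"
  by (rule lowest_term[OF sub_ring_UNIV G P psubset_imp_subset[OF GP] UNIV_I f UNIV_I s conjunct1[OF j0(1)] low])
 thus ?thesis using j0(1) unfolding q_def by blast
qed

context dvr begin

lemma scale_to_S: "EX n. mconst (pp ^ n) * f : S"
proof -
 from pp_power_mult have "ALL m. EX n. pp ^ n * coef f m : Ov" by blast
 then obtain n where n: "!!m. pp ^ n m * coef f m : Ov" by metis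
 define k where "k = (SUM m:supp f. n m)"
 have "pp ^ k * coef f m : Ov" for m
 proof (cases "m : supp f")
  case True
  hence "n m <= k" unfolding k_def by (intro member_le_sum) auto
  hence e: "pp ^ k = pp ^ (k - n m) * pp ^ n m" by (simp flip: power_add)
  show ?thesis unfolding e mult.assoc by (rule O_closed(5)[OF O_closed(7)[OF pp(3)] n])
 qed (simp add: in_keys_iff O_closed(1))
 thus ?thesis by (intro exI[of _ k]) (simp add: mpols_over_def)
qed

end

context dvr_closed begin

text \<open>Clear denominators by a power of \<open>pp\<close>, then remove it by torsion-freeness:
  \<open>pfI c\<close> is the trace on \<open>S\<close> of the ideal it generates over the
  field.\<close>

lemma pfI_of_field_combination:
 assumes c: "minimal_tensor c" and f: "f : S" "f = pf_comb c z"
 shows "f : pfI c"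
proof -
 from scale_to_S have "ALL i. EX n. mconst (pp ^ n) * z i : S" by blast
 then obtain n where n: "!!i. mconst (pp ^ n i) * z i : S" by metis
 define k where "k = (SUM i:UNIV. n i)"
 have "mconst (pp ^ k) * z i : S" for i
 proof -
  have "n i <= k" unfolding k_def by (intro member_le_sum) auto
  hence e: "pp ^ k = pp ^ (k - n i) * pp ^ n i" by (simp flip: power_add)
  show ?thesis unfolding e rhomD(3)[OF rhom_mconst] mult.assoc by (rule S_closed(5)[OF _ n]) (simp add: O_closed(7)[OF pp(3)])
 qed
 hence "mconst (pp ^ k) * f : pfI c" unfolding pfI_def f(2) pf_comb_linear(2)[symmetric] by blast
 thus ?thesis
 proof (induction k)
  case 0 thus ?case by (simp add: rhomD[OF rhom_mconst])
 next
  case (Suc k)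
  have "mconst (pp ^ k) * f : S" using O_closed(7)[OF pp(3)] by (intro S_closed(5) f(1)) simp
  moreover have "mconst pp * (mconst (pp ^ k) * f) : pfI c" using Suc.prems by (simp add: rhomD[OF rhom_mconst] mult.assoc)
  ultimately show ?case using pfaffian_quotient_torsion_free[OF c] Suc.IH by blast
 qed
qed

lemma pfaffian_scheme_integral_dim:
 assumes c: "minimal_tensor c" and int: "integral_scheme UNIV {pf_comb (tac c) z | z. True}" and dim: "space_dim (proj_space UNIV {pf_comb (tac c) z | z. True}) = 1"
 shows "integral_scheme Ov (pfI c)" "space_dim (proj_space Ov (pfI c)) = 2"
proof -
 define J where "J = {pf_comb (tac c) z | z. True}"
 have U: "mpols_over UNIV = (UNIV :: 'a alg_closure pol5 set)" by (simp add: mpols_over_def)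
 have "is_ideal UNIV J" using ideal_pf_comb[OF sub_ring_UNIV, of "tac c"] unfolding U J_def by simp
 moreover have "graded J" unfolding graded_def J_def using form_part_pf_comb by blast
 ultimately interpret G: graded_ideal "UNIV :: 'a alg_closure set" J by unfold_locales (simp_all add: sub_ring_UNIV U)
 interpret gi: graded_ideal Ov "pfI c" by (rule graded_ideal_pfI[OF c])
 note pts = G.proj_points_iff[unfolded U]
 have intJ: "integral_scheme UNIV J" and dimJ: "space_dim (proj_space UNIV J) = 1" using int dim by (simp_all add: J_def)
 have "irreducible_space (proj_space UNIV J)" using intJ unfolding integral_scheme_def by blast
 then obtain \<eta> where \<eta>: "\<eta> : proj_points UNIV J" "ALL P:proj_points UNIV J. \<eta> \<subseteq> P" unfolding G.irreducible_proj_space_iff by blast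
 from G.space_dim_1E[OF dimJ] obtain P0 P1 where P01: "P0 : proj_points UNIV J" "P1 : proj_points UNIV J" "P0 \<subset> P1" by blast
 have \<eta>P: "\<eta> \<subset> P1" using \<eta>(2) P01 by blast
 \<comment> \<open>The contraction of a point of the geometric generic fibre; it contains no nonzero
   constant, in particular not \<open>pp\<close>.\<close>
 define con where "con P = {f : S. mac f : P}" for P
 have con: "con P : opts c" "mconst a : con P ==> a = 0" if "P : proj_points UNIV J" for P a
 proof -
  have p: "is_prime UNIV P" "graded P" "J \<subseteq> P" "EX i. mvar i ~: P" using that pts by blast+
  note iP = is_idealD[OF sub_ring_UNIV is_primeD(1)[OF p(1)]]
  have "is_ideal S (con P)" unfolding con_def
   using iP S_closed by (intro is_idealI) (auto simp: rhomD[OF rhom_mac])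
  hence "is_prime S (con P)" unfolding is_prime_def con_def using is_primeD(2,3)[OF p(1)] by (auto simp: rhomD[OF rhom_mac])
  moreover have "graded (con P)" using p(2) form_part_in[OF O_closed(1)] unfolding graded_def con_def by (auto simp: form_part_mac[symmetric])
  moreover have "pfI c \<subseteq> con P"
  proof
   fix f assume f: "f : pfI c"
   then obtain z where "f = pf_comb c z" unfolding pfI_def by blast
   hence "mac f : J" unfolding J_def by (intro CollectI exI[of _ "%i. mac (z i)"]) (simp add: pf_comb_mac)
   thus "f : con P" unfolding con_def using p(3) gi.I_closed(1)[OF f] by blast
  qed
  moreover have "EX i. mvar i ~: con P" using p(4) unfolding con_def mac_gens by (auto simp: mac_gens)
  ultimately show "con P : opts c" unfolding gi.proj_points_iff by blast
  show "a = 0" if a: "mconst a : con P"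
  proof (rule ccontr)
   assume "a ~= 0"
   moreover have "mconst (inverse (to_ac a)) * mconst (to_ac a) : P" using a unfolding con_def by (intro iP(4)) (simp_all add: mac_gens)
   ultimately show False using is_primeD(2)[OF p(1)] by (simp add: rhomD(3)[OF rhom_mconst, symmetric] rhomD(1)[OF rhom_mconst])
  qed
 qed
 \<comment> \<open>This serves twice: it places \<open>con \<eta>\<close> inside every point, which
   gives irreducibility, and it makes nilpotent germs vanish.\<close>
 have sat: "EX n. mvar i ^ n * f : pfI c" if f: "f : con \<eta>" "form_of_degree d f" for f d i
 proof -
  have "form_of_degree d (mac f)" using f(2) by (simp add: form_of_degree_alt coef_mac)
  hence "EX n. mvar i ^ n * mac f : J"
   using f(1) \<eta>(2) by (intro G.integral_scheme_saturation[OF intJ]) (auto simp: con_def U)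
  then obtain n z where "mvar i ^ n * mac f = pf_comb (tac c) z" unfolding J_def by blast
  hence "mac (mvar i ^ n * f) = pf_comb (tac c) z" by (simp add: rhomD[OF rhom_mac] mac_gens)
  from pf_comb_contraction[OF this] obtain z' where "mvar i ^ n * f = pf_comb c z'" by blast
  moreover have "mvar i ^ n * f : S" using f(1) by (intro S_closed(5,7) S_gens(2)) (simp add: con_def)
  ultimately show ?thesis using pfI_of_field_combination[OF c] by blast
 qed
 have gen: "con \<eta> \<subseteq> P" if P: "P : opts c" for P
 proof
  fix f assume f: "f : con \<eta>"
  have p: "is_prime S P" "pfI c \<subseteq> P" using P gi.proj_points_iff by blast+
  from P obtain i where i: "mvar i ~: P" using gi.proj_points_iff by blast
  have "form_part d f : P" for d
  proof -
   have fd: "form_part d f : con \<eta>" using con(1)[OF \<eta>(1)] f unfolding gi.proj_points_iff graded_def by blast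
   from sat[OF this form_form_part, of i] obtain n where "mvar i ^ n * form_part d f : P" using p(2) by blast
   thus ?thesis using is_primeD(3)[OF p(1) S_closed(7)[OF S_gens(2)], of "form_part d f" i n] is_prime_power[OF sub_ring_S p(1) S_gens(2), of i n] i fd
    by (auto simp: con_def)
  qed
  hence "(SUM d:mon_deg ` supp f. form_part d f) : P" by (intro is_idealD(8)[OF sub_ring_S is_primeD(1)[OF p(1)]])
  thus "f : P" using sum_form_parts[of f] by simp
 qed
 have "reduced_ring (stalk Ov (pfI c) P)" if P: "P : opts c" for P
 proof -
  interpret pt: graded_ideal_point Ov "pfI c" P by unfold_locales (rule P)
  show ?thesis
  proof (rule pt.reduced_stalkI)
   fix f h n d assume f: "f : S" "form_of_degree d f" "pt.den h" "h * f ^ n : pfI c"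
   have q: "is_prime S (con \<eta>)" "pfI c \<subseteq> con \<eta>" using con(1)[OF \<eta>(1)] gi.proj_points_iff by blast+
   have "h * f ^ n : con \<eta>" using f(4) q(2) by blast
   moreover have "h ~: con \<eta>" using f(3) gen[OF P] unfolding pt.den_def by blast
   ultimately have "f ^ n : con \<eta>" using is_primeD(3)[OF q(1) pt.den_T[OF f(3)] S_closed(7)[OF f(1)]] by blast
   hence fc: "f : con \<eta>" by (rule is_prime_power[OF sub_ring_S q(1) f(1)])
   from P obtain i where i: "mvar i ~: P" using gi.proj_points_iff by blast
   from sat[OF fc f(2), of i] obtain k where "mvar i ^ k * f : pfI c" by blast
   moreover have "pt.den (mvar i ^ k)" by (rule pt.den_power) (use i S_gens(2) form_mvar in \<open>auto simp: pt.den_def\<close>)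
   ultimately show "EX h. pt.den h & h * f : pfI c" by blast
  qed
 qed
 thus "integral_scheme Ov (pfI c)"
  unfolding integral_scheme_def gi.irreducible_proj_space_iff using con(1)[OF \<eta>(1)] gen by blast
 have pr: "is_prime UNIV \<eta>" "is_prime UNIV P1" using \<eta>(1) P01(2) pts by blast+
 from contraction_strict[OF pr \<eta>P] obtain h where h: "mac h : P1" "mac h ~: \<eta>" by blast
 \<comment> \<open>Contraction to the field separates the two points; clearing denominators moves
   the separating polynomial into \<open>S\<close>.\<close>
 from scale_to_S[of h] obtain n where n: "mconst (pp ^ n) * h : S" by blast
 have "mac (mconst (pp ^ n) * h) : P1" unfolding rhomD(3)[OF rhom_mac] by (rule is_idealD(4)[OF sub_ring_UNIV is_primeD(1)[OF pr(2)] UNIV_I h(1)])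
 moreover have "mac (mconst (pp ^ n) * h) ~: \<eta>"
 proof
  assume "mac (mconst (pp ^ n) * h) : \<eta>"
  hence "mac (mconst (pp ^ n)) : \<eta>" using is_primeD(3)[OF pr(1) UNIV_I UNIV_I] h(2) unfolding rhomD(3)[OF rhom_mac] by blast
  hence "mconst (pp ^ n) : con \<eta>" unfolding con_def using O_closed(7)[OF pp(3)] by simp
  from con(2)[OF \<eta>(1) this] show False using pp(1) by simp
 qed
 ultimately have "con \<eta> \<subset> con P1" using n \<eta>P unfolding con_def by blast
 moreover have "mconst pp ~: con P1" using con(2)[OF P01(2)] pp(1) by blast
 from exists_special_point_above[OF c con(1)[OF P01(2)] this] obtain P2 where "P2 : opts c" "con P1 \<subset> P2" by blast
 ultimately show "space_dim (proj_space Ov (pfI c)) = 2"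
  by (intro gi.space_dim_eq_2[OF con(1)[OF \<eta>(1)] con(1)[OF P01(2)]]) (blast intro: no_point_chain[OF c])+
qed

end

section \<open>Torsion-free modules over valuation rings are flat\<close>

lemma tensor_relations_closed:
 assumes "s : tensor_relations A N M" "t : tensor_relations A N M"
 shows "- s : tensor_relations A N M" "s + t : tensor_relations A N M"
proof -
 have neg: "- u : tensor_relations A N M" if "u : tensor_relations A N M" for u
  using tensor_relations.diff[OF tensor_relations.zero that] by simp
 thus "- s : tensor_relations A N M" using assms(1) by blast
 show "s + t : tensor_relations A N M" using tensor_relations.diff[OF assms(1) neg[OF assms(2)]] by simp
qed

lemma tensor_relations_sum:
 "(!!i. i : I ==> f i : tensor_relations A N M) ==> sum f I : tensor_relations A N M"
 by (induction I rule: infinite_finite_induct) (auto intro: tensor_relations.zero tensor_relations_closed)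

context Module.module
begin

definition lin :: "'c set => ('c => 'a) => 'c" where "lin E a = (\<Oplus>\<^bsub>M\<^esub>e\<in>E. a e \<odot>\<^bsub>M\<^esub> e)"

definition span_of :: "'c set => 'c set" where "span_of E = {lin E a | a. a : E \<rightarrow> carrier R}"

definition independent :: "'c set => bool" where
 "independent E \<longleftrightarrow> (ALL a : E \<rightarrow> carrier R. lin E a = \<zero>\<^bsub>M\<^esub> --> (ALL e:E. a e = \<zero>))"

lemma lin_closed: "E \<subseteq> carrier M ==> a : E \<rightarrow> carrier R ==> lin E a : carrier M"
 unfolding lin_def by (intro M.finsum_closed) auto

lemma lin_add:
 assumes "E \<subseteq> carrier M" "a : E \<rightarrow> carrier R" "b : E \<rightarrow> carrier R"
 shows "lin E (%e. a e \<oplus> b e) = lin E a \<oplus>\<^bsub>M\<^esub> lin E b"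
proof -
 have "lin E (%e. a e \<oplus> b e) = (\<Oplus>\<^bsub>M\<^esub>e\<in>E. a e \<odot>\<^bsub>M\<^esub> e \<oplus>\<^bsub>M\<^esub> b e \<odot>\<^bsub>M\<^esub> e)"
  unfolding lin_def using assms by (intro M.finsum_cong') (auto simp: smult_l_distr Pi_iff subset_iff)
 also have "... = lin E a \<oplus>\<^bsub>M\<^esub> lin E b" unfolding lin_def using assms by (intro M.finsum_addf) auto
 finally show ?thesis .
qed

lemma lin_smult:
 assumes "finite E" "E \<subseteq> carrier M" "a : E \<rightarrow> carrier R" "r : carrier R"
 shows "lin E (%e. r \<otimes> a e) = r \<odot>\<^bsub>M\<^esub> lin E a"
proof -
 have "lin E (%e. r \<otimes> a e) = (\<Oplus>\<^bsub>M\<^esub>e\<in>E. r \<odot>\<^bsub>M\<^esub> (a e \<odot>\<^bsub>M\<^esub> e))"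
  unfolding lin_def using assms by (intro M.finsum_cong') (auto simp: smult_assoc1 Pi_iff subset_iff)
 also have "... = r \<odot>\<^bsub>M\<^esub> lin E a" unfolding lin_def using assms by (intro finsum_smult_ldistr[symmetric]) auto
 finally show ?thesis .
qed

lemma lin_insert:
 assumes "finite E" "k ~: E" "insert k E \<subseteq> carrier M" "a : insert k E \<rightarrow> carrier R"
 shows "lin (insert k E) a = a k \<odot>\<^bsub>M\<^esub> k \<oplus>\<^bsub>M\<^esub> lin E a"
 unfolding lin_def using assms by (intro M.finsum_insert) auto

lemma lin_zero: "E \<subseteq> carrier M ==> lin E (%_. \<zero>) = \<zero>\<^bsub>M\<^esub>"
proof -
 assume E: "E \<subseteq> carrier M"
 have "lin E (%_. \<zero>) = (\<Oplus>\<^bsub>M\<^esub>e\<in>E. \<zero>\<^bsub>M\<^esub>)" unfolding lin_def using E by (intro M.finsum_cong') auto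
 thus ?thesis by simp
qed

lemma span_of_closed:
 assumes E: "finite E" "E \<subseteq> carrier M"
 shows "span_of E \<subseteq> carrier M" "y : span_of E ==> y' : span_of E ==> y \<oplus>\<^bsub>M\<^esub> y' : span_of E"
  "r : carrier R ==> y : span_of E ==> r \<odot>\<^bsub>M\<^esub> y : span_of E"
proof -
 show "span_of E \<subseteq> carrier M" unfolding span_of_def using lin_closed[OF E(2)] by blast
 show "y \<oplus>\<^bsub>M\<^esub> y' : span_of E" if y: "y : span_of E" "y' : span_of E"
 proof -
  from y obtain a b where "y = lin E a" "a : E \<rightarrow> carrier R" "y' = lin E b" "b : E \<rightarrow> carrier R" unfolding span_of_def by blast
  thus ?thesis unfolding span_of_def using lin_add[OF E(2)] by (intro CollectI exI[of _ "%e. a e \<oplus> b e"]) auto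
 qed
 show "r \<odot>\<^bsub>M\<^esub> y : span_of E" if y: "r : carrier R" "y : span_of E"
 proof -
  from y obtain a where "y = lin E a" "a : E \<rightarrow> carrier R" unfolding span_of_def by blast
  thus ?thesis unfolding span_of_def using lin_smult[OF E _ y(1)] y(1) by (intro CollectI exI[of _ "%e. r \<otimes> a e"]) auto
 qed
qed

lemma subset_span_of: assumes E: "finite E" "E \<subseteq> carrier M" shows "E \<subseteq> span_of E"
proof
 fix y assume y: "y : E"
 define a where "a e = (if e = y then \<one> else \<zero>)" for e
 have "lin (insert y (E - {y})) a = a y \<odot>\<^bsub>M\<^esub> y \<oplus>\<^bsub>M\<^esub> lin (E - {y}) a" using E y by (intro lin_insert) (auto simp: a_def)
 also have "lin (E - {y}) a = lin (E - {y}) (%_. \<zero>)" unfolding lin_def using E by (intro M.finsum_cong') (auto simp: a_def)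
 also have "... = \<zero>\<^bsub>M\<^esub>" using E by (intro lin_zero) auto
 finally have "lin E a = a y \<odot>\<^bsub>M\<^esub> y \<oplus>\<^bsub>M\<^esub> \<zero>\<^bsub>M\<^esub>" unfolding insert_Diff[OF y] .
 hence "lin E a = y" using y E by (simp add: a_def[of y] subset_iff)
 moreover have "a : E \<rightarrow> carrier R" by (simp add: a_def)
 ultimately show "y : span_of E" unfolding span_of_def by blast
qed

lemma lin_inject:
 assumes E: "finite E" "E \<subseteq> carrier M" "independent E" and a: "a : E \<rightarrow> carrier R" "b : E \<rightarrow> carrier R" and eq: "lin E a = lin E b" and e: "e : E"
 shows "a e = b e"
proof -
 have nb: "(%e. \<ominus> \<one> \<otimes> b e) : E \<rightarrow> carrier R" using a by auto
 have "lin E (%e. a e \<oplus> \<ominus> \<one> \<otimes> b e) = lin E b \<oplus>\<^bsub>M\<^esub> (\<ominus> \<one>) \<odot>\<^bsub>M\<^esub> lin E b"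
  unfolding lin_add[OF E(2) a(1) nb] lin_smult[OF E(1,2) a(2) R.a_inv_closed[OF R.one_closed]] eq ..
 also have "... = (\<one> \<oplus> \<ominus> \<one>) \<odot>\<^bsub>M\<^esub> lin E b" using lin_closed[OF E(2) a(2)] by (subst smult_l_distr) auto
 also have "... = \<zero>\<^bsub>M\<^esub>" using lin_closed[OF E(2) a(2)] by (simp add: R.r_neg)
 finally have "a e \<oplus> \<ominus> \<one> \<otimes> b e = \<zero>" using E(3) e a nb unfolding independent_def by (auto simp: Pi_iff)
 moreover have "a e : carrier R" "b e : carrier R" using a e by auto
 ultimately show ?thesis by (simp add: R.l_minus R.minus_equality R.add.inv_equality R.add.inv_solve_right' flip: R.minus_eq)
qed

text \<open>The choice of coefficients is made by \<open>SOME\<close>; for independent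
  \<open>E\<close> they are unique, which is how \<open>coord_linear\<close> is obtained.\<close>

definition coord :: "'c set => 'c => 'c => 'a" where
 "coord E e y = (SOME a. a : E \<rightarrow> carrier R & y = lin E a) e"

lemma coord:
 assumes E: "finite E" "E \<subseteq> carrier M" "independent E" and y: "y : span_of E"
 shows "(%e. coord E e y) : E \<rightarrow> carrier R" "lin E (%e. coord E e y) = y"
proof -
 from y obtain a where "a : E \<rightarrow> carrier R & y = lin E a" unfolding span_of_def by blast
 from someI[of "%a. a : E \<rightarrow> carrier R & y = lin E a", OF this]
 show "(%e. coord E e y) : E \<rightarrow> carrier R" "lin E (%e. coord E e y) = y" unfolding coord_def by auto
qed

lemma coord_linear:
 assumes E: "finite E" "E \<subseteq> carrier M" "independent E" and y: "y : span_of E" "y' : span_of E" and e: "e : E"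
 shows "coord E e (y \<oplus>\<^bsub>M\<^esub> y') = coord E e y \<oplus> coord E e y'" "r : carrier R ==> coord E e (r \<odot>\<^bsub>M\<^esub> y) = r \<otimes> coord E e y"
proof -
 note c = coord[OF E y(1)] and c' = coord[OF E y(2)]
 have "lin E (%e. coord E e y \<oplus> coord E e y') = y \<oplus>\<^bsub>M\<^esub> y'" unfolding lin_add[OF E(2) c(1) c'(1)] c(2) c'(2) ..
 moreover have "(%e. coord E e y \<oplus> coord E e y') : E \<rightarrow> carrier R" using c(1) c'(1) by auto
 ultimately show "coord E e (y \<oplus>\<^bsub>M\<^esub> y') = coord E e y \<oplus> coord E e y'"
  using lin_inject[OF E coord(1)[OF E span_of_closed(2)[OF E(1,2) y]] _ _ e] coord(2)[OF E span_of_closed(2)[OF E(1,2) y]] by metis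
 assume r: "r : carrier R"
 have "lin E (%e. r \<otimes> coord E e y) = r \<odot>\<^bsub>M\<^esub> y" unfolding lin_smult[OF E(1,2) c(1) r] c(2) ..
 moreover have "(%e. r \<otimes> coord E e y) : E \<rightarrow> carrier R" using c(1) r by auto
 ultimately show "coord E e (r \<odot>\<^bsub>M\<^esub> y) = r \<otimes> coord E e y"
  using lin_inject[OF E coord(1)[OF E span_of_closed(3)[OF E(1,2) r y(1)]] _ _ e] coord(2)[OF E span_of_closed(3)[OF E(1,2) r y(1)]] by metis
qed

lemma divisor_of_family:
 assumes val: "!!a b. a : carrier R ==> b : carrier R ==> (EX c:carrier R. a = c \<otimes> b) \<or> (EX c:carrier R. b = c \<otimes> a)"
  and "finite E" "E ~= {}" "a : E \<rightarrow> carrier R"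
 shows "EX k:E. ALL e:E. EX c:carrier R. a e = c \<otimes> a k"
 using assms(2-)
proof (induction E rule: finite_ne_induct)
 case (singleton x)
 thus ?case using R.l_one[of "a x"] by (intro bexI[of _ x]) (auto intro!: bexI[of _ \<one>])
next
 case (insert x F)
 then obtain k where k: "k : F" "ALL e:F. EX c:carrier R. a e = c \<otimes> a k" by auto
 have c: "a x : carrier R" "a k : carrier R" using insert.prems k(1) by auto
 from val[OF c] show ?case
 proof
  assume "EX c:carrier R. a x = c \<otimes> a k"
  thus ?case using k by blast
 next
  assume "EX c:carrier R. a k = c \<otimes> a x"
  then obtain u where u: "u : carrier R" "a k = u \<otimes> a x" by blast
  have "EX c:carrier R. a e = c \<otimes> a x" if "e : F" for e
  proof -
   from k(2) that obtain w where "w : carrier R" "a e = w \<otimes> a k" by blast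
   thus ?thesis using u c by (intro bexI[of _ "w \<otimes> u"]) (auto simp: R.m_assoc)
  qed
  moreover have "a x = \<one> \<otimes> a x" using c by simp
  ultimately show ?case by (intro bexI[of _ x]) auto
 qed
qed

text \<open>Take a smallest set whose span contains \<open>Y\<close>. A relation could be divided by
  a coefficient dividing all the others, since there is no torsion; one element would then be a
  combination of the rest.\<close>

lemma exists_basis:
 assumes val: "!!a b. a : carrier R ==> b : carrier R ==> (EX c:carrier R. a = c \<otimes> b) \<or> (EX c:carrier R. b = c \<otimes> a)"
  and tf: "!!a x. a : carrier R ==> x : carrier M ==> a \<odot>\<^bsub>M\<^esub> x = \<zero>\<^bsub>M\<^esub> ==> a = \<zero> \<or> x = \<zero>\<^bsub>M\<^esub>"
  and Y: "finite Y" "Y \<subseteq> carrier M"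
 shows "EX E. finite E & E \<subseteq> carrier M & Y \<subseteq> span_of E & independent E"
proof -
 let ?P = "%E. finite E & E \<subseteq> carrier M & Y \<subseteq> span_of E"
 from ex_has_least_nat[of ?P Y card] Y subset_span_of[OF Y] obtain E where E: "finite E" "E \<subseteq> carrier M" "Y \<subseteq> span_of E"
  and least: "!!E'. ?P E' ==> card E <= card E'" by blast
 have "independent E" unfolding independent_def
 proof (intro ballI impI, rule ccontr)
  fix a e0 assume a: "a : E \<rightarrow> carrier R" "lin E a = \<zero>\<^bsub>M\<^esub>" "e0 : E" "a e0 ~= \<zero>"
  have "E ~= {}" using a(3) by blast
  from divisor_of_family[OF val E(1) this a(1)] obtain k where k: "k : E" "ALL e:E. EX c:carrier R. a e = c \<otimes> a k" by blast
  from bchoice[OF k(2)[unfolded Bex_def]] obtain b0 where b0: "ALL e:E. b0 e : carrier R & a e = b0 e \<otimes> a k" by blast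
  define b where "b e = (if e = k then \<one> else b0 e)" for e
  have ak: "a k : carrier R" using a(1) k(1) by auto
  have bE: "b : E \<rightarrow> carrier R" and ab: "!!e. e : E ==> a e = a k \<otimes> b e" using b0 ak by (auto simp: b_def R.m_comm)
  have "lin E a = lin E (%e. a k \<otimes> b e)" unfolding lin_def using ab a(1) bE E(2) ak by (intro M.finsum_cong') (auto simp: Pi_iff subset_iff)
  hence "a k \<odot>\<^bsub>M\<^esub> lin E b = \<zero>\<^bsub>M\<^esub>" using lin_smult[OF E(1,2) bE ak] a(2) by simp
  moreover have "a k ~= \<zero>" using b0 a(3,4) by auto
  ultimately have b: "lin E b = \<zero>\<^bsub>M\<^esub>" using tf[OF ak lin_closed[OF E(2) bE]] by blast
  have "Y \<subseteq> span_of (E - {k})"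
  proof
   fix y assume "y : Y"
   then obtain c where c: "c : E \<rightarrow> carrier R" "y = lin E c" using E(3) unfolding span_of_def by blast
   have ck: "c k : carrier R" using c(1) k(1) by auto
   define d where "d e = c e \<oplus> (\<ominus> c k) \<otimes> b e" for e
   have nb: "(%e. (\<ominus> c k) \<otimes> b e) : E \<rightarrow> carrier R" using bE ck by auto
   have dE: "d : E \<rightarrow> carrier R" using c(1) nb by (intro Pi_I) (simp add: d_def Pi_iff)
   have "lin E d = y" unfolding d_def lin_add[OF E(2) c(1) nb] lin_smult[OF E(1,2) bE R.a_inv_closed[OF ck]] b
    using c ck lin_closed[OF E(2) c(1)] by simp
   moreover have "d k = \<zero>" using ck by (simp add: d_def b_def R.r_neg)
   moreover have "lin (insert k (E - {k})) d = d k \<odot>\<^bsub>M\<^esub> k \<oplus>\<^bsub>M\<^esub> lin (E - {k}) d"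
    using E k(1) dE by (intro lin_insert) auto
   moreover have "lin (E - {k}) d : carrier M" using E(2) dE by (intro lin_closed) auto
   ultimately have "y = lin (E - {k}) d" using k(1) E(2) unfolding insert_Diff[OF k(1)] by auto
   moreover have "d : E - {k} \<rightarrow> carrier R" using dE by auto
   ultimately show "y : span_of (E - {k})" unfolding span_of_def by blast
  qed
  hence "card E <= card (E - {k})" using E by (intro least) auto
  thus False using E(1) k(1) by (metis card_Diff1_less leD)
 qed
 thus ?thesis using E by blast
qed

end

lemma hom_free:
 assumes h: "h : hom (free_Abelian_group D) (add_monoid N)" and N: "abelian_group N"
  and k: "supp a \<subseteq> D" "supp b \<subseteq> D"
 shows "h a : carrier N" "h (a + b) = h a \<oplus>\<^bsub>N\<^esub> h b" "h a = h (a - b) \<oplus>\<^bsub>N\<^esub> h b" "h a = h b ==> h (a - b) = \<zero>\<^bsub>N\<^esub>"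
  "supp (a - b) \<subseteq> D" "supp (a + b) \<subseteq> D" "h (a - b) = h a \<ominus>\<^bsub>N\<^esub> h b"
proof -
 interpret N: abelian_group N by (rule N)
 show kd: "supp (a - b) \<subseteq> D" using keys_diff[of a b] k by blast
 show "supp (a + b) \<subseteq> D" using Poly_Mapping.keys_add[of a b] k by blast
 have c: "h x : carrier N" if "supp x \<subseteq> D" for x using h that by (auto simp: hom_def free_Abelian_group_def Pi_iff)
 thus "h a : carrier N" using k(1) by blast
 have hm: "h (x + y) = h x \<oplus>\<^bsub>N\<^esub> h y" if "supp x \<subseteq> D" "supp y \<subseteq> D" for x y
  using h that unfolding hom_def free_Abelian_group_def by auto
 thus "h (a + b) = h a \<oplus>\<^bsub>N\<^esub> h b" using k by blast
 from hm[OF kd k(2)] show e: "h a = h (a - b) \<oplus>\<^bsub>N\<^esub> h b" by simp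
 show d: "h (a - b) = h a \<ominus>\<^bsub>N\<^esub> h b" unfolding e N.minus_eq using c[OF kd] c[OF k(2)] by (simp add: N.a_assoc N.r_neg)
 show "h (a - b) = \<zero>\<^bsub>N\<^esub>" if "h a = h b" unfolding d that N.minus_eq using c[OF k(2)] by (simp add: N.r_neg)
qed

text \<open>A homomorphism \<open>h\<close> realising
  \<open>x \<otimes> y \<mapsto> lam y x\<close>. Its values are prescribed only for
  \<open>y\<close> in a submodule \<open>L\<close>, because coordinate functions exist only on a
  free submodule.\<close>

definition tensor_functional where
 "tensor_functional A N M L lam h \<longleftrightarrow> L \<subseteq> carrier M & (ALL y:L. ALL y':L. y \<oplus>\<^bsub>M\<^esub> y' : L & lam (y \<oplus>\<^bsub>M\<^esub> y') = lam y \<oplus>\<^bsub>A\<^esub> lam y') &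
  (ALL r:carrier A. ALL y:L. r \<odot>\<^bsub>M\<^esub> y : L & lam (r \<odot>\<^bsub>M\<^esub> y) = r \<otimes>\<^bsub>A\<^esub> lam y) & lam : L \<rightarrow> carrier A &
  h : hom (free_Abelian_group (carrier N \<times> carrier M)) (add_monoid N) & (ALL x:carrier N. ALL y:L. h (frag_of (x, y)) = lam y \<odot>\<^bsub>N\<^esub> x)"

lemma tensor_functionalD:
 assumes "tensor_functional A N M L lam h"
 shows "h : hom (free_Abelian_group (carrier N \<times> carrier M)) (add_monoid N)" "y : L ==> lam y : carrier A"
  "x : carrier N ==> y : L ==> h (frag_of (x, y)) = lam y \<odot>\<^bsub>N\<^esub> x"
  "y : L ==> y' : L ==> y \<oplus>\<^bsub>M\<^esub> y' : L & lam (y \<oplus>\<^bsub>M\<^esub> y') = lam y \<oplus>\<^bsub>A\<^esub> lam y'"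
  "r : carrier A ==> y : L ==> r \<odot>\<^bsub>M\<^esub> y : L & lam (r \<odot>\<^bsub>M\<^esub> y) = r \<otimes>\<^bsub>A\<^esub> lam y"
 using assms unfolding tensor_functional_def by blast+

text \<open>The set \<open>Y\<close> collects the elements of \<open>M\<close> that occur in a
  derivation of \<open>s\<close>. It is fixed before \<open>L\<close> and \<open>lam\<close>, so
  that the free submodule can be chosen to contain it.\<close>

lemma tensor_relations_vanish:
 assumes N: "Module.module A N" and M: "Module.module A M" and s: "s : tensor_relations A N M"
 shows "supp s \<subseteq> carrier N \<times> carrier M &
  (EX Y. finite Y & Y \<subseteq> carrier M & (ALL L lam h. tensor_functional A N M L lam h --> Y \<subseteq> L --> h s = \<zero>\<^bsub>N\<^esub>))"
 using s
proof (induction rule: tensor_relations.induct)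
 interpret N: Module.module A N by (rule N)
 interpret M: Module.module A M by (rule M)
 let ?D = "carrier N \<times> carrier M"
 note hf = hom_free[OF _ N.abelian_group_axioms, where D = ?D]
 have gen: "supp (u - w) \<subseteq> ?D &
   (EX Y. finite Y & Y \<subseteq> carrier M & (ALL L lam h. tensor_functional A N M L lam h --> Y \<subseteq> L --> h (u - w) = \<zero>\<^bsub>N\<^esub>))"
  if k: "supp u \<subseteq> ?D" "supp w \<subseteq> ?D" and Y: "finite Y" "Y \<subseteq> carrier M"
   and e: "!!L lam h. tensor_functional A N M L lam h ==> Y \<subseteq> L ==> h u = h w" for u w Y
 proof
  show "supp (u - w) \<subseteq> ?D" using keys_diff[of u w] k by blast
  show "EX Y. finite Y & Y \<subseteq> carrier M & (ALL L lam h. tensor_functional A N M L lam h --> Y \<subseteq> L --> h (u - w) = \<zero>\<^bsub>N\<^esub>)"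
   using Y e hf(4)[OF _ k] by (intro exI[of _ Y]) (auto simp: tensor_functional_def)
 qed
 { case zero
  show ?case using gen[of 0 0 "{}"] by simp
 next
  case (diff s t)
  then obtain Y Y' where Y: "finite Y" "Y \<subseteq> carrier M" "ALL L lam h. tensor_functional A N M L lam h --> Y \<subseteq> L --> h s = \<zero>\<^bsub>N\<^esub>"
   "finite Y'" "Y' \<subseteq> carrier M" "ALL L lam h. tensor_functional A N M L lam h --> Y' \<subseteq> L --> h t = \<zero>\<^bsub>N\<^esub>" by blast
  show ?case
  proof (rule gen[of s t "Y \<union> Y'"])
   show "h s = h t" if "tensor_functional A N M L lam h" "Y \<union> Y' \<subseteq> L" for L lam h using Y(3,6) that by (metis Un_subset_iff)
  qed (use diff Y in auto)
 next
  case (add_left x x' y)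
  have k: "supp (frag_of (x, y)) \<subseteq> ?D" "supp (frag_of (x', y)) \<subseteq> ?D" using add_left by simp_all
  show ?case unfolding diff_diff_eq
  proof (rule gen[of _ _ "{y}"])
   fix L lam h assume t: "tensor_functional A N M L lam h" "{y} \<subseteq> L"
   note d = tensor_functionalD[OF t(1)]
   have y: "y : L" using t(2) by simp
   show "h (frag_of (x \<oplus>\<^bsub>N\<^esub> x', y)) = h (frag_of (x, y) + frag_of (x', y))"
    unfolding hf(2)[OF d(1) k] d(3)[OF add_left(1) y] d(3)[OF add_left(2) y] d(3)[OF N.M.a_closed[OF add_left(1,2)] y]
    by (rule N.smult_r_distr[OF d(2)[OF y] add_left(1,2)])
  qed (use add_left keys_add[of "frag_of (x, y)" "frag_of (x', y)"] in auto)
 next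
  case (add_right x y y')
  have k: "supp (frag_of (x, y)) \<subseteq> ?D" "supp (frag_of (x, y')) \<subseteq> ?D" using add_right by simp_all
  show ?case unfolding diff_diff_eq
  proof (rule gen[of _ _ "{y, y'}"])
   fix L lam h assume t: "tensor_functional A N M L lam h" "{y, y'} \<subseteq> L"
   note d = tensor_functionalD[OF t(1)]
   have y: "y : L" "y' : L" using t(2) by simp_all
   show "h (frag_of (x, y \<oplus>\<^bsub>M\<^esub> y')) = h (frag_of (x, y) + frag_of (x, y'))"
    unfolding hf(2)[OF d(1) k] d(3)[OF add_right(1) y(1)] d(3)[OF add_right(1) y(2)] d(3)[OF add_right(1) conjunct1[OF d(4)[OF y]]] conjunct2[OF d(4)[OF y]]
    by (rule N.smult_l_distr[OF d(2)[OF y(1)] d(2)[OF y(2)] add_right(1)])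
  qed (use add_right keys_add[of "frag_of (x, y)" "frag_of (x, y')"] in auto)
 next
  case (balanced a x y)
  show ?case
  proof (rule gen[of _ _ "{y}"])
   fix L lam h assume t: "tensor_functional A N M L lam h" "{y} \<subseteq> L"
   note d = tensor_functionalD[OF t(1)]
   have y: "y : L" using t(2) by simp
   show "h (frag_of (a \<odot>\<^bsub>N\<^esub> x, y)) = h (frag_of (x, a \<odot>\<^bsub>M\<^esub> y))"
    unfolding d(3)[OF N.smult_closed[OF balanced(1,2)] y] d(3)[OF balanced(2) conjunct1[OF d(5)[OF balanced(1) y]]] conjunct2[OF d(5)[OF balanced(1) y]]
    using balanced d(2)[OF y] by (simp add: N.smult_assoc1[symmetric] N.R.m_comm)
  qed (use balanced in auto) }
qed

text \<open>
  A relation in \<open>N \<otimes> M\<close> involves finitely many elements of \<open>M\<close>; they lie in a free submodule, whose coordinate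
  functions detect the vanishing of a tensor.
\<close>

theorem torsion_free_flat:
 assumes M: "Module.module A M"
  and val: "!!a b. a : carrier A ==> b : carrier A ==> (EX c:carrier A. a = c \<otimes>\<^bsub>A\<^esub> b) \<or> (EX c:carrier A. b = c \<otimes>\<^bsub>A\<^esub> a)"
  and tf: "!!a x. a : carrier A ==> x : carrier M ==> a \<odot>\<^bsub>M\<^esub> x = \<zero>\<^bsub>M\<^esub> ==> a = \<zero>\<^bsub>A\<^esub> \<or> x = \<zero>\<^bsub>M\<^esub>"
 shows "flat_module TYPE('n) A M"
 unfolding flat_module_def
proof (intro conjI allI impI M)
 fix N' N :: "('a, 'n) module" and \<phi> t
 assume mono: "module_mono A N' N \<phi>" and kt: "supp t \<subseteq> carrier N' \<times> carrier M"
  and rel: "frag_extend (%(x, y). frag_of (\<phi> x, y)) t : tensor_relations A N M"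
 let ?F = "frag_extend (%(x, y). frag_of (\<phi> x, y)) :: (_ \<Rightarrow>\<^sub>0 int) => _"
 interpret M: Module.module A M by (rule M)
 have N: "Module.module A N'" "Module.module A N" and \<phi>: "\<phi> : carrier N' \<rightarrow> carrier N" "inj_on \<phi> (carrier N')"
  "!!x y. x : carrier N' ==> y : carrier N' ==> \<phi> (x \<oplus>\<^bsub>N'\<^esub> y) = \<phi> x \<oplus>\<^bsub>N\<^esub> \<phi> y"
  "!!a x. a : carrier A ==> x : carrier N' ==> \<phi> (a \<odot>\<^bsub>N'\<^esub> x) = a \<odot>\<^bsub>N\<^esub> \<phi> x" using mono unfolding module_mono_def by blast+
 interpret N': Module.module A N' by (rule N(1))
 interpret N: Module.module A N by (rule N(2))
 from tensor_relations_vanish[OF N(2) M rel] obtain Y0 where Y0: "finite Y0" "Y0 \<subseteq> carrier M"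
  "!!L lam h. tensor_functional A N M L lam h ==> Y0 \<subseteq> L ==> h (?F t) = \<zero>\<^bsub>N\<^esub>" by blast
 define Y where "Y = Y0 \<union> snd ` supp t"
 have "finite Y" "Y \<subseteq> carrier M" using Y0(1,2) kt by (auto simp: Y_def)
 from M.exists_basis[OF val tf this] obtain E where E: "finite E" "E \<subseteq> carrier M" "Y \<subseteq> M.span_of E" "M.independent E" by blast
 define L where "L = M.span_of E"
 note cl = M.span_of_closed[OF E(1,2), folded L_def] and co = M.coord[OF E(1,2,4), folded L_def] and cli = M.coord_linear[OF E(1,2,4), folded L_def]
 have coA: "M.coord E e y : carrier A" if "e : E" "y : L" for e y using co(1)[OF that(2)] that(1) by auto
 \<comment> \<open>Outside \<open>L\<close> the coordinate is replaced by 0;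
   \<open>tensor_functional\<close> prescribes nothing there.\<close>
 have ex: "EX h. tensor_functional A K M L (M.coord E e) h" if K: "Module.module A K" and e: "e : E" for K :: "('a, 'n) module" and e
 proof -
  interpret K: Module.module A K by (rule K)
  let ?f = "%(x, y). (if y : L then M.coord E e y else \<zero>\<^bsub>A\<^esub>) \<odot>\<^bsub>K\<^esub> x"
  have "?f ` (carrier K \<times> carrier M) \<subseteq> carrier (add_monoid K)" using coA[OF e] by auto
  then obtain h where h: "h : hom (free_Abelian_group (carrier K \<times> carrier M)) (add_monoid K)" "!!x. x : carrier K \<times> carrier M ==> h (frag_of x) = ?f x"
   by (rule comm_group.free_Abelian_group_universal[OF K.a_comm_group]) blast
  thus ?thesis unfolding tensor_functional_def using cl coA[OF e] cli[OF _ _ e] by (intro exI[of _ h]) (auto simp: subset_iff)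
 qed
 from ex[OF N(2)] obtain h where h: "!!e. e : E ==> tensor_functional A N M L (M.coord E e) (h e)" by metis
 from ex[OF N(1)] obtain h' where h': "!!e. e : E ==> tensor_functional A N' M L (M.coord E e) (h' e)" by metis
 let ?D = "carrier N \<times> carrier M" and ?D' = "carrier N' \<times> carrier M"
 have hh: "h e : hom (free_Abelian_group ?D) (add_monoid N)" "h' e : hom (free_Abelian_group ?D') (add_monoid N')" if "e : E" for e
  using h[OF that] h'[OF that] unfolding tensor_functional_def by blast+
 note hf = hom_free[OF hh(1) N.abelian_group_axioms] and hf' = hom_free[OF hh(2) N'.abelian_group_axioms]
 have hv: "h e (frag_of (x, y)) = M.coord E e y \<odot>\<^bsub>N\<^esub> x" if "e : E" "x : carrier N" "y : L" for e x y
  using h[OF that(1)] that(2,3) unfolding tensor_functional_def by blast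
 have hv': "h' e (frag_of (x, y)) = M.coord E e y \<odot>\<^bsub>N'\<^esub> x" if "e : E" "x : carrier N'" "y : L" for e x y
  using h'[OF that(1)] that(2,3) unfolding tensor_functional_def by blast
 have LM: "L \<subseteq> carrier M" by (rule cl(1))
 have ktL: "supp t \<subseteq> carrier N' \<times> L" using kt E(3) unfolding Y_def L_def by force
 \<comment> \<open>The coordinates of a tensor are compatible with \<open>\<phi>\<close>;
   injectivity of \<open>\<phi>\<close> will carry their vanishing back to
   \<open>N'\<close>.\<close>
 have comm: "supp s \<subseteq> ?D' & supp (?F s) \<subseteq> ?D & \<phi> (h' e s) = h e (?F s)" if e: "e : E" and s: "supp s \<subseteq> carrier N' \<times> L" for e s
  using s
 proof (induction rule: frag_induction)
  case zero
  have "h' e 0 = \<zero>\<^bsub>N'\<^esub>" "h e 0 = \<zero>\<^bsub>N\<^esub>" using hf'(4)[OF e, of 0 0] hf(4)[OF e, of 0 0] by simp_all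
  moreover have "\<phi> \<zero>\<^bsub>N'\<^esub> = \<zero>\<^bsub>N\<^esub>" using \<phi>(4)[of "\<zero>\<^bsub>A\<^esub>" "\<zero>\<^bsub>N'\<^esub>"] \<phi>(1) by (simp add: Pi_iff)
  ultimately show ?case by simp
 next
  case (one p)
  then obtain x y where p: "p = (x, y)" "x : carrier N'" "y : L" by auto
  hence "\<phi> x : carrier N" "y : carrier M" using \<phi>(1) LM by auto
  thus ?case using p e coA[OF e p(3)] by (simp add: hv hv' \<phi>(4))
 next
  case (diff a b)
  hence k: "supp a \<subseteq> ?D'" "supp b \<subseteq> ?D'" "supp (?F a) \<subseteq> ?D" "supp (?F b) \<subseteq> ?D" by blast+
  note x = hf'(3,5,1)[OF e k(1,2)] hf'(1)[OF e hf'(5)[OF e k(1,2)] k(2)] hf'(1)[OF e k(2,1)] hf(5)[OF e k(3,4)]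
  have "\<phi> (h' e a) = \<phi> (h' e (a - b)) \<oplus>\<^bsub>N\<^esub> \<phi> (h' e b)" using \<phi>(3)[OF x(4,5)] x(1) by simp
  moreover have "h e (?F a) = h e (?F a - ?F b) \<oplus>\<^bsub>N\<^esub> h e (?F b)" by (rule hf(3)[OF e k(3,4)])
  moreover have "\<phi> (h' e (a - b)) : carrier N" "h e (?F a - ?F b) : carrier N" "h e (?F b) : carrier N"
   using \<phi>(1) x(4) hf(1)[OF e x(6) k(3)] hf(1)[OF e k(4,3)] by auto
  ultimately have "\<phi> (h' e (a - b)) = h e (?F a - ?F b)" using diff by (simp add: N.add.right_cancel)
  thus ?case using x(2,6) by (simp add: frag_extend_diff)
 qed
 have lin: "frag_of (x, M.lin D a) - (SUM e:D. frag_of (a e \<odot>\<^bsub>N'\<^esub> x, e)) : tensor_relations A N' M"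
  if "finite D" "D \<subseteq> carrier M" "a : D \<rightarrow> carrier A" "x : carrier N'" for x D a
  using that
 proof (induction D rule: finite_induct)
  case empty
  from tensor_relations.add_right[of x N' "\<zero>\<^bsub>M\<^esub>" M "\<zero>\<^bsub>M\<^esub>" A] empty have "- frag_of (x, \<zero>\<^bsub>M\<^esub>) : tensor_relations A N' M" by simp
  from tensor_relations_closed(1)[OF this this] show ?case by (simp add: M.lin_def)
 next
  case (insert k D)
  have c: "k : carrier M" "a k : carrier A" "M.lin D a : carrier M" using insert by (auto intro!: M.lin_closed)
  have 1: "frag_of (x, a k \<odot>\<^bsub>M\<^esub> k \<oplus>\<^bsub>M\<^esub> M.lin D a) - frag_of (x, a k \<odot>\<^bsub>M\<^esub> k) - frag_of (x, M.lin D a) : tensor_relations A N' M"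
   using c insert by (intro tensor_relations.add_right) auto
  have 2: "frag_of (a k \<odot>\<^bsub>N'\<^esub> x, k) - frag_of (x, a k \<odot>\<^bsub>M\<^esub> k) : tensor_relations A N' M" using c insert by (intro tensor_relations.balanced) auto
  have 3: "frag_of (x, M.lin D a) - (SUM e:D. frag_of (a e \<odot>\<^bsub>N'\<^esub> x, e)) : tensor_relations A N' M" using insert by auto
  have "M.lin (insert k D) a = a k \<odot>\<^bsub>M\<^esub> k \<oplus>\<^bsub>M\<^esub> M.lin D a" using insert by (intro M.lin_insert) auto
  hence "frag_of (x, M.lin (insert k D) a) - (SUM e:insert k D. frag_of (a e \<odot>\<^bsub>N'\<^esub> x, e)) =
   (frag_of (x, a k \<odot>\<^bsub>M\<^esub> k \<oplus>\<^bsub>M\<^esub> M.lin D a) - frag_of (x, a k \<odot>\<^bsub>M\<^esub> k) - frag_of (x, M.lin D a)) - (frag_of (a k \<odot>\<^bsub>N'\<^esub> x, k) - frag_of (x, a k \<odot>\<^bsub>M\<^esub> k)) +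
   (frag_of (x, M.lin D a) - (SUM e:D. frag_of (a e \<odot>\<^bsub>N'\<^esub> x, e)))" using insert(1,2) by simp
  thus ?case using tensor_relations_closed(2)[OF tensor_relations.diff[OF 1 2] 3] by simp
 qed
 have fz: "frag_of (\<zero>\<^bsub>N'\<^esub>, e) : tensor_relations A N' M" if "e : E" for e
  using tensor_relations.add_left[of "\<zero>\<^bsub>N'\<^esub>" N' "\<zero>\<^bsub>N'\<^esub>" e M A] tensor_relations_closed(1) that E(2) by fastforce
 \<comment> \<open>Modulo the relations, a tensor is the sum of its coordinates paired with the
   basis \<open>E\<close>.\<close>
 have red: "supp s \<subseteq> ?D' & s - (SUM e:E. frag_of (h' e s, e)) : tensor_relations A N' M" if s: "supp s \<subseteq> carrier N' \<times> L" for s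
  using s
 proof (induction rule: frag_induction)
  case zero
  have "h' e 0 = \<zero>\<^bsub>N'\<^esub>" if "e : E" for e using hf'(4)[OF that, of 0 0] by simp
  hence "(SUM e:E. frag_of (h' e 0, e)) : tensor_relations A N' M" using fz by (intro tensor_relations_sum) simp
  from tensor_relations.diff[OF tensor_relations.zero this] show ?case by simp
 next
  case (one p)
  then obtain x y where p: "p = (x, y)" "x : carrier N'" "y : L" by auto
  have "(SUM e:E. frag_of (h' e (frag_of p), e)) = (SUM e:E. frag_of (M.coord E e y \<odot>\<^bsub>N'\<^esub> x, e))" using p by (intro sum.cong refl) (simp add: hv')
  thus ?case using lin[OF E(1,2) co(1)[OF p(3)] p(2)] co(2)[OF p(3)] p LM by auto
 next
  case (diff a b)
  hence k: "supp a \<subseteq> ?D'" "supp b \<subseteq> ?D'" by blast+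
  have "frag_of (h' e a, e) - frag_of (h' e (a - b), e) - frag_of (h' e b, e) : tensor_relations A N' M" if e: "e : E" for e
   unfolding hf'(3)[OF e k] using tensor_relations.add_left[OF hf'(1)[OF e hf'(5)[OF e k] k(2)] hf'(1)[OF e k(2,1)], of e M A] e E(2) by blast
  hence "(SUM e:E. frag_of (h' e a, e) - frag_of (h' e (a - b), e) - frag_of (h' e b, e)) : tensor_relations A N' M" by (rule tensor_relations_sum)
  from tensor_relations_closed(2)[OF tensor_relations.diff[OF conjunct2[OF diff(1)] conjunct2[OF diff(2)]] this]
  have "a - b - (SUM e:E. frag_of (h' e (a - b), e)) : tensor_relations A N' M" unfolding sum_subtractf by (simp add: algebra_simps)
  thus ?case using keys_diff[of a b] k by blast
 qed
 have z: "h' e t = \<zero>\<^bsub>N'\<^esub>" if e: "e : E" for e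
 proof (rule inj_onD[OF \<phi>(2)])
  have "h e (?F t) = \<zero>\<^bsub>N\<^esub>" using Y0(3)[OF h[OF e]] E(3) unfolding Y_def L_def by blast
  thus "\<phi> (h' e t) = \<phi> \<zero>\<^bsub>N'\<^esub>" using comm[OF e ktL] \<phi>(4)[of "\<zero>\<^bsub>A\<^esub>" "\<zero>\<^bsub>N'\<^esub>"] \<phi>(1) by (simp add: Pi_iff)
  show "h' e t : carrier N'" by (rule hf'(1)[OF e kt kt])
 qed simp
 have "(SUM e:E. frag_of (h' e t, e)) : tensor_relations A N' M" using z fz by (intro tensor_relations_sum) simp
 from tensor_relations_closed(2)[OF conjunct2[OF red[OF ktL]] this] show "t : tensor_relations A N' M" by simp
qed

section \<open>Flatness of the Pfaffian scheme\<close>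

context graded_ideal_point begin

definition base :: "'a set" where "base = {a / b | a b. a : R & b : R & mconst b ~: P}"

lemma baseE: assumes "r : base" obtains a b where "a : R" "b : R" "den (mconst b)" "b ~= 0" "r = a / b"
proof -
 from assms obtain a b where ab: "a : R" "b : R" "mconst b ~: P" "r = a / b" unfolding base_def by blast
 have "b ~= 0" using ab(3) is_idealD(2)[OF sub_ring_T is_primeD(1)[OF point(1)]] by (auto simp: rhomD(4)[OF rhom_mconst])
 moreover have "den (mconst b)" unfolding den_def using ab(2,3) sub_ringD(1)[OF R] form_mconst by auto
 ultimately show ?thesis using that ab by blast
qed

lemma baseI: "a : R ==> b : R ==> den (mconst b) ==> a / b : base" unfolding base_def den_def by blast

lemma mconst_T: "a : R ==> mconst a : T" using sub_ringD(1)[OF R] by simp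

lemma den_mconst_mult: "den (mconst b) ==> den (mconst b') ==> den (mconst (b * b'))"
 unfolding rhomD(3)[OF rhom_mconst] by (rule den_mult)

lemma base_inclusion: "R \<subseteq> base"
proof
 fix a assume "a : R"
 hence "a / 1 : base" using den_1 sub_ringD(2)[OF R] by (intro baseI) (simp_all add: rhomD(1)[OF rhom_mconst])
 thus "a : base" by simp
qed

lemma sub_ring_base: "sub_ring base"
 unfolding sub_ring_def
proof (intro conjI ballI)
 note Rc = sub_ringD[OF R]
 show "0 : base" "1 : base" using base_inclusion Rc(1,2) by blast+
 fix r assume "r : base"
 then obtain a b where r: "a : R" "b : R" "den (mconst b)" "b ~= 0" "r = a / b" by (rule baseE)
 show "- r : base" using baseI[OF Rc(3)[OF r(1)] r(2,3)] r(5) by simp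
 fix s assume "s : base"
 then obtain a' b' where s: "a' : R" "b' : R" "den (mconst b')" "b' ~= 0" "s = a' / b'" by (rule baseE)
 have "r + s = (a * b' + a' * b) / (b * b')" "r * s = (a * a') / (b * b')" unfolding r(5) s(5) using r(4) s(4) by (simp_all add: field_simps)
 thus "r + s : base" "r * s : base" using den_mconst_mult[OF r(3) s(3)] r(1,2) s(1,2) by (auto intro!: baseI Rc(4,5))
qed

lemma fractions_smult:
 assumes "(f, g) : fracs" "a : R" "den (mconst b)"
 shows "(mconst a * f, mconst b * g) : fracs"
proof -
 from fractionsD(3)[OF assms(1)] obtain d where d: "form_of_degree d f" "form_of_degree d g" by blast
 show ?thesis by (rule fractionsI[OF T_closed(5)[OF mconst_T[OF assms(2)] fractionsD(1)[OF assms(1)]] den_mult[OF assms(3) fractionsD(2)[OF assms(1)]]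
  form_mconst_mult[OF d(1)] form_mconst_mult[OF d(2)]])
qed

lemma stalk_smult:
 assumes fg: "(f, g) : fracs" and ab: "a : R" "b : R" "den (mconst b)" "b ~= 0"
 shows "(a / b) \<odot>\<^bsub>stk\<^esub> frc f g = frc (mconst a * f) (mconst b * g)"
proof -
 let ?C = "frc (mconst a * f) (mconst b * g)"
 let ?X = "{frc (mconst a' * f') (mconst b' * g') | a' b' f' g'. a' : R & b' : R & mconst b' ~: P & a / b = a' / b' & (f', g') : frc f g}"
 have "x = ?C" if "x : ?X" for x
 proof -
  from that obtain a' b' f' g' where x: "x = frc (mconst a' * f') (mconst b' * g')" "a' : R" "b' : R" "mconst b' ~: P" "a / b = a' / b'"
   "(f', g') : frc f g" by blast
  from x(6) obtain h where h: "(f', g') : fracs" "den h" "h * (f * g' - f' * g) : I" unfolding fraction_mem by blast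
  have b': "den (mconst b')" unfolding den_def using x(3,4) sub_ringD(1)[OF R] form_mconst by auto
  have "b' ~= 0" using x(4) is_idealD(2)[OF sub_ring_T is_primeD(1)[OF point(1)]] by (auto simp: rhomD(4)[OF rhom_mconst])
  hence "a * b' = a' * b" using x(5) ab(4) by (simp add: field_simps)
  hence e: "mconst a * mconst b' = mconst a' * (mconst b :: 'a pol5)" by (metis rhomD(3)[OF rhom_mconst])
  have "h * (mconst a' * f' * (mconst b * g) - mconst a * f * (mconst b' * g')) = - (mconst a' * mconst b * (h * (f * g' - f' * g))) - h * f * g' * (mconst a * mconst b' - mconst a' * mconst b)"
   by (simp add: algebra_simps)
  also have "... : I" unfolding e using I_closed(6)[OF I_closed(4)[OF T_closed(5)[OF mconst_T[OF x(2)] mconst_T[OF ab(2)]] h(3)]] by simp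
  finally show ?thesis unfolding x(1) fraction_eq_iff[OF fractions_smult[OF h(1) x(2) b'] fractions_smult[OF fg ab(1,3)]] using h(2) by blast
 qed
 moreover have "?C : ?X" using ab fraction_self[OF fg] unfolding den_def by blast
 ultimately have "?X = {?C}" by blast
 thus ?thesis by (simp add: stalk_def)
qed

lemma stalkE: assumes "x : carrier (stk)" obtains f g where "(f, g) : fracs" "x = frc f g"
 using assms unfolding stalk_carrier by auto

lemma stalkI: "(f, g) : fracs ==> frc f g : carrier (stk)" unfolding stalk_carrier by force

lemma fraction_cong: "(f, g) : fracs ==> (f1, g1) : fracs ==> f * g1 = f1 * g ==> frc f g = frc f1 g1"
 using fraction_eq_iff den_1 I_closed(2) by auto

lemma abelian_group_stalk: "abelian_group (stk)"
proof (rule abelian_groupI)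
 note fc = fractions_closed(2)
 fix x assume "x : carrier (stk)"
 then obtain f g where x: "(f, g) : fracs" "x = frc f g" by (rule stalkE)
 show "\<zero>\<^bsub>stk\<^esub> \<oplus>\<^bsub>stk\<^esub> x = x" unfolding x(2) stalk_carrier(2) stalk_add[OF fractions_0_1(1) x(1)] by simp
 have "(- f, g) : fracs" using x(1) T_closed(3) form_uminus unfolding fractions_def by blast
 moreover have "frc (- f) g \<oplus>\<^bsub>stk\<^esub> x = \<zero>\<^bsub>stk\<^esub>"
  unfolding x(2) stalk_add[OF calculation x(1)] stalk_zero_iff[OF fc[OF calculation x(1)]] using den_1 I_closed(2) by auto
 ultimately show "EX y:carrier (stk). y \<oplus>\<^bsub>stk\<^esub> x = \<zero>\<^bsub>stk\<^esub>" using stalkI by blast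
 fix y assume "y : carrier (stk)"
 then obtain f' g' where y: "(f', g') : fracs" "y = frc f' g'" by (rule stalkE)
 show "x \<oplus>\<^bsub>stk\<^esub> y : carrier (stk)" unfolding x(2) y(2) stalk_add[OF x(1) y(1)] by (rule stalkI[OF fc[OF x(1) y(1)]])
 show "x \<oplus>\<^bsub>stk\<^esub> y = y \<oplus>\<^bsub>stk\<^esub> x" unfolding x(2) y(2) stalk_add[OF x(1) y(1)] stalk_add[OF y(1) x(1)] by (simp add: algebra_simps)
 fix z assume "z : carrier (stk)"
 then obtain f'' g'' where z: "(f'', g'') : fracs" "z = frc f'' g''" by (rule stalkE)
 show "x \<oplus>\<^bsub>stk\<^esub> y \<oplus>\<^bsub>stk\<^esub> z = x \<oplus>\<^bsub>stk\<^esub> (y \<oplus>\<^bsub>stk\<^esub> z)"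
  unfolding x(2) y(2) z(2) stalk_add[OF x(1) y(1)] stalk_add[OF y(1) z(1)] stalk_add[OF fc[OF x(1) y(1)] z(1)] stalk_add[OF x(1) fc[OF y(1) z(1)]]
  by (simp add: algebra_simps)
qed (use stalkI[OF fractions_0_1(1)] in \<open>simp add: stalk_carrier\<close>)

lemma module_stalk: "Module.module (ring_on base) (stk)"
proof (rule moduleI[OF cring_ring_on[OF sub_ring_base] abelian_group_stalk])
 fix r x assume "r : carrier (ring_on base)" "x : carrier (stk)"
 then obtain a b f g where r: "a : R" "b : R" "den (mconst b)" "b ~= 0" "r = a / b" and x: "(f, g) : fracs" "x = frc f g"
  by (auto simp: ring_on_def elim!: baseE stalkE)
 note rx = stalk_smult[OF x(1) r(1-4)] fractions_smult[OF x(1) r(1,3)]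
 show "r \<odot>\<^bsub>stk\<^esub> x : carrier (stk)" unfolding r(5) x(2) rx(1) by (rule stalkI[OF rx(2)])
 { fix s assume "s : carrier (ring_on base)"
  then obtain a' b' where s: "a' : R" "b' : R" "den (mconst b')" "b' ~= 0" "s = a' / b'" by (auto simp: ring_on_def elim!: baseE)
  note sx = stalk_smult[OF x(1) s(1-4)] fractions_smult[OF x(1) s(1,3)]
  have bb: "b * b' : R" "den (mconst (b * b'))" "b * b' ~= 0" "a * b' + a' * b : R" "a * a' : R"
   using r s den_mconst_mult sub_ringD(4,5)[OF R] by auto
  have e: "r + s = (a * b' + a' * b) / (b * b')" "r * s = (a * a') / (b * b')" unfolding r(5) s(5) using r(4) s(4) by (simp_all add: field_simps)
  have "(r + s) \<odot>\<^bsub>stk\<^esub> x = r \<odot>\<^bsub>stk\<^esub> x \<oplus>\<^bsub>stk\<^esub> s \<odot>\<^bsub>stk\<^esub> x"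
   unfolding e(1) x(2) stalk_smult[OF x(1) bb(4,1,2,3)] unfolding r(5) s(5) rx(1) sx(1) stalk_add[OF rx(2) sx(2)]
   by (rule fraction_cong[OF fractions_smult[OF x(1) bb(4,2)] fractions_closed(2)[OF rx(2) sx(2)]]) (simp add: rhomD[OF rhom_mconst] algebra_simps)
  thus "(r \<oplus>\<^bsub>ring_on base\<^esub> s) \<odot>\<^bsub>stk\<^esub> x = r \<odot>\<^bsub>stk\<^esub> x \<oplus>\<^bsub>stk\<^esub> s \<odot>\<^bsub>stk\<^esub> x" by (simp add: ring_on_def)
  have "(r * s) \<odot>\<^bsub>stk\<^esub> x = r \<odot>\<^bsub>stk\<^esub> (s \<odot>\<^bsub>stk\<^esub> x)"
   unfolding e(2) x(2) stalk_smult[OF x(1) bb(5,1,2,3)] unfolding r(5) s(5) sx(1) stalk_smult[OF sx(2) r(1-4)]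
   by (simp add: rhomD[OF rhom_mconst] mult.assoc)
  thus "(r \<otimes>\<^bsub>ring_on base\<^esub> s) \<odot>\<^bsub>stk\<^esub> x = r \<odot>\<^bsub>stk\<^esub> (s \<odot>\<^bsub>stk\<^esub> x)" by (simp add: ring_on_def) }
 { fix y assume "y : carrier (stk)"
  then obtain f' g' where y: "(f', g') : fracs" "y = frc f' g'" by (rule stalkE)
  note ry = stalk_smult[OF y(1) r(1-4)] fractions_smult[OF y(1) r(1,3)]
  show "r \<odot>\<^bsub>stk\<^esub> (x \<oplus>\<^bsub>stk\<^esub> y) = r \<odot>\<^bsub>stk\<^esub> x \<oplus>\<^bsub>stk\<^esub> r \<odot>\<^bsub>stk\<^esub> y"
   unfolding r(5) x(2) y(2) stalk_add[OF x(1) y(1)] rx(1) ry(1) stalk_smult[OF fractions_closed(2)[OF x(1) y(1)] r(1-4)] stalk_add[OF rx(2) ry(2)]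
   by (rule fraction_cong[OF fractions_smult[OF fractions_closed(2)[OF x(1) y(1)] r(1,3)] fractions_closed(2)[OF rx(2) ry(2)]]) (simp add: algebra_simps) }
next
 fix x assume "x : carrier (stk)"
 then obtain f g where x: "(f, g) : fracs" "x = frc f g" by (rule stalkE)
 have "(1 / 1) \<odot>\<^bsub>stk\<^esub> x = x"
  unfolding x(2) using den_1 sub_ringD(2)[OF R] by (subst stalk_smult[OF x(1)]) (simp_all add: rhomD(1)[OF rhom_mconst])
 thus "\<one>\<^bsub>ring_on base\<^esub> \<odot>\<^bsub>stk\<^esub> x = x" by (simp add: ring_on_def)
qed

end

context dvr_closed begin

text \<open>The local ring of the base contains the valuation ring, so divisibility in it is total.
  A nonzero scalar is invertible in the field, so \<open>pfI_of_field_combination\<close> removes it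
  from a relation and stalks have no torsion.\<close>

lemma pfaffian_scheme_flat:
 assumes c: "minimal_tensor c"
 shows "flat_over_base TYPE('n) Ov (pfI c)"
 unfolding flat_over_base_def
proof
 fix P assume P: "P : opts c"
 interpret gi: graded_ideal Ov "pfI c" by (rule graded_ideal_pfI[OF c])
 interpret pt: graded_ideal_point Ov "pfI c" P by unfold_locales (rule P)
 have bs: "base_stalk Ov P = ring_on pt.base" unfolding base_stalk_def pt.base_def ..
 show "flat_module TYPE('n) (base_stalk Ov P) (stalk Ov (pfI c) P)" unfolding bs
 proof (rule torsion_free_flat[OF pt.module_stalk])
  fix a b assume "a : carrier (ring_on pt.base)" "b : carrier (ring_on pt.base)"
  show "(EX c:carrier (ring_on pt.base). a = c \<otimes>\<^bsub>ring_on pt.base\<^esub> b) \<or> (EX c:carrier (ring_on pt.base). b = c \<otimes>\<^bsub>ring_on pt.base\<^esub> a)"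
  proof (cases "a = 0 \<or> b = 0")
   case True
   thus ?thesis using sub_ringD(1)[OF pt.sub_ring_base] by (auto simp: ring_on_def intro!: bexI[of _ 0])
  next
   case False
   have "a / b : Ov \<or> b / a : Ov" using O_total[of "a / b"] M_closed(1)[of "b / a"] by auto
   hence "a / b : pt.base \<or> b / a : pt.base" using pt.base_inclusion by blast
   thus ?thesis
   proof
    assume "a / b : pt.base"
    thus ?thesis using False by (intro disjI1 bexI[of _ "a / b"]) (simp_all add: ring_on_def)
   next
    assume "b / a : pt.base"
    thus ?thesis using False by (intro disjI2 bexI[of _ "b / a"]) (simp_all add: ring_on_def)
   qed
  qed
 next
  fix r x assume rx: "r : carrier (ring_on pt.base)" "x : carrier (stalk Ov (pfI c) P)" "r \<odot>\<^bsub>stalk Ov (pfI c) P\<^esub> x = \<zero>\<^bsub>stalk Ov (pfI c) P\<^esub>"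
  then obtain a b f g where r: "a : Ov" "b : Ov" "pt.den (mconst b)" "b ~= 0" "r = a / b" and x: "(f, g) : fractions Ov P" "x = fraction Ov (pfI c) P f g"
   by (auto simp: ring_on_def elim!: pt.baseE pt.stalkE)
  from rx(3) obtain h where h: "pt.den h" "h * (mconst a * f) : pfI c"
   unfolding r(5) x(2) pt.stalk_smult[OF x(1) r(1-4)] pt.stalk_zero_iff[OF pt.fractions_smult[OF x(1) r(1,3)]] by blast
  show "r = \<zero>\<^bsub>ring_on pt.base\<^esub> \<or> x = \<zero>\<^bsub>stalk Ov (pfI c) P\<^esub>"
  proof (cases "a = 0")
   case True thus ?thesis by (simp add: ring_on_def r(5))
  next
   case False
   from h(2) obtain z where z: "h * (mconst a * f) = pf_comb c z" unfolding pfI_def by blast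
   have "h * f = mconst (inverse a) * (h * (mconst a * f))"
    using False by (simp add: mult.left_commute[of h] mult.assoc[symmetric] rhomD(3)[OF rhom_mconst, symmetric] rhomD(1)[OF rhom_mconst])
   also have "... = pf_comb c (%i. mconst (inverse a) * z i)" unfolding z pf_comb_linear ..
   finally have "h * f : pfI c" using pfI_of_field_combination[OF c] S_closed(5)[OF pt.den_T[OF h(1)] pt.fractionsD(1)[OF x(1)]] by blast
   thus ?thesis unfolding x(2) pt.stalk_zero_iff[OF x(1)] using h(1) by blast
  qed
 qed
qed

end

section \<open>Minimal models\<close>

text \<open>The generators with increasing indices and the five cyclic ones differ only by signs.
  The subring \<open>R\<close> is general so that the lemma applies to the valuation ring and to the
  algebraic closure alike.\<close>

lemma pfaffian_ideal_eq:
 fixes c :: "'k::field tensor"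
 assumes R: "sub_ring R" and \<Phi>: "!!i j. \<Phi> $ i $ j = lform c i j" and alt: "alternating2 (lform c)" and T: "!!i j. lform c i j : mpols_over R"
 shows "pfaffian_ideal R \<Phi> = {pf_comb c z | z. ALL i. z i : mpols_over R}" (is "_ = ?J")
proof -
 note sT = sub_ring_mpols_over[OF R, where 'v = 5]
 note Tc = sub_ringD[OF sT]
 interpret mp: cring "mpol_ring R" by (rule cring_ring_on[OF sT])
 have pT: "pf2 (lform c) (lform c) p q r s : mpols_over R" for p q r s unfolding pf2_def by (intro Tc(4,5,6) T)
 have pf: "pfaffians \<Phi> = {pf2 (lform c) (lform c) a b d e | a b d e. a < b & b < d & d < e}" unfolding pfaffians_def pf2_def \<Phi> ..
 have J: "is_ideal (mpols_over R) ?J" by (rule ideal_pf_comb[OF R]) (unfold pf5_def, rule pT)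
 note Jc = is_idealD[OF sT J]
 have pf5J: "pf5 (lform c) i : ?J" for i
 proof -
  have "pf_comb c (%j. if j = i then 1 else 0) = (SUM j:UNIV. if j = i then pf5 (lform c) i else 0)" unfolding pf_comb_def by (intro sum.cong refl) auto
  thus ?thesis using Tc(1,2) by (intro CollectI exI[of _ "%j. if j = i then 1 else 0"]) simp
 qed
 have "pf2 (lform c) (lform c) p q r s : ?J" for p q r s
  by (rule pf2_from_pf5[OF alt, where Q = "%y. y : ?J"]) (rule Jc(2) Jc(6) pf5J; assumption)+
 hence "pfaffians \<Phi> \<subseteq> ?J" unfolding pf by blast
 hence 1: "pfaffian_ideal R \<Phi> \<subseteq> ?J" unfolding pfaffian_ideal_def using J ideal_ring_on_iff[OF sT] by (intro mp.genideal_minimal) blast+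
 have sub: "pfaffians \<Phi> \<subseteq> carrier (mpol_ring R)" unfolding pf using pT by (auto simp: ring_on_def)
 have I: "is_ideal (mpols_over R) (pfaffian_ideal R \<Phi>)" using mp.genideal_ideal[OF sub] ideal_ring_on_iff[OF sT] unfolding pfaffian_ideal_def by blast
 note Ic = is_idealD[OF sT I]
 have self: "pfaffians \<Phi> \<subseteq> pfaffian_ideal R \<Phi>" unfolding pfaffian_ideal_def by (rule mp.genideal_self[OF sub])
 have "pf2 (lform c) (lform c) p q r s : pfaffian_ideal R \<Phi>" for p q r s
 proof (rule pf2_induct_increasing[OF alt, where Q = "%y. y : pfaffian_ideal R \<Phi>"])
  show "pf2 (lform c) (lform c) a b d e : pfaffian_ideal R \<Phi>" if "a < b" "b < d" "d < e" for a b d e using self that unfolding pf by blast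
 qed (rule Ic(2) Ic(6); assumption)+
 hence "?J \<subseteq> pfaffian_ideal R \<Phi>" unfolding pf_comb_def pf5_def by (auto intro!: Ic(8) Ic(4))
 thus ?thesis using 1 by blast
qed

lemma model_act_lform:
 assumes "!!i j. \<Phi> $ i $ j = lform c i j"
 shows "model_act A B \<Phi> $ r $ s = lform (row_act A (col_act B c)) r s"
proof -
 have "((\<chi> i j. mconst (A $ i $ j)) ** \<Phi> ** transpose (\<chi> i j. mconst (A $ i $ j))) $ r $ s =
  (SUM b:UNIV. (SUM a:UNIV. mconst (A $ r $ a) * lform c a b) * mconst (A $ s $ b))"
  by (simp add: matrix_matrix_mult_def transpose_def assms)
 also have "... = (SUM a:UNIV. SUM b:UNIV. mconst (A $ r $ a * A $ s $ b) * lform c a b)"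
  unfolding sum_distrib_right rhomD(3)[OF rhom_mconst] by (subst sum.swap) (simp add: ac_simps)
 also have "... = lform (row_act A c) r s"
 proof -
  have "lform (row_act A c) r s = (SUM k:UNIV. SUM a:UNIV. SUM b:UNIV. mconst (A $ r $ a * A $ s $ b) * (mconst (c a b k) * mvar k))"
   unfolding lform_def row_act_def rhomD(7)[OF rhom_mconst] sum_distrib_right rhomD(3)[OF rhom_mconst] by (simp add: mult.assoc)
  also have "... = (SUM a:UNIV. SUM b:UNIV. SUM k:UNIV. mconst (A $ r $ a * A $ s $ b) * (mconst (c a b k) * mvar k))"
   by (subst sum.swap) (intro sum.cong refl sum.swap)
  finally show ?thesis unfolding lform_def sum_distrib_left ..
 qed
 finally show ?thesis unfolding model_act_def Let_def by (simp add: subst_def[symmetric] subst_lform row_col_commute)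
qed

text \<open>The discriminant is nonzero at a nonsingular model, so its valuation changes by exactly
  \<open>12 v (det A ^ 2 * det B)\<close> under \<open>[A, B]\<close>, and minimality makes this
  nonnegative.\<close>

lemma (in dvr) minimal_tensor_of_minimal_model:
 assumes D: "pfaffian_discriminant TYPE('a) D" and min: "minimal_model v D \<Phi>"
  and c: "!!i j. \<Phi> $ i $ j = lform c i j" "alternating c" "integral c"
 shows "minimal_tensor c"
proof -
 have X: "lform d i j : mpols_over Ov" if "integral d" for d i j unfolding lform_def using that by (intro S_closed(8,5) S_gens(2)) (simp add: integral_def)
 have U: "p : mpols_over UNIV" for p :: "'a pol5" by (simp add: mpols_over_def)
 have ns: "nonsingular_model \<Phi>" and "\<Phi> : X5 Ov" using min unfolding minimal_model_def by blast+
 hence \<Phi>U: "\<Phi> : X5 UNIV" unfolding X5_def using U by blast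
 have nz: "eval_model D \<Phi> ~= 0" using D \<Phi>U ns unfolding pfaffian_discriminant_def by blast
 have "0 <= v (det A ^ 2 * det B)" if AB: "det A ~= 0" "det B ~= 0" "integral (row_act A (col_act B c))" for A B
 proof -
  let ?\<Psi> = "model_act A B \<Phi>" and ?d = "row_act A (col_act B c)"
  have \<Psi>: "?\<Psi> $ i $ j = lform ?d i j" for i j by (rule model_act_lform[OF c(1)])
  have alt: "alternating ?d" by (intro alternating_row_act alternating_col_act c(2))
  have "lform ?d j i = - lform ?d i j" "lform ?d i i = 0" for i j
  proof -
   have s: "?d j i k = - ?d i j k" "?d i i k = 0" for k using alt unfolding alternating_def by blast+
   show "lform ?d j i = - lform ?d i j" unfolding lform_def s(1) rhomD(5)[OF rhom_mconst] mult_minus_left sum_negf ..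
   show "lform ?d i i = 0" unfolding lform_def s(2) by (simp add: rhomD[OF rhom_mconst])
  qed
  hence "?\<Psi> : X5 Ov" unfolding X5_def mem_Collect_eq \<Psi> using X[OF AB(3)] form_lform by blast
  moreover have GL: "A : GL5 UNIV" "B : GL5 UNIV" using AB(1,2) invertible_det_nz unfolding GL5_def invertible_def by blast+
  ultimately have "v (eval_model D \<Phi>) <= v (eval_model D ?\<Psi>)" using min unfolding minimal_model_def model_equiv_def by blast
  also have "eval_model D ?\<Psi> = (det A ^ 2 * det B) ^ 12 * eval_model D \<Phi>" using D \<Phi>U GL unfolding pfaffian_discriminant_def by blast
  finally show ?thesis using nz AB(1,2) by (simp add: v_mult v_power)
 qed
 thus ?thesis unfolding minimal_tensor_def using c by blast
qed

theorem theorem5p5: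
  fixes v :: "'a::field \<Rightarrow> int"
    and \<Delta> :: X5_pol
    and \<Phi> :: "'a pfaffian_model"
  assumes "discrete_valuation v"
    and "algebraically_closed (residue_field v)"
    and "pfaffian_discriminant TYPE(complex) \<Delta>"
    and "pfaffian_discriminant TYPE('a) \<Delta>"
    and "\<Phi> \<in> X5 (valuation_ring v)"
    and "minimal_model v \<Delta> \<Phi>"
  shows "fibred_surface TYPE('n) (valuation_ring v) (pfaffian_ideal (valuation_ring v) \<Phi>)"
proof -
 interpret dvr_closed v by (intro dvr_closed.intro dvr.intro dvr_closed_axioms.intro assms(1,2))
 define c where "c i j k = coef (\<Phi> $ i $ j) (sgl k 1)" for i j k
 have X: "\<Phi> $ i $ j : S" "form_of_degree 1 (\<Phi> $ i $ j)" "\<Phi> $ j $ i = - \<Phi> $ i $ j" "\<Phi> $ i $ i = 0" for i j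
  using assms(5) unfolding X5_def by blast+
 have \<Phi>: "\<Phi> $ i $ j = lform c i j" for i j unfolding lform_def c_def by (rule linear_form_expand[OF X(2)])
 have alt: "alternating c" unfolding alternating_def
 proof (intro conjI allI)
  show "c j i k = - c i j k" for i j k unfolding c_def X(3)[of i j] by simp
  show "c i i k = 0" for i k unfolding c_def X(4) by simp
 qed
 have int: "integral c" using X(1) unfolding integral_def c_def by (simp add: mpols_over_def)
 have c: "minimal_tensor c" by (rule minimal_tensor_of_minimal_model[OF assms(4,6) \<Phi> alt int])
 have I: "pfaffian_ideal Ov \<Phi> = pfI c" unfolding pfI_def by (rule pfaffian_ideal_eq[OF sub_ring_O \<Phi> alternating2_lform[OF c] lform_S[OF c]])
 have "alternating2 (lform (tac c))" unfolding alternating2_def lform_mac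
 proof (intro conjI allI)
  have sk: "lform c j i = - lform c i j" "lform c i i = 0" for i j using alternating2_lform[OF c] unfolding alternating2_def by blast+
  show "mac (lform c j i) = - mac (lform c i j)" for i j by (subst sk(1)) (rule rhomD(5)[OF rhom_mac])
  show "mac (lform c i i) = 0" for i unfolding sk(2) by (rule rhomD(4)[OF rhom_mac])
 qed
 hence "pfaffian_ideal UNIV (base_change_ac \<Phi>) = {pf_comb (tac c) z | z. ALL i. z i : mpols_over UNIV}"
  by (intro pfaffian_ideal_eq sub_ring_UNIV) (simp_all add: base_change_ac_def \<Phi> lform_mac mac_def[symmetric] mpols_over_def)
 hence J: "pfaffian_ideal UNIV (base_change_ac \<Phi>) = {pf_comb (tac c) z | z. True}" by (simp add: mpols_over_def)
 have "nonsingular_model \<Phi>" using assms(6) unfolding minimal_model_def by blast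
 hence K: "integral_scheme UNIV {pf_comb (tac c) z | z. True}" "space_dim (proj_space UNIV {pf_comb (tac c) z | z. True}) = 1"
  unfolding nonsingular_model_def Let_def J by blast+
 have "homogeneous_ideal Ov (pfI c)"
  unfolding homogeneous_ideal_def ideal_ring_on_iff[OF sub_ring_S] using ideal_pfI[OF c] form_part_pfI by blast
 thus ?thesis unfolding fibred_surface_def I using pfaffian_scheme_integral_dim[OF c K] pfaffian_scheme_flat[OF c] by blast
qed

end
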